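(* Let $u_0\in X$ and let $(u_\varepsilon)_{\varepsilon>0}\subset AC([0,T];X)$ be a family of solutions of the viscous equation $$\partial\Psi_\varepsilon(\dot u_\varepsilon(t))+D\mathcal E_t(u_\varepsilon(t))\ni0\ \text{ in }X^*\quad\text{for a.a. }t\in(0,T),$$ with $u_\varepsilon(0)\to u_0$ as $\varepsilon\downarrow0$. Then every vanishing sequence $\varepsilon_k\downarrow0$ admits a further subsequence (still denoted $(\varepsilon_k)$) and a limit function $u\in BV([0,T];X)$ such that $$u_{\varepsilon_k}(t)\to u(t)\quad\text{for every }t\in[0,T]\text{ as }k\uparrow+\infty,$$ and $u$ is a $BV$ solution of the rate-independent system $(X,\mathcal E,\mathfrak p)$ induced by the vanishing viscosity contact potential $\mathfrak p$.
   Context: Let $(X,\|\cdot\|_X)$ be a finite-dimensional real normed vector space with dual $X^*$ and pairing $\langle\cdot,\cdot\rangle$, and let $T>0$. $\Psi_0:X\to[0,+\infty)$ is a gauge: $\Psi_0(v)>0$ if $v\neq0$, $\Psi_0(v_1+v_2)\le\Psi_0(v_1)+\Psi_0(v_2)$, $\Psi_0(\lambda v)=\lambda\Psi_0(v)$ for all $\lambda\ge0$, $v,v_1,v_2\in X$. $\partial$ denotes the convex subdifferential and $K^*:=\partial\Psi_0(0)=\{w\in X^*:\langle w,z\rangle\le\Psi_0(z)\ \forall z\in X\}$. The energy $\mathcal E\in C^1([0,T]\times X)$, written $\mathcal E_t(u)$, satisfies for some $C>0$ and all $(t,u)$: $\mathcal E_t(u)\ge -C$ and $|\partial_t\mathcal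 E_t(u)|\le C(1+\mathcal E_t(u)^+)$, with $(\cdot)^+$ the positive part; $D\mathcal E_t(u)\in X^*$ is the differential in $u$. Viscosity: $\Psi:X\to[0,+\infty)$ is convex, $\Psi(0)=0$, $\Psi(v)/\|v\|_X\to+\infty$ as $\|v\|_X\to+\infty$; for $\varepsilon>0$, $\Psi_\varepsilon(v):=\varepsilon^{-1}\Psi(\varepsilon v)$, and $\Psi_0(v)=\lim_{\varepsilon\downarrow0}\Psi_\varepsilon(v)$ for every $v$. The Legendre conjugate is $\Psi_\varepsilon^*=\varepsilon^{-1}\Psi^*$. The vanishing viscosity contact potential is $\mathfrak p(v,w):=\inf_{\varepsilon>0}\big(\Psi_\varepsilon(v)+\Psi_\varepsilon^*(w)\big)$, $v\in X$, $w\in X^*$. BV functions: elements of $BV([0,T];X)$ are defined at every point and have finite pointwise total variation. $u(t_\pm)$ are the right/left limits, with $u(0_-):=u(0)$, $u(T_+):=u(T)$; $J_u:=\{t\in[0,T]:u(t_-)\ne u(t)\text{ or }u(t)\neq u(t_+)\}$. The distributional derivative splits as $u'=u'_{\mathscr L}+u'_{\rm C}+u'_{J}$ (absolutely continuous, Cantor, jump part); $u'_{\rm co}:=u'_{\mathscr L}+u'_{\rm C}$ and $\mu:=\mathscr L^1+|u'_{\rm C}|$. Finsler cost: $\Delta_{\mathfrak p,\mathcal E}(t;u_0,u_1):=\inf\big\{\int_{r_0}^{r_1}\mathfrak p(\dot\vartheta(r),-D\mathcal E_t(\vartheta(r)))\,\mathrm dr:\ \vartheta\in AC([r_0,r_1];X),\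 \vartheta(r_0)=u_0,\ \vartheta(r_1)=u_1\big\}$, and $\Delta_{\mathfrak p,\mathcal E}(t;u_-,u,u_+):=\Delta_{\mathfrak p,\mathcal E}(t;u_-,u)+\Delta_{\mathfrak p,\mathcal E}(t;u,u_+)$. Pseudo-total variation: $$\mathit{Var}_{\mathfrak p,\mathcal E}(u;[a,b]):=\int_a^b\Psi_0\Big(\frac{\mathrm d u'_{\rm co}}{\mathrm d\mu}\Big)\mathrm d\mu+\Delta_{\mathfrak p,\mathcal E}(a;u(a),u(a_+))+\Delta_{\mathfrak p,\mathcal E}(b;u(b_-),u(b))+\sum_{t\in J_u\cap(a,b)}\Delta_{\mathfrak p,\mathcal E}(t;u(t_-),u(t),u(t_+)).$$ $u\in BV([0,T];X)$ is a $BV$ solution of $(X,\mathcal E,\mathfrak p)$ if $-D\mathcal E_t(u(t))\in K^*$ for a.a. $t\in[0,T]\setminus J_u$ and, for all $t\in[0,T]$, $\mathit{Var}_{\mathfrak p,\mathcal E}(u;[0,t])+\mathcal E_t(u(t))=\mathcal E_0(u(0))+\int_0^t\partial_t\mathcal E_s(u(s))\,\mathrm ds$.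
   Formalization: The pseudo-total variation over the degenerate interval [0,0] is taken to be 0; read literally, the formula would give Δ(0;u(0),u(0₊)), and the energy balance at t=0 would then wrongly exclude an initial jump when u_0 is unstable. *)

theory Defs
  imports "HOL-Analysis.Analysis"
begin

text \<open>
  The state space \<open>X\<close> is a type of class \<^class>\<open>real_normed_vector\<close> on which
  \<open>finite_dim\<close> is assumed; its dual is the type of bounded linear functionals
  \<open>'a \<Rightarrow>\<^sub>L real\<close>. Integrals of \<open>X\<close>-valued functions and measures are tested against all
  functionals in the dual, so that no further type class is needed.
\<close>

definition finite_dim :: "'a::real_vector itself \<Rightarrow> bool" where
  "finite_dim _ \<longleftrightarrow> (\<exists>B :: 'a set. finite B \<and> span B = UNIV)"


section \<open>Dissipation potentials\<close>

definition gauge_function :: "('a::real_normed_vector \<Rightarrow> real) \<Rightarrow> bool" where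
  "gauge_function \<Psi>\<^sub>0 \<longleftrightarrow>
     (\<forall>v. 0 \<le> \<Psi>\<^sub>0 v) \<and> (\<forall>v. v \<noteq> 0 \<longrightarrow> 0 < \<Psi>\<^sub>0 v) \<and>
     (\<forall>v\<^sub>1 v\<^sub>2. \<Psi>\<^sub>0 (v\<^sub>1 + v\<^sub>2) \<le> \<Psi>\<^sub>0 v\<^sub>1 + \<Psi>\<^sub>0 v\<^sub>2) \<and>
     (\<forall>c v. 0 \<le> c \<longrightarrow> \<Psi>\<^sub>0 (c *\<^sub>R v) = c * \<Psi>\<^sub>0 v)"

definition subdifferential ::
    "('a::real_normed_vector \<Rightarrow> real) \<Rightarrow> 'a \<Rightarrow> ('a \<Rightarrow>\<^sub>L real) set" where
  "subdifferential F v = {w. \<forall>z. F v + blinfun_apply w (z - v) \<le> F z}"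

definition viscous_potential ::
    "('a::real_normed_vector \<Rightarrow> real) \<Rightarrow> real \<Rightarrow> 'a \<Rightarrow> real" where
  "viscous_potential \<Psi> \<epsilon> v = \<Psi> (\<epsilon> *\<^sub>R v) / \<epsilon>"

definition legendre_conjugate ::
    "('a::real_normed_vector \<Rightarrow> real) \<Rightarrow> ('a \<Rightarrow>\<^sub>L real) \<Rightarrow> ereal" where
  "legendre_conjugate F w = (SUP v. ereal (blinfun_apply w v - F v))"

definition contact_potential ::
    "('a::real_normed_vector \<Rightarrow> real) \<Rightarrow> 'a \<Rightarrow> ('a \<Rightarrow>\<^sub>L real) \<Rightarrow> ereal" where
  "contact_potential \<Psi> v w =
     (INF \<epsilon>\<in>{0<..}. ereal (viscous_potential \<Psi> \<epsilon> v)
                   + legendre_conjugate (viscous_potential \<Psi> \<epsilon>) w)"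


section \<open>The energy\<close>

text \<open>On a set that is not open, such as \<open>[0,T] \<times> X\<close>, derivatives are taken relative to the set.\<close>

definition C1_on ::
    "'b::real_normed_vector set \<Rightarrow> ('b \<Rightarrow> real) \<Rightarrow> bool" where
  "C1_on S f \<longleftrightarrow> (\<exists>D :: 'b \<Rightarrow> 'b \<Rightarrow>\<^sub>L real.
     continuous_on S D \<and> (\<forall>x\<in>S. (f has_derivative blinfun_apply (D x)) (at x within S)))"

definition energy_dt :: "real \<Rightarrow> (real \<Rightarrow> 'a \<Rightarrow> real) \<Rightarrow> real \<Rightarrow> 'a \<Rightarrow> real" where
  "energy_dt T E t x = vector_derivative (\<lambda>s. E s x) (at t within {0..T})"

definition energy_diff ::
    "(real \<Rightarrow> 'a::real_normed_vector \<Rightarrow> real) \<Rightarrow> real \<Rightarrow> 'a \<Rightarrow> ('a \<Rightarrow>\<^sub>L real)" where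
  "energy_diff E t x = Blinfun (frechet_derivative (E t) (at x))"


section \<open>Functions of one real variable\<close>

definition abs_continuous_on :: "real \<Rightarrow> real \<Rightarrow> (real \<Rightarrow> 'a::real_normed_vector) \<Rightarrow> bool" where
  "abs_continuous_on a b f \<longleftrightarrow>
     (\<forall>e>0. \<exists>d>0. \<forall>\<D>. \<D> division_of \<Union>\<D> \<and> \<Union>\<D> \<subseteq> {a..b} \<and> (\<Sum>I\<in>\<D>. Sup I - Inf I) < d \<longrightarrow>
        (\<Sum>I\<in>\<D>. norm (f (Sup I) - f (Inf I))) < e)"

definition BV_on :: "real \<Rightarrow> (real \<Rightarrow> 'a::real_normed_vector) \<Rightarrow> bool" where
  "BV_on T u \<longleftrightarrow>
     (\<exists>M. \<forall>\<D>. \<D> division_of {0..T} \<longrightarrow> (\<Sum>I\<in>\<D>. norm (u (Sup I) - u (Inf I))) \<le> M)"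

definition left_lim :: "(real \<Rightarrow> 'a::real_normed_vector) \<Rightarrow> real \<Rightarrow> 'a" where
  "left_lim u t = (if t \<le> 0 then u 0 else Lim (at_left t) u)"

definition right_lim :: "real \<Rightarrow> (real \<Rightarrow> 'a::real_normed_vector) \<Rightarrow> real \<Rightarrow> 'a" where
  "right_lim T u t = (if T \<le> t then u T else Lim (at_right t) u)"

definition jump_set :: "real \<Rightarrow> (real \<Rightarrow> 'a::real_normed_vector) \<Rightarrow> real set" where
  "jump_set T u = {t \<in> {0..T}. left_lim u t \<noteq> u t \<or> u t \<noteq> right_lim T u t}"


section \<open>Vector measures on the line\<close>

text \<open>A vector measure is a set function whose values matter on Borel sets only.\<close>

definition vector_measure :: "(real set \<Rightarrow> 'a::real_normed_vector) \<Rightarrow> bool" where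
  "vector_measure m \<longleftrightarrow>
     (\<forall>A :: nat \<Rightarrow> real set. range A \<subseteq> sets borel \<and> disjoint_family A \<longrightarrow>
        (\<lambda>n. m (A n)) sums m (\<Union>n. A n))"

definition variation_measure :: "(real set \<Rightarrow> 'a::real_normed_vector) \<Rightarrow> real measure" where
  "variation_measure m = measure_of UNIV (sets borel)
     (\<lambda>B. SUP A\<in>{A :: nat \<Rightarrow> real set. range A \<subseteq> sets borel \<and> disjoint_family A \<and> (\<Union>n. A n) = B}.
        \<Sum>n. ennreal (norm (m (A n))))"

definition vector_density ::
    "(real set \<Rightarrow> 'a::real_normed_vector) \<Rightarrow> real measure \<Rightarrow> (real \<Rightarrow> 'a) \<Rightarrow> bool" where
  "vector_density m \<nu> h \<longleftrightarrow>
     h \<in> borel_measurable \<nu> \<and>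
     (\<forall>w :: 'a \<Rightarrow>\<^sub>L real. integrable \<nu> (\<lambda>t. blinfun_apply w (h t)) \<and>
        (\<forall>A\<in>sets borel. blinfun_apply w (m A) = (LINT t:A|\<nu>. blinfun_apply w (h t))))"

definition test_function :: "real \<Rightarrow> (real \<Rightarrow> real) \<Rightarrow> bool" where
  "test_function T \<phi> \<longleftrightarrow>
     (\<forall>n x. (deriv ^^ n) \<phi> field_differentiable at x) \<and>
     (\<exists>a b. 0 < a \<and> b < T \<and> (\<forall>x. x \<notin> {a..b} \<longrightarrow> \<phi> x = 0))"

text \<open>
  The integral \<open>\<integral>\<phi> dm\<close> of a test function against a vector measure is written by means of the
  polar decomposition \<open>m = h |m|\<close>. The endpoints carry no mass.
\<close>

definition distributional_derivative ::
    "real \<Rightarrow> (real \<Rightarrow> 'a::real_normed_vector) \<Rightarrow> (real set \<Rightarrow> 'a) \<Rightarrow> bool" where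
  "distributional_derivative T u m \<longleftrightarrow>
     vector_measure m \<and> (\<forall>A\<in>sets borel. m A = m (A \<inter> {0<..<T})) \<and>
     (\<exists>h. vector_density m (variation_measure m) h \<and>
        (\<forall>\<phi> (w :: 'a \<Rightarrow>\<^sub>L real). test_function T \<phi> \<longrightarrow>
           (LINT t:{0<..<T}|lborel. deriv \<phi> t * blinfun_apply w (u t))
             = - (LINT t|variation_measure m. \<phi> t * blinfun_apply w (h t))))"

text \<open>
  \<open>BV_decomposition T u mL mC mJ\<close> says that the distributional derivative of \<open>u\<close> is \<open>mL + mC + mJ\<close>
  with absolutely continuous part \<open>mL\<close>, Cantor part \<open>mC\<close> and jump part \<open>mJ\<close>. For \<open>u\<close> of bounded
  variation this determines the three parts on Borel sets.
\<close>

definition BV_decomposition ::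
    "real \<Rightarrow> (real \<Rightarrow> 'a::real_normed_vector) \<Rightarrow>
     (real set \<Rightarrow> 'a) \<Rightarrow> (real set \<Rightarrow> 'a) \<Rightarrow> (real set \<Rightarrow> 'a) \<Rightarrow> bool" where
  "BV_decomposition T u mL mC mJ \<longleftrightarrow>
     distributional_derivative T u (\<lambda>A. mL A + mC A + mJ A) \<and>
     vector_measure mL \<and> vector_measure mC \<and> vector_measure mJ \<and>
     (\<forall>A\<in>null_sets lborel. mL A = 0) \<and>
     (\<exists>N\<in>null_sets lborel. \<forall>A\<in>sets borel. mC A = mC (A \<inter> N)) \<and>
     (\<forall>t. mC {t} = 0) \<and>
     (\<forall>A\<in>sets borel. mJ A = mJ (A \<inter> jump_set T u))"

definition BV_parts ::
    "real \<Rightarrow> (real \<Rightarrow> 'a::real_normed_vector) \<Rightarrow>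
     (real set \<Rightarrow> 'a) \<times> (real set \<Rightarrow> 'a) \<times> (real set \<Rightarrow> 'a)" where
  "BV_parts T u = (SOME (mL, mC, mJ). BV_decomposition T u mL mC mJ)"

definition ac_part :: "real \<Rightarrow> (real \<Rightarrow> 'a::real_normed_vector) \<Rightarrow> real set \<Rightarrow> 'a" where
  "ac_part T u = fst (BV_parts T u)"

definition cantor_part :: "real \<Rightarrow> (real \<Rightarrow> 'a::real_normed_vector) \<Rightarrow> real set \<Rightarrow> 'a" where
  "cantor_part T u = fst (snd (BV_parts T u))"

definition co_part :: "real \<Rightarrow> (real \<Rightarrow> 'a::real_normed_vector) \<Rightarrow> real set \<Rightarrow> 'a" where
  "co_part T u A = ac_part T u A + cantor_part T u A"

definition ref_measure :: "real \<Rightarrow> (real \<Rightarrow> 'a::real_normed_vector) \<Rightarrow> real measure" where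
  "ref_measure T u = measure_of UNIV (sets borel)
     (\<lambda>A. emeasure lborel A + emeasure (variation_measure (cantor_part T u)) A)"

definition co_density :: "real \<Rightarrow> (real \<Rightarrow> 'a::real_normed_vector) \<Rightarrow> real \<Rightarrow> 'a" where
  "co_density T u = (SOME h. vector_density (co_part T u) (ref_measure T u) h)"


section \<open>Finsler cost, pseudo-total variation and BV solutions\<close>

text \<open>
  The cost does not depend on the parameter interval when \<open>\<pp>\<close> is positively 1-homogeneous in its
  first argument; the infimum also ranges over the interval. The function \<open>\<pp>\<close> is meant to be
  nonnegative, so that \<^const>\<open>e2ennreal\<close> does not truncate (cf. \<open>contact_potential_nonneg\<close>).
\<close>

definition finsler_cost ::
    "('a::real_normed_vector \<Rightarrow> ('a \<Rightarrow>\<^sub>L real) \<Rightarrow> ereal) \<Rightarrow> (real \<Rightarrow> 'a \<Rightarrow> real) \<Rightarrow>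
     real \<Rightarrow> 'a \<Rightarrow> 'a \<Rightarrow> ennreal" where
  "finsler_cost \<pp> E t x\<^sub>0 x\<^sub>1 =
     Inf {(\<integral>\<^sup>+ r\<in>{r\<^sub>0..r\<^sub>1}. e2ennreal (\<pp> (vector_derivative \<theta> (at r)) (- energy_diff E t (\<theta> r))) \<partial>lborel)
          | \<theta> r\<^sub>0 r\<^sub>1. r\<^sub>0 < r\<^sub>1 \<and> abs_continuous_on r\<^sub>0 r\<^sub>1 \<theta> \<and> \<theta> r\<^sub>0 = x\<^sub>0 \<and> \<theta> r\<^sub>1 = x\<^sub>1}"

text \<open>
  A degenerate interval \<open>[a,a]\<close> has variation 0. The formula for \<open>a < b\<close> would instead
  return the whole cost of a jump of \<open>u\<close> at \<open>a\<close>, and the energy balance at time \<open>0\<close> would then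
  exclude an initial jump.
\<close>

definition pseudo_variation ::
    "real \<Rightarrow> (real \<Rightarrow> 'a \<Rightarrow> real) \<Rightarrow> ('a::real_normed_vector \<Rightarrow> real) \<Rightarrow>
     ('a \<Rightarrow> ('a \<Rightarrow>\<^sub>L real) \<Rightarrow> ereal) \<Rightarrow> (real \<Rightarrow> 'a) \<Rightarrow> real \<Rightarrow> real \<Rightarrow> ennreal" where
  "pseudo_variation T E \<Psi>\<^sub>0 \<pp> u a b =
     (if a < b then
        (\<integral>\<^sup>+ t\<in>{a..b}. ennreal (\<Psi>\<^sub>0 (co_density T u t)) \<partial>(ref_measure T u))
        + finsler_cost \<pp> E a (u a) (right_lim T u a)
        + finsler_cost \<pp> E b (left_lim u b) (u b)
        + (\<Sum>\<^sub>\<infinity>t\<in>jump_set T u \<inter> {a<..<b}.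
             finsler_cost \<pp> E t (left_lim u t) (u t) + finsler_cost \<pp> E t (u t) (right_lim T u t))
      else 0)"

text \<open>The energy balance is an identity of extended reals and includes finiteness of the variation.\<close>

definition BV_solution ::
    "real \<Rightarrow> (real \<Rightarrow> 'a \<Rightarrow> real) \<Rightarrow> ('a::real_normed_vector \<Rightarrow> real) \<Rightarrow>
     ('a \<Rightarrow> ('a \<Rightarrow>\<^sub>L real) \<Rightarrow> ereal) \<Rightarrow> (real \<Rightarrow> 'a) \<Rightarrow> bool" where
  "BV_solution T E \<Psi>\<^sub>0 \<pp> u \<longleftrightarrow>
     BV_on T u \<and>
     (AE t in lborel. t \<in> {0..T} - jump_set T u \<longrightarrow>
        - energy_diff E t (u t) \<in> subdifferential \<Psi>\<^sub>0 0) \<and>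
     (\<forall>t\<in>{0..T}.
        enn2ereal (pseudo_variation T E \<Psi>\<^sub>0 \<pp> u 0 t) + ereal (E t (u t))
          = ereal (E 0 (u 0) + (LINT s:{0..t}|lborel. energy_dt T E s (u s))))"

definition viscous_solution ::
    "real \<Rightarrow> (real \<Rightarrow> 'a \<Rightarrow> real) \<Rightarrow> ('a::real_normed_vector \<Rightarrow> real) \<Rightarrow> real \<Rightarrow>
     (real \<Rightarrow> 'a) \<Rightarrow> bool" where
  "viscous_solution T E \<Psi> \<epsilon> u \<longleftrightarrow>
     abs_continuous_on 0 T u \<and>
     (AE t in lborel. t \<in> {0<..<T} \<longrightarrow>
        (\<exists>v. (u has_vector_derivative v) (at t) \<and>
           (\<exists>w\<in>subdifferential (viscous_potential \<Psi> \<epsilon>) v. w + energy_diff E t (u t) = 0)))"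


section \<open>Consistency checks\<close>

lemma legendre_conjugate_viscous:
  assumes "0 < \<epsilon>"
  shows "legendre_conjugate (viscous_potential \<Psi> \<epsilon>) w = ereal (1 / \<epsilon>) * legendre_conjugate \<Psi> w"
proof -
  have surj: "range (\<lambda>v::'a. \<epsilon> *\<^sub>R v) = UNIV"
  proof -
    have "v = \<epsilon> *\<^sub>R ((1 / \<epsilon>) *\<^sub>R v)" for v :: 'a
      using assms by simp
    then show ?thesis by blast
  qed
  have "legendre_conjugate (viscous_potential \<Psi> \<epsilon>) w
          = (SUP v. ereal (1 / \<epsilon>) * ereal (blinfun_apply w (\<epsilon> *\<^sub>R v) - \<Psi> (\<epsilon> *\<^sub>R v)))"
    unfolding legendre_conjugate_def viscous_potential_def
    using assms by (intro SUP_cong) (auto simp: blinfun.scaleR_right field_simps)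
  also have "\<dots> = (SUP v\<in>range (\<lambda>v. \<epsilon> *\<^sub>R v). ereal (1 / \<epsilon>) * ereal (blinfun_apply w v - \<Psi> v))"
    by (simp add: image_image)
  also have "\<dots> = ereal (1 / \<epsilon>) * (SUP v. ereal (blinfun_apply w v - \<Psi> v))"
    unfolding surj using assms by (intro Sup_ereal_mult_left'[symmetric]) auto
  finally show ?thesis by (simp add: legendre_conjugate_def)
qed

lemma contact_potential_nonneg:
  assumes "\<And>v. 0 \<le> \<Psi> v" "\<Psi> 0 = 0"
  shows "0 \<le> contact_potential \<Psi> v w"
  unfolding contact_potential_def
proof (rule INF_greatest)
  fix \<epsilon> :: real assume "\<epsilon> \<in> {0<..}"
  then have "0 \<le> viscous_potential \<Psi> \<epsilon> v"
    by (simp add: viscous_potential_def assms)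
  moreover have "0 \<le> legendre_conjugate (viscous_potential \<Psi> \<epsilon>) w"
    unfolding legendre_conjugate_def
    by (rule SUP_upper2[of 0]) (auto simp: viscous_potential_def assms)
  ultimately show "0 \<le> ereal (viscous_potential \<Psi> \<epsilon> v) + legendre_conjugate (viscous_potential \<Psi> \<epsilon>) w"
    by simp
qed

end

theory Submission
  imports Defs "HOL-Complex_Analysis.Great_Picard"
begin

text \<open>
  For a viscous solution the dissipated energy
  \<open>V t = \<E>\<^sub>0(u 0) + \<integral>\<^sub>0\<^sup>t \<partial>\<^sub>t\<E> - \<E>\<^sub>t(u t)\<close> equals
  \<open>\<integral> \<Psi>\<^sub>\<epsilon>(u') + \<Psi>\<^sub>\<epsilon>\<^sup>*(-D\<E>)\<close>. It is nondecreasing, it bounds the \<open>\<Psi>\<^sub>0\<close>-length of every increment, and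
  Gronwall's inequality bounds it uniformly in \<open>\<epsilon>\<close>. Helly's theorem gives pointwise limits \<open>u\<close> and \<open>V\<close>,
  still related by the same formula, and the bound \<open>\<integral> \<Psi>\<^sup>*(-D\<E>) \<le> \<epsilon> V T\<close> gives stability almost everywhere.
  What remains is that \<open>V t\<close> is the pseudo-variation of \<open>u\<close>, which is seen by splitting the Stieltjes measure of \<open>V\<close>.
  At a jump the chain rule bounds the Finsler cost from below by the energy released, which is the jump
  of \<open>V\<close>, and the viscous solutions with frozen time are competitors of almost that cost.
  Off the jump set, \<open>\<Psi>\<^sub>0(u')\<close> is at most \<open>V'\<close> because this holds for increments; conversely,
  stability at the left end of a short interval bounds the increment of \<open>V\<close> by \<open>\<Psi>\<^sub>0\<close> of the increment of \<open>u\<close>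
  up to a small multiple of the total mass, and Jensen's inequality allows to sum over a partition.
\<close>

section \<open>Finite-dimensional normed spaces\<close>

text \<open>The delicate estimate is the upper bound for the cost of a jump. A viscous curve solves
  an equation with moving time, the Finsler cost has the time frozen, and
  \<open>\<Psi>s w / e\<close> reacts to a small change of \<open>w\<close> with the factor
  \<open>1 / e\<close>. The infimum over \<open>e\<close> in the contact potential repairs this:
  where \<open>e * norm v\<close> is small, another parameter does better
  (\<open>contact_frozen\<close>). Stability is known almost everywhere only and may fail at jump
  times. Off the jump set the estimates are therefore made not with \<open>u\<close> and
  \<open>V\<close> but with their one-sided limits \<open>X\<close> and \<open>F\<close>, which are
  stable at every time. The parts of the derivative and the density in the pseudo-variation are
  arbitrary choices. Expressing the integral of a gauge of a density by partitions and the vector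
  measure alone makes these choices disappear. Curves in the cost are absolutely continuous in the
  epsilon-delta sense, while the integrand contains \<open>vector_derivative\<close>; hence
  differentiability almost everywhere is derived from Vitali covers. Vectors are handled through
  finitely many coordinate functionals, since the state space has no type class beyond its
  norm.\<close>

lemma independent_norm_bound:
  fixes B :: "'a::real_normed_vector set"
  assumes "finite B" "independent B"
  obtains K where "0 < K" "\<And>f. (\<Sum>b\<in>B. \<bar>f b\<bar>) \<le> K * norm (\<Sum>b\<in>B. f b *\<^sub>R b)"
proof -
  have "\<exists>K>0. \<forall>f. (\<Sum>b\<in>B. \<bar>f b\<bar>) \<le> K * norm (\<Sum>b\<in>B. f b *\<^sub>R b)"
  proof (rule ccontr)
    assume *: "\<not> ?thesis"
    have "\<exists>f. (\<Sum>b\<in>B. \<bar>f b\<bar>) > real (Suc n) * norm (\<Sum>b\<in>B. f b *\<^sub>R b)" for n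
      using * by (meson not_le of_nat_0_less_iff zero_less_Suc)
    then obtain f where f: "\<And>n. (\<Sum>b\<in>B. \<bar>f n b\<bar>) > real (Suc n) * norm (\<Sum>b\<in>B. f n b *\<^sub>R b)"
      by metis
    \<comment> \<open>Normalising by \<open>s n\<close> keeps the absolute values of the
      coefficients summing to 1. A limit of the normalised coefficients inherits this sum, while its
      linear combination vanishes; this contradicts independence.\<close>
    define s where "s n = (\<Sum>b\<in>B. \<bar>f n b\<bar>)" for n
    define g where "g n b = f n b / s n" for n b
    have s_pos: "0 < s n" for n
      using f[of n] norm_ge_zero[of "\<Sum>b\<in>B. f n b *\<^sub>R b"] unfolding s_def
      by (smt (verit) mult_nonneg_nonneg of_nat_0_le_iff)
    have g_sum: "(\<Sum>b\<in>B. \<bar>g n b\<bar>) = 1" for n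
    proof -
      have "(\<Sum>b\<in>B. \<bar>g n b\<bar>) = (\<Sum>b\<in>B. \<bar>f n b\<bar>) / s n"
        using s_pos[of n] by (simp add: g_def sum_divide_distrib abs_div)
      then show ?thesis using s_pos[of n] by (simp add: s_def)
    qed
    have g_norm: "norm (\<Sum>b\<in>B. g n b *\<^sub>R b) \<le> inverse (real (Suc n))" for n
    proof -
      have "(\<Sum>b\<in>B. g n b *\<^sub>R b) = (1 / s n) *\<^sub>R (\<Sum>b\<in>B. f n b *\<^sub>R b)"
        by (simp add: g_def scaleR_right.sum)
      then have "norm (\<Sum>b\<in>B. g n b *\<^sub>R b) = norm (\<Sum>b\<in>B. f n b *\<^sub>R b) / s n"
        using s_pos[of n] by simp
      also have "\<dots> \<le> inverse (real (Suc n))"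
        using f[of n] s_pos[of n] unfolding s_def[symmetric] by (simp add: field_simps)
      finally show ?thesis .
    qed
    have g_le: "norm (g n b) \<le> 1" if "b \<in> B" for n b
      using member_le_sum[of b B "\<lambda>b. \<bar>g n b\<bar>"] that assms(1) g_sum[of n] by auto
    obtain k where k: "strict_mono (k::nat\<Rightarrow>nat)" "\<And>b. b \<in> B \<Longrightarrow> \<exists>l. (\<lambda>n. g (k n) b) \<longlonglongrightarrow> l"
      using function_convergent_subsequence[of B g 1] g_le assms(1) countable_finite by metis
    then obtain l where l: "\<And>b. b \<in> B \<Longrightarrow> (\<lambda>n. g (k n) b) \<longlonglongrightarrow> l b" by metis
    have "(\<lambda>n. \<Sum>b\<in>B. \<bar>g (k n) b\<bar>) \<longlonglongrightarrow> (\<Sum>b\<in>B. \<bar>l b\<bar>)"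
      by (intro tendsto_sum tendsto_rabs l)
    then have l_sum: "(\<Sum>b\<in>B. \<bar>l b\<bar>) = 1"
      using g_sum by (simp add: LIMSEQ_const_iff)
    have 1: "(\<lambda>n. \<Sum>b\<in>B. g (k n) b *\<^sub>R b) \<longlonglongrightarrow> (\<Sum>b\<in>B. l b *\<^sub>R b)"
      by (intro tendsto_sum tendsto_scaleR l tendsto_const)
    have "(\<lambda>n. \<Sum>b\<in>B. g (k n) b *\<^sub>R b) \<longlonglongrightarrow> 0"
    proof (rule Lim_null_comparison)
      show "\<forall>\<^sub>F n in sequentially. norm (\<Sum>b\<in>B. g (k n) b *\<^sub>R b) \<le> inverse (real (Suc (k n)))"
        using g_norm by auto
      show "(\<lambda>n. inverse (real (Suc (k n)))) \<longlonglongrightarrow> 0"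
        using LIMSEQ_subseq_LIMSEQ[OF LIMSEQ_inverse_real_of_nat k(1)] by (simp add: o_def)
    qed
    then have "(\<Sum>b\<in>B. l b *\<^sub>R b) = 0" using 1 LIMSEQ_unique by blast
    then have "\<forall>b\<in>B. l b = 0"
      using assms independent_explicit_finite_subsets[of B] by blast
    then show False using l_sum by simp
  qed
  then show ?thesis using that by blast
qed

text \<open>The norm bound makes the coordinates of a basis bounded functionals. Limits, equations
  and measurability of vectors are reduced to these finitely many functionals throughout.\<close>

lemma finite_dim_coordinates:
  assumes "finite_dim TYPE('a::real_normed_vector)"
  obtains B :: "'a::real_normed_vector set" and c :: "'a::real_normed_vector \<Rightarrow> 'a \<Rightarrow>\<^sub>L real"
  where "finite B" "\<And>x. (\<Sum>b\<in>B. blinfun_apply (c b) x *\<^sub>R b) = x"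
proof -
  obtain B0 :: "'a set" where B0: "finite B0" "span B0 = UNIV"
    using assms by (auto simp: finite_dim_def)
  obtain B where B: "B \<subseteq> B0" "independent B" "B0 \<subseteq> span B"
    using maximal_independent_subset[of B0] by blast
  have fB: "finite B" using B(1) B0(1) finite_subset by blast
  have sp: "span B = UNIV"
    using B(3) B0(2) span_mono span_span by (metis top.extremum_uniqueI)
  obtain K where K: "0 < K" "\<And>f. (\<Sum>b\<in>B. \<bar>f b\<bar>) \<le> K * norm (\<Sum>b\<in>B. f b *\<^sub>R b)"
    using independent_norm_bound[OF fB B(2)] by metis
  define r where "r = representation B"
  have eq: "(\<Sum>b\<in>B. r x b *\<^sub>R b) = x" for x
    unfolding r_def using sum_representation_eq[OF B(2), of x B] sp fB by auto
  have lin: "bounded_linear (\<lambda>x. r x b)" if "b \<in> B" for b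
  proof
    show "r (x + y) b = r x b + r y b" for x y
      using B(2) sp by (simp add: r_def representation_add)
    show "r (a *\<^sub>R x) b = a *\<^sub>R r x b" for a x
      using B(2) sp by (simp add: r_def representation_scale)
    show "\<exists>K. \<forall>x. norm (r x b) \<le> norm x * K"
    proof (intro exI allI)
      fix x
      have "\<bar>r x b\<bar> \<le> (\<Sum>b\<in>B. \<bar>r x b\<bar>)"
        using member_le_sum[of b B "\<lambda>b. \<bar>r x b\<bar>"] that fB by auto
      also have "\<dots> \<le> K * norm x" using K(2)[of "r x"] eq by simp
      finally show "norm (r x b) \<le> norm x * K" by (simp add: mult.commute)
    qed
  qed
  have "(\<Sum>b\<in>B. blinfun_apply (Blinfun (\<lambda>x. r x b)) x *\<^sub>R b) = x" for x
    using eq[of x] lin by (simp add: bounded_linear_Blinfun_apply cong: sum.cong)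
  then show ?thesis using that[OF fB, of "\<lambda>b. Blinfun (\<lambda>x. r x b)"] by blast
qed

lemma finite_dim_tendstoI:
  fixes f :: "'b \<Rightarrow> 'a::real_normed_vector"
  assumes "finite_dim TYPE('a)"
    and "\<And>w :: 'a \<Rightarrow>\<^sub>L real. ((\<lambda>x. blinfun_apply w (f x)) \<longlongrightarrow> blinfun_apply w l) F"
  shows "(f \<longlongrightarrow> l) F"
proof -
  obtain B :: "'a set" and c where c: "\<And>x::'a. (\<Sum>b\<in>B. blinfun_apply (c b) x *\<^sub>R b) = x"
    using finite_dim_coordinates[OF assms(1)] by metis
  have "((\<lambda>x. \<Sum>b\<in>B. blinfun_apply (c b) (f x) *\<^sub>R b) \<longlongrightarrow> (\<Sum>b\<in>B. blinfun_apply (c b) l *\<^sub>R b)) F"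
    by (intro tendsto_intros assms(2))
  then show ?thesis by (simp add: c)
qed

lemma finite_dim_eqI:
  fixes x y :: "'a::real_normed_vector"
  assumes "finite_dim TYPE('a)" and "\<And>w :: 'a \<Rightarrow>\<^sub>L real. blinfun_apply w x = blinfun_apply w y"
  shows "x = y"
proof -
  obtain B :: "'a set" and c where c: "\<And>x::'a. (\<Sum>b\<in>B. blinfun_apply (c b) x *\<^sub>R b) = x"
    using finite_dim_coordinates[OF assms(1)] by metis
  show ?thesis
    by (subst c[of x, symmetric], subst c[of y, symmetric]) (simp only: assms(2))
qed

lemma finite_dim_bounded_convergent_subsequence:
  fixes f :: "nat \<Rightarrow> 'i \<Rightarrow> 'a::real_normed_vector"
  assumes fin: "finite_dim TYPE('a)" and S: "countable S"
    and M: "\<And>n i. i \<in> S \<Longrightarrow> norm (f n i) \<le> M"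
  obtains k where "strict_mono (k::nat\<Rightarrow>nat)" "\<And>i. i \<in> S \<Longrightarrow> \<exists>l. (\<lambda>n. f (k n) i) \<longlonglongrightarrow> l"
proof -
  obtain B :: "'a set" and c where B: "finite B" and c: "\<And>x::'a. (\<Sum>b\<in>B. blinfun_apply (c b) x *\<^sub>R b) = x"
    using finite_dim_coordinates[OF fin] by metis
  define L where "L = (\<Sum>b\<in>B. norm (c b))"
  have L: "norm (c b) \<le> L" if "b \<in> B" for b
    unfolding L_def using that B by (intro member_le_sum) auto
  have bd: "norm (blinfun_apply (c (snd p)) (f n (fst p))) \<le> L * M" if "p \<in> S \<times> B" for n p
  proof -
    have "norm (blinfun_apply (c (snd p)) (f n (fst p))) \<le> norm (c (snd p)) * norm (f n (fst p))"
      by (rule norm_blinfun)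
    also have "\<dots> \<le> L * M"
      using that L M by (intro mult_mono) (auto intro: order_trans[OF norm_ge_zero])
    finally show ?thesis .
  qed
  obtain k where k: "strict_mono (k::nat\<Rightarrow>nat)"
      "\<And>p. p \<in> S \<times> B \<Longrightarrow> \<exists>l. (\<lambda>n. blinfun_apply (c (snd p)) (f (k n) (fst p))) \<longlonglongrightarrow> l"
    using function_convergent_subsequence[of "S \<times> B" "\<lambda>n p. blinfun_apply (c (snd p)) (f n (fst p))" "L * M"]
      bd S B by (metis countable_SIGMA countable_finite)
  have "\<exists>l. (\<lambda>n. f (k n) i) \<longlonglongrightarrow> l" if i: "i \<in> S" for i
  proof -
    have "\<forall>b\<in>B. \<exists>l. (\<lambda>n. blinfun_apply (c b) (f (k n) i)) \<longlonglongrightarrow> l"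
      using k(2)[of "(i, _)"] i by auto
    then obtain l where "\<And>b. b \<in> B \<Longrightarrow> (\<lambda>n. blinfun_apply (c b) (f (k n) i)) \<longlonglongrightarrow> l b" by metis
    then have "(\<lambda>n. \<Sum>b\<in>B. blinfun_apply (c b) (f (k n) i) *\<^sub>R b) \<longlonglongrightarrow> (\<Sum>b\<in>B. l b *\<^sub>R b)"
      by (intro tendsto_sum tendsto_scaleR tendsto_const)
    then show ?thesis by (auto simp: c)
  qed
  then show ?thesis using that k(1) by blast
qed

lemma finite_dim_compact:
  fixes S :: "'a::real_normed_vector set"
  assumes fin: "finite_dim TYPE('a)" and "closed S" "bounded S"
  shows "compact S"
  unfolding compact_eq_seq_compact_metric seq_compact_def
proof (intro allI impI)
  fix f :: "nat \<Rightarrow> 'a" assume f: "\<forall>n. f n \<in> S"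
  obtain M where M: "\<And>x. x \<in> S \<Longrightarrow> norm x \<le> M" using assms(3) bounded_iff by metis
  obtain k where k: "strict_mono (k::nat\<Rightarrow>nat)" "\<And>i::unit. i \<in> UNIV \<Longrightarrow> \<exists>l. (\<lambda>n. f (k n)) \<longlonglongrightarrow> l"
    by (rule finite_dim_bounded_convergent_subsequence[OF fin, of "UNIV :: unit set" "\<lambda>n i. f n" M]) (use M f in auto)
  obtain l where l: "(\<lambda>n. f (k n)) \<longlonglongrightarrow> l" using k(2)[of "()"] by auto
  moreover have "l \<in> S" using closed_sequentially[OF assms(2) _ l] f by blast
  ultimately show "\<exists>l\<in>S. \<exists>r::nat\<Rightarrow>nat. strict_mono r \<and> (f \<circ> r) \<longlonglongrightarrow> l"
    using k(1) by (auto simp: o_def)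
qed

lemma finite_dim_Cauchy_convergent:
  fixes f :: "nat \<Rightarrow> 'a::real_normed_vector"
  assumes fin: "finite_dim TYPE('a)" and "Cauchy f"
  shows "convergent f"
proof -
  have b: "bounded (range f)" using assms(2) by (rule cauchy_imp_bounded)
  have "compact (closure (range f))"
    by (intro finite_dim_compact[OF fin]) (auto simp: b)
  then have "complete (closure (range f))" by (rule compact_imp_complete)
  then show ?thesis
    using assms(2) closure_subset[of "range f"] unfolding complete_def convergent_def by blast
qed

text \<open>The type class of \<open>'a\<close> does not give second countability, so sums of
  measurable vector functions are avoided. Instead \<open>h\<close> is factored through its
  coordinates in the product space \<open>nat \<Rightarrow> real\<close>, where measurability is
  coordinatewise, followed by a continuous map.\<close>

lemma finite_dim_borel_measurable:
  fixes h :: "'b \<Rightarrow> 'a::real_normed_vector"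
  assumes fin: "finite_dim TYPE('a)"
    and meas: "\<And>w :: 'a \<Rightarrow>\<^sub>L real. (\<lambda>t. blinfun_apply w (h t)) \<in> borel_measurable M"
  shows "h \<in> borel_measurable M"
proof -
  obtain B :: "'a set" and c where B: "finite B" and c: "\<And>x::'a. (\<Sum>b\<in>B. blinfun_apply (c b) x *\<^sub>R b) = x"
    using finite_dim_coordinates[OF fin] by metis
  obtain e :: "nat \<Rightarrow> 'a" where e: "bij_betw e {0..<card B} B"
    using ex_bij_betw_nat_finite[OF B] by blast
  define q where "q t i = blinfun_apply (c (e i)) (h t)" for t i
  have "q \<in> borel_measurable M"
    unfolding q_def by (rule measurable_coordinatewise_then_product) (rule meas)
  moreover have "(\<lambda>y::nat\<Rightarrow>real. \<Sum>i\<in>{0..<card B}. y i *\<^sub>R e i) \<in> borel_measurable borel"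
    by (intro borel_measurable_continuous_onI continuous_intros continuous_on_product_coordinates)
  ultimately have "(\<lambda>t. \<Sum>i\<in>{0..<card B}. q t i *\<^sub>R e i) \<in> borel_measurable M"
    by (rule measurable_compose)
  moreover have "(\<Sum>i\<in>{0..<card B}. q t i *\<^sub>R e i) = h t" for t
    unfolding q_def using sum.reindex_bij_betw[OF e, of "\<lambda>b. blinfun_apply (c b) (h t) *\<^sub>R b"] c by simp
  ultimately show ?thesis by simp
qed

text \<open>Rational combinations of a spanning set are countable and dense. The sequence serves to
  cut the line into countably many sets on which a given density is almost constant.\<close>

lemma finite_dim_dense_sequence:
  assumes fin: "finite_dim TYPE('a::real_normed_vector)"
  obtains x :: "nat \<Rightarrow> 'a::real_normed_vector" where "\<And>y e. 0 < e \<Longrightarrow> \<exists>n. dist (x n) y < e"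
proof -
  obtain B :: "'a set" and c where B: "finite B" and c: "\<And>x::'a. (\<Sum>b\<in>B. blinfun_apply (c b) x *\<^sub>R b) = x"
    using finite_dim_coordinates[OF fin] by metis
  define D where "D = (\<lambda>q. \<Sum>b\<in>B. q b *\<^sub>R b) ` (PiE B (\<lambda>_. \<rat>))"
  have "countable (PiE B (\<lambda>_. \<rat> :: real set))"
    by (intro countable_PiE B countable_rat)
  then have cD: "countable D" unfolding D_def by (rule countable_image)
  have "D \<noteq> {}" unfolding D_def by (auto simp: PiE_eq_empty_iff)
  then obtain x :: "nat \<Rightarrow> 'a" where x: "range x = D"
    using cD by (metis uncountable_def)
  have "\<exists>n. dist (x n) y < e" if "0 < e" for y e
  proof -
    define K where "K = (\<Sum>b\<in>B. norm b) + 1"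
    have K: "0 < K" unfolding K_def by (smt (verit) norm_ge_zero sum_nonneg)
    have "\<exists>q\<in>\<rat>. \<bar>q - blinfun_apply (c b) y\<bar> < e / K" for b
      using Rats_dense_in_real[of "blinfun_apply (c b) y" "blinfun_apply (c b) y + e / K"] K that
      by (force simp: abs_less_iff)
    then obtain q where q: "\<And>b. q b \<in> \<rat>" "\<And>b. \<bar>q b - blinfun_apply (c b) y\<bar> < e / K" by metis
    have "(\<Sum>b\<in>B. restrict q B b *\<^sub>R b) \<in> D"
      unfolding D_def using q(1) by (intro imageI) auto
    then obtain n where n: "x n = (\<Sum>b\<in>B. q b *\<^sub>R b)" using x by force
    have "dist (x n) y = norm (\<Sum>b\<in>B. (q b - blinfun_apply (c b) y) *\<^sub>R b)"
      unfolding dist_norm n by (subst c[of y, symmetric]) (simp add: scaleR_left_diff_distrib sum_subtractf)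
    also have "\<dots> \<le> (\<Sum>b\<in>B. e / K * norm b)"
    proof (intro sum_norm_le)
      fix b show "norm ((q b - blinfun_apply (c b) y) *\<^sub>R b) \<le> e / K * norm b"
        using mult_right_mono[OF less_imp_le[OF q(2)[of b]], of "norm b"] by simp
    qed
    also have "\<dots> = e / K * (K - 1)" by (simp add: K_def sum_distrib_left)
    also have "\<dots> < e" using K that by (simp add: field_simps)
    finally show ?thesis by blast
  qed
  then show ?thesis using that by blast
qed

text \<open>A convex function that is locally bounded is continuous. For the upper bound,
  \<open>x\<close> is written as the mean of its coordinate vectors scaled by \<open>n\<close>, and
  each of these lies on a segment from \<open>- M b *\<^sub>R b\<close> to
  \<open>M b *\<^sub>R b\<close>; nonnegativity supplies the lower bound.\<close>

lemma finite_dim_convex_continuous: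
  fixes f :: "'a::real_normed_vector \<Rightarrow> real"
  assumes fin: "finite_dim TYPE('a)" and cvx: "convex_on UNIV f" and nonneg: "\<And>x. 0 \<le> f x"
  shows "continuous_on UNIV f"
proof -
  obtain B0 :: "'a set" and c where B0: "finite B0" and c0: "\<And>x::'a. (\<Sum>b\<in>B0. blinfun_apply (c b) x *\<^sub>R b) = x"
    using finite_dim_coordinates[OF fin] by metis
  have "\<exists>b. \<forall>x\<in>ball (0::'a) r. \<bar>f x\<bar> \<le> b" for r
  proof (cases "B0 = {}")
    case True
    then have "x = 0" for x :: 'a using c0[of x] by simp
    then show ?thesis by (metis order_refl)
  next
    case False
    define n where "n = real (card B0)"
    have n: "0 < n" using False B0 by (simp add: n_def card_gt_0_iff)
    define M where "M b = n * (norm (c b) * \<bar>r\<bar>) + 1" for b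
    have M: "0 < M b" for b unfolding M_def using n by (smt (verit) abs_ge_zero mult_nonneg_nonneg norm_ge_zero)
    have "f x \<le> (\<Sum>b\<in>B0. 1 / n * (f (M b *\<^sub>R b) + f (- M b *\<^sub>R b)))" if x: "x \<in> ball 0 r" for x
    proof -
      have "f x = f (\<Sum>b\<in>B0. (1 / n) *\<^sub>R ((n * blinfun_apply (c b) x) *\<^sub>R b))"
        using n c0[of x] by simp
      also have "\<dots> \<le> (\<Sum>b\<in>B0. 1 / n * f ((n * blinfun_apply (c b) x) *\<^sub>R b))"
        using n False B0 by (intro convex_on_sum[OF _ _ cvx]) (auto simp: n_def)
      also have "\<dots> \<le> (\<Sum>b\<in>B0. 1 / n * (f (M b *\<^sub>R b) + f (- M b *\<^sub>R b)))"
      proof (intro sum_mono mult_left_mono)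
        fix b
        have "\<bar>blinfun_apply (c b) x\<bar> \<le> norm (c b) * \<bar>r\<bar>"
          using norm_blinfun[of "c b" x] x
          by (smt (verit, best) dist_0_norm mem_ball mult_left_mono norm_ge_zero real_norm_def)
        then have "\<bar>n * blinfun_apply (c b) x\<bar> \<le> M b"
          unfolding M_def using n by (simp add: abs_mult) (smt (verit) mult_left_mono)
        define l where "l = (n * blinfun_apply (c b) x + M b) / (2 * M b)"
        have l: "0 \<le> l" "l \<le> 1" using M[of b] \<open>\<bar>n * _\<bar> \<le> M b\<close> by (auto simp: l_def field_simps)
        have eq: "(n * blinfun_apply (c b) x) = (1 - l) * (- M b) + l * M b"
          using M[of b] by (simp add: l_def field_simps)
        have "f ((n * blinfun_apply (c b) x) *\<^sub>R b) = f ((1 - l) *\<^sub>R (- M b *\<^sub>R b) + l *\<^sub>R (M b *\<^sub>R b))"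
          unfolding eq by (simp add: scaleR_left_distrib scaleR_left_diff_distrib)
        also have "\<dots> \<le> (1 - l) * f (- M b *\<^sub>R b) + l * f (M b *\<^sub>R b)"
          using cvx l by (intro convex_onD) auto
        also have "\<dots> \<le> 1 * f (- M b *\<^sub>R b) + 1 * f (M b *\<^sub>R b)"
          using l nonneg by (intro add_mono mult_right_mono) auto
        finally show "f ((n * blinfun_apply (c b) x) *\<^sub>R b) \<le> f (M b *\<^sub>R b) + f (- M b *\<^sub>R b)" by simp
      qed (use n in auto)
      finally show ?thesis .
    qed
    then show ?thesis by (intro exI[of _ "\<Sum>b\<in>B0. 1 / n * (f (M b *\<^sub>R b) + f (- M b *\<^sub>R b))"]) (simp add: abs_of_nonneg nonneg)
  qed
  then have *: "continuous_on (ball 0 r) f" for r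
    using convex_on_bounded_continuous[of "ball 0 r" f] convex_on_subset[OF cvx] by auto
  show ?thesis
    unfolding continuous_on_eq_continuous_at[OF open_UNIV]
  proof
    fix x :: 'a
    have "x \<in> ball 0 (norm x + 1)" by simp
    then show "isCont f x" using *[of "norm x + 1"] continuous_on_eq_continuous_at[OF open_ball] by blast
  qed
qed

section \<open>Gauges and the contact potential\<close>

locale finite_dim_gauge =
  fixes \<Psi>\<^sub>0 :: "'a::real_normed_vector \<Rightarrow> real"
  assumes fin: "finite_dim TYPE('a)"
    and gauge: "gauge_function \<Psi>\<^sub>0"
begin

lemma gauge_nonneg: "0 \<le> \<Psi>\<^sub>0 v"
  and gauge_pos: "v \<noteq> 0 \<Longrightarrow> 0 < \<Psi>\<^sub>0 v"
  and gauge_add: "\<Psi>\<^sub>0 (x + y) \<le> \<Psi>\<^sub>0 x + \<Psi>\<^sub>0 y"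
  and gauge_scale: "0 \<le> a \<Longrightarrow> \<Psi>\<^sub>0 (a *\<^sub>R v) = a * \<Psi>\<^sub>0 v"
  using gauge by (auto simp: gauge_function_def)

lemma gauge_zero [simp]: "\<Psi>\<^sub>0 0 = 0"
  using gauge_scale[of 0 0] by simp

lemma gauge_sum: "\<Psi>\<^sub>0 (\<Sum>i\<in>I. f i) \<le> (\<Sum>i\<in>I. \<Psi>\<^sub>0 (f i))"
proof (induction I rule: infinite_finite_induct)
  case (insert i I)
  then show ?case using gauge_add[of "f i" "sum f I"] by simp
qed auto

text \<open>Subadditivity reduces the claim to multiples of the spanning vectors. Homogeneity holds
  for nonnegative factors only, so the values at \<open>b\<close> and at \<open>- b\<close> both
  enter the constant.\<close>

lemma gauge_upper_bound:
  obtains K where "0 < K" "\<And>v. \<Psi>\<^sub>0 v \<le> K * norm v"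
proof -
  obtain B :: "'a set" and c where B: "finite B" and c: "\<And>x::'a. (\<Sum>b\<in>B. blinfun_apply (c b) x *\<^sub>R b) = x"
    using finite_dim_coordinates[OF fin] by metis
  define K where "K = (\<Sum>b\<in>B. norm (c b) * (\<Psi>\<^sub>0 b + \<Psi>\<^sub>0 (- b))) + 1"
  have "0 < K" unfolding K_def
    by (intro add_nonneg_pos sum_nonneg mult_nonneg_nonneg add_nonneg_nonneg gauge_nonneg) auto
  moreover have "\<Psi>\<^sub>0 v \<le> K * norm v" for v
  proof -
    have 1: "\<Psi>\<^sub>0 (a *\<^sub>R b) \<le> \<bar>a\<bar> * (\<Psi>\<^sub>0 b + \<Psi>\<^sub>0 (- b))" for a b
    proof (cases "0 \<le> a")
      case True
      then show ?thesis using gauge_nonneg[of "- b"] by (simp add: gauge_scale mult_left_mono)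
    next
      case False
      have "\<Psi>\<^sub>0 (a *\<^sub>R b) = \<Psi>\<^sub>0 (\<bar>a\<bar> *\<^sub>R (- b))" using False by simp
      also have "\<dots> = \<bar>a\<bar> * \<Psi>\<^sub>0 (- b)" by (rule gauge_scale) simp
      finally show ?thesis using gauge_nonneg[of b] by (simp add: mult_left_mono)
    qed
    have "\<Psi>\<^sub>0 v = \<Psi>\<^sub>0 (\<Sum>b\<in>B. blinfun_apply (c b) v *\<^sub>R b)" by (simp add: c)
    also have "\<dots> \<le> (\<Sum>b\<in>B. \<Psi>\<^sub>0 (blinfun_apply (c b) v *\<^sub>R b))" by (rule gauge_sum)
    also have "\<dots> \<le> (\<Sum>b\<in>B. (norm (c b) * norm v) * (\<Psi>\<^sub>0 b + \<Psi>\<^sub>0 (- b)))"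
    proof (rule sum_mono)
      fix b
      have "\<bar>blinfun_apply (c b) v\<bar> \<le> norm (c b) * norm v" using norm_blinfun[of "c b" v] by simp
      then show "\<Psi>\<^sub>0 (blinfun_apply (c b) v *\<^sub>R b) \<le> (norm (c b) * norm v) * (\<Psi>\<^sub>0 b + \<Psi>\<^sub>0 (- b))"
        using 1[of "blinfun_apply (c b) v" b] gauge_nonneg[of b] gauge_nonneg[of "- b"]
        by (smt (verit) mult_right_mono)
    qed
    also have "\<dots> = (K - 1) * norm v"
      unfolding K_def by (simp add: sum_distrib_right sum_distrib_left mult_ac)
    also have "\<dots> \<le> K * norm v" by (simp add: mult_right_mono)
    finally show ?thesis .
  qed
  ultimately show ?thesis using that by blast
qed

lemma gauge_diff: "\<Psi>\<^sub>0 x - \<Psi>\<^sub>0 y \<le> \<Psi>\<^sub>0 (x - y)"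
  using gauge_add[of "x - y" y] by simp

lemma gauge_continuous: "continuous_on UNIV \<Psi>\<^sub>0"
proof -
  obtain K where K: "0 < K" "\<And>v. \<Psi>\<^sub>0 v \<le> K * norm v" using gauge_upper_bound by metis
  have "dist (\<Psi>\<^sub>0 x) (\<Psi>\<^sub>0 y) \<le> K * dist x y" for x y
    using gauge_diff[of x y] gauge_diff[of y x] K(2)[of "x - y"] K(2)[of "y - x"]
    by (simp add: dist_norm norm_minus_commute abs_le_iff)
  then have "lipschitz_on K UNIV \<Psi>\<^sub>0" using K(1) by (intro lipschitz_onI) auto
  then show ?thesis by (rule lipschitz_on_continuous_on)
qed

lemma gauge_tendsto: "(f \<longlongrightarrow> l) F \<Longrightarrow> ((\<lambda>x. \<Psi>\<^sub>0 (f x)) \<longlongrightarrow> \<Psi>\<^sub>0 l) F"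
  by (rule continuous_on_tendsto_compose[OF gauge_continuous]) auto

lemma compact_sphere: "compact (sphere (0::'a) 1)"
proof (rule finite_dim_compact[OF fin])
  show "closed (sphere (0::'a) 1)"
    unfolding sphere_def by (intro closed_Collect_eq continuous_intros)
  show "bounded (sphere (0::'a) 1)"
    by (rule bounded_subset[OF bounded_cball sphere_cball])
qed

lemma compact_cball: "compact (cball (0::'a) R)"
  by (rule finite_dim_compact[OF fin]) auto

text \<open>The constant is the minimum of \<open>\<Psi>\<^sub>0\<close> on the unit sphere, which
  is attained by compactness and positive. The sphere is empty exactly in the zero space, where any
  constant works.\<close>

lemma gauge_lower_bound:
  obtains c where "0 < c" "\<And>v. c * norm v \<le> \<Psi>\<^sub>0 v"
proof (cases "sphere (0::'a) 1 = {}")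
  case True
  have "v = 0" for v :: 'a
  proof (rule ccontr)
    assume "v \<noteq> 0"
    then have "(1 / norm v) *\<^sub>R v \<in> sphere 0 1" by simp
    then show False using True by blast
  qed
  then have "1 * norm v \<le> \<Psi>\<^sub>0 v" for v by simp (metis gauge_nonneg norm_zero)
  then show ?thesis using that[of 1] by auto
next
  case False
  obtain x where x: "x \<in> sphere 0 1" "\<And>y. y \<in> sphere 0 1 \<Longrightarrow> \<Psi>\<^sub>0 x \<le> \<Psi>\<^sub>0 y"
    using continuous_attains_inf[OF compact_sphere False continuous_on_subset[OF gauge_continuous]] by auto
  have "\<Psi>\<^sub>0 x * norm v \<le> \<Psi>\<^sub>0 v" for v
  proof (cases "v = 0")
    case False
    have "\<Psi>\<^sub>0 x \<le> \<Psi>\<^sub>0 ((1 / norm v) *\<^sub>R v)" using False by (intro x) simp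
    also have "\<dots> = \<Psi>\<^sub>0 v / norm v" by (subst gauge_scale) auto
    finally show ?thesis using False by (simp add: field_simps)
  qed simp
  moreover have "0 < \<Psi>\<^sub>0 x" using x(1) by (intro gauge_pos) auto
  ultimately show ?thesis using that by blast
qed

end

text \<open>A real supremum is convenient for estimates but means something only for sets bounded
  above; superlinear growth guarantees this in \<open>conjugate_bdd\<close>, and
  \<open>legendre_eq\<close> identifies it with the extended real conjugate.\<close>

definition real_conjugate :: "('a::real_normed_vector \<Rightarrow> real) \<Rightarrow> ('a \<Rightarrow>\<^sub>L real) \<Rightarrow> real" where
  "real_conjugate F w = (SUP v. blinfun_apply w v - F v)"

locale viscous_dissipation = finite_dim_gauge \<Psi>\<^sub>0 for \<Psi>\<^sub>0 :: "'a::real_normed_vector \<Rightarrow> real" +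
  fixes \<Psi> :: "'a \<Rightarrow> real"
  assumes \<Psi>_nonneg: "\<And>v. 0 \<le> \<Psi> v"
    and \<Psi>_convex: "convex_on UNIV \<Psi>"
    and \<Psi>_zero: "\<Psi> 0 = 0"
    and \<Psi>_superlinear: "filterlim (\<lambda>v. \<Psi> v / norm v) at_top at_infinity"
    and \<Psi>_limit: "\<And>v. ((\<lambda>\<epsilon>. viscous_potential \<Psi> \<epsilon> v) \<longlongrightarrow> \<Psi>\<^sub>0 v) (at_right 0)"
begin

abbreviation "\<Psi>v \<equiv> viscous_potential \<Psi>"
abbreviation "\<Psi>s \<equiv> real_conjugate \<Psi>"

text \<open>\<open>\<Psi> (e *\<^sub>R v) / e\<close> is a difference quotient at the origin of a
  convex function of \<open>e\<close> that vanishes there, and such quotients grow with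
  \<open>e\<close>.\<close>

lemma viscous_mono:
  assumes "0 < e" "e \<le> e'"
  shows "\<Psi>v e v \<le> \<Psi>v e' v"
proof -
  define l where "l = e / e'"
  have l: "0 \<le> l" "l \<le> 1" using assms by (auto simp: l_def)
  have "\<Psi> (e *\<^sub>R v) = \<Psi> ((1 - l) *\<^sub>R 0 + l *\<^sub>R (e' *\<^sub>R v))"
    using assms by (simp add: l_def)
  also have "\<dots> \<le> (1 - l) * \<Psi> 0 + l * \<Psi> (e' *\<^sub>R v)"
    using l \<Psi>_convex by (intro convex_onD) auto
  also have "\<dots> = e / e' * \<Psi> (e' *\<^sub>R v)" by (simp add: \<Psi>_zero l_def)
  finally show ?thesis using assms by (simp add: viscous_potential_def field_simps)
qed

lemma gauge_le_viscous:
  assumes "0 < e"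
  shows "\<Psi>\<^sub>0 v \<le> \<Psi>v e v"
proof (rule tendsto_upperbound[OF \<Psi>_limit])
  show "\<forall>\<^sub>F x in at_right 0. \<Psi>v x v \<le> \<Psi>v e v"
    using eventually_at_right_less[of "0::real"] order_tendstoD(2)[OF tendsto_ident_at assms]
    by eventually_elim (auto intro: viscous_mono)
qed simp

lemma viscous_scale: "0 < a \<Longrightarrow> 0 < e \<Longrightarrow> \<Psi>v e (a *\<^sub>R v) = a * \<Psi>v (e * a) v"
  by (simp add: viscous_potential_def mult.commute)

lemma viscous_continuous: "continuous_on UNIV (\<Psi>v e)"
proof -
  have "continuous_on UNIV (\<lambda>v. \<Psi> (e *\<^sub>R v))"
    by (rule continuous_on_compose2[OF finite_dim_convex_continuous[OF fin \<Psi>_convex \<Psi>_nonneg]])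
      (auto intro: continuous_intros)
  then show ?thesis unfolding viscous_potential_def divide_inverse by (intro continuous_intros)
qed

text \<open>A Dini argument: the potentials decrease to the continuous function \<open>\<Psi>\<^sub>0\<close> on the compact sphere.\<close>

lemma viscous_uniform:
  assumes "0 < \<eta>"
  obtains e where "0 < e" "\<And>v. norm v = 1 \<Longrightarrow> \<Psi>v e v \<le> \<Psi>\<^sub>0 v + \<eta>"
proof -
  define U where "U n = {v. \<Psi>v (inverse (real (Suc n))) v < \<Psi>\<^sub>0 v + \<eta>}" for n
  have op: "open (U n)" for n
    unfolding U_def by (intro open_Collect_less continuous_intros viscous_continuous gauge_continuous)
  have cov: "sphere 0 1 \<subseteq> (\<Union>n\<in>UNIV. U n)"
  proof
    fix v
    have "(\<lambda>n. \<Psi>v (inverse (real (Suc n))) v) \<longlonglongrightarrow> \<Psi>\<^sub>0 v"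
      by (rule filterlim_compose[OF \<Psi>_limit tendsto_imp_filterlim_at_right[OF LIMSEQ_inverse_real_of_nat]]) simp
    then have "\<forall>\<^sub>F n in sequentially. \<Psi>v (inverse (real (Suc n))) v < \<Psi>\<^sub>0 v + \<eta>"
      using assms by (intro order_tendstoD) auto
    then show "v \<in> (\<Union>n\<in>UNIV. U n)" unfolding U_def eventually_sequentially by auto
  qed
  obtain I where I: "finite I" "sphere 0 1 \<subseteq> (\<Union>n\<in>I. U n)"
    using compactE_image[OF compact_sphere, of UNIV U] op cov by auto
  define m where "m = Max (insert 0 I)"
  have "\<Psi>v (inverse (real (Suc m))) v \<le> \<Psi>\<^sub>0 v + \<eta>" if v: "norm v = 1" for v
  proof -
    obtain n where n: "n \<in> I" "v \<in> U n" using I(2) v by auto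
    then have "n \<le> m" using I(1) by (simp add: m_def)
    then have "inverse (real (Suc m)) \<le> inverse (real (Suc n))" by simp
    then have "\<Psi>v (inverse (real (Suc m))) v \<le> \<Psi>v (inverse (real (Suc n))) v"
      by (intro viscous_mono) auto
    then show ?thesis using n(2) by (simp add: U_def)
  qed
  then show ?thesis using that[of "inverse (real (Suc m))"] by simp
qed

text \<open>By scaling, \<open>\<Psi>v d v\<close> is \<open>norm v\<close> times the value at the
  unit vector of \<open>v\<close> with parameter \<open>d * norm v\<close>. The uniform bound on the
  sphere therefore applies as soon as this product is at most \<open>e\<close>.\<close>

lemma viscous_uniform_le:
  assumes "0 < \<eta>"
  obtains e where "0 < e" "\<And>v d. 0 < d \<Longrightarrow> d * norm v \<le> e \<Longrightarrow> \<Psi>v d v \<le> \<Psi>\<^sub>0 v + \<eta> * norm v"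
proof -
  obtain e where e: "0 < e" "\<And>v. norm v = 1 \<Longrightarrow> \<Psi>v e v \<le> \<Psi>\<^sub>0 v + \<eta>"
    using viscous_uniform[OF assms] by metis
  have "\<Psi>v d v \<le> \<Psi>\<^sub>0 v + \<eta> * norm v" if d: "0 < d" "d * norm v \<le> e" for v d
  proof (cases "v = 0")
    case True
    then show ?thesis by (simp add: viscous_potential_def \<Psi>_zero)
  next
    case False
    define n where "n = norm v"
    define x where "x = (1 / n) *\<^sub>R v"
    have n: "0 < n" using False by (simp add: n_def)
    have v: "v = n *\<^sub>R x" using n by (simp add: x_def)
    have nx: "norm x = 1" using n by (simp add: x_def n_def)
    have "\<Psi>v d v = n * \<Psi>v (d * n) x" unfolding v using n d by (intro viscous_scale) auto
    also have "\<dots> \<le> n * \<Psi>v e x"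
      using n d by (intro mult_left_mono viscous_mono) (auto simp: n_def)
    also have "\<dots> \<le> n * (\<Psi>\<^sub>0 x + \<eta>)" using n e(2)[OF nx] by (intro mult_left_mono) auto
    also have "\<dots> = \<Psi>\<^sub>0 v + \<eta> * n" unfolding v using n by (simp add: gauge_scale algebra_simps)
    finally show ?thesis by (simp add: n_def)
  qed
  then show ?thesis using that e(1) by blast
qed

lemma superlinear_bound:
  obtains r where "0 < r" "\<And>v. r \<le> norm v \<Longrightarrow> R * norm v \<le> \<Psi> v"
proof -
  obtain b where b: "\<And>v. b \<le> norm v \<Longrightarrow> R \<le> \<Psi> v / norm v"
    using \<Psi>_superlinear unfolding filterlim_at_top eventually_at_infinity by metis
  have "R * norm v \<le> \<Psi> v" if "max b 1 \<le> norm v" for v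
  proof -
    have "0 < norm v" "b \<le> norm v" using that by linarith+
    then show ?thesis using b[of v] by (simp add: pos_le_divide_eq)
  qed
  then show ?thesis using that[of "max b 1"] by auto
qed

lemma conjugate_bdd: "bdd_above (range (\<lambda>v. blinfun_apply w v - \<Psi> v))"
proof -
  obtain r where r: "0 < r" "\<And>v. r \<le> norm v \<Longrightarrow> norm w * norm v \<le> \<Psi> v"
    using superlinear_bound by metis
  have "blinfun_apply w v - \<Psi> v \<le> norm w * r" for v
  proof (cases "r \<le> norm v")
    case True
    have "0 \<le> norm w * r" using r(1) by simp
    then show ?thesis using norm_blinfun[of w v] r(2)[OF True] by simp
  next
    case False
    then have "norm w * norm v \<le> norm w * r" by (intro mult_left_mono) auto
    then show ?thesis using norm_blinfun[of w v] \<Psi>_nonneg[of v] by simp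
  qed
  then show ?thesis by (auto intro!: bdd_aboveI)
qed

lemma conjugate_ge: "blinfun_apply w v - \<Psi> v \<le> \<Psi>s w"
  unfolding real_conjugate_def by (rule cSUP_upper[OF UNIV_I conjugate_bdd])

lemma conjugate_le: "(\<And>v. blinfun_apply w v - \<Psi> v \<le> b) \<Longrightarrow> \<Psi>s w \<le> b"
  unfolding real_conjugate_def by (rule cSUP_least) auto

lemma conjugate_nonneg: "0 \<le> \<Psi>s w"
  using conjugate_ge[of w 0] by (simp add: \<Psi>_zero)

lemma legendre_eq: "legendre_conjugate \<Psi> w = ereal (\<Psi>s w)"
proof (rule antisym)
  show "legendre_conjugate \<Psi> w \<le> ereal (\<Psi>s w)"
    unfolding legendre_conjugate_def by (intro SUP_least) (use conjugate_ge in auto)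
  have ub: "ereal (blinfun_apply w v - \<Psi> v) \<le> legendre_conjugate \<Psi> w" for v
    unfolding legendre_conjugate_def by (intro SUP_upper) auto
  show "ereal (\<Psi>s w) \<le> legendre_conjugate \<Psi> w"
  proof (cases "legendre_conjugate \<Psi> w")
    case (real b)
    then show ?thesis using ub by (auto intro: conjugate_le)
  next
    case MInf
    then show ?thesis using ub[of 0] by simp
  qed simp
qed

lemma legendre_viscous_eq:
  "0 < e \<Longrightarrow> legendre_conjugate (\<Psi>v e) w = ereal (\<Psi>s w / e)"
  by (simp add: legendre_conjugate_viscous legendre_eq)

text \<open>For \<open>norm w \<le> R\<close> the vectors of norm at least \<open>r\<close>
  contribute nonpositive values, by superlinearity, while the supremum is nonnegative. The remaining
  vectors give functions of \<open>w\<close> with Lipschitz constant \<open>r\<close>.\<close>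

lemma conjugate_lipschitz:
  obtains L where "0 < L"
    "\<And>w w'. norm w \<le> R \<Longrightarrow> norm w' \<le> R \<Longrightarrow> \<Psi>s w' \<le> \<Psi>s w + L * norm (w' - w)"
proof -
  obtain r where r: "0 < r" "\<And>v. r \<le> norm v \<Longrightarrow> R * norm v \<le> \<Psi> v"
    using superlinear_bound by metis
  have "\<Psi>s w' \<le> \<Psi>s w + r * norm (w' - w)" if w: "norm w \<le> R" "norm w' \<le> R" for w w'
  proof (rule conjugate_le)
    fix v
    show "blinfun_apply w' v - \<Psi> v \<le> \<Psi>s w + r * norm (w' - w)"
    proof (cases "r \<le> norm v")
      case True
      have "blinfun_apply w' v \<le> norm w' * norm v" using norm_blinfun[of w' v] by simp
      also have "\<dots> \<le> R * norm v" using w by (intro mult_right_mono) auto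
      finally have "blinfun_apply w' v - \<Psi> v \<le> 0" using r(2)[OF True] by simp
      moreover have "0 \<le> r * norm (w' - w)" using r(1) by simp
      ultimately show ?thesis using conjugate_nonneg[of w] by linarith
    next
      case False
      have "blinfun_apply (w' - w) v \<le> norm (w' - w) * norm v" using norm_blinfun[of "w' - w" v] by simp
      also have "\<dots> \<le> norm (w' - w) * r" using False by (intro mult_left_mono) auto
      finally have "blinfun_apply w' v - blinfun_apply w v \<le> r * norm (w' - w)"
        by (simp add: blinfun.diff_left mult.commute)
      then show ?thesis using conjugate_ge[of w v] by linarith
    qed
  qed
  then show ?thesis using that[OF r(1)] by blast
qed

lemma conjugate_continuous: "continuous_on UNIV \<Psi>s"
proof -
  have *: "continuous_on (ball 0 R) \<Psi>s" for R
  proof -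
    obtain L where L: "0 < L" "\<And>w w'. norm w \<le> R \<Longrightarrow> norm w' \<le> R \<Longrightarrow> \<Psi>s w' \<le> \<Psi>s w + L * norm (w' - w)"
      using conjugate_lipschitz by metis
    have "dist (\<Psi>s x) (\<Psi>s y) \<le> L * dist x y" if "x \<in> ball 0 R" "y \<in> ball 0 R" for x y
      using L(2)[of x y] L(2)[of y x] that by (auto simp: dist_norm norm_minus_commute abs_le_iff)
    then have "lipschitz_on L (ball 0 R) \<Psi>s" using L(1) by (intro lipschitz_onI) auto
    then show ?thesis by (rule lipschitz_on_continuous_on)
  qed
  show ?thesis
    unfolding continuous_on_eq_continuous_at[OF open_UNIV]
  proof
    fix x :: "'a \<Rightarrow>\<^sub>L real"
    have "x \<in> ball 0 (norm x + 1)" by simp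
    then show "isCont \<Psi>s x" using *[of "norm x + 1"] continuous_on_eq_continuous_at[OF open_ball] by blast
  qed
qed

text \<open>Fenchel's inequality at \<open>e *\<^sub>R v\<close>, divided by \<open>e\<close>,
  bounds every member of the family from below by the same number.\<close>

lemma contact_lower: "ereal (blinfun_apply w v) \<le> contact_potential \<Psi> v w"
  unfolding contact_potential_def
proof (rule INF_greatest)
  fix e :: real assume "e \<in> {0<..}"
  then have e: "0 < e" by simp
  have "e * blinfun_apply w v - \<Psi> (e *\<^sub>R v) \<le> \<Psi>s w"
    using conjugate_ge[of w "e *\<^sub>R v"] by (simp add: blinfun.scaleR_right)
  then have "blinfun_apply w v \<le> \<Psi>v e v + \<Psi>s w / e"
    using e by (simp add: viscous_potential_def field_simps)
  then show "ereal (blinfun_apply w v) \<le> ereal (\<Psi>v e v) + legendre_conjugate (\<Psi>v e) w"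
    using e by (simp add: legendre_viscous_eq)
qed

lemma contact_upper:
  assumes "0 < e"
  shows "contact_potential \<Psi> v w \<le> ereal (\<Psi>v e v + \<Psi>s w / e)"
  unfolding contact_potential_def
  by (rule INF_lower2[of e]) (use assms in \<open>auto simp: legendre_viscous_eq\<close>)

text \<open>At \<open>v = 0\<close> only \<open>\<Psi>s w / e\<close> remains, and it tends to 0 for
  large \<open>e\<close>. Standing still is therefore free, whether or not the state is
  stable.\<close>

lemma contact_zero: "contact_potential \<Psi> 0 w \<le> 0"
proof (rule tendsto_lowerbound)
  show "((\<lambda>e. ereal (\<Psi>v e 0 + \<Psi>s w / e)) \<longlongrightarrow> 0) at_top"
    unfolding zero_ereal_def tendsto_ereal
    by (simp add: viscous_potential_def \<Psi>_zero) (intro tendsto_divide_0[OF tendsto_const] filterlim_at_top_imp_at_infinity filterlim_ident)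
  show "\<forall>\<^sub>F e in at_top. contact_potential \<Psi> 0 w \<le> ereal (\<Psi>v e 0 + \<Psi>s w / e)"
    using eventually_gt_at_top[of "0::real"] by eventually_elim (rule contact_upper)
qed simp

text \<open>With the parameter \<open>e / norm v\<close> both terms become linear in
  \<open>norm v\<close>: the first by the uniform comparison with \<open>\<Psi>\<^sub>0\<close>, the
  second because a bounded conjugate is divided by the parameter. This is the price of the short
  segments that connect a viscous curve with prescribed end points.\<close>

lemma contact_norm_bound:
  obtains K where "0 < K" "\<And>v w. norm w \<le> R \<Longrightarrow> contact_potential \<Psi> v w \<le> ereal (K * norm v)"
proof -
  obtain L where L: "0 < L" "\<And>w w'. norm w \<le> \<bar>R\<bar> \<Longrightarrow> norm w' \<le> \<bar>R\<bar> \<Longrightarrow> \<Psi>s w' \<le> \<Psi>s w + L * norm (w' - w)"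
    using conjugate_lipschitz by metis
  obtain G where G: "0 < G" "\<And>v. \<Psi>\<^sub>0 v \<le> G * norm v" using gauge_upper_bound by metis
  obtain e where e: "0 < e" "\<And>v d. 0 < d \<Longrightarrow> d * norm v \<le> e \<Longrightarrow> \<Psi>v d v \<le> \<Psi>\<^sub>0 v + 1 * norm v"
    using viscous_uniform_le[of 1] by (metis zero_less_one)
  define b where "b = \<Psi>s 0 + L * \<bar>R\<bar>"
  have b: "0 \<le> b" unfolding b_def using L(1) conjugate_nonneg by (intro add_nonneg_nonneg) auto
  have "contact_potential \<Psi> v w \<le> ereal ((G + 1 + b / e) * norm v)" if w: "norm w \<le> R" for v w
  proof (cases "v = 0")
    case True
    then show ?thesis using contact_zero[of w] by (simp add: zero_ereal_def)
  next
    case False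
    have d: "0 < e / norm v" using e False by simp
    have "\<Psi>s w \<le> \<Psi>s 0 + L * norm (w - 0)" using w by (intro L(2)) auto
    also have "\<dots> \<le> b" unfolding b_def using w L(1) by (intro add_left_mono mult_left_mono) auto
    finally have "\<Psi>s w / (e / norm v) \<le> b / (e / norm v)" using d by (intro divide_right_mono) auto
    moreover have "\<Psi>v (e / norm v) v \<le> G * norm v + norm v"
      using e(2)[OF d, of v] False G(2)[of v] by simp
    ultimately have "\<Psi>v (e / norm v) v + \<Psi>s w / (e / norm v) \<le> (G + 1 + b / e) * norm v"
      by (simp add: algebra_simps)
    then show ?thesis using contact_upper[OF d, of v w] by (metis ereal_less_eq(3) order_trans)
  qed
  moreover have "0 < G + 1 + b / e" using G(1) b e(1) by (intro add_pos_nonneg) auto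
  ultimately show ?thesis by (intro that[of "G + 1 + b / e"])
qed

text \<open>The bound that lets the time in the second argument be frozen: the dependence of the
  contact potential on \<open>w\<close> is uniform although \<open>\<Psi>\<^sup>*(w) / e\<close> itself blows up as \<open>e\<close> tends to 0. When
  \<open>e \<bar>v\<bar>\<close> is small one trades \<open>e\<close> for a larger parameter, at the price \<open>\<Psi>\<^sub>e v - \<Psi>\<^sub>0 v\<close>.\<close>

lemma contact_frozen:
  assumes "0 < \<eta>"
  obtains \<omega> where "0 < \<omega>"
    "\<And>v w w' e. 0 < e \<Longrightarrow> norm w \<le> R \<Longrightarrow> norm w' \<le> R \<Longrightarrow> norm (w' - w) \<le> \<omega> \<Longrightarrow>
       contact_potential \<Psi> v w' \<le> ereal (\<Psi>v e v + \<Psi>s w / e + \<eta> * norm v)"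
proof -
  obtain L where L: "0 < L" "\<And>w w'. norm w \<le> R \<Longrightarrow> norm w' \<le> R \<Longrightarrow> \<Psi>s w' \<le> \<Psi>s w + L * norm (w' - w)"
    using conjugate_lipschitz by metis
  obtain d where d: "0 < d" "\<And>v e. 0 < e \<Longrightarrow> e * norm v \<le> d \<Longrightarrow> \<Psi>v e v \<le> \<Psi>\<^sub>0 v + \<eta> / 2 * norm v"
    using viscous_uniform_le[of "\<eta> / 2"] assms by (metis half_gt_zero)
  \<comment> \<open>A change of \<open>w\<close> by at most \<open>\<omega>\<close> raises the
    conjugate by at most \<open>\<eta> / 2 * d\<close>. Divided by a parameter \<open>e\<close> with
    \<open>e * norm v\<close> at least \<open>d\<close>, this costs at most half of the budget
    \<open>\<eta> * norm v\<close>; the other half pays for enlarging the parameter.\<close>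
  define \<omega> where "\<omega> = \<eta> / 2 * d / L"
  have \<omega>: "0 < \<omega>" using assms d L by (simp add: \<omega>_def)
  have main: "contact_potential \<Psi> v w' \<le> ereal (\<Psi>v e v + \<Psi>s w / e + \<eta> * norm v)"
    if e: "0 < e" and w: "norm w \<le> R" "norm w' \<le> R" "norm (w' - w) \<le> \<omega>" for v w w' e
  proof -
    have "\<Psi>s w' \<le> \<Psi>s w + L * norm (w' - w)" using w by (intro L) auto
    also have "\<dots> \<le> \<Psi>s w + L * \<omega>" using w L by (intro add_left_mono mult_left_mono) auto
    finally have c: "\<Psi>s w' \<le> \<Psi>s w + \<eta> / 2 * d" using L(1) by (simp add: \<omega>_def)
    consider "v = 0" | "v \<noteq> 0" "d \<le> e * norm v" | "v \<noteq> 0" "e * norm v < d" by linarith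
    then show ?thesis
    proof cases
      case 1
      have "0 \<le> \<Psi>v e 0 + \<Psi>s w / e"
        using e conjugate_nonneg[of w] by (simp add: viscous_potential_def \<Psi>_zero)
      then show ?thesis using contact_zero[of w'] 1 by (simp add: order_trans)
    next
      case 2
      have "\<Psi>s w' / e \<le> (\<Psi>s w + \<eta> / 2 * d) / e" using c e by (intro divide_right_mono) auto
      also have "\<dots> \<le> \<Psi>s w / e + \<eta> / 2 * norm v"
        using e 2 assms mult_left_mono[of d "e * norm v" "\<eta> / 2"] by (simp add: field_simps)
      also have "\<dots> \<le> \<Psi>s w / e + \<eta> * norm v" using assms by (simp add: mult_right_mono)
      finally have "\<Psi>v e v + \<Psi>s w' / e \<le> \<Psi>v e v + \<Psi>s w / e + \<eta> * norm v" by simp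
      then show ?thesis using contact_upper[OF e, of v w'] by (metis ereal_less_eq(3) order_trans)
    next
      case 3
      define e' where "e' = d / norm v"
      have nv: "0 < norm v" using 3 by simp
      have e': "0 < e'" "e < e'" using nv 3 d(1) by (auto simp: e'_def field_simps)
      have "\<Psi>v e' v \<le> \<Psi>\<^sub>0 v + \<eta> / 2 * norm v" using nv e' by (intro d(2)) (auto simp: e'_def)
      also have "\<dots> \<le> \<Psi>v e v + \<eta> / 2 * norm v" using gauge_le_viscous[OF e, of v] by simp
      finally have 31: "\<Psi>v e' v \<le> \<Psi>v e v + \<eta> / 2 * norm v" .
      have "\<Psi>s w' / e' \<le> (\<Psi>s w + \<eta> / 2 * d) / e'" using c e' by (intro divide_right_mono) auto
      also have "\<dots> = \<Psi>s w / e' + \<eta> / 2 * norm v" using nv d(1) by (simp add: e'_def field_simps)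
      also have "\<Psi>s w / e' \<le> \<Psi>s w / e" using e e' conjugate_nonneg by (intro divide_left_mono) auto
      finally have "\<Psi>v e' v + \<Psi>s w' / e' \<le> \<Psi>v e v + \<Psi>s w / e + \<eta> * norm v" using 31 by (simp add: field_simps)
      then show ?thesis using contact_upper[OF e'(1), of v w'] by (metis ereal_less_eq(3) order_trans)
    qed
  qed
  show ?thesis by (rule that[OF \<omega> main])
qed

text \<open>If the conjugate vanishes, \<open>w\<close> lies below \<open>\<Psi>\<close>, hence by
  scaling below every \<open>\<Psi>v e\<close>, hence below their limit. This is how a vanishing
  integral of \<open>\<Psi>s\<close> becomes the stability condition.\<close>

lemma conjugate_zero_imp_le:
  assumes "\<Psi>s w = 0"
  shows "blinfun_apply w v \<le> \<Psi>\<^sub>0 v"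
proof (rule tendsto_lowerbound[OF \<Psi>_limit])
  show "\<forall>\<^sub>F e in at_right 0. blinfun_apply w v \<le> \<Psi>v e v"
    using eventually_at_right_less[of "0::real"]
  proof eventually_elim
    case (elim e)
    then show ?case using conjugate_ge[of w "e *\<^sub>R v"] assms
      by (simp add: viscous_potential_def blinfun.scaleR_right field_simps)
  qed
qed simp

text \<open>An element of the subdifferential attains the supremum that defines the conjugate. The
  viscous equation thereby turns into a bound of both dissipation terms by the dissipated
  power.\<close>

lemma subdifferential_viscous:
  assumes "0 < e" "w \<in> subdifferential (\<Psi>v e) v"
  shows "\<Psi>v e v + \<Psi>s w / e \<le> blinfun_apply w v"
proof -
  have "legendre_conjugate (\<Psi>v e) w \<le> ereal (blinfun_apply w v - \<Psi>v e v)"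
    unfolding legendre_conjugate_def
  proof (rule SUP_least)
    fix z
    have "\<Psi>v e v + blinfun_apply w (z - v) \<le> \<Psi>v e z"
      using assms(2) by (auto simp: subdifferential_def)
    then show "ereal (blinfun_apply w z - \<Psi>v e z) \<le> ereal (blinfun_apply w v - \<Psi>v e v)"
      by (simp add: blinfun.diff_right)
  qed
  then show ?thesis using assms(1) by (simp add: legendre_viscous_eq)
qed

end

section \<open>Absolutely continuous functions\<close>

lemma negligible_open_cover:
  fixes N :: "real set"
  assumes "negligible N" "0 < d"
  obtains U where "open U" "N \<subseteq> U" "U \<in> lmeasurable" "measure lebesgue U < d"
proof -
  have NL: "N \<in> sets lebesgue" using assms(1) negligible_imp_sets by blast
  obtain U where U: "open U" "N \<subseteq> U" "U - N \<in> lmeasurable" "emeasure lebesgue (U - N) < ennreal d"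
    using sets_lebesgue_outer_open[OF NL assms(2)] by metis
  have "U = (U - N) \<union> N" using U by auto
  moreover have NM: "N \<in> lmeasurable" using assms(1) negligible_imp_measurable by blast
  ultimately have UM: "U \<in> lmeasurable" using U(3) fmeasurable.Un by metis
  have "measure lebesgue U = measure lebesgue (U - N)"
    using measure_Diff_null_set[of U lebesgue N] assms(1) UM by (auto simp: negligible_iff_null_sets)
  also have "\<dots> < d" using U(3,4) assms(2) by (simp add: emeasure_eq_measure2 ennreal_less_iff)
  finally show ?thesis using that U UM by blast
qed

lemma division_sum_length:
  fixes D :: "real set set"
  assumes "D division_of S"
  shows "(\<Sum>K\<in>D. Sup K - Inf K) = measure lebesgue S"
proof -
  have "(\<Sum>K\<in>D. Sup K - Inf K) = (\<Sum>K\<in>D. measure lebesgue K)"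
  proof (rule sum.cong)
    fix K assume "K \<in> D"
    then obtain u v where "K = {u..v}" "K \<noteq> {}" using assms by (metis division_ofD(3,4) box_real(2))
    then show "Sup K - Inf K = measure lebesgue K" by auto
  qed simp
  also have "\<dots> = measure lebesgue S" by (rule content_division[OF assms])
  finally show ?thesis .
qed

text \<open>Two different tags can share an interval only if it is degenerate, and a degenerate
  interval has increment 0. So the sum may be taken over the intervals alone.\<close>

lemma sum_tagged_eq_division:
  fixes f :: "real \<Rightarrow> 'b::real_normed_vector"
  assumes "p tagged_partial_division_of S"
  shows "(\<Sum>(x,K)\<in>p. norm (f (Sup K) - f (Inf K))) = (\<Sum>K\<in>snd ` p. norm (f (Sup K) - f (Inf K)))"
proof -
  have ne: "K \<noteq> {}" if "(x, K) \<in> p" for x K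
    using tagged_partial_division_ofD(2)[OF assms that] by auto
  \<comment> \<open>The lemma on tagged divisions wants the value 0 on every box with empty
    interior, including the empty one, where \<open>Sup\<close> and \<open>Inf\<close> have no
    useful value.\<close>
  define d where "d K = (if K = {} then 0 else norm (f (Sup K) - f (Inf K)))" for K
  have "(\<Sum>(x,K)\<in>p. norm (f (Sup K) - f (Inf K))) = (\<Sum>(x,K)\<in>p. d K)"
    by (intro sum.cong) (auto simp: d_def dest: ne)
  also have "\<dots> = sum d (snd ` p)"
  proof (rule sum.over_tagged_division_lemma)
    show "p tagged_division_of \<Union>(snd ` p)" by (rule tagged_partial_division_of_Union_self[OF assms])
    show "d (cbox u v) = 0" if "box u v = {}" for u v
    proof (cases "u = v")
      case False
      then have "cbox u v = {}" using that by auto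
      then show ?thesis by (simp add: d_def)
    qed (simp add: d_def)
  qed
  also have "\<dots> = (\<Sum>K\<in>snd ` p. norm (f (Sup K) - f (Inf K)))"
    by (intro sum.cong) (auto simp: d_def dest: ne)
  finally show ?thesis .
qed

text \<open>Tags in a null set drop out of Riemann sums: if the open cover has measure below the
  \<open>d\<close> of absolute continuity, the total increment over all non-overlapping intervals
  inside it stays below \<open>e\<close>.\<close>

lemma abs_continuous_small_cover:
  fixes f :: "real \<Rightarrow> 'b::real_normed_vector"
  assumes ac: "abs_continuous_on a b f" and N: "negligible N" and "0 < e"
  obtains U where "open U" "N \<subseteq> U"
    "\<And>p. p tagged_partial_division_of {a..b} \<Longrightarrow> (\<And>x K. (x, K) \<in> p \<Longrightarrow> K \<subseteq> U) \<Longrightarrow>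
       (\<Sum>(x,K)\<in>p. norm (f (Sup K) - f (Inf K))) < e"
proof -
  obtain d where d: "0 < d"
    "\<And>\<D>. \<D> division_of \<Union>\<D> \<Longrightarrow> \<Union>\<D> \<subseteq> {a..b} \<Longrightarrow> (\<Sum>I\<in>\<D>. Sup I - Inf I) < d \<Longrightarrow>
        (\<Sum>I\<in>\<D>. norm (f (Sup I) - f (Inf I))) < e"
    using ac \<open>0 < e\<close> unfolding abs_continuous_on_def by meson
  obtain U where U: "open U" "N \<subseteq> U" "U \<in> lmeasurable" "measure lebesgue U < d"
    using negligible_open_cover[OF N d(1)] by metis
  have "(\<Sum>(x,K)\<in>p. norm (f (Sup K) - f (Inf K))) < e"
    if p: "p tagged_partial_division_of {a..b}" and sub: "\<And>x K. (x, K) \<in> p \<Longrightarrow> K \<subseteq> U" for p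
  proof -
    have D: "snd ` p division_of \<Union>(snd ` p)" by (rule partial_division_of_tagged_division[OF p])
    have "\<Union>(snd ` p) \<in> lmeasurable"
      by (rule lmeasurable_division[OF D])
    then have "measure lebesgue (\<Union>(snd ` p)) \<le> measure lebesgue U"
      using sub U(3) by (intro measure_mono_fmeasurable) (fastforce intro: fmeasurableD)+
    then have "(\<Sum>I\<in>snd ` p. Sup I - Inf I) < d" using division_sum_length[OF D] U(4) by simp
    moreover have "\<Union>(snd ` p) \<subseteq> {a..b}" using tagged_partial_division_ofD(3)[OF p] by fastforce
    ultimately show ?thesis using d(2)[OF D] sum_tagged_eq_division[OF p, of f] by simp
  qed
  then show ?thesis using that U by blast
qed

lemma tagged_interval:
  fixes p :: "(real \<times> real set) set"
  assumes "p tagged_division_of {a..b}" "(x, K) \<in> p"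
  obtains u v where "K = {u..v}" "u \<le> x" "x \<le> v" "a \<le> u" "v \<le> b" "Sup K = v" "Inf K = u" "measure lborel K = v - u"
proof -
  obtain u v where K: "K = {u..v}" using tagged_division_ofD(4)[OF assms] by auto
  have "x \<in> K" "K \<subseteq> {a..b}" using tagged_division_ofD(2,3)[OF assms] by auto
  then show ?thesis using that[of u v] K by auto
qed

text \<open>The gauge takes the radius of differentiability at tags off \<open>N\<close> and a small
  open cover at tags in \<open>N\<close>, so each kind of tag is controlled by its own property of
  \<open>f\<close>. Integrability of \<open>f'\<close> comes out as part of the conclusion.\<close>

theorem abs_continuous_FTC:
  fixes f :: "real \<Rightarrow> 'b::real_normed_vector"
  assumes "a \<le> b" and ac: "abs_continuous_on a b f" and N: "negligible N"
    and der: "\<And>x. x \<in> {a..b} - N \<Longrightarrow> (f has_vector_derivative f' x) (at x within {a..b})"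
  shows "(f' has_integral (f b - f a)) {a..b}"
proof (cases "a = b")
  case True
  then show ?thesis by (simp add: has_integral_refl)
next
  case False
  then have ab: "a < b" using assms(1) by simp
  define g where "g x = (if x \<in> N then 0 else f' x)" for x
  have "(g has_integral (f b - f a)) {a..b}"
    unfolding has_integral_factor_content_real
  proof (intro allI impI)
    fix e :: real assume e: "0 < e"
    \<comment> \<open>Half of the admissible error is reserved for the tags in \<open>N\<close>, the
      other half for the differentiability error at the remaining tags.\<close>
    have e1: "0 < e / 2 * (b - a)" using e ab by simp
    obtain U where U: "open U" "N \<subseteq> U"
      "\<And>p. p tagged_partial_division_of {a..b} \<Longrightarrow> (\<And>x K. (x, K) \<in> p \<Longrightarrow> K \<subseteq> U) \<Longrightarrow>
         (\<Sum>(x,K)\<in>p. norm (f (Sup K) - f (Inf K))) < e / 2 * (b - a)"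
      by (rule abs_continuous_small_cover[OF ac N e1]) blast
    have "\<exists>d>0. \<forall>y\<in>{a..b}. norm (y - x) < d \<longrightarrow> norm (f y - f x - (y - x) *\<^sub>R f' x) \<le> e / 2 * norm (y - x)"
      if "x \<in> {a..b} - N" for x
      using der[OF that] e unfolding has_vector_derivative_def has_derivative_within_alt
      by (metis half_gt_zero)
    then have "\<forall>x. \<exists>d. x \<in> {a..b} - N \<longrightarrow> 0 < d \<and>
        (\<forall>y\<in>{a..b}. norm (y - x) < d \<longrightarrow> norm (f y - f x - (y - x) *\<^sub>R f' x) \<le> e / 2 * norm (y - x))"
      by blast
    from choice[OF this] obtain d where "\<forall>x. x \<in> {a..b} - N \<longrightarrow> 0 < d x \<and>
        (\<forall>y\<in>{a..b}. norm (y - x) < d x \<longrightarrow> norm (f y - f x - (y - x) *\<^sub>R f' x) \<le> e / 2 * norm (y - x))"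
      by blast
    then have d: "\<And>x. x \<in> {a..b} - N \<Longrightarrow> 0 < d x"
      "\<And>x y. x \<in> {a..b} - N \<Longrightarrow> y \<in> {a..b} \<Longrightarrow> norm (y - x) < d x \<Longrightarrow>
         norm (f y - f x - (y - x) *\<^sub>R f' x) \<le> e / 2 * norm (y - x)"
      by blast+
    define \<gamma> where "\<gamma> x = (if x \<in> N then U else if x \<in> {a..b} then ball x (d x) else ball x 1)" for x
    have gau: "gauge \<gamma>" unfolding \<gamma>_def gauge_def using U d(1) by auto
    have main: "norm ((\<Sum>(x,k)\<in>p. measure lborel k *\<^sub>R g x) - (f b - f a)) \<le> e * measure lborel {a..b}"
      if p: "p tagged_division_of {a..b}" and fine: "\<gamma> fine p" for p
    proof -
      have fin: "finite p" using p by blast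
      define pN where "pN = {xk \<in> p. fst xk \<in> N}"
      have pN: "pN tagged_partial_division_of {a..b}"
        using p tagged_partial_division_subset[of p "{a..b}" pN]
        by (auto simp: pN_def tagged_division_of_def)
      have subU: "K \<subseteq> U" if "(x, K) \<in> pN" for x K
        using fine that unfolding fine_def pN_def \<gamma>_def by fastforce
      have "norm ((\<Sum>(x,k)\<in>p. measure lborel k *\<^sub>R g x) - (f b - f a))
          = norm (\<Sum>(x,k)\<in>p. measure lborel k *\<^sub>R g x - (f (Sup k) - f (Inf k)))"
        by (subst additive_tagged_division_1[OF assms(1) p, symmetric])
          (simp add: sum_subtractf split_beta)
      also have "\<dots> \<le> (\<Sum>(x,k)\<in>p. e / 2 * measure lborel k + (if x \<in> N then norm (f (Sup k) - f (Inf k)) else 0))"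
      proof (rule sum_norm_le)
        fix xK assume "xK \<in> p"
        then obtain x K where xK: "xK = (x, K)" "(x, K) \<in> p" by (cases xK) auto
        obtain u v where K: "K = {u..v}" "u \<le> x" "x \<le> v" "a \<le> u" "v \<le> b" "Sup K = v" "Inf K = u" "measure lborel K = v - u"
          using tagged_interval[OF p xK(2)] by metis
        have inN: "norm (measure lborel K *\<^sub>R g x - (f (Sup K) - f (Inf K))) \<le> e / 2 * measure lborel K + norm (f (Sup K) - f (Inf K))"
          if "x \<in> N" using that e K by (simp add: g_def norm_minus_commute)
        have notN: "norm (measure lborel K *\<^sub>R g x - (f (Sup K) - f (Inf K))) \<le> e / 2 * measure lborel K" if "x \<notin> N"
        proof -
          have x: "x \<in> {a..b} - N" using that K by auto
          have sub: "K \<subseteq> ball x (d x)" using fineD[OF fine xK(2)] x by (simp add: \<gamma>_def)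
          have "u \<in> K" "v \<in> K" using K by auto
          then have "u \<in> ball x (d x)" "v \<in> ball x (d x)" using sub by blast+
          then have "norm (u - x) < d x" "norm (v - x) < d x" by (auto simp: dist_norm)
          moreover have "u \<in> {a..b}" "v \<in> {a..b}" using K by auto
          ultimately have 1: "norm (f u - f x - (u - x) *\<^sub>R f' x) \<le> e / 2 * norm (u - x)"
            and 2: "norm (f v - f x - (v - x) *\<^sub>R f' x) \<le> e / 2 * norm (v - x)"
            using d(2)[OF x] by blast+
          have "measure lborel K *\<^sub>R g x - (f (Sup K) - f (Inf K))
              = (f u - f x - (u - x) *\<^sub>R f' x) - (f v - f x - (v - x) *\<^sub>R f' x)"
            using that K by (simp add: g_def algebra_simps)
          then have "norm (measure lborel K *\<^sub>R g x - (f (Sup K) - f (Inf K))) \<le> e / 2 * norm (u - x) + e / 2 * norm (v - x)"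
            using 1 2 norm_triangle_ineq4 by (smt (verit))
          also have "norm (u - x) = x - u" using K by simp
          also have "norm (v - x) = v - x" using K by simp
          also have "e / 2 * (x - u) + e / 2 * (v - x) = e / 2 * (v - u)"
            unfolding distrib_left[symmetric] by simp
          also have "v - u = measure lborel K" using K by simp
          finally show ?thesis .
        qed
        show "norm (case xK of (x, k) \<Rightarrow> measure lborel k *\<^sub>R g x - (f (Sup k) - f (Inf k)))
            \<le> (case xK of (x, k) \<Rightarrow> e / 2 * measure lborel k + (if x \<in> N then norm (f (Sup k) - f (Inf k)) else 0))"
          using inN notN xK(1) by (cases "x \<in> N") auto
      qed
      also have "\<dots> = e / 2 * (\<Sum>(x,k)\<in>p. measure lborel k) + (\<Sum>(x,k)\<in>p. if x \<in> N then norm (f (Sup k) - f (Inf k)) else 0)"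
        by (simp add: sum.distrib sum_distrib_left split_beta)
      also have "(\<Sum>(x,k)\<in>p. measure lborel k) = measure lborel {a..b}"
        using additive_content_tagged_division[of p a b] p by simp
      also have "(\<Sum>(x,k)\<in>p. if x \<in> N then norm (f (Sup k) - f (Inf k)) else 0) = (\<Sum>(x,k)\<in>pN. norm (f (Sup k) - f (Inf k)))"
        unfolding pN_def using fin by (simp add: sum.inter_filter split_beta)
      also have "\<dots> \<le> e / 2 * (b - a)" by (rule less_imp_le[OF U(3)[OF pN subU]])
      finally show ?thesis using ab by (simp add: field_simps)
    qed
    show "\<exists>d. gauge d \<and> (\<forall>p. p tagged_division_of {a..b} \<and> d fine p \<longrightarrow>
        norm ((\<Sum>(x,k)\<in>p. measure lborel k *\<^sub>R g x) - (f b - f a)) \<le> e * measure lborel {a..b})"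
      by (intro exI[of _ \<gamma>] conjI allI impI gau) (elim conjE, rule main)
  qed
  then show ?thesis
    by (rule has_integral_spike[OF N, rotated]) (simp add: g_def)
qed

text \<open>A one-sided bound on small increments across a point replaces the sign of a derivative.
  It is made for functions such as \<open>\<Psi>\<^sub>0\<close> of a curve, which need not be
  differentiable where the curve is.\<close>

lemma abs_continuous_mono_straddle:
  fixes f :: "real \<Rightarrow> real"
  assumes ab: "a \<le> b" and ac: "abs_continuous_on a b f" and N: "negligible N"
    and strad: "\<And>x e. x \<in> {a..b} - N \<Longrightarrow> 0 < e \<Longrightarrow>
      \<exists>d>0. \<forall>u v. a \<le> u \<and> u \<le> x \<and> x \<le> v \<and> v \<le> b \<and> v - u < d \<longrightarrow> f u - f v \<le> e * (v - u)"
  shows "f a \<le> f b"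
proof -
  have *: "f a - f b \<le> e * (b - a + 1)" if e: "0 < e" for e
  proof -
    obtain U where U: "open U" "N \<subseteq> U"
      "\<And>p. p tagged_partial_division_of {a..b} \<Longrightarrow> (\<And>x K. (x, K) \<in> p \<Longrightarrow> K \<subseteq> U) \<Longrightarrow>
         (\<Sum>(x,K)\<in>p. norm (f (Sup K) - f (Inf K))) < e"
      by (rule abs_continuous_small_cover[OF ac N e]) blast
    have "\<forall>x. \<exists>d. x \<in> {a..b} - N \<longrightarrow> 0 < d \<and>
        (\<forall>u v. a \<le> u \<and> u \<le> x \<and> x \<le> v \<and> v \<le> b \<and> v - u < d \<longrightarrow> f u - f v \<le> e * (v - u))"
      using strad[OF _ e] by blast
    from choice[OF this] obtain d where d0: "\<forall>x. x \<in> {a..b} - N \<longrightarrow> 0 < d x \<and>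
        (\<forall>u v. a \<le> u \<and> u \<le> x \<and> x \<le> v \<and> v \<le> b \<and> v - u < d x \<longrightarrow> f u - f v \<le> e * (v - u))"
      by blast
    then have d: "\<And>x. x \<in> {a..b} - N \<Longrightarrow> 0 < d x"
      "\<And>x u v. x \<in> {a..b} - N \<Longrightarrow> a \<le> u \<Longrightarrow> u \<le> x \<Longrightarrow> x \<le> v \<Longrightarrow> v \<le> b \<Longrightarrow> v - u < d x \<Longrightarrow> f u - f v \<le> e * (v - u)"
      by blast+
    define \<gamma> where "\<gamma> x = (if x \<in> N then U else if x \<in> {a..b} then ball x (d x / 2) else ball x 1)" for x
    have "gauge \<gamma>" unfolding \<gamma>_def gauge_def using U d(1) by auto
    then obtain p where p: "p tagged_division_of {a..b}" and fine: "\<gamma> fine p"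
      using fine_division_exists_real by metis
    have fin: "finite p" using p by blast
    define pN where "pN = {xk \<in> p. fst xk \<in> N}"
    have pN: "pN tagged_partial_division_of {a..b}"
      using p tagged_partial_division_subset[of p "{a..b}" pN]
      by (auto simp: pN_def tagged_division_of_def)
    have subU: "K \<subseteq> U" if "(x, K) \<in> pN" for x K
      using fine that unfolding fine_def pN_def \<gamma>_def by fastforce
    have "f a - f b = - (\<Sum>(x,k)\<in>p. f (Sup k) - f (Inf k))"
      by (subst additive_tagged_division_1[OF ab p]) simp
    also have "\<dots> = (\<Sum>(x,k)\<in>p. f (Inf k) - f (Sup k))"
      by (simp add: sum_negf[symmetric] split_beta)
    also have "\<dots> \<le> (\<Sum>(x,k)\<in>p. e * measure lborel k + (if x \<in> N then norm (f (Sup k) - f (Inf k)) else 0))"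
    proof (rule sum_mono, clarsimp, intro conjI impI)
      fix x K assume xK: "(x, K) \<in> p"
      obtain u v where K: "K = {u..v}" "u \<le> x" "x \<le> v" "a \<le> u" "v \<le> b" "Sup K = v" "Inf K = u" "measure lborel K = v - u"
        using tagged_interval[OF p xK] by metis
      have ec: "0 \<le> e * measure lborel K" using e K by simp
      show "f (Inf K) - f (Sup K) \<le> e * measure lborel K + \<bar>f (Sup K) - f (Inf K)\<bar>"
        if "x \<in> N" using ec by linarith
      show "f (Inf K) - f (Sup K) \<le> e * measure lborel K" if "x \<notin> N"
      proof -
        have x: "x \<in> {a..b} - N" using that K by auto
        have sub: "K \<subseteq> ball x (d x / 2)" using fineD[OF fine xK] x by (simp add: \<gamma>_def)
        have "u \<in> K" "v \<in> K" using K by auto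
        then have "u \<in> ball x (d x / 2)" "v \<in> ball x (d x / 2)" using sub by blast+
        then have "x - u < d x / 2" "v - x < d x / 2" using K by (auto simp: dist_real_def)
        then have "v - u < d x" by linarith
        then show ?thesis using d(2)[OF x] K by simp
      qed
    qed
    also have "\<dots> = e * (\<Sum>(x,k)\<in>p. measure lborel k) + (\<Sum>(x,k)\<in>p. if x \<in> N then norm (f (Sup k) - f (Inf k)) else 0)"
      by (simp add: sum.distrib sum_distrib_left split_beta)
    also have "(\<Sum>(x,k)\<in>p. measure lborel k) = measure lborel {a..b}"
      using additive_content_tagged_division[of p a b] p by simp
    also have "(\<Sum>(x,k)\<in>p. if x \<in> N then norm (f (Sup k) - f (Inf k)) else 0) = (\<Sum>(x,k)\<in>pN. norm (f (Sup k) - f (Inf k)))"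
      unfolding pN_def using fin by (simp add: sum.inter_filter split_beta cong: if_cong)
    also have "\<dots> \<le> e" by (rule less_imp_le[OF U(3)[OF pN subU]])
    finally show ?thesis using ab by (simp add: algebra_simps)
  qed
  have "f a - f b \<le> 0 + e" if "0 < e" for e
    using *[of "e / (b - a + 1)"] that ab by simp
  then have "f a - f b \<le> 0" by (rule field_le_epsilon)
  then show ?thesis by simp
qed


lemma division_telescope:
  fixes \<phi> :: "real \<Rightarrow> real"
  assumes "a \<le> b" "D division_of {a..b}"
  shows "(\<Sum>K\<in>D. \<phi> (Sup K) - \<phi> (Inf K)) = \<phi> b - \<phi> a"
proof -
  let ?p = "(\<lambda>K. (Inf K, K)) ` D"
  have "?p tagged_division_of {a..b}"
  proof (rule tagged_division_ofI)
    show "finite ?p" using assms(2) by auto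
    fix x K assume "(x, K) \<in> ?p"
    then have K: "K \<in> D" "x = Inf K" by auto
    obtain u v where uv: "K = cbox u v" "K \<noteq> {}" using assms(2) K(1) by (metis division_ofD(3,4))
    then show "x \<in> K" using K by auto
    show "K \<subseteq> {a..b}" using assms(2) K(1) by (rule division_ofD(2))
    show "\<exists>a b. K = cbox a b" using uv by blast
    fix x' K' assume "(x', K') \<in> ?p" "(x, K) \<noteq> (x', K')"
    then show "interior K \<inter> interior K' = {}" using K assms(2) by (auto dest: division_ofD(5))
  next
    have "{K. \<exists>x. (x, K) \<in> ?p} = D" by auto
    then show "\<Union>{K. \<exists>x. (x, K) \<in> ?p} = {a..b}" using assms(2) by auto
  qed
  from additive_tagged_division_1[OF assms(1) this, of \<phi>] show ?thesis
    by (subst (asm) sum.reindex) (auto simp: inj_on_def o_def)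
qed

section \<open>Differentiability almost everywhere of functions of bounded variation\<close>

definition variation_sum :: "(real \<Rightarrow> real) \<Rightarrow> real set set \<Rightarrow> real" where
  "variation_sum f D = (\<Sum>K\<in>D. \<bar>f (Sup K) - f (Inf K)\<bar>)"

lemma division_nonempty_interval:
  fixes D :: "real set set"
  assumes "D division_of S" "K \<in> D"
  obtains u v where "K = {u..v}" "u \<le> v" "Inf K = u" "Sup K = v"
proof -
  obtain u v where "K = cbox u v" "K \<noteq> {}" using assms by (metis division_ofD(3,4))
  then show ?thesis using that[of u v] by auto
qed

lemma division_join:
  fixes D1 D2 :: "real set set"
  assumes "D1 division_of {a..x}" "D2 division_of {x..y}" "a \<le> x" "x \<le> y"
  shows "(D1 \<union> D2) division_of {a..y}" "variation_sum f (D1 \<union> D2) = variation_sum f D1 + variation_sum f D2"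
proof -
  have "interior {a..x} \<inter> interior {x..y} = {}" by auto
  then show "(D1 \<union> D2) division_of {a..y}"
    using division_disjoint_union[OF assms(1,2)] ivl_disj_un_two_touch(4)[OF assms(3,4)] by simp
  \<comment> \<open>The two divisions need not be disjoint as sets of intervals: both may contain
    the degenerate interval at \<open>x\<close>.\<close>
  have "\<bar>f (Sup K) - f (Inf K)\<bar> = 0" if "K \<in> D1 \<inter> D2" for K
  proof -
    have "K \<in> D1" using that by simp
    then obtain u v where K: "K = {u..v}" "u \<le> v" "Inf K = u" "Sup K = v"
      by (rule division_nonempty_interval[OF assms(1)])
    have sub: "K \<subseteq> {a..x}" "K \<subseteq> {x..y}" using that assms(1,2) by (auto dest: division_ofD(2))
    have "u \<in> K" "v \<in> K" using K by auto
    then have "x \<le> u" "v \<le> x" using sub by auto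
    then have "u = v" using K by simp
    then show ?thesis using K by simp
  qed
  then show "variation_sum f (D1 \<union> D2) = variation_sum f D1 + variation_sum f D2"
    unfolding variation_sum_def using assms by (intro sum.union_inter_neutral) auto
qed

text \<open>A form of the statement that an upper derivate at \<open>x\<close> exceeds
  \<open>c\<close>, with intervals that contain \<open>x\<close> instead of starting there: these
  are the intervals of a Vitali cover. Lower derivates are treated by passing to
  \<open>- f\<close>.\<close>

definition slope_above :: "(real \<Rightarrow> real) \<Rightarrow> real \<Rightarrow> real \<Rightarrow> real \<Rightarrow> real \<Rightarrow> bool" where
  "slope_above f a b x c \<longleftrightarrow>
     (\<forall>d>0. \<exists>u v. a \<le> u \<and> u \<le> x \<and> x \<le> v \<and> v \<le> b \<and> u < v \<and> v - u < d \<and> f v - f u > c * (v - u))"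

text \<open>The covering theorem selects a countable disjoint subfamily that covers \<open>S\<close>
  up to a null set. A bound on the total length of finite disjoint subfamilies thus becomes a bound
  on the outer measure of \<open>S\<close>.\<close>

lemma Vitali_intervals:
  fixes S :: "real set"
  assumes "\<And>u v. (u, v) \<in> K \<Longrightarrow> u < v"
    and "\<And>x d. x \<in> S \<Longrightarrow> 0 < d \<Longrightarrow> \<exists>u v. (u, v) \<in> K \<and> u \<le> x \<and> x \<le> v \<and> v - u < d"
    and bound: "\<And>F. finite F \<Longrightarrow> F \<subseteq> K \<Longrightarrow> pairwise (\<lambda>p q. disjnt {fst p..snd p} {fst q..snd q}) F \<Longrightarrow>
           (\<Sum>p\<in>F. snd p - fst p) \<le> B"
  obtains T where "S \<subseteq> T" "T \<in> lmeasurable" "measure lebesgue T \<le> B"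
proof -
  let ?a = "\<lambda>p::real\<times>real. (fst p + snd p) / 2" and ?r = "\<lambda>p::real\<times>real. (snd p - fst p) / 2"
  have cb: "cball (?a p) (?r p) = {fst p..snd p}" for p
    by (auto simp: dist_real_def abs_le_iff field_simps)
  obtain C where C: "countable C" "C \<subseteq> K"
    "pairwise (\<lambda>i j. disjnt (cball (?a i) (?r i)) (cball (?a j) (?r j))) C"
    "negligible (S - (\<Union>i\<in>C. cball (?a i) (?r i)))"
  proof (rule Vitali_covering_theorem_cballs[of K ?r S ?a])
    show "0 < ?r i" if "i \<in> K" for i using assms(1)[of "fst i" "snd i"] that by simp
    show "\<exists>i. i \<in> K \<and> x \<in> cball (?a i) (?r i) \<and> ?r i < d" if xd: "x \<in> S" "0 < d" for x d
    proof -
      obtain u v where "(u, v) \<in> K" "u \<le> x" "x \<le> v" "v - u < d" using assms(2)[OF xd] by blast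
      then show ?thesis unfolding cb using assms(1)[of u v] by (intro exI[of _ "(u, v)"]) auto
    qed
  qed auto
  have sum_eq: "measure lebesgue (\<Union>p\<in>F. {fst p..snd p}) \<le> B" if F: "F \<subseteq> C" "finite F" for F
  proof -
    have "measure lebesgue (\<Union>p\<in>F. {fst p..snd p}) \<le> (\<Sum>p\<in>F. measure lebesgue {fst p..snd p})"
      using F(2) by (intro measure_UNION_le) auto
    also have "\<dots> = (\<Sum>p\<in>F. snd p - fst p)"
      using assms(1) F(1) C(2) by (intro sum.cong) (auto simp: subset_iff less_imp_le)
    also have "\<dots> \<le> B"
      using F C(2) pairwise_subset[OF C(3) F(1)] unfolding cb by (intro bound) auto
    finally show ?thesis .
  qed
  let ?U = "\<Union>p\<in>C. {fst p..snd p}"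
  have U: "?U \<in> lmeasurable" "measure lebesgue ?U \<le> B"
    using fmeasurable_UN_bound[OF C(1) _ sum_eq] measure_UN_bound[OF C(1) _ sum_eq] by auto
  have N: "negligible (S - ?U)" using C(4) unfolding cb .
  show ?thesis
  proof (rule that[of "?U \<union> (S - ?U)"])
    show "?U \<union> (S - ?U) \<in> lmeasurable" using U N negligible_imp_measurable by blast
    have "measure lebesgue (?U \<union> (S - ?U)) = measure lebesgue ?U"
      using U N by (intro measure_Un_null_set) (auto simp: negligible_iff_null_sets)
    then show "measure lebesgue (?U \<union> (S - ?U)) \<le> B" using U by simp
  qed auto
qed

lemma disjoint_intervals_division:
  fixes F :: "(real \<times> real) set"
  assumes "finite F" "\<And>p. p \<in> F \<Longrightarrow> fst p < snd p"
    "pairwise (\<lambda>p q. disjnt {fst p..snd p} {fst q..snd q}) F"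
    "\<And>p. p \<in> F \<Longrightarrow> l \<le> fst p \<and> snd p \<le> m"
  obtains q where "q division_of {l..m}" "(\<lambda>p. {fst p..snd p}) ` F \<subseteq> q" "inj_on (\<lambda>p. {fst p..snd p}) F"
proof -
  let ?I = "\<lambda>p::real\<times>real. {fst p..snd p}"
  have inj: "inj_on ?I F"
    using assms(2) by (intro inj_onI) (auto simp: Icc_eq_Icc prod_eq_iff less_imp_le dest!: assms(2))
  have "?I ` F division_of \<Union>(?I ` F)"
  proof (rule division_ofI)
    fix K1 K2 assume "K1 \<in> ?I ` F" "K2 \<in> ?I ` F" "K1 \<noteq> K2"
    then have "disjnt K1 K2" using assms(3) by (auto simp: pairwise_def)
    then show "interior K1 \<inter> interior K2 = {}"
      using interior_subset[of K1] interior_subset[of K2] by (auto simp: disjnt_def)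
  next
    fix K assume "K \<in> ?I ` F"
    then show "K \<noteq> {}" "K \<subseteq> \<Union>(?I ` F)" "\<exists>a b. K = cbox a b" using assms(2) by (force simp: less_imp_le)+
  qed (use assms(1) in auto)
  moreover have "\<Union>(?I ` F) \<subseteq> cbox l m" using assms(4) by fastforce
  ultimately obtain q where "?I ` F \<subseteq> q" "q division_of cbox l m"
    using partial_division_extend_interval by metis
  then show ?thesis using that[of q] inj by simp
qed

locale bounded_variation_interval =
  fixes f :: "real \<Rightarrow> real" and a b W :: real
  assumes ab: "a < b" and W: "\<And>D. D division_of {a..b} \<Longrightarrow> variation_sum f D \<le> W"
begin

definition var :: "real \<Rightarrow> real" where
  "var x = Sup (variation_sum f ` {D. D division_of {a..x}})"

lemma var_bdd:
  assumes "a \<le> x" "x \<le> b"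
  shows "bdd_above (variation_sum f ` {D. D division_of {a..x}})" "{D. D division_of {a..x}} \<noteq> {}"
proof -
  have "variation_sum f D \<le> W" if "D division_of {a..x}" for D
  proof -
    have "{{x..b}} division_of {x..b}" using assms by (intro division_of_self[of x b, simplified]) auto
    from W[OF division_join(1)[OF that this assms]] division_join(2)[OF that this assms, of f]
    show ?thesis by (simp add: variation_sum_def)
  qed
  then show "bdd_above (variation_sum f ` {D. D division_of {a..x}})" by (auto intro!: bdd_aboveI)
  have "{{a..x}} division_of {a..x}" using assms by (intro division_of_self[of a x, simplified]) auto
  then show "{D. D division_of {a..x}} \<noteq> {}" by blast
qed

lemma var_split:
  assumes "a \<le> x" "x \<le> y" "y \<le> b" "D division_of {x..y}"
  shows "var x + variation_sum f D \<le> var y"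
proof -
  have "var x \<le> var y - variation_sum f D"
    unfolding var_def[of x]
  proof (rule cSUP_least)
    show "{D. D division_of {a..x}} \<noteq> {}" using var_bdd assms by auto
    fix D1 assume "D1 \<in> {D. D division_of {a..x}}"
    then have D1: "D1 division_of {a..x}" by simp
    note J = division_join[OF D1 assms(4,1,2)]
    have "variation_sum f (D1 \<union> D) \<le> var y"
      unfolding var_def using J(1) var_bdd(1)[of y] assms by (intro cSUP_upper) auto
    then show "variation_sum f D1 \<le> var y - variation_sum f D" using J(2)[of f] by simp
  qed
  then show ?thesis by simp
qed

text \<open>Disjoint intervals on which the increment exceeds \<open>M\<close> times the length
  consume at least \<open>M\<close> times their total length from the variation \<open>W\<close>.
  For \<open>M = (W + 1) / e\<close> that length is at most \<open>e\<close>.\<close>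

lemma negligible_infinite_slope:
  "negligible {x \<in> {a<..<b}. \<forall>M. slope_above f a b x M \<or> slope_above (\<lambda>x. - f x) a b x M}"
  (is "negligible ?E")
  unfolding negligible_outer_le
proof (intro allI impI)
  fix e :: real assume e: "0 < e"
  have W0: "0 \<le> W"
    using W[OF division_of_self[of a b, simplified]] ab by (auto simp: variation_sum_def intro: order_trans[OF abs_ge_zero])
  define M where "M = (W + 1) / e"
  have M: "0 < M" using W0 e by (simp add: M_def)
  define K where "K = {(u, v). a \<le> u \<and> v \<le> b \<and> u < v \<and> \<bar>f v - f u\<bar> > M * (v - u)}"
  obtain T where "?E \<subseteq> T" "T \<in> lmeasurable" "measure lebesgue T \<le> e"
  proof (rule Vitali_intervals[of K ?E e])
    show "u < v" if "(u, v) \<in> K" for u v using that by (simp add: K_def)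
    show "\<exists>u v. (u, v) \<in> K \<and> u \<le> x \<and> x \<le> v \<and> v - u < d" if x: "x \<in> ?E" and d: "0 < d" for x d
    proof -
      have "slope_above f a b x M \<or> slope_above (\<lambda>x. - f x) a b x M" using x by auto
      then obtain u v where "a \<le> u" "u \<le> x" "x \<le> v" "v \<le> b" "u < v" "v - u < d"
          "f v - f u > M * (v - u) \<or> - f v - - f u > M * (v - u)"
        unfolding slope_above_def using d by meson
      then show ?thesis unfolding K_def by (intro exI[of _ u] exI[of _ v]) auto
    qed
    show "(\<Sum>p\<in>F. snd p - fst p) \<le> e"
      if F: "finite F" "F \<subseteq> K" "pairwise (\<lambda>p q. disjnt {fst p..snd p} {fst q..snd q}) F" for F
    proof -
      obtain q where q: "q division_of {a..b}" "(\<lambda>p. {fst p..snd p}) ` F \<subseteq> q" "inj_on (\<lambda>p. {fst p..snd p}) F"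
        by (rule disjoint_intervals_division[of F a b]) (use F in \<open>auto simp: K_def\<close>)
      have "M * (\<Sum>p\<in>F. snd p - fst p) \<le> (\<Sum>p\<in>F. \<bar>f (snd p) - f (fst p)\<bar>)"
        unfolding sum_distrib_left using F by (intro sum_mono) (auto simp: K_def)
      also have "\<dots> = (\<Sum>p\<in>F. \<bar>f (Sup {fst p..snd p}) - f (Inf {fst p..snd p})\<bar>)"
        using F by (intro sum.cong) (auto simp: K_def)
      also have "\<dots> = variation_sum f ((\<lambda>p. {fst p..snd p}) ` F)"
        unfolding variation_sum_def by (simp add: sum.reindex[OF q(3)])
      also have "\<dots> \<le> variation_sum f q"
        unfolding variation_sum_def using q by (intro sum_mono2) auto
      also have "\<dots> \<le> W" by (rule W[OF q(1)])
      also have "\<dots> \<le> M * e" using e by (simp add: M_def)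
      finally show ?thesis using M by simp
    qed
  qed auto
  then show "\<exists>T. ?E \<subseteq> T \<and> T \<in> lmeasurable \<and> measure lebesgue T \<le> e" by blast
qed

text \<open>On the pieces of a division that almost exhausts the variation, intervals on which \<open>f\<close> moves
  against the increment over the piece contribute twice to the variation; so there is little room for them.\<close>

lemma negligible_two_slopes:
  assumes c: "0 < c"
  shows "negligible {x \<in> {a<..<b}. slope_above f a b x c \<and> slope_above (\<lambda>x. - f x) a b x c}"
  (is "negligible ?E")
  unfolding negligible_outer_le
proof (intro allI impI)
  fix e :: real assume e: "0 < e"
  \<comment> \<open>The deficit \<open>2 * c * e\<close> is the gain in variation that intervals of
    total length \<open>e\<close> with adverse slope \<open>c\<close> would produce.\<close>
  have "\<exists>D. D division_of {a..b} \<and> var b - 2 * c * e < variation_sum f D"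
    using less_cSUP_iff[of "{D. D division_of {a..b}}" "variation_sum f" "var b - 2 * c * e"] var_bdd[of b] ab c e
    by (auto simp: var_def)
  then obtain D where D: "D division_of {a..b}" "var b - 2 * c * e < variation_sum f D" by blast
  have finD: "finite D" using D(1) by auto
  \<comment> \<open>The finitely many end points are set aside; around any other point all
    sufficiently short intervals stay inside a single piece of \<open>D\<close>.\<close>
  define P where "P = Inf ` D \<union> Sup ` D"
  define ok where "ok J u v \<longleftrightarrow> Inf J \<le> u \<and> v \<le> Sup J \<and>
     (if 0 \<le> f (Sup J) - f (Inf J) then f u - f v > c * (v - u) else f v - f u > c * (v - u))" for J u v
  define K where "K = {(u, v). u < v \<and> (\<exists>J\<in>D. ok J u v)}"
  obtain T where T: "?E - P \<subseteq> T" "T \<in> lmeasurable" "measure lebesgue T \<le> e"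
  proof (rule Vitali_intervals[of K "?E - P" e])
    show "u < v" if "(u, v) \<in> K" for u v using that by (simp add: K_def)
    show "\<exists>u v. (u, v) \<in> K \<and> u \<le> x \<and> x \<le> v \<and> v - u < d" if x: "x \<in> ?E - P" and d: "0 < d" for x d
    proof -
      have "x \<in> \<Union>D" using D(1) x by (auto simp: division_ofD(6))
      then obtain J where J: "J \<in> D" "x \<in> J" by blast
      obtain l m where lm: "J = {l..m}" "l \<le> m" "Inf J = l" "Sup J = m"
        using division_nonempty_interval[OF D(1) J(1)] by metis
      have "Inf J \<in> P" "Sup J \<in> P" using J(1) unfolding P_def by blast+
      then have "x \<noteq> l" "x \<noteq> m" using x lm by auto
      then have xl: "l < x" "x < m" using J(2) lm by auto
      define d' where "d' = min d (min (x - l) (m - x))"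
      have d': "0 < d'" using d xl by (simp add: d'_def)
      have x2: "slope_above f a b x c" "slope_above (\<lambda>x. - f x) a b x c" using x by auto
      obtain u v where uv: "u \<le> x" "x \<le> v" "u < v" "v - u < d'"
        "if 0 \<le> f (Sup J) - f (Inf J) then f u - f v > c * (v - u) else f v - f u > c * (v - u)"
      proof (cases "0 \<le> f (Sup J) - f (Inf J)")
        case True
        obtain u v where "u \<le> x" "x \<le> v" "u < v" "v - u < d'" "- f v - - f u > c * (v - u)"
          using x2(2) d' unfolding slope_above_def by meson
        then show ?thesis using that[of u v] True by auto
      next
        case False
        obtain u v where "u \<le> x" "x \<le> v" "u < v" "v - u < d'" "f v - f u > c * (v - u)"
          using x2(1) d' unfolding slope_above_def by meson
        then show ?thesis using that[of u v] False by auto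
      qed
      have "l \<le> u" "v \<le> m" "v - u < d" using uv(1-4) by (auto simp: d'_def)
      then have "ok J u v" unfolding ok_def using uv(5) lm by simp
      then have "(u, v) \<in> K" unfolding K_def using uv(3) J(1) by blast
      then show ?thesis using uv \<open>v - u < d\<close> by blast
    qed
    show "(\<Sum>p\<in>F. snd p - fst p) \<le> e"
      if F: "finite F" "F \<subseteq> K" "pairwise (\<lambda>p q. disjnt {fst p..snd p} {fst q..snd q}) F" for F
    proof -
      have "\<forall>p. \<exists>J. p \<in> F \<longrightarrow> J \<in> D \<and> ok J (fst p) (snd p) \<and> fst p < snd p"
        using F(2) by (auto simp: K_def subset_iff)
      from choice[OF this] obtain \<kappa> where
        "\<forall>p. p \<in> F \<longrightarrow> \<kappa> p \<in> D \<and> ok (\<kappa> p) (fst p) (snd p) \<and> fst p < snd p" by blast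
      then have \<kappa>: "\<And>p. p \<in> F \<Longrightarrow> \<kappa> p \<in> D" "\<And>p. p \<in> F \<Longrightarrow> ok (\<kappa> p) (fst p) (snd p)"
        "\<And>p. p \<in> F \<Longrightarrow> fst p < snd p" by auto
      have piece: "\<bar>f (Sup J) - f (Inf J)\<bar> + 2 * c * (\<Sum>p\<in>{p\<in>F. \<kappa> p = J}. snd p - fst p) \<le> var (Sup J) - var (Inf J)"
        if J: "J \<in> D" for J
      proof -
        obtain l m where lm: "J = {l..m}" "l \<le> m" "Inf J = l" "Sup J = m"
          using division_nonempty_interval[OF D(1) J] by metis
        have "J \<subseteq> {a..b}" using D(1) J by auto
        then have lma: "a \<le> l" "m \<le> b" using lm by auto
        define G where "G = {p\<in>F. \<kappa> p = J}"
        have G: "\<And>p. p \<in> G \<Longrightarrow> ok J (fst p) (snd p)" "\<And>p. p \<in> G \<Longrightarrow> fst p < snd p" "G \<subseteq> F"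
          using \<kappa> by (auto simp: G_def)
        have finG: "finite G" using F(1) G(3) finite_subset by blast
        obtain q where q: "q division_of {l..m}" "(\<lambda>p. {fst p..snd p}) ` G \<subseteq> q" "inj_on (\<lambda>p. {fst p..snd p}) G"
        proof (rule disjoint_intervals_division[of G l m])
          show "pairwise (\<lambda>p q. disjnt {fst p..snd p} {fst q..snd q}) G"
            using pairwise_subset[OF F(3) G(3)] .
          show "l \<le> fst p \<and> snd p \<le> m" if "p \<in> G" for p using G(1)[OF that] lm by (simp add: ok_def)
        qed (use finG G in auto)
        \<comment> \<open>With the sign \<open>s\<close> the total of \<open>\<Delta>\<close> over
          the piece is nonnegative and the selected intervals have negative \<open>\<Delta>\<close>.
          Taking absolute values flips them, so each one adds twice its size to the
          variation.\<close>
        define s :: real where "s = (if 0 \<le> f m - f l then 1 else - 1)"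
        define \<Delta> where "\<Delta> K = s * (f (Sup K) - f (Inf K))" for K
        let ?p = "(\<lambda>p. {fst p..snd p}) ` G"
        have finq: "finite q" using q(1) by auto
        have abs\<Delta>: "\<bar>\<Delta> K\<bar> = \<bar>f (Sup K) - f (Inf K)\<bar>" for K by (simp add: \<Delta>_def s_def abs_mult)
        have tel: "sum \<Delta> q = \<bar>f m - f l\<bar>"
          using division_telescope[OF lm(2) q(1), of f] by (simp add: \<Delta>_def sum_distrib_left[symmetric] s_def)
        have neg: "c * (\<Sum>p\<in>G. snd p - fst p) \<le> - sum \<Delta> ?p"
        proof -
          have "c * (\<Sum>p\<in>G. snd p - fst p) \<le> (\<Sum>p\<in>G. - \<Delta> {fst p..snd p})"
            unfolding sum_distrib_left
          proof (rule sum_mono)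
            fix p assume "p \<in> G"
            from G(1)[OF this] G(2)[OF this] show "c * (snd p - fst p) \<le> - \<Delta> {fst p..snd p}"
              using lm by (auto simp: ok_def \<Delta>_def s_def split: if_splits)
          qed
          then show ?thesis by (simp add: sum.reindex[OF q(3)] sum_negf)
        qed
        have "variation_sum f q = (\<Sum>K\<in>q. \<bar>\<Delta> K\<bar>)" by (simp add: variation_sum_def abs\<Delta>)
        also have "\<dots> = (\<Sum>K\<in>q - ?p. \<bar>\<Delta> K\<bar>) + (\<Sum>K\<in>?p. \<bar>\<Delta> K\<bar>)"
          by (rule sum.subset_diff[OF q(2) finq])
        also have "\<dots> \<ge> sum \<Delta> (q - ?p) + (- sum \<Delta> ?p)"
          unfolding sum_negf[symmetric] by (intro add_mono sum_mono) auto
        finally have "sum \<Delta> (q - ?p) + (- sum \<Delta> ?p) \<le> variation_sum f q" .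
        moreover have "sum \<Delta> q = sum \<Delta> (q - ?p) + sum \<Delta> ?p" by (rule sum.subset_diff[OF q(2) finq])
        ultimately have "\<bar>f m - f l\<bar> + 2 * (- sum \<Delta> ?p) \<le> variation_sum f q" using tel by linarith
        moreover have "var l + variation_sum f q \<le> var m" by (rule var_split[OF lma(1) lm(2) lma(2) q(1)])
        ultimately show ?thesis using neg lm unfolding G_def by auto
      qed
      have "var b - var a = (\<Sum>J\<in>D. var (Sup J) - var (Inf J))"
        using division_telescope[OF less_imp_le[OF ab] D(1), of var] by simp
      also have "\<dots> \<ge> (\<Sum>J\<in>D. \<bar>f (Sup J) - f (Inf J)\<bar> + 2 * c * (\<Sum>p\<in>{p\<in>F. \<kappa> p = J}. snd p - fst p))"
        by (intro sum_mono piece)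
      finally have 1: "variation_sum f D + 2 * c * (\<Sum>J\<in>D. \<Sum>p\<in>{p\<in>F. \<kappa> p = J}. snd p - fst p) \<le> var b - var a"
        by (simp add: variation_sum_def sum.distrib sum_distrib_left)
      have 2: "(\<Sum>J\<in>D. \<Sum>p\<in>{p\<in>F. \<kappa> p = J}. snd p - fst p) = (\<Sum>p\<in>F. snd p - fst p)"
        using \<kappa>(1) F(1) finD by (intro sum.group) auto
      have "{{a}} division_of {a..a}" using division_of_self[of a a] by simp
      then have "variation_sum f {{a}} \<le> var a"
        unfolding var_def using var_bdd(1)[of a] ab by (intro cSUP_upper) auto
      then have 3: "0 \<le> var a" by (simp add: variation_sum_def)
      have "2 * c * (\<Sum>p\<in>F. snd p - fst p) \<le> 2 * c * e" using 1[unfolded 2] 3 D(2) by linarith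
      then show ?thesis using c by simp
    qed
  qed auto
  have NP: "negligible P" unfolding P_def using finD by (intro negligible_finite) auto
  have "measure lebesgue (T \<union> P) = measure lebesgue T"
    using T(2) NP by (intro measure_Un_null_set) (auto simp: negligible_iff_null_sets)
  moreover have "T \<union> P \<in> lmeasurable" using T(2) NP negligible_imp_measurable by blast
  moreover have "?E \<subseteq> T \<union> P" using T(1) by blast
  ultimately show "\<exists>T. ?E \<subseteq> T \<and> T \<in> lmeasurable \<and> measure lebesgue T \<le> e" using T(3) by metis
qed

end

lemma quotient_slope_above:
  assumes x: "a < x" "x < b"
    and q: "\<And>d. 0 < d \<Longrightarrow> \<exists>h. h \<noteq> 0 \<and> \<bar>h\<bar> < d \<and> (f (x + h) - f x) / h > c"
  shows "slope_above f a b x c"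
  unfolding slope_above_def
proof (intro allI impI)
  fix d :: real assume d: "0 < d"
  obtain h where h: "h \<noteq> 0" "\<bar>h\<bar> < min d (min (x - a) (b - x))" "(f (x + h) - f x) / h > c"
    using q[of "min d (min (x - a) (b - x))"] d x by auto
  show "\<exists>u v. a \<le> u \<and> u \<le> x \<and> x \<le> v \<and> v \<le> b \<and> u < v \<and> v - u < d \<and> f v - f u > c * (v - u)"
  proof (cases "0 < h")
    case True
    then show ?thesis using h by (intro exI[of _ x] exI[of _ "x + h"]) (auto simp: field_simps)
  next
    case False
    then show ?thesis using h by (intro exI[of _ "x + h"] exI[of _ x]) (auto simp: field_simps)
  qed
qed

text \<open>Bounded difference quotients have a cluster value \<open>L\<close> at 0. If they did not
  converge to it, quotients at distance \<open>e\<close> from \<open>L\<close> would recur, and a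
  rational \<open>r\<close> in between would be exceeded and undercut by a margin \<open>c\<close>
  infinitely often. Rational \<open>r\<close> and \<open>c\<close> keep the number of exceptional
  sets countable.\<close>

lemma differentiable_if_slopes:
  assumes x: "a < x" "x < b"
    and fin: "\<not> (\<forall>M. slope_above f a b x M \<or> slope_above (\<lambda>x. - f x) a b x M)"
    and two: "\<And>r c. r \<in> \<rat> \<Longrightarrow> c \<in> \<rat> \<Longrightarrow> 0 < c \<Longrightarrow>
      \<not> (slope_above f a b x (c + r) \<and> slope_above (\<lambda>x. - f x) a b x (c - r))"
  shows "\<exists>L. (f has_real_derivative L) (at x)"
proof -
  define q where "q h = (f (x + h) - f x) / h" for h
  have above: "slope_above f a b x c" if "\<And>d. 0 < d \<Longrightarrow> \<exists>h. h \<noteq> 0 \<and> \<bar>h\<bar> < d \<and> q h > c" for c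
    by (rule quotient_slope_above[OF x]) (use that in \<open>simp add: q_def\<close>)
  have below: "slope_above (\<lambda>x. - f x) a b x (- c)"
    if *: "\<And>d. 0 < d \<Longrightarrow> \<exists>h. h \<noteq> 0 \<and> \<bar>h\<bar> < d \<and> q h < c" for c
  proof (rule quotient_slope_above[OF x])
    fix d :: real assume "0 < d"
    then obtain h where "h \<noteq> 0" "\<bar>h\<bar> < d" "q h < c" using * by blast
    then show "\<exists>h. h \<noteq> 0 \<and> \<bar>h\<bar> < d \<and> (- f (x + h) - - f x) / h > - c"
      by (intro exI[of _ h]) (auto simp: q_def diff_divide_distrib)
  qed
  obtain M where M: "\<not> slope_above f a b x M" "\<not> slope_above (\<lambda>x. - f x) a b x M"
    using fin by blast
  obtain d1 where d1: "0 < d1" "\<And>h. h \<noteq> 0 \<Longrightarrow> \<bar>h\<bar> < d1 \<Longrightarrow> q h \<le> M"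
    using above[of M] M(1) by (meson not_le)
  obtain d2 where d2: "0 < d2" "\<And>h. h \<noteq> 0 \<Longrightarrow> \<bar>h\<bar> < d2 \<Longrightarrow> q h \<ge> - M"
    using below[of "- M"] M(2) by (metis minus_minus not_le)
  define s where "s n = min d1 d2 / (real n + 2)" for n :: nat
  have s: "s n \<noteq> 0" "\<bar>s n\<bar> < d1" "\<bar>s n\<bar> < d2" for n
  proof -
    have "0 < s n" using d1(1) d2(1) by (simp add: s_def)
    moreover have "s n \<le> min d1 d2 / 2"
      unfolding s_def using d1(1) d2(1) by (intro divide_left_mono) auto
    ultimately show "s n \<noteq> 0" "\<bar>s n\<bar> < d1" "\<bar>s n\<bar> < d2" using d1(1) d2(1) by auto
  qed
  have s0: "s \<longlonglongrightarrow> 0" unfolding s_def by real_asymp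
  have "q (s n) \<in> {-M..M}" for n using d1(2)[OF s(1,2)] d2(2)[OF s(1,3)] by auto
  then obtain L k where k: "strict_mono (k::nat\<Rightarrow>nat)" "((\<lambda>n. q (s n)) \<circ> k) \<longlonglongrightarrow> L"
    using compact_imp_seq_compact[OF compact_Icc[of "-M" M]] unfolding seq_compact_def by metis
  have sk: "(\<lambda>n. s (k n)) \<longlonglongrightarrow> 0" using LIMSEQ_subseq_LIMSEQ[OF s0 k(1)] by (simp add: o_def)
  have near: "\<exists>h. h \<noteq> 0 \<and> \<bar>h\<bar> < d \<and> \<bar>q h - L\<bar> < e" if "0 < d" "0 < e" for d e
  proof -
    have "\<forall>\<^sub>F n in sequentially. dist (s (k n)) 0 < d" using sk that tendstoD by blast
    moreover have "\<forall>\<^sub>F n in sequentially. dist (q (s (k n))) L < e"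
      using k(2) that(2) tendstoD unfolding o_def by blast
    ultimately have "\<forall>\<^sub>F n in sequentially. dist (s (k n)) 0 < d \<and> dist (q (s (k n))) L < e"
      by (rule eventually_conj)
    then obtain n where "dist (s (k n)) 0 < d" "dist (q (s (k n))) L < e"
      by (auto simp: eventually_sequentially)
    then show ?thesis using s(1) by (intro exI[of _ "s (k n)"]) (auto simp: dist_real_def)
  qed
  have "q \<midarrow>0\<rightarrow> L"
  proof (rule ccontr)
    assume "\<not> ?thesis"
    then have "\<not> (\<forall>e>0. \<exists>d>0. \<forall>h. h \<noteq> 0 \<and> \<bar>h\<bar> < d \<longrightarrow> \<bar>q h - L\<bar> < e)"
      unfolding LIM_def by (simp add: dist_real_def)
    then obtain e where e0: "0 < e" "\<not> (\<exists>d>0. \<forall>h. h \<noteq> 0 \<and> \<bar>h\<bar> < d \<longrightarrow> \<bar>q h - L\<bar> < e)" by blast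
    have e: "0 < e" "\<And>d. 0 < d \<Longrightarrow> \<exists>h. h \<noteq> 0 \<and> \<bar>h\<bar> < d \<and> e \<le> \<bar>q h - L\<bar>"
      using e0 not_le by blast+
    \<comment> \<open>Since \<open>r\<close> is taken between \<open>e / 3\<close> and
      \<open>e / 2\<close> away from \<open>L\<close>, a margin below \<open>e / 6\<close> separates
      it both from the quotients within \<open>e / 6\<close> of \<open>L\<close> and from those at
      distance at least \<open>e\<close>.\<close>
    obtain c where c: "c \<in> \<rat>" "0 < c" "c < e / 6" using Rats_dense_in_real[of 0 "e / 6"] e(1) by auto
    show False
    proof (cases "\<forall>d>0. \<exists>h. h \<noteq> 0 \<and> \<bar>h\<bar> < d \<and> e \<le> q h - L")
      case True
      obtain r where r: "r \<in> \<rat>" "L + e / 3 < r" "r < L + e / 2"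
        using Rats_dense_in_real[of "L + e / 3" "L + e / 2"] e(1) by auto
      have "slope_above f a b x (c + r)"
      proof (rule above)
        fix d :: real assume "0 < d"
        then obtain h where h: "h \<noteq> 0" "\<bar>h\<bar> < d" "e \<le> q h - L" using True by blast
        have "c + r < q h" using h(3) r(3) c(3) e(1) by linarith
        then show "\<exists>h. h \<noteq> 0 \<and> \<bar>h\<bar> < d \<and> c + r < q h" using h by blast
      qed
      moreover have "slope_above (\<lambda>x. - f x) a b x (- (r - c))"
      proof (rule below)
        fix d :: real assume "0 < d"
        then obtain h where h: "h \<noteq> 0" "\<bar>h\<bar> < d" "\<bar>q h - L\<bar> < e / 6" using near[of d "e / 6"] e(1) by auto
        have "q h < r - c" using h(3) c(3) r(2) by linarith
        then show "\<exists>h. h \<noteq> 0 \<and> \<bar>h\<bar> < d \<and> q h < r - c" using h by blast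
      qed
      ultimately show False using two[OF r(1) c(1,2)] by simp
    next
      case False
      then obtain d0 where d0: "0 < d0" "\<And>h. h \<noteq> 0 \<Longrightarrow> \<bar>h\<bar> < d0 \<Longrightarrow> q h - L < e" by (meson not_le)
      obtain r where r: "r \<in> \<rat>" "L - e / 2 < r" "r < L - e / 3"
        using Rats_dense_in_real[of "L - e / 2" "L - e / 3"] e(1) by auto
      have "slope_above f a b x (c + r)"
      proof (rule above)
        fix d :: real assume "0 < d"
        then obtain h where h: "h \<noteq> 0" "\<bar>h\<bar> < d" "\<bar>q h - L\<bar> < e / 6" using near[of d "e / 6"] e(1) by auto
        have "c + r < q h" using h(3) c(3) r(3) by linarith
        then show "\<exists>h. h \<noteq> 0 \<and> \<bar>h\<bar> < d \<and> c + r < q h" using h by blast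
      qed
      moreover have "slope_above (\<lambda>x. - f x) a b x (- (r - c))"
      proof (rule below)
        fix d :: real assume "0 < d"
        then obtain h where h: "h \<noteq> 0" "\<bar>h\<bar> < min d d0" "e \<le> \<bar>q h - L\<bar>" using e(2)[of "min d d0"] d0 by auto
        then have "q h - L \<le> - e" using d0(2)[of h] by auto
        then have "q h < r - c" using c(3) r(2) e(1) by linarith
        then show "\<exists>h. h \<noteq> 0 \<and> \<bar>h\<bar> < d \<and> q h < r - c" using h by auto
      qed
      ultimately show False using two[OF r(1) c(1,2)] by simp
    qed
  qed
  then show ?thesis unfolding DERIV_def q_def by blast
qed

text \<open>Subtracting the line of slope \<open>r\<close> turns slopes above \<open>r + c\<close>
  and below \<open>r - c\<close> into the symmetric situation of
  \<open>negligible_two_slopes\<close>; the variation grows by at most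
  \<open>\<bar>r\<bar> * (b - a)\<close>. The exceptional set is covered by countably many such
  sets.\<close>

lemma (in bounded_variation_interval) negligible_not_differentiable:
  "negligible {x \<in> {a<..<b}. \<not> (\<exists>L. (f has_real_derivative L) (at x))}"
proof -
  let ?A = "{x \<in> {a<..<b}. \<forall>M. slope_above f a b x M \<or> slope_above (\<lambda>x. - f x) a b x M}"
  let ?B = "\<lambda>(r, c). {x \<in> {a<..<b}. slope_above f a b x (c + r) \<and> slope_above (\<lambda>x. - f x) a b x (c - r)}"
  have B: "negligible (?B (r, c))" if "0 < c" for r c
  proof -
    define g where "g x = f x - r * x" for x
    interpret g: bounded_variation_interval g a b "W + \<bar>r\<bar> * (b - a)"
    proof
      fix D assume D: "D division_of {a..b}"
      have "variation_sum g D \<le> (\<Sum>K\<in>D. \<bar>f (Sup K) - f (Inf K)\<bar> + \<bar>r\<bar> * (Sup K - Inf K))"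
        unfolding variation_sum_def
      proof (rule sum_mono)
        fix K assume "K \<in> D"
        then obtain u v where "K = {u..v}" "u \<le> v" "Inf K = u" "Sup K = v"
          by (rule division_nonempty_interval[OF D])
        have eq: "g (Sup K) - g (Inf K) = (f (Sup K) - f (Inf K)) - r * (Sup K - Inf K)"
          by (simp add: g_def algebra_simps)
        have "\<bar>r * (Sup K - Inf K)\<bar> = \<bar>r\<bar> * (Sup K - Inf K)"
          using \<open>Inf K = u\<close> \<open>Sup K = v\<close> \<open>u \<le> v\<close> by (simp add: abs_mult)
        then show "\<bar>g (Sup K) - g (Inf K)\<bar> \<le> \<bar>f (Sup K) - f (Inf K)\<bar> + \<bar>r\<bar> * (Sup K - Inf K)"
          using eq by linarith
      qed
      also have "\<dots> = variation_sum f D + \<bar>r\<bar> * (b - a)"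
        using division_telescope[OF less_imp_le[OF ab] D, of "\<lambda>x. x"]
        by (simp add: variation_sum_def sum.distrib sum_distrib_left[symmetric])
      finally show "variation_sum g D \<le> W + \<bar>r\<bar> * (b - a)" using W[OF D] by simp
    qed (rule ab)
    have "slope_above g a b x c \<longleftrightarrow> slope_above f a b x (c + r)"
      "slope_above (\<lambda>x. - g x) a b x c \<longleftrightarrow> slope_above (\<lambda>x. - f x) a b x (c - r)" for x
      unfolding slope_above_def g_def by (simp_all add: algebra_simps)
    then show ?thesis using g.negligible_two_slopes[OF that] by simp
  qed
  have "negligible (\<Union>p\<in>{p\<in>\<rat> \<times> \<rat>. 0 < snd p}. ?B p)"
  proof (rule negligible_countable_Union)
    show "countable (?B ` {p \<in> \<rat> \<times> \<rat>. 0 < snd p})"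
      by (intro countable_image countable_subset[OF _ countable_SIGMA[OF countable_rat countable_rat]]) auto
    show "negligible S" if "S \<in> ?B ` {p \<in> \<rat> \<times> \<rat>. 0 < snd p}" for S using that B by auto
  qed
  then have "negligible (?A \<union> (\<Union>p\<in>{p\<in>\<rat> \<times> \<rat>. 0 < snd p}. ?B p))"
    using negligible_infinite_slope by (rule negligible_Un[rotated])
  then show ?thesis
  proof (rule negligible_subset)
    show "{x \<in> {a<..<b}. \<not> (\<exists>L. (f has_real_derivative L) (at x))} \<subseteq> ?A \<union> (\<Union>p\<in>{p\<in>\<rat> \<times> \<rat>. 0 < snd p}. ?B p)"
    proof
      fix x assume x: "x \<in> {x \<in> {a<..<b}. \<not> (\<exists>L. (f has_real_derivative L) (at x))}"
      show "x \<in> ?A \<union> (\<Union>p\<in>{p\<in>\<rat> \<times> \<rat>. 0 < snd p}. ?B p)"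
      proof (rule ccontr)
        assume n: "\<not> ?thesis"
        have "\<exists>L. (f has_real_derivative L) (at x)"
        proof (rule differentiable_if_slopes[of a x b])
          fix r c :: real assume "r \<in> \<rat>" "c \<in> \<rat>" "0 < c"
          then have "(r, c) \<in> {p\<in>\<rat> \<times> \<rat>. 0 < snd p}" by simp
          then have "x \<notin> ?B (r, c)" using n by blast
          then show "\<not> (slope_above f a b x (c + r) \<and> slope_above (\<lambda>x. - f x) a b x (c - r))" using x by simp
        qed (use x n in auto)
        then show False using x by simp
      qed
    qed
  qed
qed

section \<open>Differentiability and closure properties of absolutely continuous functions\<close>

lemma abs_continuous_on_subinterval:
  "abs_continuous_on a b f \<Longrightarrow> a \<le> s \<Longrightarrow> t \<le> b \<Longrightarrow> abs_continuous_on s t f"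
  unfolding abs_continuous_on_def by (meson atLeastatMost_subset_iff order_trans)

text \<open>On an interval shorter than the \<open>d\<close> belonging to \<open>e = 1\<close> the
  variation is at most 1, so the result for bounded variation applies there. Being negligible is a
  local property, hence no global bound on the variation is assembled.\<close>

lemma abs_continuous_negligible_not_differentiable:
  fixes f :: "real \<Rightarrow> real"
  assumes ac: "abs_continuous_on a b f"
  shows "negligible {x \<in> {a<..<b}. \<not> (\<exists>L. (f has_real_derivative L) (at x))}" (is "negligible ?S")
proof -
  obtain d where d: "0 < d"
    "\<And>\<D>. \<D> division_of \<Union>\<D> \<Longrightarrow> \<Union>\<D> \<subseteq> {a..b} \<Longrightarrow> (\<Sum>I\<in>\<D>. Sup I - Inf I) < d \<Longrightarrow>
        (\<Sum>I\<in>\<D>. norm (f (Sup I) - f (Inf I))) < 1"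
    using ac unfolding abs_continuous_on_def by (meson zero_less_one)
  show ?thesis
  proof (rule locally_negligible_alt[THEN iffD2], rule ballI)
    fix x assume x: "x \<in> ?S"
    define r where "r = min (d / 3) (min (x - a) (b - x))"
    have "0 < r" "r \<le> x - a" "r \<le> b - x" using x d(1) by (auto simp: r_def)
    moreover have "r \<le> d / 3" unfolding r_def by (rule min.cobounded1)
    ultimately have r: "0 < r" "2 * r < d" "a \<le> x - r" "x + r \<le> b" using d(1) by linarith+
    interpret bounded_variation_interval f "x - r" "x + r" 1
    proof
      fix D assume D: "D division_of {x - r..x + r}"
      have "(\<Sum>I\<in>D. Sup I - Inf I) < d" using division_telescope[OF _ D, of "\<lambda>x. x"] r by simp
      moreover have "\<Union>D = {x - r..x + r}" using D by (simp add: division_ofD(6))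
      ultimately have "(\<Sum>I\<in>D. norm (f (Sup I) - f (Inf I))) < 1" using D r by (intro d(2)) auto
      then show "variation_sum f D \<le> 1" by (simp add: variation_sum_def)
    qed (use r in simp)
    have "openin (top_of_set ?S) (?S \<inter> ball x r)" by (intro openin_open_Int) auto
    moreover have "negligible (?S \<inter> ball x r)"
      by (rule negligible_subset[OF negligible_not_differentiable]) (auto simp: dist_real_def)
    ultimately show "\<exists>U. openin (top_of_set ?S) U \<and> x \<in> U \<and> negligible U" using x r(1)
      by (intro exI[of _ "?S \<inter> ball x r"]) auto
  qed
qed

text \<open>Most later claims of absolute continuity go through this rule. Two dominating curves are
  allowed because typical functions combine the state with its energy or its dissipation; the linear
  term accounts for explicit time dependence.\<close>

lemma abs_continuous_on_dominated:
  fixes f :: "real \<Rightarrow> 'a::real_normed_vector" and g :: "real \<Rightarrow> 'b::real_normed_vector"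
    and h :: "real \<Rightarrow> 'c::real_normed_vector"
  assumes f: "abs_continuous_on a b f" and g: "abs_continuous_on a b g"
    and dom: "\<And>s t. a \<le> s \<Longrightarrow> s \<le> t \<Longrightarrow> t \<le> b \<Longrightarrow>
      norm (h t - h s) \<le> K * norm (f t - f s) + M * norm (g t - g s) + L * (t - s)"
  shows "abs_continuous_on a b h"
  unfolding abs_continuous_on_def
proof (intro allI impI)
  fix e :: real assume e: "0 < e"
  define B where "B = \<bar>K\<bar> + \<bar>M\<bar> + \<bar>L\<bar> + 1"
  have B: "0 < B" by (simp add: B_def)
  define e' where "e' = e / B"
  have e': "0 < e'" using e B by (simp add: e'_def)
  obtain d1 where d1: "0 < d1"
    "\<And>\<D>. \<D> division_of \<Union>\<D> \<Longrightarrow> \<Union>\<D> \<subseteq> {a..b} \<Longrightarrow> (\<Sum>I\<in>\<D>. Sup I - Inf I) < d1 \<Longrightarrow>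
        (\<Sum>I\<in>\<D>. norm (f (Sup I) - f (Inf I))) < e'"
    using f e' unfolding abs_continuous_on_def by meson
  obtain d2 where d2: "0 < d2"
    "\<And>\<D>. \<D> division_of \<Union>\<D> \<Longrightarrow> \<Union>\<D> \<subseteq> {a..b} \<Longrightarrow> (\<Sum>I\<in>\<D>. Sup I - Inf I) < d2 \<Longrightarrow>
        (\<Sum>I\<in>\<D>. norm (g (Sup I) - g (Inf I))) < e'"
    using g e' unfolding abs_continuous_on_def by meson
  show "\<exists>d>0. \<forall>\<D>. \<D> division_of \<Union>\<D> \<and> \<Union>\<D> \<subseteq> {a..b} \<and> (\<Sum>I\<in>\<D>. Sup I - Inf I) < d \<longrightarrow>
        (\<Sum>I\<in>\<D>. norm (h (Sup I) - h (Inf I))) < e"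
  proof (intro exI[of _ "min (min d1 d2) e'"] conjI allI impI)
    fix \<D> assume D: "\<D> division_of \<Union>\<D> \<and> \<Union>\<D> \<subseteq> {a..b} \<and> (\<Sum>I\<in>\<D>. Sup I - Inf I) < min (min d1 d2) e'"
    let ?l = "\<Sum>I\<in>\<D>. Sup I - Inf I" and ?F = "\<Sum>I\<in>\<D>. norm (f (Sup I) - f (Inf I))"
      and ?G = "\<Sum>I\<in>\<D>. norm (g (Sup I) - g (Inf I))"
    have bnds: "?F < e'" "?G < e'" "?l < e'" using D d1(2)[of \<D>] d2(2)[of \<D>] by auto
    have "(\<Sum>I\<in>\<D>. norm (h (Sup I) - h (Inf I)))
        \<le> (\<Sum>I\<in>\<D>. \<bar>K\<bar> * norm (f (Sup I) - f (Inf I)) + \<bar>M\<bar> * norm (g (Sup I) - g (Inf I)) + \<bar>L\<bar> * (Sup I - Inf I))"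
    proof (rule sum_mono)
      fix I assume I: "I \<in> \<D>"
      obtain u v where uv: "I = {u..v}" "u \<le> v" "Inf I = u" "Sup I = v"
        using division_nonempty_interval[OF _ I] D by metis
      have "I \<subseteq> {a..b}" using D I by auto
      then have "a \<le> u" "v \<le> b" using uv by auto
      from dom[OF this(1) uv(2) this(2)]
      show "norm (h (Sup I) - h (Inf I)) \<le> \<bar>K\<bar> * norm (f (Sup I) - f (Inf I)) + \<bar>M\<bar> * norm (g (Sup I) - g (Inf I)) + \<bar>L\<bar> * (Sup I - Inf I)"
        unfolding uv(3,4) using uv(2)
        by (elim order_trans) (intro add_mono mult_right_mono, auto)
    qed
    also have "\<dots> = \<bar>K\<bar> * ?F + \<bar>M\<bar> * ?G + \<bar>L\<bar> * ?l"
      by (simp add: sum.distrib sum_distrib_left)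
    also have "\<dots> \<le> \<bar>K\<bar> * e' + \<bar>M\<bar> * e' + \<bar>L\<bar> * e'"
      using bnds by (intro add_mono mult_left_mono) auto
    also have "\<dots> < B * e'" using e' by (simp add: B_def algebra_simps)
    also have "\<dots> = e" using B by (simp add: e'_def)
    finally show "(\<Sum>I\<in>\<D>. norm (h (Sup I) - h (Inf I))) < e" .
  qed (use d1 d2 e' in auto)
qed

lemma abs_continuous_on_dominated1:
  fixes f :: "real \<Rightarrow> 'a::real_normed_vector" and h :: "real \<Rightarrow> 'c::real_normed_vector"
  assumes f: "abs_continuous_on a b f"
    and dom: "\<And>s t. a \<le> s \<Longrightarrow> s \<le> t \<Longrightarrow> t \<le> b \<Longrightarrow> norm (h t - h s) \<le> K * norm (f t - f s) + L * (t - s)"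
  shows "abs_continuous_on a b h"
  by (rule abs_continuous_on_dominated[OF f f, of h K 0 L]) (use dom in simp)

lemma abs_continuous_on_const: "abs_continuous_on a b (\<lambda>_. c)"
  unfolding abs_continuous_on_def by (auto intro: exI[of _ 1])

lemma abs_continuous_on_lipschitz:
  fixes h :: "real \<Rightarrow> 'c::real_normed_vector"
  assumes "\<And>s t. a \<le> s \<Longrightarrow> s \<le> t \<Longrightarrow> t \<le> b \<Longrightarrow> norm (h t - h s) \<le> L * (t - s)"
  shows "abs_continuous_on a b h"
  by (rule abs_continuous_on_dominated1[OF abs_continuous_on_const[of a b "0::real"], of h 0 L]) (use assms in simp)

lemma abs_continuous_on_add:
  assumes "abs_continuous_on a b f" "abs_continuous_on a b g"
  shows "abs_continuous_on a b (\<lambda>x. f x + g x)"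
  by (rule abs_continuous_on_dominated[OF assms, of _ 1 1 0])
    (simp add: add_diff_add norm_triangle_ineq)

text \<open>A competitor for a jump uses a viscous curve on \<open>{s..t}\<close> only. Clamping
  maps the pieces of a division to non-overlapping pieces of \<open>{s..t}\<close> that are not
  longer than the originals, so the same \<open>d\<close> works.\<close>

lemma abs_continuous_on_clamp:
  fixes f :: "real \<Rightarrow> 'a::real_normed_vector"
  assumes f: "abs_continuous_on s t f" and st: "s \<le> t"
  shows "abs_continuous_on a b (\<lambda>r. f (max s (min t r)))"
  unfolding abs_continuous_on_def
proof (intro allI impI)
  fix e :: real assume e: "0 < e"
  obtain d where d: "0 < d"
    "\<And>\<D>. \<D> division_of \<Union>\<D> \<Longrightarrow> \<Union>\<D> \<subseteq> {s..t} \<Longrightarrow> (\<Sum>I\<in>\<D>. Sup I - Inf I) < d \<Longrightarrow>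
        (\<Sum>I\<in>\<D>. norm (f (Sup I) - f (Inf I))) < e"
    using f e unfolding abs_continuous_on_def by meson
  let ?c = "\<lambda>r. max s (min t r)"
  have "(\<Sum>I\<in>\<D>. norm (f (?c (Sup I)) - f (?c (Inf I)))) < e"
    if D: "\<D> division_of \<Union>\<D>" "(\<Sum>I\<in>\<D>. Sup I - Inf I) < d" for \<D>
  proof -
    \<comment> \<open>Pieces collapsed to a point are dropped: several of them may have the same
      image, and their increments vanish anyway. On the rest the clamp is injective.\<close>
    define D' where "D' = {I\<in>\<D>. ?c (Inf I) < ?c (Sup I)}"
    define T where "T I = {?c (Inf I)..?c (Sup I)}" for I
    have D': "D' \<subseteq> \<D>" "finite D'" using D(1) by (auto simp: D'_def)
    have int: "T I = I \<inter> {s..t}" "I = {Inf I..Sup I}" "Inf I \<le> Sup I" if "I \<in> D'" for I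
    proof -
      have "I \<in> \<D>" using that D' by auto
      then obtain u v where uv: "I = {u..v}" "u \<le> v" "Inf I = u" "Sup I = v"
        by (rule division_nonempty_interval[OF D(1)])
      have "?c u < ?c v" using that uv by (simp add: D'_def)
      then show "T I = I \<inter> {s..t}" "I = {Inf I..Sup I}" "Inf I \<le> Sup I"
        unfolding T_def uv(3,4) uv(1) using st uv(2) by (auto simp: max_def min_def split: if_splits)
    qed
    have TT: "T I \<noteq> {}" "Inf (T I) = ?c (Inf I)" "Sup (T I) = ?c (Sup I)" if "I \<in> D'" for I
    proof -
      define lo hi where "lo = ?c (Inf I)" and "hi = ?c (Sup I)"
      have "?c (Inf I) < ?c (Sup I)" using that unfolding D'_def by blast
      then have "lo \<le> hi" by (simp only: lo_def hi_def less_imp_le)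
      then have "T I \<noteq> {} \<and> Inf (T I) = lo \<and> Sup (T I) = hi"
        unfolding T_def lo_def[symmetric] hi_def[symmetric] by simp
      then show "T I \<noteq> {}" "Inf (T I) = ?c (Inf I)" "Sup (T I) = ?c (Sup I)"
        unfolding lo_def hi_def by blast+
    qed
    have disj: "interior (T I) \<inter> interior (T J) = {}" if "I \<in> D'" "J \<in> D'" "I \<noteq> J" for I J
    proof -
      have "interior I \<inter> interior J = {}" using that D(1) D' by (auto dest: division_ofD(5))
      moreover have "interior (T I) \<subseteq> interior I" "interior (T J) \<subseteq> interior J"
        using that int(1) by (auto intro!: interior_mono)
      ultimately show ?thesis by blast
    qed
    have inj: "inj_on T D'"
    proof (rule inj_onI, rule ccontr)
      fix I J assume IJ: "I \<in> D'" "J \<in> D'" "T I = T J" "I \<noteq> J"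
      have "?c (Inf I) < ?c (Sup I)" using IJ(1) unfolding D'_def by blast
      then have "interior (T I) \<noteq> {}"
        unfolding T_def interior_atLeastAtMost_real by (metis greaterThanLessThan_empty_iff not_le)
      then show False using disj[OF IJ(1,2,4)] IJ(3) by simp
    qed
    have div: "T ` D' division_of \<Union>(T ` D')"
    proof (rule division_ofI)
      fix K assume "K \<in> T ` D'"
      then show "K \<subseteq> \<Union>(T ` D')" "K \<noteq> {}" "\<exists>a b. K = cbox a b"
        using TT(1) by (auto simp: T_def simp del: atLeastatMost_empty_iff)
    next
      fix K1 K2 assume "K1 \<in> T ` D'" "K2 \<in> T ` D'" "K1 \<noteq> K2"
      then show "interior K1 \<inter> interior K2 = {}" using disj by blast
    qed (use D' in auto)
    have sub: "\<Union>(T ` D') \<subseteq> {s..t}" using int(1) by blast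
    have "(\<Sum>K\<in>T ` D'. Sup K - Inf K) = (\<Sum>I\<in>D'. ?c (Sup I) - ?c (Inf I))"
      by (simp add: sum.reindex[OF inj] TT cong: sum.cong)
    also have "\<dots> \<le> (\<Sum>I\<in>D'. Sup I - Inf I)"
    proof (rule sum_mono)
      fix I assume "I \<in> D'"
      then have "Inf I \<le> Sup I" by (rule int(3))
      then show "?c (Sup I) - ?c (Inf I) \<le> Sup I - Inf I" using st by (auto simp: max_def min_def)
    qed
    also have "\<dots> \<le> (\<Sum>I\<in>\<D>. Sup I - Inf I)"
    proof (rule sum_mono2)
      fix I assume "I \<in> \<D> - D'"
      then show "0 \<le> Sup I - Inf I" using division_nonempty_interval[OF D(1)] by (metis DiffD1 diff_ge_0_iff_ge)
    qed (use D D' in auto)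
    finally have "(\<Sum>K\<in>T ` D'. norm (f (Sup K) - f (Inf K))) < e"
      using D(2) by (intro d(2)[OF div sub]) simp
    then have "(\<Sum>I\<in>D'. norm (f (?c (Sup I)) - f (?c (Inf I)))) < e"
      by (simp add: sum.reindex[OF inj] TT cong: sum.cong)
    moreover have "(\<Sum>I\<in>\<D>. norm (f (?c (Sup I)) - f (?c (Inf I)))) = (\<Sum>I\<in>D'. norm (f (?c (Sup I)) - f (?c (Inf I))))"
    proof (rule sum.mono_neutral_right)
      show "\<forall>I\<in>\<D> - D'. norm (f (?c (Sup I)) - f (?c (Inf I))) = 0"
      proof
        fix I assume I: "I \<in> \<D> - D'"
        then obtain u v where uv: "I = {u..v}" "u \<le> v" "Inf I = u" "Sup I = v"
          using division_nonempty_interval[OF D(1)] by (metis DiffD1)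
        have "?c u \<le> ?c v" using uv(2) by (auto simp: max_def min_def)
        moreover have "\<not> ?c u < ?c v" using I uv by (auto simp: D'_def)
        ultimately have "?c u = ?c v" by linarith
        then show "norm (f (?c (Sup I)) - f (?c (Inf I))) = 0" using uv by simp
      qed
    qed (use D D' in auto)
    ultimately show ?thesis by simp
  qed
  then show "\<exists>d>0. \<forall>\<D>. \<D> division_of \<Union>\<D> \<and> \<Union>\<D> \<subseteq> {a..b} \<and> (\<Sum>I\<in>\<D>. Sup I - Inf I) < d \<longrightarrow>
        (\<Sum>I\<in>\<D>. norm (f (?c (Sup I)) - f (?c (Inf I)))) < e"
    using d(1) by blast
qed

lemma abs_continuous_on_imp_continuous:
  fixes f :: "real \<Rightarrow> 'a::real_normed_vector"
  assumes "abs_continuous_on a b f"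
  shows "continuous_on {a..b} f"
  unfolding continuous_on_iff
proof (intro ballI allI impI)
  fix x e :: real assume x: "x \<in> {a..b}" and e: "0 < e"
  obtain d where d: "0 < d"
    "\<And>\<D>. \<D> division_of \<Union>\<D> \<Longrightarrow> \<Union>\<D> \<subseteq> {a..b} \<Longrightarrow> (\<Sum>I\<in>\<D>. Sup I - Inf I) < d \<Longrightarrow>
        (\<Sum>I\<in>\<D>. norm (f (Sup I) - f (Inf I))) < e"
    using assms e unfolding abs_continuous_on_def by meson
  have *: "norm (f v - f u) < e" if "a \<le> u" "u \<le> v" "v \<le> b" "v - u < d" for u v
  proof -
    have "{{u..v}} division_of \<Union>{{u..v}}" using that by (simp add: division_of_self[of u v, simplified])
    from d(2)[OF this] show ?thesis using that by simp
  qed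
  show "\<exists>d>0. \<forall>x'\<in>{a..b}. dist x' x < d \<longrightarrow> dist (f x') (f x) < e"
  proof (intro exI[of _ d] conjI ballI impI)
    fix y assume y: "y \<in> {a..b}" "dist y x < d"
    show "dist (f y) (f x) < e"
      using *[of x y] *[of y x] x y by (cases "x \<le> y") (auto simp: dist_norm norm_minus_commute)
  qed (rule d(1))
qed

lemma abs_continuous_derivative_ae:
  fixes f :: "real \<Rightarrow> 'a::real_normed_vector"
  assumes fin: "finite_dim TYPE('a)" and ac: "abs_continuous_on a b f"
  obtains N where "negligible N" "a \<in> N" "b \<in> N"
    "\<And>x. x \<in> {a..b} - N \<Longrightarrow> (f has_vector_derivative vector_derivative f (at x)) (at x)"
proof -
  obtain B :: "'a set" and c where B: "finite B" and c: "\<And>x::'a. (\<Sum>b\<in>B. blinfun_apply (c b) x *\<^sub>R b) = x"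
    using finite_dim_coordinates[OF fin] by metis
  let ?N = "\<lambda>e. {x \<in> {a<..<b}. \<not> (\<exists>L. ((\<lambda>x. blinfun_apply (c e) (f x)) has_real_derivative L) (at x))}"
  have N: "negligible (?N e)" for e
  proof (rule abs_continuous_negligible_not_differentiable)
    show "abs_continuous_on a b (\<lambda>x. blinfun_apply (c e) (f x))"
      by (rule abs_continuous_on_dominated1[OF ac, of _ "norm (c e)" 0])
        (use norm_blinfun in \<open>simp add: blinfun.diff_right[symmetric] del: real_norm_def\<close>)
  qed
  have "negligible ({a, b} \<union> (\<Union>e\<in>B. ?N e))"
    using B N by (intro negligible_Un negligible_Union) auto
  moreover have "(f has_vector_derivative vector_derivative f (at x)) (at x)"
    if x: "x \<in> {a..b} - ({a, b} \<union> (\<Union>e\<in>B. ?N e))" for x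
  proof -
    have "\<forall>e\<in>B. \<exists>L. ((\<lambda>x. blinfun_apply (c e) (f x)) has_real_derivative L) (at x)" using x by auto
    then obtain L where L: "\<And>e. e \<in> B \<Longrightarrow> ((\<lambda>x. blinfun_apply (c e) (f x)) has_real_derivative L e) (at x)"
      by metis
    have "((\<lambda>x. \<Sum>e\<in>B. blinfun_apply (c e) (f x) *\<^sub>R e) has_vector_derivative (\<Sum>e\<in>B. L e *\<^sub>R e)) (at x)"
    proof (rule has_vector_derivative_sum)
      fix e assume "e \<in> B"
      from has_vector_derivative_scaleR[OF L[OF this] has_vector_derivative_const[of e]]
      show "((\<lambda>x. blinfun_apply (c e) (f x) *\<^sub>R e) has_vector_derivative L e *\<^sub>R e) (at x)" by simp
    qed
    then have "(f has_vector_derivative (\<Sum>e\<in>B. L e *\<^sub>R e)) (at x)" by (simp add: c)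
    then show ?thesis by (simp add: vector_derivative_at)
  qed
  ultimately show ?thesis using that[of "{a, b} \<union> (\<Union>e\<in>B. ?N e)"] by blast
qed

section \<open>Vector measures\<close>

lemma
  fixes h :: "real \<Rightarrow> 'a::real_normed_vector" and w :: "'a \<Rightarrow>\<^sub>L real"
  assumes "vector_density m \<nu> h"
  shows vector_density_measurable: "h \<in> borel_measurable \<nu>"
    and vector_density_integrable: "integrable \<nu> (\<lambda>t. blinfun_apply w (h t))"
    and vector_density_apply: "A \<in> sets borel \<Longrightarrow> blinfun_apply w (m A) = (LINT t:A|\<nu>. blinfun_apply w (h t))"
  using assms by (auto simp: vector_density_def)

lemma scaled_fraction_le:
  fixes e r :: real
  assumes "0 < e" "0 \<le> r"
  shows "e / (r + 1) * r \<le> e"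
proof -
  have "0 < r + 1" using assms by simp
  then show ?thesis using assms by (simp add: divide_le_eq algebra_simps)
qed

lemma finite_dim_integrable_compose:
  fixes h :: "'b \<Rightarrow> 'a::real_normed_vector" and N :: "'a \<Rightarrow> real"
  assumes fin: "finite_dim TYPE('a)" and h: "h \<in> borel_measurable M"
    and int: "\<And>w :: 'a \<Rightarrow>\<^sub>L real. integrable M (\<lambda>t. blinfun_apply w (h t))"
    and N: "continuous_on UNIV N" "\<And>x. \<bar>N x\<bar> \<le> K * norm x"
  shows "integrable M (\<lambda>t. N (h t))"
proof -
  obtain B :: "'a set" and c where B: "finite B" and c: "\<And>x::'a. (\<Sum>b\<in>B. blinfun_apply (c b) x *\<^sub>R b) = x"
    using finite_dim_coordinates[OF fin] by metis
  have "integrable M (\<lambda>t. \<bar>K\<bar> * (\<Sum>b\<in>B. \<bar>blinfun_apply (c b) (h t)\<bar> * norm b))"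
    by (intro integrable_mult_right Bochner_Integration.integrable_sum integrable_mult_left integrable_abs int)
  then show ?thesis
  proof (rule Bochner_Integration.integrable_bound)
    show "(\<lambda>t. N (h t)) \<in> borel_measurable M"
      by (rule measurable_compose[OF h borel_measurable_continuous_onI[OF N(1)]])
    have "norm x \<le> (\<Sum>b\<in>B. \<bar>blinfun_apply (c b) x\<bar> * norm b)" for x
      using norm_sum[of "\<lambda>b. blinfun_apply (c b) x *\<^sub>R b" B] by (simp add: c)
    then have bound: "\<bar>N x\<bar> \<le> \<bar>K\<bar> * (\<Sum>b\<in>B. \<bar>blinfun_apply (c b) x\<bar> * norm b)" for x
      using N(2)[of x] by (meson abs_ge_self abs_ge_zero mult_mono norm_ge_zero order_trans)
    show "AE t in M. norm (N (h t)) \<le> norm (\<bar>K\<bar> * (\<Sum>b\<in>B. \<bar>blinfun_apply (c b) (h t)\<bar> * norm b))"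
      unfolding real_norm_def by (intro AE_I2 order_trans[OF bound abs_ge_self])
  qed
qed

lemma vector_density_exists:
  fixes h :: "real \<Rightarrow> 'a::real_normed_vector"
  assumes fin: "finite_dim TYPE('a)"
    and int: "\<And>w :: 'a \<Rightarrow>\<^sub>L real. integrable \<nu> (\<lambda>t. blinfun_apply w (h t))"
    and S: "sets \<nu> = sets borel"
  obtains m where "vector_density m \<nu> h"
proof -
  obtain B :: "'a set" and c where B: "finite B" and c: "\<And>x::'a. (\<Sum>b\<in>B. blinfun_apply (c b) x *\<^sub>R b) = x"
    using finite_dim_coordinates[OF fin] by metis
  define m where "m A = (\<Sum>b\<in>B. (LINT t:A|\<nu>. blinfun_apply (c b) (h t)) *\<^sub>R b)" for A
  have meas: "h \<in> borel_measurable \<nu>"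
    by (rule finite_dim_borel_measurable[OF fin]) (use int in blast)
  have "blinfun_apply w (m A) = (LINT t:A|\<nu>. blinfun_apply w (h t))" if A: "A \<in> sets borel"
    for w :: "'a \<Rightarrow>\<^sub>L real" and A
  proof -
    have "blinfun_apply w (m A) = (\<Sum>b\<in>B. (LINT t:A|\<nu>. blinfun_apply (c b) (h t)) * blinfun_apply w b)"
      by (simp add: m_def blinfun.sum_right blinfun.scaleR_right)
    also have "\<dots> = (\<Sum>b\<in>B. (LINT t:A|\<nu>. blinfun_apply (c b) (h t) * blinfun_apply w b))"
      by (simp add: set_integral_mult_left)
    also have "\<dots> = (LINT t:A|\<nu>. (\<Sum>b\<in>B. blinfun_apply (c b) (h t) * blinfun_apply w b))"
      unfolding set_lebesgue_integral_def sum_distrib_left scaleR_sum_right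
      using A S int by (intro Bochner_Integration.integral_sum[symmetric] integrable_mult_indicator integrable_mult_left) auto
    also have "\<dots> = (LINT t:A|\<nu>. blinfun_apply w (\<Sum>b\<in>B. blinfun_apply (c b) (h t) *\<^sub>R b))"
      by (simp add: blinfun.sum_right blinfun.scaleR_right)
    finally show ?thesis by (simp add: c)
  qed
  then show ?thesis using that[of m] meas int by (simp add: vector_density_def)
qed

lemma vector_density_set_integrable:
  fixes h :: "real \<Rightarrow> 'a::real_normed_vector" and w :: "'a \<Rightarrow>\<^sub>L real"
  assumes "vector_density m \<nu> h" "sets \<nu> = sets borel" "A \<in> sets borel"
  shows "set_integrable \<nu> A (\<lambda>t. blinfun_apply w (h t))"
  unfolding set_integrable_def
  by (rule integrable_mult_indicator[OF _ vector_density_integrable[OF assms(1)]]) (use assms in simp)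

lemma vector_density_incseq:
  fixes h :: "real \<Rightarrow> 'a::real_normed_vector"
  assumes fin: "finite_dim TYPE('a)" and vd: "vector_density m \<nu> h" and S: "sets \<nu> = sets borel"
    and A: "range A \<subseteq> sets borel" "incseq A"
  shows "(\<lambda>n. m (A n)) \<longlonglongrightarrow> m (\<Union>n. A n)"
proof (rule finite_dim_tendstoI[OF fin])
  fix w :: "'a \<Rightarrow>\<^sub>L real"
  have "(\<lambda>n. LINT t:A n|\<nu>. blinfun_apply w (h t)) \<longlonglongrightarrow> (LINT t:(\<Union>n. A n)|\<nu>. blinfun_apply w (h t))"
    using A S by (intro set_integral_cont_up vector_density_set_integrable[OF vd S]) auto
  moreover have "A n \<in> sets borel" "(\<Union>n. A n) \<in> sets borel" for n using A by auto
  ultimately show "(\<lambda>n. blinfun_apply w (m (A n))) \<longlonglongrightarrow> blinfun_apply w (m (\<Union>n. A n))"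
    by (simp add: vector_density_apply[OF vd])
qed

lemma vector_density_decseq:
  fixes h :: "real \<Rightarrow> 'a::real_normed_vector"
  assumes fin: "finite_dim TYPE('a)" and vd: "vector_density m \<nu> h" and S: "sets \<nu> = sets borel"
    and A: "range A \<subseteq> sets borel" "decseq A"
  shows "(\<lambda>n. m (A n)) \<longlonglongrightarrow> m (\<Inter>n. A n)"
proof (rule finite_dim_tendstoI[OF fin])
  fix w :: "'a \<Rightarrow>\<^sub>L real"
  have "(\<lambda>n. LINT t:A n|\<nu>. blinfun_apply w (h t)) \<longlonglongrightarrow> (LINT t:(\<Inter>n. A n)|\<nu>. blinfun_apply w (h t))"
    using A S by (intro set_integral_cont_down vector_density_set_integrable[OF vd S]) auto
  moreover have "A n \<in> sets borel" "(\<Inter>n. A n) \<in> sets borel" for n using A by auto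
  ultimately show "(\<lambda>n. blinfun_apply w (m (A n))) \<longlonglongrightarrow> blinfun_apply w (m (\<Inter>n. A n))"
    by (simp add: vector_density_apply[OF vd])
qed

lemma vector_density_Un:
  fixes h :: "real \<Rightarrow> 'a::real_normed_vector"
  assumes fin: "finite_dim TYPE('a)" and vd: "vector_density m \<nu> h" and S: "sets \<nu> = sets borel"
    and A: "A \<in> sets borel" "B \<in> sets borel" "A \<inter> B = {}"
  shows "m (A \<union> B) = m A + m B"
proof (rule finite_dim_eqI[OF fin])
  fix w :: "'a \<Rightarrow>\<^sub>L real"
  show "blinfun_apply w (m (A \<union> B)) = blinfun_apply w (m A + m B)"
    using A S by (simp add: vector_density_apply[OF vd] blinfun.add_right set_integral_Un
        vector_density_set_integrable[OF vd S])
qed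

lemma vector_density_empty:
  fixes h :: "real \<Rightarrow> 'a::real_normed_vector"
  assumes "finite_dim TYPE('a)" "vector_density m \<nu> h"
  shows "m {} = 0"
  by (rule finite_dim_eqI[OF assms(1)]) (simp add: vector_density_apply[OF assms(2)] set_lebesgue_integral_def)

lemma vector_density_measure:
  fixes h :: "real \<Rightarrow> 'a::real_normed_vector"
  assumes fin: "finite_dim TYPE('a)" and vd: "vector_density m \<nu> h" and S: "sets \<nu> = sets borel"
  shows "vector_measure m"
  unfolding vector_measure_def
proof (intro allI impI)
  fix A :: "nat \<Rightarrow> real set" assume A: "range A \<subseteq> sets borel \<and> disjoint_family A"
  have eq: "(\<Sum>i<n. m (A i)) = m (\<Union>i<n. A i)" for n
  proof (induction n)
    case 0
    then show ?case by (simp add: vector_density_empty[OF fin vd])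
  next
    case (Suc n)
    have "A i \<inter> A n = {}" if "i < n" for i
      using A that unfolding disjoint_family_on_def by (metis UNIV_I nat_neq_iff)
    then have "(\<Union>i<n. A i) \<inter> A n = {}" by blast
    moreover have "(\<Union>i<Suc n. A i) = (\<Union>i<n. A i) \<union> A n" by (auto simp: lessThan_Suc)
    moreover have "(\<Union>i<n. A i) \<in> sets borel" "A n \<in> sets borel" using A by auto
    ultimately show ?case using Suc vector_density_Un[OF fin vd S, of "\<Union>i<n. A i" "A n"] by simp
  qed
  have "(\<lambda>n. m (\<Union>i<n. A i)) \<longlonglongrightarrow> m (\<Union>n. \<Union>i<n. A i)"
  proof (rule vector_density_incseq[OF fin vd S])
    show "range (\<lambda>n. \<Union>i<n. A i) \<subseteq> sets borel" using A by auto
    show "incseq (\<lambda>n. \<Union>i<n. A i)" by (intro incseq_SucI UN_mono) auto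
  qed
  moreover have "(\<Union>n. \<Union>i<n. A i) = (\<Union>n. A n)" by auto
  ultimately show "(\<lambda>n. m (A n)) sums m (\<Union>n. A n)" unfolding sums_def eq by simp
qed

lemma vector_density_restrict:
  fixes h :: "real \<Rightarrow> 'a::real_normed_vector"
  assumes fin: "finite_dim TYPE('a)" and vd: "vector_density m \<nu> h" and S: "sets \<nu> = sets borel"
    and B: "B \<in> sets borel"
  shows "vector_density (\<lambda>A. m (A \<inter> B)) \<nu> (\<lambda>t. indicator B t *\<^sub>R h t)"
proof -
  have int: "integrable \<nu> (\<lambda>t. blinfun_apply w (indicator B t *\<^sub>R h t))" for w :: "'a \<Rightarrow>\<^sub>L real"
    using vector_density_set_integrable[OF vd S B, of w] by (simp add: set_integrable_def blinfun.scaleR_right)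
  have "blinfun_apply w (m (A \<inter> B)) = (LINT t:A|\<nu>. blinfun_apply w (indicator B t *\<^sub>R h t))"
    if "A \<in> sets borel" for w :: "'a \<Rightarrow>\<^sub>L real" and A
    using that B unfolding set_lebesgue_integral_def
    by (subst vector_density_apply[OF vd])
      (auto simp: set_lebesgue_integral_def blinfun.scaleR_right indicator_inter_arith mult.assoc)
  then show ?thesis
    unfolding vector_density_def using int
    by (auto intro!: finite_dim_borel_measurable[OF fin])
qed

lemma vector_density_cong:
  "vector_density m \<nu> h \<Longrightarrow> (\<And>A. A \<in> sets borel \<Longrightarrow> m A = m' A) \<Longrightarrow> vector_density m' \<nu> h"
  by (simp add: vector_density_def)

section \<open>Integrals of a gauge of a vector density\<close>

context finite_dim_gauge
begin

lemma gauge_measurable: "\<Psi>\<^sub>0 \<in> borel_measurable borel"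
  by (rule borel_measurable_continuous_onI[OF gauge_continuous])

lemma vector_density_gauge_integrable:
  assumes "vector_density m \<nu> h"
  shows "integrable \<nu> (\<lambda>t. \<Psi>\<^sub>0 (h t))"
proof -
  obtain K where K: "0 < K" "\<And>v. \<Psi>\<^sub>0 v \<le> K * norm v" using gauge_upper_bound by metis
  show ?thesis
  proof (rule finite_dim_integrable_compose[OF fin vector_density_measurable[OF assms] vector_density_integrable[OF assms] gauge_continuous])
    show "\<bar>\<Psi>\<^sub>0 x\<bar> \<le> K * norm x" for x using K(2)[of x] gauge_nonneg[of x] by simp
  qed
qed

lemma gauge_suminf_le:
  fixes x :: "nat \<Rightarrow> 'a"
  assumes "x sums s"
  shows "ennreal (\<Psi>\<^sub>0 s) \<le> (\<Sum>n. ennreal (\<Psi>\<^sub>0 (x n)))"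
proof (rule LIMSEQ_le_const2)
  show "(\<lambda>n. ennreal (\<Psi>\<^sub>0 (\<Sum>i<n. x i))) \<longlonglongrightarrow> ennreal (\<Psi>\<^sub>0 s)"
    using assms unfolding sums_def by (intro tendsto_ennrealI gauge_tendsto)
  have "ennreal (\<Psi>\<^sub>0 (\<Sum>i<n. x i)) \<le> (\<Sum>n. ennreal (\<Psi>\<^sub>0 (x n)))" for n
  proof -
    have "ennreal (\<Psi>\<^sub>0 (\<Sum>i<n. x i)) \<le> ennreal (\<Sum>i<n. \<Psi>\<^sub>0 (x i))" by (rule ennreal_leI[OF gauge_sum])
    also have "\<dots> = (\<Sum>i<n. ennreal (\<Psi>\<^sub>0 (x i)))" by (simp add: sum_ennreal gauge_nonneg)
    also have "\<dots> \<le> (\<Sum>n. ennreal (\<Psi>\<^sub>0 (x n)))" by (rule sum_le_suminf) auto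
    finally show ?thesis .
  qed
  then show "\<exists>N. \<forall>n\<ge>N. ennreal (\<Psi>\<^sub>0 (\<Sum>i<n. x i)) \<le> (\<Sum>n. ennreal (\<Psi>\<^sub>0 (x n)))" by blast
qed

text \<open>If \<open>h\<close> stays within \<open>d\<close> of one vector \<open>x\<close> on
  \<open>A\<close>, the integral of \<open>\<Psi>\<^sub>0 (h t)\<close> and
  \<open>\<Psi>\<^sub>0 (m A)\<close> are both close to
  \<open>measure \<nu> A * \<Psi>\<^sub>0 x\<close>. The constant depends on the space and the gauge
  alone, so that one radius serves all cells.\<close>

lemma vector_density_almost_constant:
  obtains C where "0 < C"
    "\<And>m \<nu> h A d x. vector_density m \<nu> h \<Longrightarrow> sets \<nu> = sets borel \<Longrightarrow> A \<in> sets borel \<Longrightarrow> emeasure \<nu> A < \<infinity> \<Longrightarrow> 0 \<le> d \<Longrightarrow>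
       (\<And>t. t \<in> A \<Longrightarrow> norm (h t - x) \<le> d) \<Longrightarrow>
       \<bar>(LINT t:A|\<nu>. \<Psi>\<^sub>0 (h t)) - \<Psi>\<^sub>0 (m A)\<bar> \<le> C * d * measure \<nu> A"
proof -
  obtain B :: "'a set" and c where B: "finite B" and c: "\<And>x::'a. (\<Sum>b\<in>B. blinfun_apply (c b) x *\<^sub>R b) = x"
    using finite_dim_coordinates[OF fin] by metis
  obtain K where K: "0 < K" "\<And>v. \<Psi>\<^sub>0 v \<le> K * norm v" using gauge_upper_bound by metis
  have lip: "\<bar>\<Psi>\<^sub>0 x - \<Psi>\<^sub>0 y\<bar> \<le> K * norm (x - y)" for x y
    using gauge_diff[of x y] gauge_diff[of y x] K(2)[of "x - y"] K(2)[of "y - x"]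
    by (simp add: norm_minus_commute abs_le_iff)
  define L where "L = (\<Sum>b\<in>B. norm (c b) * norm b)"
  have L: "0 \<le> L" unfolding L_def by (intro sum_nonneg) auto
  have "\<bar>(LINT t:A|\<nu>. \<Psi>\<^sub>0 (h t)) - \<Psi>\<^sub>0 (m A)\<bar> \<le> K * (1 + L) * d * measure \<nu> A"
    if vd: "vector_density m \<nu> h" and S: "sets \<nu> = sets borel" and A: "A \<in> sets borel" "emeasure \<nu> A < \<infinity>" and d: "0 \<le> d"
      and close: "\<And>t. t \<in> A \<Longrightarrow> norm (h t - x) \<le> d" for m \<nu> h A d x
  proof -
    let ?a = "measure \<nu> A"
    have fm: "A \<in> fmeasurable \<nu>" using A S by (simp add: fmeasurable_def)
    have const: "set_integrable \<nu> A (\<lambda>t. r)" "(LINT t:A|\<nu>. r) = r * ?a" for r :: real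
      using fm S A by (auto simp: set_integrable_def set_lebesgue_integral_def)
    have bnd: "\<bar>(LINT t:A|\<nu>. f t) - r * ?a\<bar> \<le> e * ?a"
      if f: "set_integrable \<nu> A f" and fr: "\<And>t. t \<in> A \<Longrightarrow> \<bar>f t - r\<bar> \<le> e" for f :: "real \<Rightarrow> real" and r e
    proof -
      have "(LINT t:A|\<nu>. f t) \<le> (LINT t:A|\<nu>. r + e)"
        by (rule set_integral_mono[OF f const(1)]) (use fr in \<open>fastforce simp: abs_le_iff\<close>)
      moreover have "(LINT t:A|\<nu>. r - e) \<le> (LINT t:A|\<nu>. f t)"
        by (rule set_integral_mono[OF const(1) f]) (use fr in \<open>fastforce simp: abs_le_iff\<close>)
      ultimately show ?thesis unfolding const(2) by (simp add: abs_le_iff algebra_simps)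
    qed
    have 1: "\<bar>blinfun_apply (c b) (m A - ?a *\<^sub>R x)\<bar> \<le> norm (c b) * d * ?a" for b
    proof -
      have "\<bar>(LINT t:A|\<nu>. blinfun_apply (c b) (h t)) - blinfun_apply (c b) x * ?a\<bar> \<le> norm (c b) * d * ?a"
      proof (rule bnd[OF vector_density_set_integrable[OF vd S A(1)]])
        fix t assume "t \<in> A"
        have "\<bar>blinfun_apply (c b) (h t - x)\<bar> \<le> norm (c b) * norm (h t - x)"
          using norm_blinfun[of "c b" "h t - x"] by simp
        also have "\<dots> \<le> norm (c b) * d" using close[OF \<open>t \<in> A\<close>] by (intro mult_left_mono) auto
        finally show "\<bar>blinfun_apply (c b) (h t) - blinfun_apply (c b) x\<bar> \<le> norm (c b) * d"
          by (simp add: blinfun.diff_right)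
      qed
      then show ?thesis
        by (simp add: vector_density_apply[OF vd A(1)] blinfun.diff_right blinfun.scaleR_right mult.commute)
    qed
    have "norm (m A - ?a *\<^sub>R x) = norm (\<Sum>b\<in>B. blinfun_apply (c b) (m A - ?a *\<^sub>R x) *\<^sub>R b)" by (simp only: c)
    also have "\<dots> \<le> (\<Sum>b\<in>B. norm (c b) * d * ?a * norm b)"
      by (rule sum_norm_le) (use 1 in \<open>auto intro!: mult_right_mono\<close>)
    also have "\<dots> = L * d * ?a" unfolding L_def by (simp add: sum_distrib_right sum_distrib_left mult_ac)
    finally have 2: "norm (m A - ?a *\<^sub>R x) \<le> L * d * ?a" .
    have "\<bar>\<Psi>\<^sub>0 (m A) - ?a * \<Psi>\<^sub>0 x\<bar> \<le> K * (L * d * ?a)"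
    proof -
      have "K * norm (m A - ?a *\<^sub>R x) \<le> K * (L * d * ?a)" using 2 K(1) by (intro mult_left_mono) auto
      then show ?thesis using order_trans[OF lip[of "m A" "?a *\<^sub>R x"]] by (simp add: gauge_scale)
    qed
    moreover have "\<bar>(LINT t:A|\<nu>. \<Psi>\<^sub>0 (h t)) - \<Psi>\<^sub>0 x * ?a\<bar> \<le> (K * d) * ?a"
    proof (rule bnd)
      show "set_integrable \<nu> A (\<lambda>t. \<Psi>\<^sub>0 (h t))"
        unfolding set_integrable_def using A S
        by (intro integrable_mult_indicator vector_density_gauge_integrable[OF vd]) auto
      show "\<bar>\<Psi>\<^sub>0 (h t) - \<Psi>\<^sub>0 x\<bar> \<le> K * d" if "t \<in> A" for t
        using order_trans[OF lip[of "h t" x] mult_left_mono[OF close[OF that], of K]] K(1) by simp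
    qed
    ultimately show ?thesis by (simp add: algebra_simps)
  qed
  moreover have "0 < K * (1 + L)" using K(1) L by simp
  ultimately show ?thesis using that[of "K * (1 + L)"] by blast
qed

text \<open>The cells are the disjointed preimages under \<open>h\<close> of balls of radius
  \<open>e / C\<close> around a dense sequence, hence \<open>h\<close> is almost constant on each.
  Jensen's inequality and its reverse then hold on every subset of a cell of finite measure, with an
  error proportional to that measure.\<close>

lemma vector_density_cells:
  assumes vd: "vector_density m \<nu> h" and S: "sets \<nu> = sets borel" and e: "0 < e"
  obtains P :: "nat \<Rightarrow> real set" where "range P \<subseteq> sets borel" "disjoint_family P" "(\<Union>n. P n) = UNIV"
    "\<And>n A. A \<in> sets borel \<Longrightarrow> A \<subseteq> P n \<Longrightarrow> emeasure \<nu> A < \<infinity> \<Longrightarrow>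
       ennreal (\<Psi>\<^sub>0 (m A)) \<le> (\<integral>\<^sup>+t\<in>A. ennreal (\<Psi>\<^sub>0 (h t)) \<partial>\<nu>) + ennreal e * emeasure \<nu> A"
    "\<And>n A. A \<in> sets borel \<Longrightarrow> A \<subseteq> P n \<Longrightarrow> emeasure \<nu> A < \<infinity> \<Longrightarrow>
       (\<integral>\<^sup>+t\<in>A. ennreal (\<Psi>\<^sub>0 (h t)) \<partial>\<nu>) \<le> ennreal (\<Psi>\<^sub>0 (m A)) + ennreal e * emeasure \<nu> A"
proof -
  obtain C where C: "0 < C"
    "\<And>m \<nu> h A d x. vector_density m \<nu> h \<Longrightarrow> sets \<nu> = sets borel \<Longrightarrow> A \<in> sets borel \<Longrightarrow> emeasure \<nu> A < \<infinity> \<Longrightarrow> 0 \<le> d \<Longrightarrow>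
       (\<And>t. t \<in> A \<Longrightarrow> norm (h t - x) \<le> d) \<Longrightarrow>
       \<bar>(LINT t:A|\<nu>. \<Psi>\<^sub>0 (h t)) - \<Psi>\<^sub>0 (m A)\<bar> \<le> C * d * measure \<nu> A"
    by (rule vector_density_almost_constant) blast
  obtain x :: "nat \<Rightarrow> 'a" where x: "\<And>y e. 0 < e \<Longrightarrow> \<exists>n. dist (x n) y < e"
    using finite_dim_dense_sequence[OF fin] by metis
  define d where "d = e / C"
  have d: "0 < d" using e C(1) by (simp add: d_def)
  define R where "R n = h -` ball (x n) d" for n
  have spc: "space \<nu> = UNIV" using sets_eq_imp_space_eq[OF S] by simp
  have "R n \<in> sets borel" for n
    using measurable_sets[OF vector_density_measurable[OF vd], of "ball (x n) d"] S spc by (simp add: R_def)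
  then have P1: "range (disjointed R) \<subseteq> sets borel" by (intro sets.range_disjointed_sets) auto
  have P2: "(\<Union>n. disjointed R n) = UNIV"
    unfolding UN_disjointed_eq R_def using x[OF d] by auto
  have key: "\<bar>(LINT t:A|\<nu>. \<Psi>\<^sub>0 (h t)) - \<Psi>\<^sub>0 (m A)\<bar> \<le> e * measure \<nu> A"
    if A: "A \<in> sets borel" "A \<subseteq> disjointed R n" "emeasure \<nu> A < \<infinity>" for n A
  proof -
    have "\<bar>(LINT t:A|\<nu>. \<Psi>\<^sub>0 (h t)) - \<Psi>\<^sub>0 (m A)\<bar> \<le> C * d * measure \<nu> A"
    proof (rule C(2)[OF vd S A(1,3)])
      fix t assume "t \<in> A"
      then have "t \<in> R n" using A(2) disjointed_subset[of R n] by blast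
      then show "norm (h t - x n) \<le> d" by (simp add: R_def dist_norm norm_minus_commute)
    qed (use d in simp)
    then show ?thesis using C(1) by (simp add: d_def)
  qed
  have nn: "(\<integral>\<^sup>+t\<in>A. ennreal (\<Psi>\<^sub>0 (h t)) \<partial>\<nu>) = ennreal (LINT t:A|\<nu>. \<Psi>\<^sub>0 (h t))" if "A \<in> sets borel" for A
  proof -
    have "(\<integral>\<^sup>+t\<in>A. ennreal (\<Psi>\<^sub>0 (h t)) \<partial>\<nu>) = (\<integral>\<^sup>+t. ennreal (indicator A t *\<^sub>R \<Psi>\<^sub>0 (h t)) \<partial>\<nu>)"
      by (intro nn_integral_cong) (auto split: split_indicator)
    also have "\<dots> = ennreal (LINT t:A|\<nu>. \<Psi>\<^sub>0 (h t))"
      unfolding set_lebesgue_integral_def using that S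
      by (intro nn_integral_eq_integral integrable_mult_indicator vector_density_gauge_integrable[OF vd])
        (auto simp: gauge_nonneg)
    finally show ?thesis .
  qed
  have em: "ennreal e * emeasure \<nu> A = ennreal (e * measure \<nu> A)" if "emeasure \<nu> A < \<infinity>" for A
    using that e by (simp add: emeasure_eq_ennreal_measure less_top ennreal_mult)
  have I0: "0 \<le> (LINT t:A|\<nu>. \<Psi>\<^sub>0 (h t))" for A
    unfolding set_lebesgue_integral_def by (intro integral_nonneg_AE) (auto simp: gauge_nonneg)
  show ?thesis
  proof (rule that[OF P1 disjoint_family_disjointed P2])
    fix n A assume A: "A \<in> sets borel" "A \<subseteq> disjointed R n" "emeasure \<nu> A < \<infinity>"
    show "ennreal (\<Psi>\<^sub>0 (m A)) \<le> (\<integral>\<^sup>+t\<in>A. ennreal (\<Psi>\<^sub>0 (h t)) \<partial>\<nu>) + ennreal e * emeasure \<nu> A"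
      unfolding nn[OF A(1)] em[OF A(3)] using key[OF A] e I0[of A]
      by (subst ennreal_plus[symmetric]) (auto intro!: ennreal_leI simp del: ennreal_plus)
    show "(\<integral>\<^sup>+t\<in>A. ennreal (\<Psi>\<^sub>0 (h t)) \<partial>\<nu>) \<le> ennreal (\<Psi>\<^sub>0 (m A)) + ennreal e * emeasure \<nu> A"
      unfolding nn[OF A(1)] em[OF A(3)] using key[OF A] e gauge_nonneg[of "m A"]
      by (subst ennreal_plus[symmetric]) (auto intro!: ennreal_leI simp del: ennreal_plus)
  qed
qed

text \<open>Each cell satisfies the inequality up to a small multiple of its measure, and countable
  subadditivity of the gauge adds the cells up. The same proof serves every gauge, including the
  norm.\<close>

lemma vector_density_Jensen:
  assumes vd: "vector_density m \<nu> h" and S: "sets \<nu> = sets borel"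
    and A: "A \<in> sets borel" "emeasure \<nu> A < \<infinity>"
  shows "ennreal (\<Psi>\<^sub>0 (m A)) \<le> (\<integral>\<^sup>+t\<in>A. ennreal (\<Psi>\<^sub>0 (h t)) \<partial>\<nu>)" (is "_ \<le> ?I A")
proof (rule ennreal_le_epsilon)
  fix e :: real assume e: "0 < e"
  define e' where "e' = e / (measure \<nu> A + 1)"
  have e': "0 < e'" using e by (simp add: e'_def add_nonneg_pos)
  obtain P :: "nat \<Rightarrow> real set" where P: "range P \<subseteq> sets borel" "disjoint_family P" "(\<Union>n. P n) = UNIV"
    "\<And>n A. A \<in> sets borel \<Longrightarrow> A \<subseteq> P n \<Longrightarrow> emeasure \<nu> A < \<infinity> \<Longrightarrow>
       ennreal (\<Psi>\<^sub>0 (m A)) \<le> ?I A + ennreal e' * emeasure \<nu> A"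
    by (rule vector_density_cells[OF vd S e']) blast
  have AP: "range (\<lambda>n. A \<inter> P n) \<subseteq> sets borel" "disjoint_family (\<lambda>n. A \<inter> P n)" "(\<Union>n. A \<inter> P n) = A"
    using P A by (auto simp: disjoint_family_on_def)
  have meas: "(\<lambda>t. ennreal (\<Psi>\<^sub>0 (h t))) \<in> borel_measurable \<nu>"
    using measurable_compose[OF vector_density_measurable[OF vd] gauge_measurable] by simp
  have sub: "emeasure \<nu> (A \<inter> P n) < \<infinity>" for n
    using emeasure_mono[of "A \<inter> P n" A \<nu>] A S by (simp add: order.strict_trans1)
  have "(\<lambda>n. m (A \<inter> P n)) sums m A"
    using vector_density_measure[OF fin vd S] AP unfolding vector_measure_def by metis
  then have "ennreal (\<Psi>\<^sub>0 (m A)) \<le> (\<Sum>n. ennreal (\<Psi>\<^sub>0 (m (A \<inter> P n))))" by (rule gauge_suminf_le)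
  also have "\<dots> \<le> (\<Sum>n. ?I (A \<inter> P n) + ennreal e' * emeasure \<nu> (A \<inter> P n))"
    using AP(1) sub by (intro suminf_le P(4)) auto
  also have "\<dots> = (\<Sum>n. ?I (A \<inter> P n)) + ennreal e' * (\<Sum>n. emeasure \<nu> (A \<inter> P n))"
    by (simp add: suminf_add[symmetric] ennreal_suminf_cmult)
  also have "(\<Sum>n. ?I (A \<inter> P n)) = ?I A"
    using nn_integral_disjoint_family[OF meas, of "\<lambda>n. A \<inter> P n"] AP S by (simp add: range_subsetD)
  also have "(\<Sum>n. emeasure \<nu> (A \<inter> P n)) = emeasure \<nu> A"
    using suminf_emeasure[of "\<lambda>n. A \<inter> P n" \<nu>] AP S by simp
  also have "ennreal e' * emeasure \<nu> A = ennreal (e' * measure \<nu> A)"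
    using A(2) e' by (simp add: emeasure_eq_ennreal_measure less_top ennreal_mult)
  also have "e' * measure \<nu> A \<le> e" unfolding e'_def using e by (intro scaled_fraction_le) auto
  finally show "ennreal (\<Psi>\<^sub>0 (m A)) \<le> ?I A + ennreal e" by (simp add: add_left_mono ennreal_leI)
qed

text \<open>The right-hand side mentions \<open>m\<close> only. So the integral of a gauge of a
  density does not depend on the reference measure or on the density; this is what makes densities
  that were picked by choice computable. Jensen's inequality gives one direction, the partition into
  cells the other.\<close>

theorem vector_density_variation:
  assumes vd: "vector_density m \<nu> h" and S: "sets \<nu> = sets borel"
    and B: "B \<in> sets borel" "emeasure \<nu> B < \<infinity>"
  shows "(\<integral>\<^sup>+t\<in>B. ennreal (\<Psi>\<^sub>0 (h t)) \<partial>\<nu>) =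
    (SUP A\<in>{A :: nat \<Rightarrow> real set. range A \<subseteq> sets borel \<and> disjoint_family A \<and> (\<Union>n. A n) = B}.
        \<Sum>n. ennreal (\<Psi>\<^sub>0 (m (A n))))" (is "?I B = (SUP A\<in>?P. ?V A)")
proof (rule antisym)
  have meas: "(\<lambda>t. ennreal (\<Psi>\<^sub>0 (h t))) \<in> borel_measurable \<nu>"
    using measurable_compose[OF vector_density_measurable[OF vd] gauge_measurable] by simp
  have split: "(\<Sum>n. ?I (A n)) = ?I B" if "A \<in> ?P" for A
    using nn_integral_disjoint_family[OF meas, of A] that S by (auto simp: range_subsetD)
  have finA: "emeasure \<nu> (A n) < \<infinity>" if "A \<in> ?P" for A n
  proof -
    have "A n \<subseteq> B" using that by blast
    then have "emeasure \<nu> (A n) \<le> emeasure \<nu> B" using B S by (intro emeasure_mono) auto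
    then show ?thesis using B(2) by (rule le_less_trans)
  qed
  show "(SUP A\<in>?P. ?V A) \<le> ?I B"
  proof (rule SUP_least)
    fix A assume A: "A \<in> ?P"
    have "?V A \<le> (\<Sum>n. ?I (A n))"
      using A finA[OF A] by (intro suminf_le vector_density_Jensen[OF vd S]) auto
    then show "?V A \<le> ?I B" using split[OF A] by simp
  qed
  show "?I B \<le> (SUP A\<in>?P. ?V A)"
  proof (rule ennreal_le_epsilon)
    fix e :: real assume e: "0 < e"
    define e' where "e' = e / (measure \<nu> B + 1)"
    have e': "0 < e'" using e by (simp add: e'_def add_nonneg_pos)
    obtain P :: "nat \<Rightarrow> real set" where P: "range P \<subseteq> sets borel" "disjoint_family P" "(\<Union>n. P n) = UNIV"
      "\<And>n A. A \<in> sets borel \<Longrightarrow> A \<subseteq> P n \<Longrightarrow> emeasure \<nu> A < \<infinity> \<Longrightarrow>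
         ?I A \<le> ennreal (\<Psi>\<^sub>0 (m A)) + ennreal e' * emeasure \<nu> A"
      by (rule vector_density_cells[OF vd S e']) blast
    let ?A = "\<lambda>n. B \<inter> P n"
    have A: "?A \<in> ?P" using P B by (auto simp: disjoint_family_on_def)
    have "?I B = (\<Sum>n. ?I (?A n))" using split[OF A] by simp
    also have "\<dots> \<le> (\<Sum>n. ennreal (\<Psi>\<^sub>0 (m (?A n))) + ennreal e' * emeasure \<nu> (?A n))"
      using A finA[OF A] by (intro suminf_le P(4)) auto
    also have "\<dots> = ?V ?A + ennreal e' * (\<Sum>n. emeasure \<nu> (?A n))"
      by (simp add: suminf_add[symmetric] ennreal_suminf_cmult)
    also have "(\<Sum>n. emeasure \<nu> (?A n)) = emeasure \<nu> B"
      using suminf_emeasure[of ?A \<nu>] A S by simp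
    also have "ennreal e' * emeasure \<nu> B = ennreal (e' * measure \<nu> B)"
      using B(2) e' by (simp add: emeasure_eq_ennreal_measure less_top ennreal_mult)
    also have "?V ?A + ennreal (e' * measure \<nu> B) \<le> (SUP A\<in>?P. ?V A) + ennreal e"
    proof (rule add_mono)
      show "?V ?A \<le> (SUP A\<in>?P. ?V A)" by (rule SUP_upper[OF A])
      show "ennreal (e' * measure \<nu> B) \<le> ennreal e"
        unfolding e'_def using e by (intro ennreal_leI scaled_fraction_le) auto
    qed
    finally show "?I B \<le> (SUP A\<in>?P. ?V A) + ennreal e" .
  qed
qed

end

lemma finite_dim_gauge_norm:
  "finite_dim TYPE('a::real_normed_vector) \<Longrightarrow> finite_dim_gauge (norm :: 'a \<Rightarrow> real)"
  by unfold_locales (auto simp: gauge_function_def norm_triangle_ineq)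

lemma variation_measure_eq_density:
  fixes h :: "real \<Rightarrow> 'a::real_normed_vector"
  assumes fin: "finite_dim TYPE('a)" and vd: "vector_density m \<nu> h" and S: "sets \<nu> = sets borel"
    and fm: "finite_measure \<nu>"
  shows "variation_measure m = density \<nu> (\<lambda>t. ennreal (norm (h t)))" (is "_ = ?D")
proof -
  interpret finite_dim_gauge "norm :: 'a \<Rightarrow> real" by (rule finite_dim_gauge_norm[OF fin])
  interpret finite_measure \<nu> by (rule fm)
  have meas: "(\<lambda>t. ennreal (norm (h t))) \<in> borel_measurable \<nu>"
    using measurable_compose[OF vector_density_measurable[OF vd] gauge_measurable] by simp
  have spc: "space ?D = UNIV" "sets ?D = sets borel" using sets_eq_imp_space_eq[OF S] S by auto
  have "variation_measure m = measure_of UNIV (sets borel) (emeasure ?D)"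
    unfolding variation_measure_def
  proof (rule measure_of_eq)
    fix B :: "real set" assume "B \<in> sigma_sets UNIV (sets borel)"
    then have B: "B \<in> sets borel" using sets.sigma_sets_eq[of "borel :: real measure"] by simp
    show "(SUP A\<in>{A :: nat \<Rightarrow> real set. range A \<subseteq> sets borel \<and> disjoint_family A \<and> (\<Union>n. A n) = B}.
        \<Sum>n. ennreal (norm (m (A n)))) = emeasure ?D B"
    proof -
      have 1: "emeasure \<nu> B < \<infinity>" by (simp add: less_top[symmetric])
      have 2: "emeasure ?D B = (\<integral>\<^sup>+t\<in>B. ennreal (norm (h t)) \<partial>\<nu>)"
        using B S by (intro emeasure_density meas) simp
      show ?thesis unfolding 2 by (rule vector_density_variation[OF vd S B 1, symmetric])
    qed
  qed simp
  also have "\<dots> = ?D" using measure_of_of_measure[of ?D] spc by simp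
  finally show ?thesis .
qed

lemma variation_measure_finite:
  fixes h :: "real \<Rightarrow> 'a::real_normed_vector"
  assumes fin: "finite_dim TYPE('a)" and vd: "vector_density m \<nu> h" and S: "sets \<nu> = sets borel"
    and fm: "finite_measure \<nu>"
  shows "finite_measure (variation_measure m)" "sets (variation_measure m) = sets borel"
    "space (variation_measure m) = UNIV"
proof -
  interpret finite_dim_gauge "norm :: 'a \<Rightarrow> real" by (rule finite_dim_gauge_norm[OF fin])
  note eq = variation_measure_eq_density[OF assms]
  have meas: "(\<lambda>t. ennreal (norm (h t))) \<in> borel_measurable \<nu>"
    using measurable_compose[OF vector_density_measurable[OF vd] gauge_measurable] by simp
  show "finite_measure (variation_measure m)"
  proof
    have "(\<integral>\<^sup>+t. ennreal (norm (h t)) \<partial>\<nu>) = ennreal (LINT t|\<nu>. norm (h t))"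
      by (rule nn_integral_eq_integral[OF vector_density_gauge_integrable[OF vd]]) simp
    then show "emeasure (variation_measure m) (space (variation_measure m)) \<noteq> \<infinity>"
      unfolding eq using meas by (simp add: emeasure_density cong: nn_integral_cong)
  qed
  show "sets (variation_measure m) = sets borel" unfolding eq using S by simp
  show "space (variation_measure m) = UNIV" unfolding eq using sets_eq_imp_space_eq[OF S] by simp
qed

text \<open>Reduced to the scalar theorem: the total variation \<open>D\<close> of \<open>m\<close>
  vanishes on the null sets of \<open>\<sigma>\<close>, because \<open>m\<close> vanishes on all
  their Borel subsets, and it has a density \<open>k\<close>. The new vector density has length
  \<open>k\<close> and keeps the direction of \<open>g\<close>. The second clause transfers
  integrals of bounded scalar functions, as needed for test functions.\<close>

theorem vector_density_Radon_Nikodym: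
  fixes g :: "real \<Rightarrow> 'a::real_normed_vector"
  assumes fin: "finite_dim TYPE('a)" and vd: "vector_density m \<rho> g" and S: "sets \<rho> = sets borel"
    and fm: "finite_measure \<rho>" and sf: "sigma_finite_measure \<sigma>" and S': "sets \<sigma> = sets borel"
    and ac: "\<And>A. A \<in> sets borel \<Longrightarrow> emeasure \<sigma> A = 0 \<Longrightarrow> m A = 0"
  obtains h where "vector_density m \<sigma> h"
    "\<And>f (w :: 'a \<Rightarrow>\<^sub>L real). f \<in> borel_measurable borel \<Longrightarrow> (\<And>t. \<bar>f t\<bar> \<le> 1) \<Longrightarrow>
      (LINT t|\<sigma>. f t * blinfun_apply w (h t)) = (LINT t|\<rho>. f t * blinfun_apply w (g t))"
proof -
  interpret N: finite_dim_gauge "norm :: 'a \<Rightarrow> real" by (rule finite_dim_gauge_norm[OF fin])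
  interpret rho: finite_measure \<rho> by (rule fm)
  interpret sigma: sigma_finite_measure \<sigma> by (rule sf)
  have gm: "g \<in> borel_measurable \<rho>" by (rule vector_density_measurable[OF vd])
  have [measurable_cong]: "sets \<rho> = sets borel" "sets \<sigma> = sets borel" by (fact S S')+
  have ng [measurable]: "(\<lambda>t. norm (g t)) \<in> borel_measurable borel"
    using measurable_compose[OF gm N.gauge_measurable] S by (simp cong: measurable_cong_sets)
  have wg [measurable]: "(\<lambda>t. blinfun_apply w (g t)) \<in> borel_measurable borel" for w :: "'a \<Rightarrow>\<^sub>L real"
    using borel_measurable_integrable[OF vector_density_integrable[OF vd, of w]] S
    by (simp cong: measurable_cong_sets)
  define D where "D = density \<rho> (\<lambda>t. ennreal (norm (g t)))"
  have SD: "sets D = sets borel" by (simp add: D_def S)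
  have fD: "finite_measure D"
    using variation_measure_finite(1)[OF fin vd S fm] variation_measure_eq_density[OF fin vd S fm]
    by (simp add: D_def)
  have acD: "absolutely_continuous \<sigma> D"
    unfolding absolutely_continuous_def
  proof
    fix A assume "A \<in> null_sets \<sigma>"
    then have A: "A \<in> sets borel" "emeasure \<sigma> A = 0" using S' by auto
    have fA: "emeasure \<rho> A < \<infinity>" by (simp add: less_top[symmetric])
    have "emeasure D A = (\<integral>\<^sup>+t\<in>A. ennreal (norm (g t)) \<partial>\<rho>)"
      unfolding D_def using A S by (intro emeasure_density) auto
    also have "\<dots> = (SUP P\<in>{P :: nat \<Rightarrow> real set. range P \<subseteq> sets borel \<and> disjoint_family P \<and> (\<Union>n. P n) = A}.
        \<Sum>n. ennreal (norm (m (P n))))"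
      by (rule N.vector_density_variation[OF vd S A(1) fA])
    also have "\<dots> \<le> 0"
    proof (rule SUP_least)
      fix P :: "nat \<Rightarrow> real set"
      assume P: "P \<in> {P. range P \<subseteq> sets borel \<and> disjoint_family P \<and> (\<Union>n. P n) = A}"
      have "m (P n) = 0" for n
      proof (rule ac)
        show "P n \<in> sets borel" using P by auto
        have "emeasure \<sigma> (P n) \<le> emeasure \<sigma> A" using P A S' by (intro emeasure_mono) auto
        then show "emeasure \<sigma> (P n) = 0" using A by simp
      qed
      then show "(\<Sum>n. ennreal (norm (m (P n)))) \<le> 0" by simp
    qed
    finally show "A \<in> null_sets D" using A SD by (auto intro: null_setsI)
  qed
  obtain k where k: "k \<in> borel_measurable \<sigma>" "AE x in \<sigma>. RN_deriv \<sigma> D x = ennreal (k x)" "\<And>x. 0 \<le> k x"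
    using sigma.real_RN_deriv[OF fD acD] SD S' by metis
  have km [measurable]: "k \<in> borel_measurable borel" using k(1) S' by (simp cong: measurable_cong_sets)
  have Dk: "D = density \<sigma> (\<lambda>x. ennreal (k x))"
  proof -
    have "D = density \<sigma> (RN_deriv \<sigma> D)"
      using sigma.density_RN_deriv[OF acD] SD S' by simp
    also have "\<dots> = density \<sigma> (\<lambda>x. ennreal (k x))"
      using k by (intro density_cong) auto
    finally show ?thesis .
  qed
  \<comment> \<open>Where \<open>g\<close> vanishes the quotient is 0 by convention, so
    \<open>h\<close> vanishes as well; this is harmless since \<open>D\<close> does not charge that
    set.\<close>
  define h where "h t = (k t / norm (g t)) *\<^sub>R g t" for t
  have hw: "blinfun_apply w (h t) = k t * (blinfun_apply w (g t) / norm (g t))" for w :: "'a \<Rightarrow>\<^sub>L real" and t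
    by (simp add: h_def blinfun.scaleR_right)
  have gw: "blinfun_apply w (g t) = norm (g t) * (blinfun_apply w (g t) / norm (g t))" for w :: "'a \<Rightarrow>\<^sub>L real" and t
    by (cases "g t = 0") auto
  have trans: "integrable \<sigma> (\<lambda>t. f t * blinfun_apply w (h t)) \<and>
      (LINT t|\<sigma>. f t * blinfun_apply w (h t)) = (LINT t|\<rho>. f t * blinfun_apply w (g t))"
    if f [measurable]: "f \<in> borel_measurable borel" and f01: "\<And>t. \<bar>f t\<bar> \<le> 1" for f and w :: "'a \<Rightarrow>\<^sub>L real"
  proof -
    let ?q = "\<lambda>t. f t * (blinfun_apply w (g t) / norm (g t))"
    have 1: "integrable \<rho> (\<lambda>t. f t * blinfun_apply w (g t))"
    proof (rule Bochner_Integration.integrable_bound[OF vector_density_integrable[OF vd, of w]])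
      show "AE t in \<rho>. norm (f t * blinfun_apply w (g t)) \<le> norm (blinfun_apply w (g t))"
        using f01 by (intro AE_I2) (simp add: abs_mult mult_left_le_one_le)
    qed measurable
    have e1: "(\<lambda>t. f t * blinfun_apply w (g t)) = (\<lambda>t. norm (g t) *\<^sub>R ?q t)"
    proof
      fix t show "f t * blinfun_apply w (g t) = norm (g t) *\<^sub>R ?q t" by (cases "g t = 0") auto
    qed
    have e2: "(\<lambda>t. f t * blinfun_apply w (h t)) = (\<lambda>t. k t *\<^sub>R ?q t)"
      by (simp add: hw mult_ac)
    have 2: "integrable D ?q" "(LINT t|D. ?q t) = (LINT t|\<rho>. f t * blinfun_apply w (g t))"
      using 1 unfolding e1 D_def by (auto simp: integrable_density integral_density)
    then have "integrable \<sigma> (\<lambda>t. k t *\<^sub>R ?q t)" "(LINT t|\<sigma>. k t *\<^sub>R ?q t) = (LINT t|\<rho>. f t * blinfun_apply w (g t))"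
      unfolding Dk using k(3) by (auto simp: integrable_density integral_density)
    then show ?thesis unfolding e2 by blast
  qed
  have int: "integrable \<sigma> (\<lambda>t. blinfun_apply w (h t))" for w :: "'a \<Rightarrow>\<^sub>L real"
    using trans[of "\<lambda>_. 1" w] by simp
  have "blinfun_apply w (m A) = (LINT t:A|\<sigma>. blinfun_apply w (h t))" if A: "A \<in> sets borel" for w :: "'a \<Rightarrow>\<^sub>L real" and A
  proof -
    have "(LINT t|\<sigma>. indicator A t * blinfun_apply w (h t)) = (LINT t|\<rho>. indicator A t * blinfun_apply w (g t))"
      using trans[of "indicator A" w] A by (simp add: indicator_def)
    then show ?thesis
      by (simp add: vector_density_apply[OF vd A] set_lebesgue_integral_def)
  qed
  moreover have "h \<in> borel_measurable \<sigma>"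
    by (rule finite_dim_borel_measurable[OF fin]) (use int in blast)
  ultimately have "vector_density m \<sigma> h" using int unfolding vector_density_def by blast
  then show ?thesis by (rule that) (use trans in blast)
qed

lemma vector_density_norm_le:
  fixes g :: "real \<Rightarrow> 'a::real_normed_vector"
  assumes fin: "finite_dim TYPE('a)" and vd: "vector_density m \<rho> g" and S: "sets \<rho> = sets borel"
    and fm: "finite_measure \<rho>" and A: "A \<in> sets borel"
  shows "ennreal (norm (m A)) \<le> emeasure (variation_measure m) A"
proof -
  interpret N: finite_dim_gauge "norm :: 'a \<Rightarrow> real" by (rule finite_dim_gauge_norm[OF fin])
  interpret rho: finite_measure \<rho> by (rule fm)
  have "(\<lambda>t. ennreal (norm (g t))) \<in> borel_measurable \<rho>"
    using measurable_compose[OF vector_density_measurable[OF vd] N.gauge_measurable] by simp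
  then have "emeasure (variation_measure m) A = (\<integral>\<^sup>+t\<in>A. ennreal (norm (g t)) \<partial>\<rho>)"
    unfolding variation_measure_eq_density[OF fin vd S fm] using A S by (intro emeasure_density) auto
  moreover have "emeasure \<rho> A < \<infinity>" by (simp add: less_top[symmetric])
  ultimately show ?thesis using N.vector_density_Jensen[OF vd S A] by simp
qed

text \<open>\<open>distributional_derivative\<close> integrates against a polar decomposition with
  respect to the variation measure. It exists because \<open>m\<close> is dominated by that measure,
  and the second clause moves the integrals back to the more explicit density
  \<open>g\<close>.\<close>

lemma vector_density_polar:
  fixes g :: "real \<Rightarrow> 'a::real_normed_vector"
  assumes fin: "finite_dim TYPE('a)" and vd: "vector_density m \<rho> g" and S: "sets \<rho> = sets borel"
    and fm: "finite_measure \<rho>"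
  obtains h where "vector_density m (variation_measure m) h"
    "\<And>f (w :: 'a \<Rightarrow>\<^sub>L real). f \<in> borel_measurable borel \<Longrightarrow> (\<And>t. \<bar>f t\<bar> \<le> 1) \<Longrightarrow>
      (LINT t|variation_measure m. f t * blinfun_apply w (h t)) = (LINT t|\<rho>. f t * blinfun_apply w (g t))"
proof -
  note vf = variation_measure_finite[OF assms]
  interpret vm: finite_measure "variation_measure m" by (rule vf)
  show ?thesis
  proof (rule vector_density_Radon_Nikodym[OF assms _ vf(2)])
    show "sigma_finite_measure (variation_measure m)" by (rule vm.sigma_finite_measure_axioms)
    show "m A = 0" if "A \<in> sets borel" "emeasure (variation_measure m) A = 0" for A
      using vector_density_norm_le[OF assms that(1)] that(2) by simp
  qed (use that in blast)
qed

text \<open>The sum is kept in the \<open>measure_of\<close> form because \<open>ref_measure\<close>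
  is written that way; countable additivity has to be checked before its values can be used.\<close>

lemma emeasure_measure_sum:
  fixes M N :: "real measure"
  assumes "sets M = sets borel" "sets N = sets borel"
  defines "P \<equiv> measure_of UNIV (sets borel) (\<lambda>A. emeasure M A + emeasure N A)"
  shows "sets P = sets borel" "space P = UNIV"
    and "A \<in> sets borel \<Longrightarrow> emeasure P A = emeasure M A + emeasure N A"
proof -
  show S: "sets P = sets borel" unfolding P_def using sets.sigma_sets_eq[of "borel :: real measure"] by simp
  show "space P = UNIV" unfolding P_def by simp
  show "emeasure P A = emeasure M A + emeasure N A" if "A \<in> sets borel"
    unfolding P_def
  proof (rule emeasure_measure_of_sigma)
    show "sigma_algebra UNIV (sets (borel :: real measure))"
      using sets.sigma_algebra_axioms[of "borel :: real measure"] by simp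
    show "positive (sets borel) (\<lambda>A. emeasure M A + emeasure N A)" by (simp add: positive_def)
    show "countably_additive (sets borel) (\<lambda>A. emeasure M A + emeasure N A)"
    proof (rule countably_additiveI)
      fix A :: "nat \<Rightarrow> real set"
      assume A: "range A \<subseteq> sets borel" "disjoint_family A" "\<Union>(range A) \<in> sets borel"
      have "(\<Sum>i. emeasure M (A i) + emeasure N (A i)) = (\<Sum>i. emeasure M (A i)) + (\<Sum>i. emeasure N (A i))"
        by (rule suminf_add[symmetric]) auto
      then show "(\<Sum>i. emeasure M (A i) + emeasure N (A i)) = emeasure M (\<Union>(range A)) + emeasure N (\<Union>(range A))"
        using suminf_emeasure[of A M] suminf_emeasure[of A N] A assms by simp
    qed
  qed (rule that)
qed

section \<open>Stieltjes measures and the derivative of a dominated curve\<close>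

lemma interval_measure_add:
  fixes F G :: "real \<Rightarrow> real"
  assumes "mono F" "mono G" "\<And>a. continuous (at_right a) F" "\<And>a. continuous (at_right a) G" "A \<in> sets borel"
  shows "emeasure (interval_measure (\<lambda>x. F x + G x)) A = emeasure (interval_measure F) A + emeasure (interval_measure G) A"
proof -
  let ?P = "measure_of UNIV (sets borel) (\<lambda>A. emeasure (interval_measure F) A + emeasure (interval_measure G) A)"
  note P = emeasure_measure_sum[of "interval_measure F" "interval_measure G", OF sets_interval_measure sets_interval_measure]
  have mon: "F x \<le> F y" "G x \<le> G y" if "x \<le> y" for x y using assms that by (auto dest: monoD)
  have "interval_measure (\<lambda>x. F x + G x) = ?P"
  proof (rule measure_eqI_generator_eq[where \<Omega> = UNIV and E = "range (\<lambda>(a, b). {a<..b::real})" and A = "\<lambda>i. {- real i<..real i}"])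
    show "Int_stable (range (\<lambda>(a, b). {a<..b::real}))"
      unfolding Int_stable_def by (auto simp: image_iff)
    show "emeasure (interval_measure (\<lambda>x. F x + G x)) X = emeasure ?P X" if X: "X \<in> range (\<lambda>(a, b). {a<..b::real})" for X
    proof -
      obtain a b where X: "X = {a<..b}" using X by auto
      show ?thesis
      proof (cases "a \<le> b")
        case True
        have "emeasure (interval_measure (\<lambda>x. F x + G x)) X = ennreal (F b + G b - (F a + G a))"
          unfolding X using True mon assms by (intro emeasure_interval_measure_Ioc) (auto intro!: add_mono continuous_add)
        also have "\<dots> = ennreal (F b - F a) + ennreal (G b - G a)"
          using mon[OF True] by (subst ennreal_plus[symmetric]) (auto simp: algebra_simps)
        also have "\<dots> = emeasure ?P X"
          unfolding X using True mon assms P(3) by (simp add: emeasure_interval_measure_Ioc)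
        finally show ?thesis .
      qed (simp add: X)
    qed
    show "sets (interval_measure (\<lambda>x. F x + G x)) = sigma_sets UNIV (range (\<lambda>(a, b). {a<..b}))"
      by (simp add: borel_sigma_sets_Ioc)
    show "sets ?P = sigma_sets UNIV (range (\<lambda>(a, b). {a<..b}))"
      unfolding P(1) by (simp add: borel_sigma_sets_Ioc)
    show "(\<Union>i. {- real i<..real i}) = UNIV"
    proof -
      have "\<exists>i. - real i < x \<and> x \<le> real i" for x :: real
      proof -
        obtain i where "\<bar>x\<bar> < real i" using reals_Archimedean2 by blast
        then show ?thesis by (intro exI[of _ i]) auto
      qed
      then show ?thesis by auto
    qed
    show "emeasure (interval_measure (\<lambda>x. F x + G x)) {- real i<..real i} \<noteq> \<infinity>" for i
    proof -
      have "emeasure (interval_measure (\<lambda>x. F x + G x)) {- real i<..real i} = ennreal (F (real i) + G (real i) - (F (- real i) + G (- real i)))"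
        using mon assms by (intro emeasure_interval_measure_Ioc) (auto intro!: add_mono continuous_add)
      then show ?thesis by simp
    qed
  qed auto
  then show ?thesis using P(3) assms(5) by metis
qed

text \<open>A function of bounded variation that is constant outside \<open>(0,T)\<close>, measured by an increasing function \<open>F\<close>.\<close>

locale stieltjes =
  fixes T :: real and F :: "real \<Rightarrow> real" and x :: "real \<Rightarrow> 'a::real_normed_vector" and K :: real
  assumes fin: "finite_dim TYPE('a)" and T_pos: "0 < T"
    and F_mono: "\<And>s t. s \<le> t \<Longrightarrow> F s \<le> F t" and F_cont: "\<And>a. continuous (at_right a) F"
    and F_left: "\<And>t. t \<le> 0 \<Longrightarrow> F t = F 0" and F_right: "\<And>t. T \<le> t \<Longrightarrow> F t = F T"
    and F_T: "(F \<longlongrightarrow> F T) (at_left T)"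
    and x_cont: "\<And>a. continuous (at_right a) x"
    and x_le: "\<And>s t. s \<le> t \<Longrightarrow> norm (x t - x s) \<le> K * (F t - F s)"
begin

abbreviation "\<rho> \<equiv> interval_measure F"

lemma sets_\<rho>: "sets \<rho> = sets borel" by simp

lemma emeasure_Ioc: "s \<le> t \<Longrightarrow> emeasure \<rho> {s<..t} = ennreal (F t - F s)"
  by (rule emeasure_interval_measure_Ioc) (auto intro: F_mono F_cont)

lemma finite_\<rho>: "finite_measure \<rho>"
proof
  have "emeasure \<rho> (\<Union>n::nat. {- real n<..real n}) = (SUP n. emeasure \<rho> {- real n<..real n})"
    by (rule SUP_emeasure_incseq[symmetric]) (auto simp: incseq_def)
  also have "\<dots> \<le> ennreal (F T - F 0)"
  proof (rule SUP_least)
    fix n :: nat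
    have "F (real n) \<le> F T"
    proof (cases "real n \<le> T")
      case True
      then show ?thesis by (rule F_mono)
    next
      case False
      then show ?thesis using F_right[of "real n"] by linarith
    qed
    moreover have "F (- real n) = F 0" by (rule F_left) simp
    ultimately have "F (real n) \<le> F T" "F 0 \<le> F (- real n)" by simp_all
    then show "emeasure \<rho> {- real n<..real n} \<le> ennreal (F T - F 0)"
      by (subst emeasure_Ioc) (auto intro!: ennreal_leI)
  qed
  also have "\<dots> < \<infinity>" by simp
  also have "(\<Union>n::nat. {- real n<..real n}) = UNIV"
  proof -
    have "\<exists>i. - real i < x \<and> x \<le> real i" for x :: real
    proof -
      obtain i where "\<bar>x\<bar> < real i" using reals_Archimedean2 by blast
      then show ?thesis by (intro exI[of _ i]) auto
    qed
    then show ?thesis by auto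
  qed
  finally show "emeasure \<rho> (space \<rho>) \<noteq> \<infinity>" by simp
qed

sublocale rho: finite_measure \<rho> by (rule finite_\<rho>)

lemma measure_Ioc: "s \<le> t \<Longrightarrow> measure \<rho> {s<..t} = F t - F s"
  using emeasure_Ioc[of s t] F_mono[of s t] by (simp add: measure_def)

text \<open>Domination by \<open>F\<close> makes \<open>L * F + w x\<close> and
  \<open>L * F - w x\<close> nondecreasing. The first generates a measure bounded by a multiple of
  \<open>\<rho>\<close>, which has a density \<open>k\<close>; subtracting the constant
  \<open>L\<close> leaves a density of the coordinate \<open>w x\<close>.\<close>

lemma coordinate_density:
  fixes w :: "'a \<Rightarrow>\<^sub>L real"
  obtains d where "integrable \<rho> d" "\<And>s t. s \<le> t \<Longrightarrow> (LINT r:{s<..t}|\<rho>. d r) = blinfun_apply w (x t) - blinfun_apply w (x s)"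
proof -
  define L where "L = norm w * K"
  define f where "f t = L * F t + blinfun_apply w (x t)" for t
  define f' where "f' t = L * F t - blinfun_apply w (x t)" for t
  have bd: "\<bar>blinfun_apply w (x t) - blinfun_apply w (x s)\<bar> \<le> L * (F t - F s)" if "s \<le> t" for s t
  proof -
    have "\<bar>blinfun_apply w (x t - x s)\<bar> \<le> norm w * norm (x t - x s)" using norm_blinfun[of w "x t - x s"] by simp
    also have "\<dots> \<le> norm w * (K * (F t - F s))" by (intro mult_left_mono x_le that) simp
    finally show ?thesis by (simp add: L_def blinfun.diff_right)
  qed
  have mf: "mono f" "mono f'" using bd by (force simp: mono_def f_def f'_def abs_le_iff algebra_simps)+
  have cf: "continuous (at_right a) f" "continuous (at_right a) f'" for a
    unfolding f_def f'_def by (intro continuous_intros F_cont x_cont)+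
  \<comment> \<open>An integer multiple of \<open>F\<close> is used because its measure follows from
    repeated addition. The function \<open>f2\<close> is the nondecreasing complement with
    \<open>f + f2 = n * F\<close>.\<close>
  obtain n :: nat where n: "2 * L \<le> real n" using real_arch_simple by blast
  define f2 where "f2 t = f' t + (real n - 2 * L) * F t" for t
  have mf2: "mono f2" unfolding f2_def using mf(2) n F_mono by (auto simp: mono_def intro!: add_mono mult_left_mono)
  have cf2: "continuous (at_right a) f2" for a unfolding f2_def by (intro continuous_intros cf F_cont)
  have nF: "emeasure (interval_measure (\<lambda>t. real k * F t)) A = of_nat k * emeasure \<rho> A" if "A \<in> sets borel" for k A
  proof (induction k)
    case 0
    have "emeasure (interval_measure (\<lambda>t::real. 0::real)) UNIV = 0"
    proof -
      have "emeasure (interval_measure (\<lambda>t. 0::real)) (\<Union>n::nat. {- real n<..real n}) = 0"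
        by (intro emeasure_UN_eq_0) (auto simp: emeasure_interval_measure_Ioc)
      moreover have "(\<Union>n::nat. {- real n<..real n}) = UNIV"
      proof -
        have "\<exists>i. - real i < x \<and> x \<le> real i" for x :: real
        proof -
          obtain i where "\<bar>x\<bar> < real i" using reals_Archimedean2 by blast
          then show ?thesis by (intro exI[of _ i]) auto
        qed
        then show ?thesis by auto
      qed
      ultimately show ?thesis by simp
    qed
    then have "emeasure (interval_measure (\<lambda>t::real. 0::real)) A = 0"
      using emeasure_mono[of A UNIV "interval_measure (\<lambda>t::real. 0::real)"] by simp
    then show ?case by simp
  next
    case (Suc k)
    have "emeasure (interval_measure (\<lambda>t. real k * F t + F t)) A
        = emeasure (interval_measure (\<lambda>t. real k * F t)) A + emeasure \<rho> A"
      by (intro interval_measure_add that continuous_intros F_cont) (auto simp: mono_def intro!: F_mono mult_left_mono)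
    then show ?case using Suc by (simp add: algebra_simps)
  qed
  let ?\<mu> = "interval_measure f"
  have sum: "of_nat n * emeasure \<rho> A = emeasure ?\<mu> A + emeasure (interval_measure f2) A" if "A \<in> sets borel" for A
  proof -
    have "(\<lambda>t. real n * F t) = (\<lambda>t. f t + f2 t)" by (auto simp: f_def f'_def f2_def algebra_simps)
    then show ?thesis using interval_measure_add[OF mf(1) mf2 cf(1) cf2 that] nF[OF that, of n] by simp
  qed
  have le: "emeasure ?\<mu> A \<le> of_nat n * emeasure \<rho> A" if "A \<in> sets borel" for A
    unfolding sum[OF that] by simp
  have fmu: "finite_measure ?\<mu>"
  proof
    have "of_nat n * emeasure \<rho> UNIV < (top::ennreal)"
      by (intro ennreal_mult_less_top[THEN iffD2]) (simp add: less_top[symmetric])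
    then show "emeasure ?\<mu> (space ?\<mu>) \<noteq> \<infinity>" using le[of UNIV] by (auto simp: top_unique)
  qed
  have ac: "absolutely_continuous \<rho> ?\<mu>"
    unfolding absolutely_continuous_def using le by (force simp: null_sets_def)
  obtain k where k: "k \<in> borel_measurable \<rho>" "AE x in \<rho>. RN_deriv \<rho> ?\<mu> x = ennreal (k x)" "\<And>x. 0 \<le> k x"
    using rho.real_RN_deriv[OF fmu ac] by (metis sets_interval_measure)
  have \<mu>: "?\<mu> = density \<rho> (\<lambda>x. ennreal (k x))"
  proof -
    have "?\<mu> = density \<rho> (RN_deriv \<rho> ?\<mu>)" using rho.density_RN_deriv[OF ac] by simp
    also have "\<dots> = density \<rho> (\<lambda>x. ennreal (k x))" using k by (intro density_cong) auto
    finally show ?thesis .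
  qed
  have nnk: "(\<integral>\<^sup>+ t\<in>A. ennreal (k t) \<partial>\<rho>) = emeasure ?\<mu> A" if "A \<in> sets borel" for A
    unfolding \<mu> using that k by (intro emeasure_density[symmetric]) auto
  have ik: "integrable \<rho> k"
    using nnk[of UNIV] finite_measure.emeasure_finite[OF fmu, of UNIV] k
    by (intro integrableI_nonneg) (auto simp: less_top[symmetric])
  have "(LINT r:{s<..t}|\<rho>. k r - L) = blinfun_apply w (x t) - blinfun_apply w (x s)" if st: "s \<le> t" for s t
  proof -
    have si: "set_integrable \<rho> {s<..t} k" "set_integrable \<rho> {s<..t} (\<lambda>_. L)"
      unfolding set_integrable_def by (intro integrable_mult_indicator ik; simp)+
    have "ennreal (LINT r:{s<..t}|\<rho>. k r) = (\<integral>\<^sup>+ r. ennreal (indicator {s<..t} r *\<^sub>R k r) \<partial>\<rho>)"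
      unfolding set_lebesgue_integral_def using si(1) k(3)
      by (intro nn_integral_eq_integral[symmetric]) (auto simp: set_integrable_def)
    also have "\<dots> = (\<integral>\<^sup>+ t\<in>{s<..t}. ennreal (k t) \<partial>\<rho>)" by (intro nn_integral_cong) (auto split: split_indicator)
    also have "\<dots> = ennreal (f t - f s)"
      using nnk[of "{s<..t}"] mf(1) cf(1) st by (simp add: emeasure_interval_measure_Ioc monoD)
    finally have "(LINT r:{s<..t}|\<rho>. k r) = f t - f s"
      using mf(1) st k(3) by (subst (asm) ennreal_inj) (auto simp: set_lebesgue_integral_def monoD intro!: integral_nonneg_AE)
    moreover have "(LINT r:{s<..t}|\<rho>. L) = L * (F t - F s)"
      using measure_Ioc[OF st] by (simp add: set_lebesgue_integral_def)
    ultimately show ?thesis using set_integral_diff(2)[OF si] by (simp add: f_def algebra_simps)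
  qed
  moreover have "integrable \<rho> (\<lambda>r. k r - L)" using ik by simp
  ultimately show ?thesis using that by blast
qed

lemma ex_density:
  obtains m g where "vector_density m \<rho> g" "\<And>s t. s \<le> t \<Longrightarrow> m {s<..t} = x t - x s"
proof -
  obtain B :: "'a set" and c where B: "finite B" and c: "\<And>x::'a. (\<Sum>b\<in>B. blinfun_apply (c b) x *\<^sub>R b) = x"
    using finite_dim_coordinates[OF fin] by metis
  have "\<forall>b. \<exists>d. integrable \<rho> d \<and> (\<forall>s t. s \<le> t \<longrightarrow> (LINT r:{s<..t}|\<rho>. d r) = blinfun_apply (c b) (x t) - blinfun_apply (c b) (x s))"
    using coordinate_density by metis
  from choice[OF this] obtain d where d: "\<And>b. integrable \<rho> (d b)"
    "\<And>b s t. s \<le> t \<Longrightarrow> (LINT r:{s<..t}|\<rho>. d b r) = blinfun_apply (c b) (x t) - blinfun_apply (c b) (x s)"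
    by blast
  define g where "g r = (\<Sum>b\<in>B. d b r *\<^sub>R b)" for r
  have wg: "blinfun_apply w (g r) = (\<Sum>b\<in>B. d b r * blinfun_apply w b)" for w :: "'a \<Rightarrow>\<^sub>L real" and r
    by (simp add: g_def blinfun.sum_right blinfun.scaleR_right)
  have int: "integrable \<rho> (\<lambda>r. blinfun_apply w (g r))" for w :: "'a \<Rightarrow>\<^sub>L real"
    unfolding wg by (intro Bochner_Integration.integrable_sum integrable_mult_left d(1))
  obtain m where m: "vector_density m \<rho> g" using vector_density_exists[OF fin int sets_\<rho>] by blast
  have "m {s<..t} = x t - x s" if st: "s \<le> t" for s t
  proof (rule finite_dim_eqI[OF fin])
    fix w :: "'a \<Rightarrow>\<^sub>L real"
    have "blinfun_apply w (m {s<..t}) = (LINT r:{s<..t}|\<rho>. (\<Sum>b\<in>B. d b r * blinfun_apply w b))"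
      by (subst vector_density_apply[OF m]) (auto simp: wg)
    also have "\<dots> = (\<Sum>b\<in>B. (LINT r:{s<..t}|\<rho>. d b r * blinfun_apply w b))"
      unfolding set_lebesgue_integral_def scaleR_sum_right
      by (intro Bochner_Integration.integral_sum integrable_mult_indicator integrable_mult_left d(1)) auto
    also have "\<dots> = (\<Sum>b\<in>B. (blinfun_apply (c b) (x t) - blinfun_apply (c b) (x s)) * blinfun_apply w b)"
      by (simp add: d(2)[OF st])
    also have "\<dots> = blinfun_apply w (\<Sum>b\<in>B. blinfun_apply (c b) (x t - x s) *\<^sub>R b)"
      by (simp add: blinfun.sum_right blinfun.scaleR_right blinfun.diff_right)
    finally show "blinfun_apply w (m {s<..t}) = blinfun_apply w (x t - x s)" by (simp only: c)
  qed
  then show ?thesis using that m by blast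
qed

end

lemma vector_density_null:
  fixes h :: "real \<Rightarrow> 'a::real_normed_vector"
  assumes fin: "finite_dim TYPE('a)" and vd: "vector_density m \<nu> h" and S: "sets \<nu> = sets borel"
    and A: "A \<in> sets borel" "emeasure \<nu> A = 0"
  shows "m A = 0"
proof (rule finite_dim_eqI[OF fin])
  fix w :: "'a \<Rightarrow>\<^sub>L real"
  have "AE t in \<nu>. t \<notin> A" using A S by (intro AE_not_in) (auto simp: null_sets_def)
  then have "(LINT t:A|\<nu>. blinfun_apply w (h t)) = 0"
    unfolding set_lebesgue_integral_def by (intro integral_eq_zero_AE) auto
  then show "blinfun_apply w (m A) = blinfun_apply w 0" by (simp add: vector_density_apply[OF vd A(1)])
qed

section \<open>From half-open intervals to Borel sets\<close>

text \<open>Left-open cells match the intervals on which a Stieltjes measure is an increment of its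
  function; membership becomes a statement about a ceiling, which makes cells of one level
  disjoint.\<close>

definition dyadic_cell :: "nat \<Rightarrow> int \<Rightarrow> real set" where
  "dyadic_cell n k = {(of_int k - 1) / 2 ^ n<..of_int k / 2 ^ n}"

lemma mem_dyadic_cell: "x \<in> dyadic_cell n k \<longleftrightarrow> \<lceil>x * 2 ^ n\<rceil> = k"
  by (auto simp: dyadic_cell_def ceiling_eq_iff field_simps)

lemma dyadic_cell_Suc: "x \<in> dyadic_cell (Suc n) k \<Longrightarrow> x \<in> dyadic_cell n l \<Longrightarrow> dyadic_cell (Suc n) k \<subseteq> dyadic_cell n l"
proof
  fix y assume x: "x \<in> dyadic_cell (Suc n) k" "x \<in> dyadic_cell n l" and y: "y \<in> dyadic_cell (Suc n) k"
  have "\<lceil>z * 2 ^ n\<rceil> = \<lceil>of_int k / 2 :: real\<rceil>" if "z \<in> dyadic_cell (Suc n) k" for z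
  proof -
    have z: "of_int k - 1 < z * 2 ^ n * 2" "z * 2 ^ n * 2 \<le> of_int k"
      using that by (auto simp: mem_dyadic_cell ceiling_eq_iff mult_ac)
    define c where "c = \<lceil>of_int k / 2 :: real\<rceil>"
    have "of_int c - 1 < (of_int k / 2 :: real)" "of_int k / 2 \<le> (of_int c :: real)"
      unfolding c_def by linarith+
    then have "(of_int (2 * c - 2) :: real) < of_int k" by simp
    then have "2 * c - 2 < k" by (simp only: of_int_less_iff)
    then have "of_int (2 * c - 2) \<le> (of_int (k - 1) :: real)" by (simp only: of_int_le_iff)
    then have "of_int c - 1 < z * 2 ^ n" using z(1) by simp
    moreover have "z * 2 ^ n \<le> of_int c" using z(2) \<open>of_int k / 2 \<le> (of_int c :: real)\<close> by linarith
    ultimately show ?thesis unfolding c_def[symmetric] by (simp add: ceiling_eq_iff)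
  qed
  from this[OF x(1)] this[OF y] x(2) show "y \<in> dyadic_cell n l" by (simp add: mem_dyadic_cell)
qed

text \<open>Of every level all cells contained in \<open>U\<close> are kept, which makes each family
  disjoint without a selection of maximal cells. Refining a kept cell yields kept cells, so the
  unions increase, and a point of \<open>U\<close> is reached once the cells are short
  enough.\<close>

lemma open_dyadic_cells:
  fixes U :: "real set"
  assumes U: "open U"
  obtains D :: "nat \<Rightarrow> nat \<Rightarrow> real set" where
    "\<And>n j. D n j = {} \<or> (\<exists>s t. s < t \<and> D n j = {s<..t} \<and> {s<..t} \<subseteq> U)"
    "\<And>n. disjoint_family (D n)" "incseq (\<lambda>n. \<Union>j. D n j)" "(\<Union>n. \<Union>j. D n j) = U"
proof -
  define D where "D n j = (if dyadic_cell n (int_decode j) \<subseteq> U then dyadic_cell n (int_decode j) else {})" for n j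
  define V where "V n = (\<Union>j. D n j)" for n
  have Db: "range (D n) \<subseteq> sets borel" for n by (auto simp: D_def dyadic_cell_def)
  have Vb: "V n \<in> sets borel" for n unfolding V_def using Db by blast
  have disj: "disjoint_family (D n)" for n
    unfolding disjoint_family_on_def D_def
    by (auto simp: mem_dyadic_cell disjoint_iff) (metis int_decode_inverse)
  have inV: "x \<in> V n \<longleftrightarrow> dyadic_cell n \<lceil>x * 2 ^ n\<rceil> \<subseteq> U" for n x
  proof
    assume "x \<in> V n"
    then obtain j where "x \<in> D n j" unfolding V_def by blast
    then have "x \<in> dyadic_cell n (int_decode j)" "dyadic_cell n (int_decode j) \<subseteq> U"
      unfolding D_def by (auto split: if_splits)
    then show "dyadic_cell n \<lceil>x * 2 ^ n\<rceil> \<subseteq> U" by (simp add: mem_dyadic_cell)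
  next
    assume *: "dyadic_cell n \<lceil>x * 2 ^ n\<rceil> \<subseteq> U"
    obtain j where j: "int_decode j = \<lceil>x * 2 ^ n\<rceil>" by (metis int_encode_inverse)
    have "x \<in> D n j" unfolding D_def j using * by (simp add: mem_dyadic_cell)
    then show "x \<in> V n" unfolding V_def by blast
  qed
  have inc: "incseq V"
  proof (rule incseq_SucI, rule subsetI)
    fix n x assume "x \<in> V n"
    then have "dyadic_cell n \<lceil>x * 2 ^ n\<rceil> \<subseteq> U" by (simp add: inV)
    moreover have "dyadic_cell (Suc n) \<lceil>x * 2 ^ Suc n\<rceil> \<subseteq> dyadic_cell n \<lceil>x * 2 ^ n\<rceil>"
      by (rule dyadic_cell_Suc[of x]) (simp_all add: mem_dyadic_cell)
    ultimately show "x \<in> V (Suc n)" unfolding inV by blast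
  qed
  have UV: "(\<Union>n. V n) = U"
  proof
    show "(\<Union>n. V n) \<subseteq> U" unfolding V_def D_def by (auto split: if_splits)
    show "U \<subseteq> (\<Union>n. V n)"
    proof
      fix x assume "x \<in> U"
      then obtain e where e: "0 < e" "ball x e \<subseteq> U" using U open_contains_ball by blast
      obtain n :: nat where n: "(1 / 2) ^ n < e" using real_arch_pow_inv[of e "1/2"] e(1) by auto
      have "dyadic_cell n \<lceil>x * 2 ^ n\<rceil> \<subseteq> ball x e"
      proof
        fix y assume y: "y \<in> dyadic_cell n \<lceil>x * 2 ^ n\<rceil>"
        have x: "x \<in> dyadic_cell n \<lceil>x * 2 ^ n\<rceil>" by (simp add: mem_dyadic_cell)
        have "\<bar>x - y\<bar> < of_int \<lceil>x * 2 ^ n\<rceil> / 2 ^ n - (of_int \<lceil>x * 2 ^ n\<rceil> - 1) / 2 ^ n"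
          using x y unfolding dyadic_cell_def by auto
        also have "\<dots> = (1 / 2) ^ n" by (simp add: diff_divide_distrib power_divide)
        finally show "y \<in> ball x e" using n by (simp add: dist_real_def)
      qed
      then show "x \<in> (\<Union>n. V n)" using e(2) by (auto simp: inV)
    qed
  qed
have cell: "D n j = {} \<or> (\<exists>s t. s < t \<and> D n j = {s<..t} \<and> {s<..t} \<subseteq> U)" for n j
  proof (cases "dyadic_cell n (int_decode j) \<subseteq> U")
    case True
    then have "D n j = dyadic_cell n (int_decode j)" by (simp add: D_def)
    moreover have "(of_int (int_decode j) - 1 :: real) / 2 ^ n < of_int (int_decode j) / 2 ^ n"
      by (simp add: divide_strict_right_mono)
    ultimately show ?thesis using True unfolding dyadic_cell_def by blast
  qed (simp add: D_def)
  show ?thesis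
    by (rule that[of D, OF cell disj]) (use inc UV in \<open>simp_all add: V_def[abs_def]\<close>)
qed

text \<open>Subadditivity of \<open>\<Psi>\<^sub>0\<close> carries the bound from intervals to
  countable disjoint unions of them, monotone limits to open sets, and outer regularity of
  \<open>\<rho>\<close> to Borel sets.\<close>

lemma (in finite_dim_gauge) gauge_le_measure:
  assumes vd: "vector_density m \<rho> g" and S: "sets \<rho> = sets borel" and fm: "finite_measure \<rho>"
    and Ioc: "\<And>s t. s \<le> t \<Longrightarrow> \<Psi>\<^sub>0 (m {s<..t}) \<le> measure \<rho> {s<..t}"
    and A: "A \<in> sets borel"
  shows "\<Psi>\<^sub>0 (m A) \<le> measure \<rho> A"
proof -
  interpret finite_measure \<rho> by (rule fm)
  have opn: "\<Psi>\<^sub>0 (m U) \<le> measure \<rho> U" if U: "open U" for U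
  proof -
    obtain D :: "nat \<Rightarrow> nat \<Rightarrow> real set" where cell:
      "\<And>n j. D n j = {} \<or> (\<exists>s t. s < t \<and> D n j = {s<..t} \<and> {s<..t} \<subseteq> U)"
      and disj: "\<And>n. disjoint_family (D n)" and inc: "incseq (\<lambda>n. \<Union>j. D n j)" and UV: "(\<Union>n. \<Union>j. D n j) = U"
      by (rule open_dyadic_cells[OF U]) blast
    define V where "V n = (\<Union>j. D n j)" for n
    have Db: "range (D n) \<subseteq> sets borel" for n
    proof (rule image_subsetI)
      fix j show "D n j \<in> sets borel" using cell[of n j] by auto
    qed
    have Vb: "V n \<in> sets borel" for n unfolding V_def using Db by blast
    note inc = inc[folded V_def] and UV = UV[folded V_def]
    have "\<Psi>\<^sub>0 (m (V n)) \<le> measure \<rho> (V n)" for n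
    proof -
      have "(\<lambda>j. m (D n j)) sums m (V n)"
        using vector_density_measure[OF fin vd S] Db disj unfolding vector_measure_def V_def by blast
      then have "ennreal (\<Psi>\<^sub>0 (m (V n))) \<le> (\<Sum>j. ennreal (\<Psi>\<^sub>0 (m (D n j))))" by (rule gauge_suminf_le)
      also have "\<dots> \<le> (\<Sum>j. emeasure \<rho> (D n j))"
      proof (rule suminf_le)
        fix j
        show "ennreal (\<Psi>\<^sub>0 (m (D n j))) \<le> emeasure \<rho> (D n j)"
          using cell[of n j] Ioc vector_density_empty[OF fin vd]
          by (auto simp: emeasure_eq_measure intro!: ennreal_leI)
      qed auto
      also have "\<dots> = emeasure \<rho> (V n)" unfolding V_def using Db disj S by (intro suminf_emeasure) auto
      finally show ?thesis by (simp add: emeasure_eq_measure)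
    qed
    moreover have "(\<lambda>n. \<Psi>\<^sub>0 (m (V n))) \<longlonglongrightarrow> \<Psi>\<^sub>0 (m U)"
      using vector_density_incseq[OF fin vd S, of V] Vb inc UV by (intro gauge_tendsto) auto
    moreover have "(\<lambda>n. measure \<rho> (V n)) \<longlonglongrightarrow> measure \<rho> U"
      using Lim_measure_incseq[of V \<rho>] Vb S inc UV by auto
    ultimately show ?thesis by (intro LIMSEQ_le) auto
  qed
  have "\<exists>U. open U \<and> A \<subseteq> U \<and> measure \<rho> U < measure \<rho> A + inverse (real (Suc n))" for n
  proof -
    have "emeasure \<rho> A = (INF U\<in>{U. A \<subseteq> U \<and> open U}. emeasure \<rho> U)"
      by (rule outer_regular[OF S _ A]) (simp add: emeasure_eq_measure)
    moreover have "emeasure \<rho> A < ennreal (measure \<rho> A + inverse (real (Suc n)))"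
      by (simp add: emeasure_eq_measure ennreal_less_iff del: ennreal_plus of_nat_Suc)
    ultimately obtain U where "A \<subseteq> U" "open U" "emeasure \<rho> U < ennreal (measure \<rho> A + inverse (real (Suc n)))"
      by (auto simp: INF_less_iff)
    then show ?thesis
      by (intro exI[of _ U]) (auto simp: emeasure_eq_measure ennreal_less_iff simp del: ennreal_plus of_nat_Suc)
  qed
  then obtain U where U: "\<And>n. open (U n)" "\<And>n. A \<subseteq> U n"
    "\<And>n. measure \<rho> (U n) < measure \<rho> A + inverse (real (Suc n))" by metis
  define V where "V n = (\<Inter>k\<le>n. U k)" for n
  have V: "open (V n)" "A \<subseteq> V n" for n unfolding V_def using U by auto
  have Vb: "V n \<in> sets borel" for n using V by auto
  have dec: "decseq V" unfolding V_def by (rule decseq_SucI) auto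
  \<comment> \<open>A decreasing intersection of open sets with the same measure as
    \<open>A\<close>. The difference is a null set of \<open>\<rho>\<close>, so \<open>m\<close>
    does not distinguish \<open>A'\<close> from \<open>A\<close>.\<close>
  define A' where "A' = (\<Inter>n. V n)"
  have A': "A' \<in> sets borel" "A \<subseteq> A'" using Vb V unfolding A'_def by auto
  have "measure \<rho> A' \<le> measure \<rho> A"
  proof (rule LIMSEQ_le_const)
    show "(\<lambda>n. measure \<rho> A + inverse (real (Suc n))) \<longlonglongrightarrow> measure \<rho> A"
      using tendsto_add[OF tendsto_const LIMSEQ_inverse_real_of_nat] by simp
    have "measure \<rho> A' \<le> measure \<rho> A + inverse (real (Suc n))" for n
    proof -
      have "A' \<subseteq> U n" unfolding A'_def V_def by blast
      then have "measure \<rho> A' \<le> measure \<rho> (U n)" using U(1) S by (intro finite_measure_mono) auto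
      then show ?thesis using U(3)[of n] by simp
    qed
    then show "\<exists>N. \<forall>n\<ge>N. measure \<rho> A' \<le> measure \<rho> A + inverse (real (Suc n))" by blast
  qed
  then have eqA: "measure \<rho> A' = measure \<rho> A"
    using finite_measure_mono[OF A'(2)] A'(1) S by (intro antisym) auto
  have "measure \<rho> (A' - A) = 0" using eqA A A' S by (subst finite_measure_Diff) auto
  then have "m (A' - A) = 0"
    using A A' by (intro vector_density_null[OF fin vd S]) (auto simp: emeasure_eq_measure)
  then have mA: "m A' = m A"
  proof -
    have "m ((A' - A) \<union> A) = m (A' - A) + m A"
      using A A' by (intro vector_density_Un[OF fin vd S]) auto
    moreover have "(A' - A) \<union> A = A'" using A'(2) by blast
    ultimately show ?thesis using \<open>m (A' - A) = 0\<close> by simp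
  qed
  have "(\<lambda>n. \<Psi>\<^sub>0 (m (V n))) \<longlonglongrightarrow> \<Psi>\<^sub>0 (m A')"
    using vector_density_decseq[OF fin vd S, of V] Vb dec unfolding A'_def by (intro gauge_tendsto) auto
  moreover have "(\<lambda>n. measure \<rho> (V n)) \<longlonglongrightarrow> measure \<rho> A'"
    using Lim_measure_decseq[of V \<rho>] Vb S dec unfolding A'_def by (auto simp: emeasure_eq_measure)
  ultimately have "\<Psi>\<^sub>0 (m A') \<le> measure \<rho> A'" using opn V by (intro LIMSEQ_le) auto
  then show ?thesis by (simp add: mA eqA)
qed

text \<open>Dynkin's argument on open intervals. Equality is assumed only for intervals whose
  closure lies inside \<open>{l<..<r}\<close>, as this is what compactly supported test functions
  provide; all other intervals are exhausted from inside.\<close>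

lemma vector_density_eq_if_intervals:
  fixes h1 h2 :: "real \<Rightarrow> 'a::real_normed_vector"
  assumes fin: "finite_dim TYPE('a)" and vd1: "vector_density m1 \<nu>1 h1" and vd2: "vector_density m2 \<nu>2 h2"
    and S1: "sets \<nu>1 = sets borel" and S2: "sets \<nu>2 = sets borel"
    and eq: "\<And>a b. l < a \<Longrightarrow> a < b \<Longrightarrow> b < r \<Longrightarrow> m1 {a<..<b} = m2 {a<..<b}"
    and A: "A \<in> sets borel"
  shows "m1 (A \<inter> {l<..<r}) = m2 (A \<inter> {l<..<r})"
proof -
  let ?S = "{l<..<r}"
  define M1 where "M1 A = m1 (A \<inter> ?S)" for A
  define M2 where "M2 A = m2 (A \<inter> ?S)" for A
  have S: "?S \<in> sets borel" by simp
  note V1 = vector_density_restrict[OF fin vd1 S1 S, folded M1_def] and V2 = vector_density_restrict[OF fin vd2 S2 S, folded M2_def]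
  have int: "M1 {a<..<b} = M2 {a<..<b}" for a b
  proof (cases "max a l < min b r")
    case False
    then have "{a<..<b} \<inter> ?S = {}" by auto
    then show ?thesis by (simp add: M1_def M2_def vector_density_empty[OF fin vd1] vector_density_empty[OF fin vd2])
  next
    case True
    define a' b' where "a' = max a l" and "b' = min b r"
    have ab: "a' < b'" "l \<le> a'" "b' \<le> r" using True by (auto simp: a'_def b'_def)
    \<comment> \<open>The summand 3 keeps \<open>3 * e n\<close> below the length, so that the
      interval shrunk on both sides stays nonempty for every \<open>n\<close>.\<close>
    define e where "e n = (b' - a') / (real n + 3)" for n :: nat
    have e: "0 < e n" "3 * e n \<le> b' - a'" for n
    proof -
      have "e n \<le> (b' - a') / 3" unfolding e_def using ab(1) by (intro divide_left_mono) auto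
      then show "3 * e n \<le> b' - a'" by simp
    qed (use ab(1) in \<open>simp add: e_def\<close>)
    have e_dec: "e n \<le> e k" if "k \<le> n" for k n
      unfolding e_def using that ab(1) by (intro divide_left_mono) auto
    have e0: "e \<longlonglongrightarrow> 0" unfolding e_def by real_asymp
    define I where "I n = {a' + e n<..<b' - e n}" for n
    have inc: "incseq I" unfolding incseq_def I_def using e_dec by (fastforce)
    have UI: "(\<Union>n. I n) = {a'<..<b'}"
    proof (rule antisym)
      show "(\<Union>n. I n) \<subseteq> {a'<..<b'}" unfolding I_def using e(1) by (auto intro: less_trans) (smt (verit) e(1))+
      show "{a'<..<b'} \<subseteq> (\<Union>n. I n)"
      proof
        fix x assume x: "x \<in> {a'<..<b'}"
        then have "\<forall>\<^sub>F n in sequentially. e n < min (x - a') (b' - x)" using e0 by (intro order_tendstoD) auto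
        then obtain n where "e n < min (x - a') (b' - x)" by (auto simp: eventually_sequentially)
        then show "x \<in> (\<Union>n. I n)" by (auto simp: I_def intro!: exI[of _ n])
      qed
    qed
    have "m1 (I n) = m2 (I n)" for n unfolding I_def using e[of n] ab by (intro eq) auto
    moreover have "(\<lambda>n. m1 (I n)) \<longlonglongrightarrow> m1 (\<Union>n. I n)"
      by (rule vector_density_incseq[OF fin vd1 S1 _ inc]) (auto simp: I_def)
    moreover have "(\<lambda>n. m2 (I n)) \<longlonglongrightarrow> m2 (\<Union>n. I n)"
      by (rule vector_density_incseq[OF fin vd2 S2 _ inc]) (auto simp: I_def)
    ultimately have "m1 {a'<..<b'} = m2 {a'<..<b'}" unfolding UI using LIMSEQ_unique by simp
    moreover have "{a<..<b} \<inter> ?S = {a'<..<b'}" by (auto simp: a'_def b'_def)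
    ultimately show ?thesis by (simp add: M1_def M2_def)
  qed
  let ?E = "range (\<lambda>(a, b). {a<..<b::real})"
  have sig: "sigma_sets UNIV ?E = sets borel"
  proof -
    have eq: "?E = range (\<lambda>(a, b). box a b)" by (rule arg_cong[of _ _ range]) (auto simp: fun_eq_iff box_real)
    show ?thesis unfolding eq by (subst borel_eq_box) simp
  qed
  have univ: "M1 UNIV = M2 UNIV" using int[of l r] by (simp add: M1_def M2_def)
  have E: "Int_stable ?E" "?E \<subseteq> Pow UNIV" "A \<in> sigma_sets UNIV ?E"
    using A sig unfolding Int_stable_def by (auto simp: image_iff)
  then have "M1 A = M2 A"
  proof (induction rule: sigma_sets_induct_disjoint)
    case (basic A)
    then show ?case using int by auto
  next
    case empty
    show ?case by (simp add: vector_density_empty[OF fin V1] vector_density_empty[OF fin V2])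
  next
    case (compl A)
    then have A: "A \<in> sets borel" "- A \<in> sets borel" using sig by auto
    have "A \<union> - A = UNIV" by auto
    then have "M1 UNIV = M1 A + M1 (- A)" "M2 UNIV = M2 A + M2 (- A)"
      using vector_density_Un[OF fin V1 S1 A] vector_density_Un[OF fin V2 S2 A] by auto
    then show ?case using univ compl by (simp add: Compl_eq_Diff_UNIV)
  next
    case (union A)
    have "(\<lambda>n. M1 (A n)) sums M1 (\<Union>n. A n)" "(\<lambda>n. M2 (A n)) sums M2 (\<Union>n. A n)"
      using vector_density_measure[OF fin V1 S1] vector_density_measure[OF fin V2 S2] union(1,2) sig
      unfolding vector_measure_def by auto
    then show ?case using union(3) sums_unique2 by simp
  qed
  then show ?thesis by (simp add: M1_def M2_def)
qed

section \<open>Test functions\<close>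

text \<open>\<open>flat 0\<close> is the classical smooth function \<open>exp (- 1 / x)\<close>,
  flat at 0. The powers of \<open>1 / x\<close> are included because differentiation produces them:
  the family is closed under derivatives up to linear combinations.\<close>

definition flat :: "nat \<Rightarrow> real \<Rightarrow> real" where
  "flat i x = (if x \<le> 0 then 0 else exp (- 1 / x) / x ^ i)"

lemma flat_tendsto_0: "(flat i \<longlongrightarrow> 0) (at_right 0)"
proof -
  have "((\<lambda>x. inverse x ^ i / exp (inverse x)) \<longlongrightarrow> (0::real)) (at_right 0)"
    by (rule filterlim_compose[OF tendsto_power_div_exp_0 filterlim_inverse_at_top_right])
  then show ?thesis
  proof (rule Lim_transform_eventually)
    show "\<forall>\<^sub>F x in at_right 0. inverse x ^ i / exp (inverse x) = flat i x"
      using eventually_at_right_less[of "0::real"]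
      by eventually_elim (simp add: flat_def exp_minus divide_inverse power_inverse mult.commute)
  qed
qed

lemma flat_has_derivative: "(flat i has_real_derivative - real i * flat (Suc i) x + flat (i + 2) x) (at x)"
proof -
  consider "x < 0" | "x = 0" | "0 < x" by linarith
  then show ?thesis
  proof cases
    case 1
    have "((\<lambda>_. 0) has_real_derivative 0) (at x)" by simp
    then have "(flat i has_real_derivative 0) (at x)"
      by (rule has_field_derivative_transform_within_open[of _ _ _ "{..<0}"]) (use 1 in \<open>auto simp: flat_def\<close>)
    then show ?thesis using 1 by (simp add: flat_def)
  next
    case 2
    have "((\<lambda>h. flat i h / h) \<longlongrightarrow> 0) (at 0)"
    proof (rule filterlim_split_at)
      show "((\<lambda>h. flat i h / h) \<longlongrightarrow> 0) (at_left 0)"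
        by (rule tendsto_eventually) (auto simp: eventually_at_filter flat_def)
      show "((\<lambda>h. flat i h / h) \<longlongrightarrow> 0) (at_right 0)"
        using flat_tendsto_0[of "Suc i"]
        by (rule Lim_transform_eventually)
          (use eventually_at_right_less[of "0::real"] in \<open>eventually_elim, simp add: flat_def mult.commute\<close>)
    qed
    then show ?thesis using 2 by (simp add: DERIV_def flat_def)
  next
    case 3
    have "((\<lambda>x. exp (- 1 / x) / x ^ i) has_real_derivative - real i * flat (Suc i) x + flat (i + 2) x) (at x)"
    proof (cases i)
      case 0
      then show ?thesis using 3
        by (auto intro!: derivative_eq_intros simp: flat_def power2_eq_square)
    next
      case (Suc k)
      show ?thesis unfolding Suc using 3
        by (auto intro!: derivative_eq_intros simp: flat_def field_simps power2_eq_square)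
          (metis One_nat_def power_eq_if)
    qed
    then show ?thesis
      by (rule has_field_derivative_transform_within_open[of _ _ _ "{0<..}"]) (use 3 in \<open>auto simp: flat_def\<close>)
  qed
qed

text \<open>A class of functions that differentiation maps into itself. Smoothness of its members
  follows by induction on the order, without formulas for higher derivatives.\<close>

inductive_set flat_span :: "real \<Rightarrow> real \<Rightarrow> real \<Rightarrow> (real \<Rightarrow> real) set" for n a b where
  base: "(\<lambda>x. flat i (n * (x - a)) * flat j (n * (b - x))) \<in> flat_span n a b"
| add: "f \<in> flat_span n a b \<Longrightarrow> g \<in> flat_span n a b \<Longrightarrow> (\<lambda>x. f x + g x) \<in> flat_span n a b"
| scale: "f \<in> flat_span n a b \<Longrightarrow> (\<lambda>x. c * f x) \<in> flat_span n a b"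

lemma flat_span_derivative:
  "f \<in> flat_span n a b \<Longrightarrow> \<exists>f'\<in>flat_span n a b. \<forall>x. (f has_real_derivative f' x) (at x)"
proof (induction rule: flat_span.induct)
  case (base i j)
  let ?B = "\<lambda>i j x. flat i (n * (x - a)) * flat j (n * (b - x))"
  let ?f' = "\<lambda>x. ((- real i * n) * ?B (Suc i) j x + n * ?B (i + 2) j x) +
      ((real j * n) * ?B i (Suc j) x + (- n) * ?B i (j + 2) x)"
  have "?f' \<in> flat_span n a b"
    by (intro flat_span.add flat_span.scale flat_span.base)
  moreover have "(?B i j has_real_derivative ?f' x) (at x)" for x
  proof -
    have 1: "((\<lambda>x. flat i (n * (x - a))) has_real_derivative
        (- real i * flat (Suc i) (n * (x - a)) + flat (i + 2) (n * (x - a))) * n) (at x)"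
      by (rule DERIV_chain2[OF flat_has_derivative]) (auto intro!: derivative_eq_intros)
    have 2: "((\<lambda>x. flat j (n * (b - x))) has_real_derivative
        (- real j * flat (Suc j) (n * (b - x)) + flat (j + 2) (n * (b - x))) * (- n)) (at x)"
      by (rule DERIV_chain2[OF flat_has_derivative]) (auto intro!: derivative_eq_intros)
    from DERIV_mult[OF 1 2] show ?thesis by (simp add: algebra_simps)
  qed
  ultimately show ?case by (rule_tac bexI[of _ ?f']) auto
next
  case (add f g)
  then obtain f' g' where "f' \<in> flat_span n a b" "\<forall>x. (f has_real_derivative f' x) (at x)"
    "g' \<in> flat_span n a b" "\<forall>x. (g has_real_derivative g' x) (at x)" by blast
  then show ?case by (intro bexI[of _ "\<lambda>x. f' x + g' x"]) (auto intro: flat_span.add DERIV_add)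
next
  case (scale f c)
  then obtain f' where "f' \<in> flat_span n a b" "\<forall>x. (f has_real_derivative f' x) (at x)" by blast
  then show ?case by (intro bexI[of _ "\<lambda>x. c * f' x"]) (auto intro: flat_span.scale DERIV_cmult)
qed

lemma flat_span_smooth: "f \<in> flat_span n a b \<Longrightarrow> (deriv ^^ k) f field_differentiable at x"
proof -
  assume f: "f \<in> flat_span n a b"
  have "(deriv ^^ k) f \<in> flat_span n a b"
  proof (induction k)
    case (Suc k)
    then obtain f' where f': "f' \<in> flat_span n a b" "\<forall>x. ((deriv ^^ k) f has_real_derivative f' x) (at x)"
      using flat_span_derivative by blast
    then have "deriv ((deriv ^^ k) f) = f'" by (auto intro: DERIV_imp_deriv)
    then show ?case using f'(1) by simp
  qed (use f in simp)
  then show ?thesis using flat_span_derivative field_differentiable_def by blast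
qed

text \<open>Positive exactly on the open interval from \<open>a\<close> to \<open>b\<close>. The
  factor \<open>Suc n\<close> steepens both flanks, so the sequence tends to the indicator of that
  interval while staying between 0 and 1.\<close>

definition bump :: "real \<Rightarrow> real \<Rightarrow> nat \<Rightarrow> real \<Rightarrow> real" where
  "bump a b n x = flat 0 (real (Suc n) * (x - a)) * flat 0 (real (Suc n) * (b - x))"

lemma bump_test_function: "0 < a \<Longrightarrow> a < b \<Longrightarrow> b < T \<Longrightarrow> test_function T (bump a b n)"
proof -
  assume ab: "0 < a" "a < b" "b < T"
  have "bump a b n \<in> flat_span (real (Suc n)) a b" unfolding bump_def by (rule flat_span.base)
  then have "\<forall>k x. (deriv ^^ k) (bump a b n) field_differentiable at x" using flat_span_smooth by blast
  moreover have "bump a b n x = 0" if "x \<notin> {a..b}" for x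
    using that by (auto simp: bump_def flat_def mult_le_0_iff not_le)
  ultimately show ?thesis unfolding test_function_def using ab by blast
qed

lemma bump_bounds: "0 \<le> bump a b n x" "bump a b n x \<le> 1"
proof -
  have "0 \<le> flat 0 y" "flat 0 y \<le> 1" for y by (auto simp: flat_def)
  then show "0 \<le> bump a b n x" "bump a b n x \<le> 1" unfolding bump_def by (auto intro: mult_le_one)
qed

lemma bump_tendsto: "(\<lambda>n. bump a b n x) \<longlonglongrightarrow> indicator {a<..<b} x"
proof (cases "a < x \<and> x < b")
  case True
  have *: "(\<lambda>n. flat 0 (real (Suc n) * y)) \<longlonglongrightarrow> 1" if "0 < y" for y
  proof -
    have "(\<lambda>n. exp (- (inverse (real (Suc n)) / y))) \<longlonglongrightarrow> exp (- (0 / y))"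
      using that by (intro tendsto_intros LIMSEQ_inverse_real_of_nat) auto
    moreover have "flat 0 (real (Suc n) * y) = exp (- (inverse (real (Suc n)) / y))" for n
      using that by (simp add: flat_def field_simps not_le mult_pos_pos add_pos_nonneg)
    ultimately show ?thesis by simp
  qed
  have "(\<lambda>n. bump a b n x) \<longlonglongrightarrow> 1 * 1"
    unfolding bump_def using True by (intro tendsto_mult *) auto
  then show ?thesis using True by simp
next
  case False
  then have "bump a b n x = 0" for n by (auto simp: bump_def flat_def mult_le_0_iff not_less)
  then show ?thesis using False by simp
qed

lemma bump_measurable: "bump a b n \<in> borel_measurable borel"
proof -
  have "bump a b n \<in> flat_span (real (Suc n)) a b" unfolding bump_def by (rule flat_span.base)
  then obtain f' where "\<forall>x. (bump a b n has_real_derivative f' x) (at x)" using flat_span_derivative by blast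
  then have "continuous_on UNIV (bump a b n)" by (meson DERIV_isCont continuous_at_imp_continuous_on)
  then show ?thesis by (rule borel_measurable_continuous_onI)
qed

lemma bump_integral_tendsto:
  fixes h :: "real \<Rightarrow> 'a::real_normed_vector" and w :: "'a \<Rightarrow>\<^sub>L real"
  assumes vd: "vector_density m \<nu> h" and S: "sets \<nu> = sets borel"
  shows "(\<lambda>n. LINT t|\<nu>. bump a b n t * blinfun_apply w (h t)) \<longlonglongrightarrow> blinfun_apply w (m {a<..<b})"
proof -
  have [measurable_cong]: "sets \<nu> = sets borel" by (rule S)
  have int: "integrable \<nu> (\<lambda>t. blinfun_apply w (h t))" by (rule vector_density_integrable[OF vd])
  have [measurable]: "(\<lambda>t. blinfun_apply w (h t)) \<in> borel_measurable \<nu>" by (rule borel_measurable_integrable[OF int])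
  have [measurable]: "bump a b n \<in> borel_measurable borel" for n by (rule bump_measurable)
  have "(\<lambda>n. LINT t|\<nu>. bump a b n t * blinfun_apply w (h t)) \<longlonglongrightarrow> (LINT t|\<nu>. indicator {a<..<b} t * blinfun_apply w (h t))"
  proof (rule integral_dominated_convergence[where w = "\<lambda>t. \<bar>blinfun_apply w (h t)\<bar>"])
    show "AE t in \<nu>. (\<lambda>n. bump a b n t * blinfun_apply w (h t)) \<longlonglongrightarrow> indicator {a<..<b} t * blinfun_apply w (h t)"
      by (intro AE_I2 tendsto_mult bump_tendsto tendsto_const)
    show "AE t in \<nu>. norm (bump a b n t * blinfun_apply w (h t)) \<le> \<bar>blinfun_apply w (h t)\<bar>" for n
      using bump_bounds by (intro AE_I2) (simp add: abs_mult mult_left_le_one_le)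
  qed (use int in simp_all)
  then show ?thesis by (simp add: vector_density_apply[OF vd] set_lebesgue_integral_def)
qed

section \<open>The distributional derivative and its parts\<close>

lemma sets_variation_measure: "sets (variation_measure m) = sets borel"
  unfolding variation_measure_def using sets.sigma_sets_eq[of "borel :: real measure"] by simp

lemma test_function_derivative:
  assumes "test_function T \<phi>"
  shows "(\<phi> has_real_derivative deriv \<phi> t) (at t)" "continuous_on UNIV (deriv \<phi>)" "continuous_on UNIV \<phi>"
proof -
  have d: "(deriv ^^ n) \<phi> field_differentiable at t" for n t using assms by (simp add: test_function_def)
  have d0: "\<phi> field_differentiable at t" for t using d[of 0 t] by simp
  have d1: "deriv \<phi> field_differentiable at t" for t using d[of 1 t] by simp
  show "(\<phi> has_real_derivative deriv \<phi> t) (at t)" using d0 field_differentiable_derivI by blast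
  show "continuous_on UNIV (deriv \<phi>)" "continuous_on UNIV \<phi>"
    using d0 d1 by (simp_all add: continuous_at_imp_continuous_on field_differentiable_imp_continuous_at)
qed

lemma test_function_FTC:
  assumes \<phi>: "test_function T \<phi>" and "s \<le> r"
  shows "(LINT t|lborel. indicator {s..r} t *\<^sub>R deriv \<phi> t) = \<phi> r - \<phi> s"
proof (rule integral_FTC_atLeastAtMost[OF assms(2)])
  show "(\<phi> has_vector_derivative deriv \<phi> t) (at t within {s..r})" for t
    using has_field_derivative_at_within[OF test_function_derivative(1)[OF \<phi>], of t "{s..r}"]
    by (simp add: has_real_derivative_iff_has_vector_derivative)
  show "continuous_on {s..r} (deriv \<phi>)" by (rule continuous_on_subset[OF test_function_derivative(2)[OF \<phi>]]) simp
qed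

lemma test_function_zero:
  assumes "test_function T \<phi>" "t \<le> 0 \<or> T \<le> t"
  shows "\<phi> t = 0"
proof -
  obtain a b where "0 < a" "b < T" "\<And>x. x \<notin> {a..b} \<Longrightarrow> \<phi> x = 0"
    using assms(1) unfolding test_function_def by blast
  then show ?thesis using assms(2) by auto
qed

lemma test_function_bounded:
  assumes "test_function T \<phi>"
  obtains B where "0 < B" "\<And>t. \<bar>\<phi> t\<bar> \<le> B"
proof -
  have "compact (\<phi> ` {0..T})"
    by (intro compact_continuous_image continuous_on_subset[OF test_function_derivative(3)[OF assms]]) auto
  then obtain B where B: "\<And>t. t \<in> {0..T} \<Longrightarrow> \<bar>\<phi> t\<bar> \<le> B"
    using compact_imp_bounded bounded_iff by (metis imageI real_norm_def)
  have "\<bar>\<phi> t\<bar> \<le> \<bar>B\<bar> + 1" for t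
  proof (cases "t \<in> {0..T}")
    case True
    then show ?thesis using B[OF True] by linarith
  next
    case False
    then have "\<phi> t = 0" by (intro test_function_zero[OF assms]) auto
    then show ?thesis by simp
  qed
  then show ?thesis using that[of "\<bar>B\<bar> + 1"] by simp
qed

context stieltjes
begin

text \<open>\<open>F\<close> is constant to the left of 0, which includes 0 itself by the left-open
  intervals, and constant from \<open>T\<close> on; left continuity at \<open>T\<close> rules out an
  atom there.\<close>

lemma emeasure_\<rho>_outside:
  assumes A: "A \<in> sets borel" "A \<inter> {0<..<T} = {}"
  shows "emeasure \<rho> A = 0"
proof -
  have cov: "\<exists>i::nat. \<bar>y\<bar> < real i" for y :: real using reals_Archimedean2 by blast
  have "emeasure \<rho> (\<Union>n::nat. {- real n<..0}) = 0"
  proof (rule emeasure_UN_eq_0)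
    show "emeasure \<rho> {- real n<..0} = 0" for n
      using F_left[of "- real n"] by (subst emeasure_Ioc) auto
  qed auto
  moreover have "emeasure \<rho> (\<Union>n::nat. {T<..T + real n}) = 0"
  proof (rule emeasure_UN_eq_0)
    show "emeasure \<rho> {T<..T + real n} = 0" for n
      using F_right[of "T + real n"] by (subst emeasure_Ioc) auto
  qed auto
  moreover have "emeasure \<rho> {T} = 0"
  proof -
    have "measure \<rho> {T} \<le> 0"
    proof (rule tendsto_lowerbound[of "\<lambda>s. F T - F s" 0 "at_left T"])
      show "((\<lambda>s. F T - F s) \<longlongrightarrow> 0) (at_left T)"
        using tendsto_diff[OF tendsto_const[of "F T"] F_T] by simp
      show "\<forall>\<^sub>F s in at_left T. measure \<rho> {T} \<le> F T - F s"
      proof -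
        have "\<forall>\<^sub>F s in at_left T. s < T" by (auto simp: eventually_at_filter)
        then show ?thesis
        proof eventually_elim
        case (elim s)
        have "measure \<rho> {T} \<le> measure \<rho> {s<..T}" using elim by (intro rho.finite_measure_mono) auto
        then show ?case using measure_Ioc[of s T] elim by simp
        qed
      qed
    qed simp
    then show ?thesis by (simp add: rho.emeasure_eq_measure measure_le_0_iff)
  qed
  ultimately have "emeasure \<rho> ((\<Union>n::nat. {- real n<..0}) \<union> (\<Union>n::nat. {T<..T + real n}) \<union> {T}) \<le> 0"
    by (intro order_trans[OF emeasure_subadditive] order_trans[OF add_mono[OF emeasure_subadditive order_refl]]) auto
  moreover have "A \<subseteq> (\<Union>n::nat. {- real n<..0}) \<union> (\<Union>n::nat. {T<..T + real n}) \<union> {T}"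
  proof
    fix y assume "y \<in> A"
    then have "y \<le> 0 \<or> T \<le> y" using A(2) by force
    then consider "y \<le> 0" | "y = T" | "T < y" by linarith
    then show "y \<in> (\<Union>n::nat. {- real n<..0}) \<union> (\<Union>n::nat. {T<..T + real n}) \<union> {T}"
    proof cases
      case 1
      obtain i :: nat where "\<bar>y\<bar> < real i" using cov by blast
      then have "y \<in> {- real i<..0}" using 1 by auto
      then show ?thesis by blast
    next
      case 3
      obtain j :: nat where "\<bar>y - T\<bar> < real j" using cov by blast
      then have "y \<in> {T<..T + real j}" using 3 by auto
      then show ?thesis by blast
    qed simp
  qed
  ultimately have "emeasure \<rho> A \<le> 0" by (elim order_trans[rotated]) (intro emeasure_mono, auto)
  then show ?thesis by simp
qed

lemma inside_\<rho>:
  fixes g :: "real \<Rightarrow> 'a"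
  assumes vd: "vector_density m \<rho> g" and A: "A \<in> sets borel"
  shows "m A = m (A \<inter> {0<..<T})"
proof -
  have "m ((A \<inter> {0<..<T}) \<union> (A - {0<..<T})) = m (A \<inter> {0<..<T}) + m (A - {0<..<T})"
    using A by (intro vector_density_Un[OF fin vd]) auto
  moreover have "m (A - {0<..<T}) = 0"
    using A by (intro vector_density_null[OF fin vd] emeasure_\<rho>_outside) auto
  moreover have "(A \<inter> {0<..<T}) \<union> (A - {0<..<T}) = A" by auto
  ultimately show ?thesis by simp
qed

text \<open>Fubini's theorem for \<open>deriv \<phi> t\<close> times the density on
  \<open>0 < s \<le> t\<close>. Integration in \<open>s\<close> gives the increment of
  \<open>x\<close> from 0 to \<open>t\<close>; integration in \<open>t\<close> gives
  \<open>- \<phi> s\<close> because \<open>\<phi>\<close> vanishes at \<open>T\<close>. The constant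
  \<open>x 0\<close> drops out since \<open>deriv \<phi>\<close> has integral 0, and countably many
  points where \<open>u\<close> differs from \<open>x\<close> do not matter for Lebesgue
  measure.\<close>

lemma integration_by_parts:
  fixes w :: "'a \<Rightarrow>\<^sub>L real"
  assumes vd: "vector_density m \<rho> g" and Ioc: "\<And>s t. s \<le> t \<Longrightarrow> m {s<..t} = x t - x s"
    and \<phi>: "test_function T \<phi>"
    and C: "countable C" and u: "\<And>t. t \<in> {0<..<T} - C \<Longrightarrow> u t = x t"
  shows "(LINT t:{0<..<T}|lborel. deriv \<phi> t * blinfun_apply w (u t)) = - (LINT t|\<rho>. \<phi> t * blinfun_apply w (g t))"
proof -
  note td = test_function_derivative[OF \<phi>]
  have [measurable]: "deriv \<phi> \<in> borel_measurable borel" by (rule borel_measurable_continuous_onI[OF td(2)])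
  define D where "D t = indicator {0<..<T} t * deriv \<phi> t" for t :: real
  have [measurable]: "D \<in> borel_measurable borel" unfolding D_def by measurable
  have intD: "integrable lborel D"
  proof -
    have "integrable lborel (\<lambda>t. indicator {0..T} t *\<^sub>R deriv \<phi> t)"
      by (rule borel_integrable_compact[of "{0..T}", simplified]) (auto intro: continuous_on_subset[OF td(2)])
    then show ?thesis
      by (rule Bochner_Integration.integrable_bound) (auto simp: D_def split: split_indicator)
  qed
  have FTC: "(LINT t|lborel. D t * indicator {0<..t} s) = - \<phi> s" if "0 < s" for s
  proof (cases "s < T")
    case True
    have "(LINT t|lborel. D t * indicator {0<..t} s) = (LINT t|lborel. indicator {s..T} t *\<^sub>R deriv \<phi> t)"
    proof (rule integral_cong_AE)
      have "(\<lambda>t. D t * indicator {0<..t} s) = (\<lambda>t. D t * (if s \<le> t then 1 else 0))"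
        using that by (auto simp: indicator_def)
      then show "(\<lambda>t. D t * indicator {0<..t} s) \<in> borel_measurable lborel" by simp
      show "AE t in lborel. D t * indicator {0<..t} s = indicator {s..T} t *\<^sub>R deriv \<phi> t"
        using AE_lborel_singleton[of T] by eventually_elim (use that in \<open>auto simp: D_def indicator_def\<close>)
    qed auto
    also have "\<dots> = \<phi> T - \<phi> s"
      using True by (intro test_function_FTC[OF \<phi>]) simp
    also have "\<phi> T = 0" by (rule test_function_zero[OF \<phi>]) simp
    finally show ?thesis by simp
  next
    case False
    then have "(\<lambda>t. D t * indicator {0<..t} s) = (\<lambda>_. 0)" by (auto simp: D_def indicator_def)
    moreover have "\<phi> s = 0" using False by (intro test_function_zero[OF \<phi>]) auto
    ultimately show ?thesis by simp
  qed
  have intD0: "(LINT t|lborel. D t) = 0"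
  proof -
    have "(LINT t|lborel. D t) = (LINT t|lborel. indicator {0..T} t *\<^sub>R deriv \<phi> t)"
    proof (rule integral_cong_AE)
      show "AE t in lborel. D t = indicator {0..T} t *\<^sub>R deriv \<phi> t"
        using AE_lborel_singleton[of T] AE_lborel_singleton[of 0]
        by eventually_elim (auto simp: D_def indicator_def)
    qed auto
    also have "\<dots> = \<phi> T - \<phi> 0"
      using T_pos by (intro test_function_FTC[OF \<phi>]) simp
    also have "\<dots> = 0" using test_function_zero[OF \<phi>, of T] test_function_zero[OF \<phi>, of 0] by simp
    finally show ?thesis .
  qed
  have intg: "integrable \<rho> (\<lambda>s. blinfun_apply w (g s))" by (rule vector_density_integrable[OF vd])
  have [measurable]: "(\<lambda>s. blinfun_apply w (g s)) \<in> borel_measurable borel"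
    using borel_measurable_integrable[OF intg] by (simp cong: measurable_cong_sets)
  have [measurable_cong]: "sets \<rho> = sets borel" by simp
  interpret pair_sigma_finite lborel \<rho>
    unfolding pair_sigma_finite_def using rho.sigma_finite_measure_axioms lborel.sigma_finite_measure_axioms by blast
  define f where "f t s = D t * (indicator {0<..t} s * blinfun_apply w (g s))" for t s
  have fm: "case_prod f \<in> borel_measurable (lborel \<Otimes>\<^sub>M \<rho>)"
  proof -
    have "f = (\<lambda>t s. D t * ((if 0 < s \<and> s \<le> t then 1 else 0) * blinfun_apply w (g s)))"
      by (auto simp: f_def indicator_def fun_eq_iff)
    then show ?thesis by simp
  qed
  have "integrable (lborel \<Otimes>\<^sub>M \<rho>) (\<lambda>(t, s). D t * blinfun_apply w (g s))"
  proof (rule Fubini_integrable)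
    have "integrable lborel (\<lambda>t. \<bar>D t\<bar> * (LINT s|\<rho>. \<bar>blinfun_apply w (g s)\<bar>))"
      using intD by (intro integrable_mult_left integrable_abs)
    then show "integrable lborel (\<lambda>t. LINT s|\<rho>. norm (case (t, s) of (t, s) \<Rightarrow> D t * blinfun_apply w (g s)))"
      by (simp add: abs_mult)
    show "AE t in lborel. integrable \<rho> (\<lambda>s. case (t, s) of (t, s) \<Rightarrow> D t * blinfun_apply w (g s))"
      using intg by simp
  qed measurable
  then have fint: "integrable (lborel \<Otimes>\<^sub>M \<rho>) (case_prod f)"
    by (rule Bochner_Integration.integrable_bound)
      (use fm in \<open>auto simp: f_def abs_mult intro!: AE_I2 mult_left_mono split: split_indicator\<close>)
  have inner1: "(LINT s|\<rho>. f t s) = D t * (blinfun_apply w (x t) - blinfun_apply w (x 0))" for t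
  proof (cases "0 < t")
    case True
    have "(LINT s|\<rho>. f t s) = D t * (LINT s:{0<..t}|\<rho>. blinfun_apply w (g s))"
      by (simp add: f_def set_lebesgue_integral_def)
    also have "(LINT s:{0<..t}|\<rho>. blinfun_apply w (g s)) = blinfun_apply w (m {0<..t})"
      by (rule vector_density_apply[OF vd, symmetric]) simp
    also have "m {0<..t} = x t - x 0" using True by (intro Ioc) simp
    finally show ?thesis by (simp add: blinfun.diff_right)
  qed (simp add: f_def D_def)
  have inner2: "(LINT t|lborel. f t s) = - \<phi> s * blinfun_apply w (g s)" for s
  proof (cases "0 < s")
    case True
    have "(LINT t|lborel. f t s) = (LINT t|lborel. D t * indicator {0<..t} s) * blinfun_apply w (g s)"
      by (simp add: f_def mult.assoc[symmetric])
    then show ?thesis using FTC[OF True] by simp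
  next
    case False
    then have "\<phi> s = 0" by (intro test_function_zero[OF \<phi>]) auto
    then show ?thesis using False by (simp add: f_def)
  qed
  have i1: "integrable lborel (\<lambda>t. D t * (blinfun_apply w (x t) - blinfun_apply w (x 0)))"
    using integrable_fst[OF fint] by (simp add: inner1)
  have eq: "(LINT t|lborel. D t * (blinfun_apply w (x t) - blinfun_apply w (x 0))) = (LINT s|\<rho>. - \<phi> s * blinfun_apply w (g s))"
    using Fubini_integral[OF fint] by (simp add: inner1 inner2)
  have i2: "integrable lborel (\<lambda>t. D t * blinfun_apply w (x 0))" using intD by simp
  have "(LINT t:{0<..<T}|lborel. deriv \<phi> t * blinfun_apply w (u t)) = (LINT t|lborel. D t * (blinfun_apply w (x t) - blinfun_apply w (x 0)) + D t * blinfun_apply w (x 0))"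
    unfolding set_lebesgue_integral_def
    using u by (intro integral_discrete_difference[OF C]) (auto simp: D_def algebra_simps indicator_def)
  also have "\<dots> = (LINT s|\<rho>. - \<phi> s * blinfun_apply w (g s))"
    using Bochner_Integration.integral_add[OF i1 i2] eq intD0 by simp
  finally show ?thesis by simp
qed

end

text \<open>Exhaustion: a countable union of null sets whose \<open>\<rho>\<close>-measures approach
  the supremum attains it, so no further null set can carry mass outside. This set carries the
  singular part of everything dominated by \<open>\<rho>\<close>.\<close>

lemma null_part_exists:
  fixes \<rho> :: "real measure"
  assumes fm: "finite_measure \<rho>" and S: "sets \<rho> = sets borel"
  obtains N where "N \<in> null_sets lborel" "\<And>A. A \<in> null_sets lborel \<Longrightarrow> emeasure \<rho> (A - N) = 0"
proof -
  interpret finite_measure \<rho> by (rule fm)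
  have bdd: "bdd_above (measure \<rho> ` null_sets lborel)"
    by (rule bdd_aboveI[of _ "measure \<rho> (space \<rho>)"]) (auto intro: bounded_measure)
  define s where "s = Sup (measure \<rho> ` null_sets lborel)"
  have ub: "measure \<rho> A \<le> s" if "A \<in> null_sets lborel" for A
    unfolding s_def using bdd that by (intro cSUP_upper) auto
  have "\<exists>N\<in>null_sets lborel. s - inverse (real (Suc n)) < measure \<rho> N" for n
  proof -
    have "null_sets lborel \<noteq> ({} :: real set set)" using countable_imp_null_set_lborel[of "{}"] by blast
    from less_cSUP_iff[OF this bdd, of "s - inverse (real (Suc n))"] show ?thesis
      unfolding s_def[symmetric] by simp
  qed
  then obtain N where N: "\<And>n. N n \<in> null_sets lborel" "\<And>n. s - inverse (real (Suc n)) < measure \<rho> (N n)" by metis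
  define M where "M = (\<Union>n. N n)"
  have M: "M \<in> null_sets lborel" unfolding M_def using N(1) by auto
  have Mb: "M \<in> sets \<rho>" using null_setsD2[OF M] S by simp
  have "s \<le> measure \<rho> M"
  proof (rule LIMSEQ_le_const2)
    show "(\<lambda>n. s - inverse (real (Suc n))) \<longlonglongrightarrow> s"
      using tendsto_diff[OF tendsto_const LIMSEQ_inverse_real_of_nat] by simp
    have "s - inverse (real (Suc n)) \<le> measure \<rho> M" for n
      using N(2)[of n] finite_measure_mono[of "N n" M] Mb unfolding M_def by force
    then show "\<exists>n0. \<forall>n\<ge>n0. s - inverse (real (Suc n)) \<le> measure \<rho> M" by blast
  qed
  then have sM: "measure \<rho> M = s" using ub[OF M] by simp
  have "emeasure \<rho> (A - M) = 0" if A: "A \<in> null_sets lborel" for A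
  proof -
    have Ab: "A \<in> sets \<rho>" using null_setsD2[OF A] S by simp
    have "measure \<rho> (M \<union> A) = measure \<rho> M + measure \<rho> (A - M)"
      using Ab Mb by (intro finite_measure_Union'[of M A])
    moreover have "measure \<rho> (M \<union> A) \<le> s" by (intro ub) (use A M in auto)
    ultimately have "measure \<rho> (A - M) = 0" using sM measure_nonneg[of \<rho> "A - M"] by linarith
    then show ?thesis by (simp add: emeasure_eq_measure)
  qed
  then show ?thesis using that M by blast
qed

lemma vector_measure_empty: "vector_measure m \<Longrightarrow> m {} = 0"
proof -
  assume "vector_measure m"
  then have "(\<lambda>n::nat. m {}) sums m (\<Union>n::nat. {})"
    unfolding vector_measure_def by (elim allE[of _ "\<lambda>_. {}"]) (auto simp: disjoint_family_on_def)
  then show ?thesis by (metis summable_LIMSEQ_zero sums_summable LIMSEQ_const_iff)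
qed

lemma vector_measure_countable_zero:
  assumes vm: "vector_measure m" and z: "\<And>t. m {t} = 0" and C: "countable C"
  shows "m C = 0"
proof (cases "C = {}")
  case True
  then show ?thesis using vector_measure_empty[OF vm] by simp
next
  case False
  define A where "A = disjointed (\<lambda>n. {from_nat_into C n})"
  have un: "(\<Union>n. A n) = C"
    unfolding A_def UN_disjointed_eq using range_from_nat_into[OF False C] by auto
  have sub: "A n \<subseteq> {from_nat_into C n}" for n unfolding A_def by (rule disjointed_subset)
  have A0: "m (A n) = 0" for n
  proof -
    have "A n = {} \<or> A n = {from_nat_into C n}" using sub[of n] by auto
    then show ?thesis using z vector_measure_empty[OF vm] by auto
  qed
  have "range A \<subseteq> sets borel"
  proof
    fix B assume "B \<in> range A"
    then have "finite B" using sub finite_subset by blast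
    then show "B \<in> sets borel" by (simp add: finite_imp_closed)
  qed
  moreover have "disjoint_family A" unfolding A_def by (rule disjoint_family_disjointed)
  ultimately have "(\<lambda>n. m (A n)) sums m (\<Union>n. A n)" using vm unfolding vector_measure_def by blast
  then have "(\<lambda>n. 0) sums m C" by (simp add: A0 un)
  then show ?thesis using sums_unique2 sums_zero by blast
qed

locale stieltjes_BV = stieltjes T F x K for T F and x :: "real \<Rightarrow> 'a::real_normed_vector" and K +
  fixes m :: "real set \<Rightarrow> 'a" and g :: "real \<Rightarrow> 'a" and u :: "real \<Rightarrow> 'a"
  assumes vd: "vector_density m (interval_measure F) g"
    and Ioc: "\<And>s t. s \<le> t \<Longrightarrow> m {s<..t} = x t - x s"
    and J_countable: "countable (jump_set T u)"
    and u_eq: "\<And>t. t \<in> {0<..<T} - jump_set T u \<Longrightarrow> u t = x t"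
    and m_cont: "\<And>t. t \<notin> jump_set T u \<Longrightarrow> m {t} = 0"
begin

abbreviation "J \<equiv> jump_set T u"

lemma J_borel [simp]: "J \<in> sets borel"
  using J_countable by (rule sets.countable[rotated]) simp

lemma Compl_J_borel [simp]: "- J \<in> sets borel"
  by (rule borel_comp) simp

lemma J_null: "A \<in> sets borel \<Longrightarrow> A \<inter> J \<in> null_sets lborel"
  by (rule countable_imp_null_set_lborel) (use J_countable countable_Int2 in blast)

lemma m_split: "A \<in> sets borel \<Longrightarrow> B \<in> sets borel \<Longrightarrow> m A = m (A \<inter> B) + m (A - B)"
proof -
  assume A: "A \<in> sets borel" "B \<in> sets borel"
  have "m ((A \<inter> B) \<union> (A - B)) = m (A \<inter> B) + m (A - B)"
    using A by (intro vector_density_Un[OF fin vd]) auto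
  then show ?thesis by (simp add: Int_Diff_Un)
qed

lemma distributional_derivative_m:
  assumes eq: "\<And>A. A \<in> sets borel \<Longrightarrow> M A = m A"
  shows "distributional_derivative T u M"
proof -
  have vdM: "vector_density M \<rho> g" using vector_density_cong[OF vd] eq by metis
  obtain h where h: "vector_density M (variation_measure M) h"
    "\<And>f (w :: 'a \<Rightarrow>\<^sub>L real). f \<in> borel_measurable borel \<Longrightarrow> (\<And>t. \<bar>f t\<bar> \<le> 1) \<Longrightarrow>
      (LINT t|variation_measure M. f t * blinfun_apply w (h t)) = (LINT t|\<rho>. f t * blinfun_apply w (g t))"
    by (rule vector_density_polar[OF fin vdM sets_\<rho> finite_\<rho>]) blast
  have "(LINT t:{0<..<T}|lborel. deriv \<phi> t * blinfun_apply w (u t)) = - (LINT t|variation_measure M. \<phi> t * blinfun_apply w (h t))"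
    if \<phi>: "test_function T \<phi>" for \<phi> and w :: "'a \<Rightarrow>\<^sub>L real"
  proof -
    obtain B where B: "0 < B" "\<And>t. \<bar>\<phi> t\<bar> \<le> B" using test_function_bounded[OF \<phi>] by metis
    \<comment> \<open>The transfer of integrals is available for functions bounded by 1, hence the
      division by a bound of \<open>\<phi>\<close>.\<close>
    have "(LINT t|variation_measure M. (\<phi> t / B) * blinfun_apply w (h t)) = (LINT t|\<rho>. (\<phi> t / B) * blinfun_apply w (g t))"
    proof (rule h(2))
      show "(\<lambda>t. \<phi> t / B) \<in> borel_measurable borel"
        using borel_measurable_continuous_onI[OF test_function_derivative(3)[OF \<phi>]] by simp
      show "\<bar>\<phi> t / B\<bar> \<le> 1" for t using B by (simp add: abs_divide)
    qed
    then have "(LINT t|variation_measure M. \<phi> t * blinfun_apply w (h t)) = (LINT t|\<rho>. \<phi> t * blinfun_apply w (g t))"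
      using B(1) by simp
    then show ?thesis
      using integration_by_parts[OF vd Ioc \<phi> J_countable u_eq, of w] by simp
  qed
  moreover have "vector_measure M" by (rule vector_density_measure[OF fin vdM sets_\<rho>])
  moreover have "M A = M (A \<inter> {0<..<T})" if "A \<in> sets borel" for A
    using inside_\<rho>[OF vdM that] .
  ultimately show ?thesis unfolding distributional_derivative_def using h(1) by blast
qed

text \<open>\<open>BV_parts\<close> is defined by choice, so it has meaning only once some
  decomposition exists. The three parts are the restrictions of \<open>m\<close> to the complement
  of \<open>N \<union> J\<close>, to \<open>N - J\<close> and to \<open>J\<close>; the middle one
  has no atoms because all atoms of \<open>m\<close> lie in \<open>J\<close>.\<close>

lemma BV_decomposition_exists: "\<exists>mL mC mJ. BV_decomposition T u mL mC mJ"
proof -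
  obtain N where N: "N \<in> null_sets lborel" "\<And>A. A \<in> null_sets lborel \<Longrightarrow> emeasure \<rho> (A - N) = 0"
    using null_part_exists[OF finite_\<rho> sets_\<rho>] by metis
  have Nb: "N \<in> sets borel" using N by auto
  define mL where "mL A = m (A \<inter> (- (N \<union> J)))" for A
  define mC where "mC A = m (A \<inter> (N - J))" for A
  define mJ where "mJ A = m (A \<inter> J)" for A
  have sum: "mL A + mC A + mJ A = m A" if A: "A \<in> sets borel" for A
  proof -
    have "m A = m (A \<inter> J) + m (A - J)" using A by (intro m_split) auto
    also have "m (A - J) = m ((A - J) \<inter> N) + m ((A - J) - N)" using A Nb by (intro m_split) auto
    also have "(A - J) \<inter> N = A \<inter> (N - J)" by auto
    also have "(A - J) - N = A \<inter> (- (N \<union> J))" by auto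
    finally show ?thesis by (simp add: mL_def mC_def mJ_def)
  qed
  have vm: "vector_measure (\<lambda>A. m (A \<inter> B))" if "B \<in> sets borel" for B
    by (rule vector_density_measure[OF fin vector_density_restrict[OF fin vd sets_\<rho> that] sets_\<rho>])
  have "BV_decomposition T u mL mC mJ"
    unfolding BV_decomposition_def
  proof (intro conjI ballI allI)
    show "distributional_derivative T u (\<lambda>A. mL A + mC A + mJ A)"
      by (rule distributional_derivative_m) (rule sum)
    show "vector_measure mL" "vector_measure mC" "vector_measure mJ"
      unfolding mL_def mC_def mJ_def using Nb by (auto intro!: vm sets.Int borel_comp)
    show "mL A = 0" if A: "A \<in> null_sets lborel" for A
    proof -
      have Ab: "A \<in> sets borel" using A by auto
      have "emeasure \<rho> (A \<inter> (- (N \<union> J))) \<le> emeasure \<rho> (A - N)"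
        using Ab Nb by (intro emeasure_mono) auto
      then show ?thesis unfolding mL_def using N(2)[OF A] Ab Nb
        by (intro vector_density_null[OF fin vd]) (auto intro!: sets.Int borel_comp)
    qed
    show "\<exists>N\<in>null_sets lborel. \<forall>A\<in>sets borel. mC A = mC (A \<inter> N)"
      using N(1) by (intro bexI[of _ N] ballI) (auto simp: mC_def Int_assoc intro!: arg_cong[of _ _ m])
    show "mC {t} = 0" for t
      using m_cont[of t] vector_density_empty[OF fin vd] by (cases "t \<in> N - J") (auto simp: mC_def)
    show "mJ A = mJ (A \<inter> J)" for A by (simp add: mJ_def Int_assoc)
  qed
  then show ?thesis by blast
qed

text \<open>Bump functions determine the sum of the three parts on open intervals, hence on Borel
  sets. On the countable set \<open>J\<close> the absolutely continuous part vanishes because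
  \<open>J\<close> is null and the Cantor part because it has no atoms, which isolates the jump
  part. On the null set that carries \<open>mC\<close> the absolutely continuous part vanishes,
  which isolates the Cantor part.\<close>

lemma BV_decomposition_unique:
  assumes dec: "BV_decomposition T u mL mC mJ"
  shows "\<And>A. A \<in> sets borel \<Longrightarrow> mL A + mC A = m (A - J)"
    and "\<exists>N\<in>sets borel. \<forall>A\<in>sets borel. mC A = m (A \<inter> (N - J))"
proof -
  define M where "M A = mL A + mC A + mJ A" for A
  have dd: "distributional_derivative T u M" and vL: "vector_measure mL" and vC: "vector_measure mC" and vJ: "vector_measure mJ"
    and L0: "\<And>A. A \<in> null_sets lborel \<Longrightarrow> mL A = 0" and C0: "\<And>t. mC {t} = 0"
    and J0: "\<And>A. A \<in> sets borel \<Longrightarrow> mJ A = mJ (A \<inter> J)"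
    using dec unfolding BV_decomposition_def M_def by auto
  obtain N where N: "N \<in> null_sets lborel" "\<And>A. A \<in> sets borel \<Longrightarrow> mC A = mC (A \<inter> N)"
    using dec unfolding BV_decomposition_def by auto
  have Nb: "N \<in> sets borel" using N by auto
  obtain h where h: "vector_density M (variation_measure M) h"
    "\<And>\<phi> (w :: 'a \<Rightarrow>\<^sub>L real). test_function T \<phi> \<Longrightarrow>
       (LINT t:{0<..<T}|lborel. deriv \<phi> t * blinfun_apply w (u t)) = - (LINT t|variation_measure M. \<phi> t * blinfun_apply w (h t))"
    and M_in: "\<And>A. A \<in> sets borel \<Longrightarrow> M A = M (A \<inter> {0<..<T})"
    using dd unfolding distributional_derivative_def by blast
  have int: "M {a<..<b} = m {a<..<b}" if ab: "0 < a" "a < b" "b < T" for a b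
  proof (rule finite_dim_eqI[OF fin])
    fix w :: "'a \<Rightarrow>\<^sub>L real"
    have "(LINT t|variation_measure M. bump a b n t * blinfun_apply w (h t)) = (LINT t|\<rho>. bump a b n t * blinfun_apply w (g t))" for n
      using h(2)[OF bump_test_function[OF ab], of n w]
        integration_by_parts[OF vd Ioc bump_test_function[OF ab] J_countable u_eq, of n w] by simp
    moreover have "(\<lambda>n. LINT t|variation_measure M. bump a b n t * blinfun_apply w (h t)) \<longlonglongrightarrow> blinfun_apply w (M {a<..<b})"
      by (rule bump_integral_tendsto[OF h(1) sets_variation_measure])
    moreover have "(\<lambda>n. LINT t|\<rho>. bump a b n t * blinfun_apply w (g t)) \<longlonglongrightarrow> blinfun_apply w (m {a<..<b})"
      by (rule bump_integral_tendsto[OF vd sets_\<rho>])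
    ultimately show "blinfun_apply w (M {a<..<b}) = blinfun_apply w (m {a<..<b})"
      using LIMSEQ_unique by simp
  qed
  have Mm: "M A = m A" if "A \<in> sets borel" for A
    using vector_density_eq_if_intervals[OF fin h(1) vd sets_variation_measure sets_\<rho> int that]
      M_in[OF that] inside_\<rho>[OF vd that] by simp
  have CJ: "mC (A \<inter> J) = 0" for A
    by (rule vector_measure_countable_zero[OF vC C0]) (use J_countable countable_Int2 in blast)
  have Jm: "mJ A = m (A \<inter> J)" if A: "A \<in> sets borel" for A
  proof -
    have "m (A \<inter> J) = mL (A \<inter> J) + mC (A \<inter> J) + mJ (A \<inter> J)"
      using Mm[OF sets.Int[OF A J_borel]] by (simp add: M_def)
    then show ?thesis using L0[OF J_null[OF A]] CJ[of A] J0[OF A] by simp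
  qed
  show co: "mL A + mC A = m (A - J)" if A: "A \<in> sets borel" for A
    using Mm[OF A] Jm[OF A] m_split[OF A J_borel] by (simp add: M_def algebra_simps)
  have "mC A = m (A \<inter> (N - J))" if A: "A \<in> sets borel" for A
  proof -
    have "A \<inter> N \<in> null_sets lborel" using N(1) A by (intro null_set_Int1) auto
    then have "mL (A \<inter> N) = 0" by (rule L0)
    then have "mC A = m (A \<inter> N - J)" using co[OF sets.Int[OF A Nb]] N(2)[OF A] by simp
    then show ?thesis by (simp add: Int_Diff)
  qed
  then show "\<exists>N\<in>sets borel. \<forall>A\<in>sets borel. mC A = m (A \<inter> (N - J))" using Nb by blast
qed

text \<open>\<open>co_density\<close> with respect to \<open>ref_measure\<close> and
  \<open>g\<close> cut off on \<open>J\<close> with respect to \<open>\<rho>\<close> are densities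
  of the same vector measure on Borel sets, and the variation formula sees only that measure. That
  the chosen \<open>co_density\<close> is a density at all requires that \<open>ref_measure\<close>
  dominates both parts.\<close>

theorem co_density_integral:
  assumes gg: "gauge_function \<Psi>"
  shows "(\<integral>\<^sup>+ t\<in>{a..b}. ennreal (\<Psi> (co_density T u t)) \<partial>(ref_measure T u)) = (\<integral>\<^sup>+ t\<in>{a..b} - J. ennreal (\<Psi> (g t)) \<partial>\<rho>)"
proof -
  interpret G: finite_dim_gauge \<Psi> by unfold_locales (use fin gg in auto)
  obtain mL mC mJ where p: "BV_parts T u = (mL, mC, mJ)" by (metis prod_cases3)
  have "\<exists>q. (case q of (mL, mC, mJ) \<Rightarrow> BV_decomposition T u mL mC mJ)"
    using BV_decomposition_exists by auto
  then have "case BV_parts T u of (mL, mC, mJ) \<Rightarrow> BV_decomposition T u mL mC mJ"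
    unfolding BV_parts_def by (rule someI_ex)
  then have dec: "BV_decomposition T u mL mC mJ" using p by simp
  note un = BV_decomposition_unique[OF dec]
  obtain N where N: "N \<in> sets borel" "\<And>A. A \<in> sets borel \<Longrightarrow> mC A = m (A \<inter> (N - J))" using un(2) by blast
  have co: "co_part T u A = m (A \<inter> - J)" if "A \<in> sets borel" for A
    using un(1)[OF that] by (simp add: co_part_def ac_part_def cantor_part_def p Diff_eq)
  have vdC: "vector_density mC \<rho> (\<lambda>t. indicator (N - J) t *\<^sub>R g t)"
    by (rule vector_density_cong[OF vector_density_restrict[OF fin vd sets_\<rho>, of "N - J"]]) (use N in auto)
  have vdco: "vector_density (co_part T u) \<rho> (\<lambda>t. indicator (- J) t *\<^sub>R g t)"
    by (rule vector_density_cong[OF vector_density_restrict[OF fin vd sets_\<rho>, of "- J"]]) (use co in auto)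
  let ?V = "variation_measure mC"
  note V = variation_measure_finite[OF fin vdC sets_\<rho> finite_\<rho>]
  interpret V: finite_measure ?V by (rule V)
  define R where "R = ref_measure T u"
  have Req: "R = measure_of UNIV (sets borel) (\<lambda>A. emeasure lborel A + emeasure ?V A)"
    by (simp add: R_def ref_measure_def cantor_part_def p)
  note Rm = emeasure_measure_sum[of lborel ?V, OF _ V(2), folded Req]
  have SR: "sets R = sets borel" by (rule Rm) simp
  have emR: "emeasure R A = emeasure lborel A + emeasure ?V A" if "A \<in> sets borel" for A
    by (rule Rm) (use that in simp_all)
  have finR: "emeasure R {c..d} < \<infinity>" for c d
    by (subst emR) (auto simp: emeasure_lborel_Icc_eq less_top[symmetric])
  have sfR: "sigma_finite_measure R"
  proof
    show "\<exists>A. countable A \<and> A \<subseteq> sets R \<and> \<Union>A = space R \<and> (\<forall>a\<in>A. emeasure R a \<noteq> \<infinity>)"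
    proof (intro exI[of _ "range (\<lambda>n::nat. {- real n..real n})"] conjI ballI)
      show "\<Union>(range (\<lambda>n::nat. {- real n..real n})) = space R"
      proof -
        have "\<exists>i::nat. - real i \<le> y \<and> y \<le> real i" for y :: real
        proof -
          obtain i where "\<bar>y\<bar> < real i" using reals_Archimedean2 by blast
          then show ?thesis by (intro exI[of _ i]) auto
        qed
        then show ?thesis using sets_eq_imp_space_eq[OF SR] by auto
      qed
      show "emeasure R a \<noteq> \<infinity>" if "a \<in> range (\<lambda>n::nat. {- real n..real n})" for a
        using that finR by (auto simp: less_top)
    qed (auto simp: SR)
  qed
  have "\<exists>h. vector_density (co_part T u) R h"
  proof (rule vector_density_Radon_Nikodym[OF fin vdco sets_\<rho> finite_\<rho> sfR SR])
    fix A assume A: "A \<in> sets borel" "emeasure R A = 0"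
    then have "emeasure lborel A = 0" "emeasure ?V A = 0" using emR by auto
    then have "A \<in> null_sets lborel" using A(1) by (simp add: null_setsI)
    then have "mL A = 0" using dec unfolding BV_decomposition_def by blast
    moreover have "mC A = 0"
      using vector_density_norm_le[OF fin vdC sets_\<rho> finite_\<rho> A(1)] \<open>emeasure ?V A = 0\<close> by simp
    ultimately show "co_part T u A = 0" by (simp add: co_part_def ac_part_def cantor_part_def p)
  qed blast
  then have vdR: "vector_density (co_part T u) R (co_density T u)"
    unfolding co_density_def R_def by (rule someI_ex)
  have B: "{a..b} \<in> sets borel" "emeasure \<rho> {a..b} < \<infinity>" by (auto simp: less_top[symmetric])
  have "(\<integral>\<^sup>+ t\<in>{a..b}. ennreal (\<Psi> (co_density T u t)) \<partial>R) = (\<integral>\<^sup>+ t\<in>{a..b}. ennreal (\<Psi> (indicator (- J) t *\<^sub>R g t)) \<partial>\<rho>)"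
    unfolding G.vector_density_variation[OF vdR SR B(1) finR] G.vector_density_variation[OF vdco sets_\<rho> B] ..
  also have "\<dots> = (\<integral>\<^sup>+ t\<in>{a..b} - J. ennreal (\<Psi> (g t)) \<partial>\<rho>)"
    by (intro nn_integral_cong) (auto split: split_indicator)
  finally show ?thesis unfolding R_def .
qed

end

section \<open>Energy estimates for viscous solutions\<close>

lemma has_vector_derivative_straddle:
  fixes f :: "real \<Rightarrow> 'b::real_normed_vector"
  assumes "(f has_vector_derivative f') (at x)" "0 < e"
  obtains d where "0 < d" "\<And>u v. u \<le> x \<Longrightarrow> x \<le> v \<Longrightarrow> v - u < d \<Longrightarrow> norm (f v - f u - (v - u) *\<^sub>R f') \<le> e * (v - u)"
proof -
  obtain d where d: "0 < d" "\<And>y. norm (y - x) < d \<Longrightarrow> norm (f y - f x - (y - x) *\<^sub>R f') \<le> e * norm (y - x)"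
    using assms unfolding has_vector_derivative_def has_derivative_at_alt by metis
  have "norm (f v - f u - (v - u) *\<^sub>R f') \<le> e * (v - u)" if uv: "u \<le> x" "x \<le> v" "v - u < d" for u v
  proof -
    have 1: "norm (f u - f x - (u - x) *\<^sub>R f') \<le> e * (x - u)" using d(2)[of u] uv by simp
    have 2: "norm (f v - f x - (v - x) *\<^sub>R f') \<le> e * (v - x)" using d(2)[of v] uv by simp
    have "f v - f u - (v - u) *\<^sub>R f' = (f v - f x - (v - x) *\<^sub>R f') - (f u - f x - (u - x) *\<^sub>R f')"
      by (simp add: algebra_simps)
    then have "norm (f v - f u - (v - u) *\<^sub>R f') \<le> norm (f v - f x - (v - x) *\<^sub>R f') + norm (f u - f x - (u - x) *\<^sub>R f')"
      by (metis norm_triangle_ineq4)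
    also have "\<dots> \<le> e * (v - x) + e * (x - u)" using 1 2 by linarith
    also have "\<dots> = e * (v - u)" unfolding distrib_left[symmetric] by simp
    finally show ?thesis .
  qed
  then show ?thesis using that d(1) by blast
qed

lemma abs_continuous_deriv_mono:
  fixes f f' :: "real \<Rightarrow> real"
  assumes "a \<le> b" "abs_continuous_on a b f" "negligible N"
    and "\<And>x. x \<in> {a..b} - N \<Longrightarrow> (f has_real_derivative f' x) (at x)" "\<And>x. x \<in> {a..b} - N \<Longrightarrow> 0 \<le> f' x"
  shows "f a \<le> f b"
proof -
  have "(f' has_integral (f b - f a)) {a..b}"
    by (rule abs_continuous_FTC[OF assms(1-3)])
      (use assms(4) in \<open>simp add: has_real_derivative_iff_has_vector_derivative has_vector_derivative_at_within\<close>)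
  then have "((\<lambda>x. if x \<in> N then 0 else f' x) has_integral (f b - f a)) {a..b}"
    by (rule has_integral_spike[OF assms(3), rotated]) auto
  then have "0 \<le> f b - f a" by (rule has_integral_nonneg) (use assms(5) in auto)
  then show ?thesis by simp
qed

locale energy_system = viscous_dissipation \<Psi>\<^sub>0 \<Psi> for \<Psi>\<^sub>0 \<Psi> :: "'a::real_normed_vector \<Rightarrow> real" +
  fixes T C :: real and E :: "real \<Rightarrow> 'a \<Rightarrow> real"
  assumes T_pos: "0 < T" and E_C1: "C1_on ({0..T} \<times> UNIV) (\<lambda>(t, x). E t x)" and C_pos: "0 < C"
    and E_bdd_below: "\<And>t x. t \<in> {0..T} \<Longrightarrow> - C \<le> E t x"
    and E_dt_bound: "\<And>t x. t \<in> {0..T} \<Longrightarrow> \<bar>energy_dt T E t x\<bar> \<le> C * (1 + max 0 (E t x))"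
begin

abbreviation "Et \<equiv> energy_dt T E"
abbreviation "DE \<equiv> energy_diff E"

text \<open>Both partial derivatives are read off from one joint derivative relative to
  \<open>{0..T} \<times> UNIV\<close>. The last clause writes \<open>DE\<close> as a composition of
  operators, which makes it continuous for the dual norm and not merely at each vector.\<close>

lemma E_derivative:
  obtains D :: "real \<times> 'a \<Rightarrow> (real \<times> 'a) \<Rightarrow>\<^sub>L real" where "continuous_on ({0..T} \<times> UNIV) D"
    "\<And>t x. t \<in> {0..T} \<Longrightarrow> ((\<lambda>(t, x). E t x) has_derivative blinfun_apply (D (t, x))) (at (t, x) within {0..T} \<times> UNIV)"
    "\<And>t x. t \<in> {0..T} \<Longrightarrow> Et t x = blinfun_apply (D (t, x)) (1, 0)"
    "\<And>t x v. t \<in> {0..T} \<Longrightarrow> blinfun_apply (DE t x) v = blinfun_apply (D (t, x)) (0, v)"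
    "\<And>t x. t \<in> {0..T} \<Longrightarrow> DE t x = D (t, x) o\<^sub>L Blinfun (\<lambda>v. (0, v))"
proof -
  obtain D :: "real \<times> 'a \<Rightarrow> (real \<times> 'a) \<Rightarrow>\<^sub>L real" where D: "continuous_on ({0..T} \<times> UNIV) D"
    "\<And>z. z \<in> {0..T} \<times> UNIV \<Longrightarrow> ((\<lambda>(t, x). E t x) has_derivative blinfun_apply (D z)) (at z within {0..T} \<times> UNIV)"
    using E_C1 unfolding C1_on_def by blast
  have bl: "bounded_linear (\<lambda>v::'a. (0::real, v))" by (intro bounded_linear_Pair bounded_linear_zero bounded_linear_ident)
  have D': "((\<lambda>(t, x). E t x) has_derivative blinfun_apply (D (t, x))) (at (t, x) within {0..T} \<times> UNIV)"
    if "t \<in> {0..T}" for t x using D(2)[of "(t, x)"] that by simp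
  have 1: "Et t x = blinfun_apply (D (t, x)) (1, 0)" if t: "t \<in> {0..T}" for t x
  proof -
    have "((\<lambda>s. (\<lambda>(t, x). E t x) (s, x)) has_derivative (\<lambda>h. blinfun_apply (D (t, x)) (h, 0))) (at t within {0..T})"
    proof (rule has_derivative_in_compose[where f = "\<lambda>s. (s, x)" and f' = "\<lambda>h. (h, 0)"])
      show "((\<lambda>s. (s, x)) has_derivative (\<lambda>h. (h, 0))) (at t within {0..T})"
        by (auto intro!: derivative_eq_intros)
      show "((\<lambda>(t, x). E t x) has_derivative blinfun_apply (D (t, x))) (at (t, x) within (\<lambda>s. (s, x)) ` {0..T})"
        by (rule has_derivative_subset[OF D'[OF t]]) auto
    qed
    moreover have eqf: "(\<lambda>h. blinfun_apply (D (t, x)) (h, 0)) = (\<lambda>h. h *\<^sub>R blinfun_apply (D (t, x)) (1, 0))"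
      by (rule ext) (subst blinfun.scaleR_right[symmetric], simp)
    ultimately have "((\<lambda>s. E s x) has_vector_derivative blinfun_apply (D (t, x)) (1, 0)) (at t within {0..T})"
      unfolding has_vector_derivative_def eqf by simp
    then show ?thesis unfolding energy_dt_def
      using vector_derivative_within_cbox[of 0 T t "\<lambda>s. E s x"] t T_pos by simp
  qed
  have 2: "DE t x = D (t, x) o\<^sub>L Blinfun (\<lambda>v. (0, v))" if t: "t \<in> {0..T}" for t x
  proof -
    have "((\<lambda>y. (\<lambda>(t, x). E t x) (t, y)) has_derivative (\<lambda>h. blinfun_apply (D (t, x)) (0, h))) (at x within UNIV)"
    proof (rule has_derivative_in_compose[where f = "\<lambda>y. (t, y)" and f' = "\<lambda>h. (0, h)"])
      show "((\<lambda>y. (t, y)) has_derivative (\<lambda>h. (0, h))) (at x within UNIV)"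
        by (auto intro!: derivative_eq_intros)
      show "((\<lambda>(t, x). E t x) has_derivative blinfun_apply (D (t, x))) (at (t, x) within (\<lambda>y. (t, y)) ` UNIV)"
        by (rule has_derivative_subset[OF D'[OF t]]) (use t in auto)
    qed
    then have "(E t has_derivative (\<lambda>h. blinfun_apply (D (t, x)) (0, h))) (at x)" by simp
    then have "frechet_derivative (E t) (at x) = (\<lambda>h. blinfun_apply (D (t, x)) (0, h))"
      using frechet_derivative_at by metis
    then have "DE t x = Blinfun (\<lambda>h. blinfun_apply (D (t, x)) (0, h))" by (simp add: energy_diff_def)
    also have "\<dots> = D (t, x) o\<^sub>L Blinfun (\<lambda>v. (0, v))"
      by (rule blinfun_eqI) (simp add: bounded_linear_Blinfun_apply bl bounded_linear_compose[OF blinfun.bounded_linear_right bl])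
    finally show ?thesis .
  qed
  have 3: "blinfun_apply (DE t x) v = blinfun_apply (D (t, x)) (0, v)" if "t \<in> {0..T}" for t x v
    by (simp add: 2[OF that] bounded_linear_Blinfun_apply[OF bl])
  show ?thesis by (rule that[OF D(1) D' 1 3 2])
qed

lemma Et_continuous: "continuous_on ({0..T} \<times> UNIV) (\<lambda>z. Et (fst z) (snd z))"
proof -
  obtain D :: "real \<times> 'a \<Rightarrow> (real \<times> 'a) \<Rightarrow>\<^sub>L real" where D: "continuous_on ({0..T} \<times> UNIV) D"
    "\<And>t x. t \<in> {0..T} \<Longrightarrow> Et t x = blinfun_apply (D (t, x)) (1, 0)"
    by (rule E_derivative) blast
  have "continuous_on ({0..T} \<times> UNIV) (\<lambda>z. blinfun_apply (D z) (1, 0))"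
    by (intro continuous_intros D(1))
  then show ?thesis by (rule continuous_on_cong[THEN iffD1, rotated -1]) (auto simp: D(2))
qed

lemma DE_continuous: "continuous_on ({0..T} \<times> UNIV) (\<lambda>z. DE (fst z) (snd z))"
proof -
  obtain D :: "real \<times> 'a \<Rightarrow> (real \<times> 'a) \<Rightarrow>\<^sub>L real" where D: "continuous_on ({0..T} \<times> UNIV) D"
    "\<And>t x. t \<in> {0..T} \<Longrightarrow> DE t x = D (t, x) o\<^sub>L Blinfun (\<lambda>v. (0, v))"
    by (rule E_derivative) blast
  have "continuous_on ({0..T} \<times> UNIV) (\<lambda>z. D z o\<^sub>L Blinfun (\<lambda>v. (0, v)))"
    by (intro bounded_bilinear.continuous_on[OF bounded_bilinear_blinfun_compose] D(1) continuous_on_const)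
  then show ?thesis by (rule continuous_on_cong[THEN iffD1, rotated -1]) (auto simp: D(2))
qed

lemma E_continuous: "continuous_on ({0..T} \<times> UNIV) (\<lambda>z. E (fst z) (snd z))"
proof -
  obtain D :: "real \<times> 'a \<Rightarrow> (real \<times> 'a) \<Rightarrow>\<^sub>L real" where D:
    "\<And>t x. t \<in> {0..T} \<Longrightarrow> ((\<lambda>(t, x). E t x) has_derivative blinfun_apply (D (t, x))) (at (t, x) within {0..T} \<times> UNIV)"
    by (rule E_derivative) blast
  have "continuous_on ({0..T} \<times> UNIV) (\<lambda>(t, x). E t x)"
    unfolding continuous_on_eq_continuous_within using D has_derivative_continuous by fastforce
  then show ?thesis by (simp add: split_beta)
qed

lemma along_tendsto:
  fixes G :: "real \<Rightarrow> 'a \<Rightarrow> 'c::topological_space"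
  assumes G: "continuous_on ({0..T} \<times> UNIV) (\<lambda>z. G (fst z) (snd z))"
    and "(s \<longlongrightarrow> t) F" "(y \<longlongrightarrow> x) F" "t \<in> {0..T}" "\<forall>\<^sub>F r in F. s r \<in> {0..T}"
  shows "((\<lambda>r. G (s r) (y r)) \<longlongrightarrow> G t x) F"
  using continuous_on_tendsto_compose[OF G, of "\<lambda>r. (s r, y r)" "(t, x)" F] assms by (auto simp: tendsto_Pair)

lemma along_continuous:
  fixes G :: "real \<Rightarrow> 'a \<Rightarrow> 'c::topological_space"
  assumes G: "continuous_on ({0..T} \<times> UNIV) (\<lambda>z. G (fst z) (snd z))"
    and "continuous_on {0..T} y"
  shows "continuous_on {0..T} (\<lambda>t. G t (y t))"
proof -
  have "continuous_on {0..T} (\<lambda>t. (t, y t))" by (intro continuous_intros assms(2))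
  then have "continuous_on {0..T} (\<lambda>t. G (fst (t, y t)) (snd (t, y t)))"
    by (rule continuous_on_compose2[OF G]) auto
  then show ?thesis by simp
qed

lemma compact_cyl: "compact ({0..T} \<times> cball (0::'a) R)"
  by (intro compact_Times compact_Icc compact_cball)

lemma cylinder_bounds:
  obtains M where "0 < M" "\<And>t x. t \<in> {0..T} \<Longrightarrow> norm x \<le> R \<Longrightarrow> norm (DE t x) \<le> M"
    "\<And>t x. t \<in> {0..T} \<Longrightarrow> norm x \<le> R \<Longrightarrow> \<bar>Et t x\<bar> \<le> M"
    "\<And>s t x y. s \<in> {0..T} \<Longrightarrow> t \<in> {0..T} \<Longrightarrow> norm x \<le> R \<Longrightarrow> norm y \<le> R \<Longrightarrow>
       \<bar>E t y - E s x\<bar> \<le> M * \<bar>t - s\<bar> + M * norm (y - x)"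
proof -
  obtain D :: "real \<times> 'a \<Rightarrow> (real \<times> 'a) \<Rightarrow>\<^sub>L real" where D: "continuous_on ({0..T} \<times> UNIV) D"
    "\<And>t x. t \<in> {0..T} \<Longrightarrow> ((\<lambda>(t, x). E t x) has_derivative blinfun_apply (D (t, x))) (at (t, x) within {0..T} \<times> UNIV)"
    by (rule E_derivative) blast
  let ?K = "{0..T} \<times> cball (0::'a) R"
  have bnd: "\<exists>b. \<forall>t x. t \<in> {0..T} \<longrightarrow> norm x \<le> R \<longrightarrow> norm (G (t, x)) \<le> b"
    if "continuous_on ({0..T} \<times> UNIV) G" for G :: "real \<times> 'a \<Rightarrow> 'c::real_normed_vector"
  proof -
    have "compact (G ` ?K)"
      by (intro compact_continuous_image compact_cyl continuous_on_subset[OF that]) auto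
    then obtain b where "\<forall>z\<in>G ` ?K. norm z \<le> b" using compact_imp_bounded bounded_iff by metis
    then show ?thesis by (intro exI[of _ b]) auto
  qed
  obtain b1 where b1: "\<And>t x. t \<in> {0..T} \<Longrightarrow> norm x \<le> R \<Longrightarrow> norm (D (t, x)) \<le> b1" using bnd[OF D(1)] by blast
  obtain b2 where b2: "\<And>t x. t \<in> {0..T} \<Longrightarrow> norm x \<le> R \<Longrightarrow> norm (DE t x) \<le> b2" using bnd[OF DE_continuous] by auto
  obtain b3 where b3: "\<And>t x. t \<in> {0..T} \<Longrightarrow> norm x \<le> R \<Longrightarrow> \<bar>Et t x\<bar> \<le> b3" using bnd[OF Et_continuous] by auto
  define M where "M = \<bar>b1\<bar> + \<bar>b2\<bar> + \<bar>b3\<bar> + 1"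
  have lip: "\<bar>E t y - E s x\<bar> \<le> M * \<bar>t - s\<bar> + M * norm (y - x)"
    if h: "s \<in> {0..T}" "t \<in> {0..T}" "norm x \<le> R" "norm y \<le> R" for s t x y
  proof -
    have "norm ((\<lambda>(t, x). E t x) (t, y) - (\<lambda>(t, x). E t x) (s, x)) \<le> M * norm ((t, y) - (s, x))"
    proof (rule differentiable_bound[where S = ?K and f' = "\<lambda>z. blinfun_apply (D z)"])
      show "convex ?K" by (intro convex_Times) auto
      show "((\<lambda>(t, x). E t x) has_derivative blinfun_apply (D z)) (at z within ?K)" if "z \<in> ?K" for z
      proof -
        have "((\<lambda>(t, x). E t x) has_derivative blinfun_apply (D (fst z, snd z))) (at (fst z, snd z) within {0..T} \<times> UNIV)"
          by (rule D(2)) (use that in auto)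
        then have "((\<lambda>(t, x). E t x) has_derivative blinfun_apply (D z)) (at z within {0..T} \<times> UNIV)" by simp
        then show ?thesis by (rule has_derivative_subset) auto
      qed
      show "onorm (blinfun_apply (D z)) \<le> M" if "z \<in> ?K" for z
      proof -
        have "norm (D (fst z, snd z)) \<le> b1" by (rule b1) (use that in auto)
        then show ?thesis by (simp add: norm_blinfun.rep_eq M_def)
      qed
    qed (use h in auto)
    also have "\<dots> \<le> M * (\<bar>t - s\<bar> + norm (y - x))"
      using norm_Pair_le[of "t - s" "y - x"] by (intro mult_left_mono) (auto simp: M_def)
    finally show ?thesis by (simp add: distrib_left)
  qed
  have M: "0 < M" "b2 \<le> M" "b3 \<le> M" by (auto simp: M_def)
  have "norm (DE t x) \<le> M" "\<bar>Et t x\<bar> \<le> M" if "t \<in> {0..T}" "norm x \<le> R" for t x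
    using b2[OF that] b3[OF that] M(2,3) by linarith+
  from that[OF M(1) this lip] show ?thesis .
qed

lemma cylinder_modulus:
  assumes "0 < \<eta>"
  obtains d where "0 < d"
    "\<And>s t x y. s \<in> {0..T} \<Longrightarrow> t \<in> {0..T} \<Longrightarrow> norm x \<le> R \<Longrightarrow> norm y \<le> R \<Longrightarrow> \<bar>t - s\<bar> < d \<Longrightarrow> norm (y - x) < d \<Longrightarrow>
       norm (DE t y - DE s x) \<le> \<eta> \<and> \<bar>Et t y - Et s x\<bar> \<le> \<eta>"
proof -
  let ?K = "{0..T} \<times> cball (0::'a) R"
  have uc: "uniformly_continuous_on ?K (\<lambda>z. DE (fst z) (snd z))" "uniformly_continuous_on ?K (\<lambda>z. Et (fst z) (snd z))"
    by (intro compact_uniformly_continuous compact_cyl continuous_on_subset[OF DE_continuous] continuous_on_subset[OF Et_continuous]; auto)+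
  obtain d1 where d1: "0 < d1"
    "\<And>z z'. z \<in> ?K \<Longrightarrow> z' \<in> ?K \<Longrightarrow> dist z' z < d1 \<Longrightarrow> dist (DE (fst z') (snd z')) (DE (fst z) (snd z)) < \<eta>"
    by (rule uniformly_continuous_onE[OF uc(1) assms]) blast
  obtain d2 where d2: "0 < d2"
    "\<And>z z'. z \<in> ?K \<Longrightarrow> z' \<in> ?K \<Longrightarrow> dist z' z < d2 \<Longrightarrow> dist (Et (fst z') (snd z')) (Et (fst z) (snd z)) < \<eta>"
    by (rule uniformly_continuous_onE[OF uc(2) assms]) blast
  note d = d1(1) d2(1) d1(2) d2(2)
  have "norm (DE t y - DE s x) \<le> \<eta> \<and> \<bar>Et t y - Et s x\<bar> \<le> \<eta>"
    if h: "s \<in> {0..T}" "t \<in> {0..T}" "norm x \<le> R" "norm y \<le> R" "\<bar>t - s\<bar> < min d1 d2 / 2" "norm (y - x) < min d1 d2 / 2" for s t x y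
  proof -
    have "dist (t, y) (s, x) \<le> \<bar>t - s\<bar> + norm (y - x)"
      using norm_Pair_le[of "t - s" "y - x"] by (simp add: dist_norm)
    then have "dist (t, y) (s, x) < d1" "dist (t, y) (s, x) < d2" using h by auto
    then have "dist (DE t y) (DE s x) < \<eta>" "dist (Et t y) (Et s x) < \<eta>"
      using d(3)[of "(s, x)" "(t, y)"] d(4)[of "(s, x)" "(t, y)"] h by auto
    then show ?thesis by (simp add: dist_norm)
  qed
  then show ?thesis using that[of "min d1 d2 / 2"] d by auto
qed

lemma E_chain_frozen:
  assumes "(y has_vector_derivative v) (at r)" "t \<in> {0..T}"
  shows "((\<lambda>r. E t (y r)) has_real_derivative blinfun_apply (DE t (y r)) v) (at r)"
proof -
  obtain D :: "real \<times> 'a \<Rightarrow> (real \<times> 'a) \<Rightarrow>\<^sub>L real" where D: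
    "\<And>t x. t \<in> {0..T} \<Longrightarrow> ((\<lambda>(t, x). E t x) has_derivative blinfun_apply (D (t, x))) (at (t, x) within {0..T} \<times> UNIV)"
    "\<And>t x v. t \<in> {0..T} \<Longrightarrow> blinfun_apply (DE t x) v = blinfun_apply (D (t, x)) (0, v)"
    by (rule E_derivative) blast
  have "((\<lambda>r. (\<lambda>(t, x). E t x) (t, y r)) has_derivative (\<lambda>h. blinfun_apply (D (t, y r)) (0, h *\<^sub>R v))) (at r within UNIV)"
  proof (rule has_derivative_in_compose[where f = "\<lambda>r. (t, y r)" and f' = "\<lambda>h. (0, h *\<^sub>R v)"])
    show "((\<lambda>r. (t, y r)) has_derivative (\<lambda>h. (0, h *\<^sub>R v))) (at r within UNIV)"
      using assms(1) unfolding has_vector_derivative_def by (auto intro!: derivative_eq_intros)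
    show "((\<lambda>(t, x). E t x) has_derivative blinfun_apply (D (t, y r))) (at (t, y r) within (\<lambda>r. (t, y r)) ` UNIV)"
      by (rule has_derivative_subset[OF D(1)[OF assms(2)]]) (use assms in auto)
  qed
  moreover have "(\<lambda>h. blinfun_apply (D (t, y r)) (0, h *\<^sub>R v)) = (*) (blinfun_apply (DE t (y r)) v)"
    by (rule ext) (simp add: D(2)[OF assms(2), symmetric] blinfun.scaleR_right)
  ultimately show ?thesis
    unfolding has_field_derivative_def by simp
qed

lemma E_chain:
  assumes "(y has_vector_derivative v) (at t)" "t \<in> {0<..<T}"
  shows "((\<lambda>t. E t (y t)) has_real_derivative (Et t (y t) + blinfun_apply (DE t (y t)) v)) (at t)"
proof -
  obtain D :: "real \<times> 'a \<Rightarrow> (real \<times> 'a) \<Rightarrow>\<^sub>L real" where D: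
    "\<And>t x. t \<in> {0..T} \<Longrightarrow> ((\<lambda>(t, x). E t x) has_derivative blinfun_apply (D (t, x))) (at (t, x) within {0..T} \<times> UNIV)"
    "\<And>t x. t \<in> {0..T} \<Longrightarrow> Et t x = blinfun_apply (D (t, x)) (1, 0)"
    "\<And>t x v. t \<in> {0..T} \<Longrightarrow> blinfun_apply (DE t x) v = blinfun_apply (D (t, x)) (0, v)"
    by (rule E_derivative) blast
  have t: "t \<in> {0..T}" using assms(2) by auto
  have "((\<lambda>r. (\<lambda>(t, x). E t x) (r, y r)) has_derivative (\<lambda>h. blinfun_apply (D (t, y t)) (h, h *\<^sub>R v))) (at t within {0..T})"
  proof (rule has_derivative_in_compose[where f = "\<lambda>r. (r, y r)" and f' = "\<lambda>h. (h, h *\<^sub>R v)"])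
    show "((\<lambda>r. (r, y r)) has_derivative (\<lambda>h. (h, h *\<^sub>R v))) (at t within {0..T})"
      using assms(1) unfolding has_vector_derivative_def
      by (auto intro!: derivative_eq_intros intro: has_derivative_at_withinI)
    show "((\<lambda>(t, x). E t x) has_derivative blinfun_apply (D (t, y t))) (at (t, y t) within (\<lambda>r. (r, y r)) ` {0..T})"
      by (rule has_derivative_subset[OF D(1)[OF t]]) auto
  qed
  moreover have "at t within {0..T} = at t" using assms(2) by (intro at_within_interior) (simp add: interior_atLeastAtMost_real)
  moreover have "(\<lambda>h. blinfun_apply (D (t, y t)) (h, h *\<^sub>R v)) = (*) (Et t (y t) + blinfun_apply (DE t (y t)) v)"
  proof (rule ext)
    fix h
    have "(h, h *\<^sub>R v) = h *\<^sub>R ((1, 0) + (0, v))" by simp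
    then show "blinfun_apply (D (t, y t)) (h, h *\<^sub>R v) = (Et t (y t) + blinfun_apply (DE t (y t)) v) * h"
      by (simp only: blinfun.scaleR_right blinfun.add_right D(2,3)[OF t]) simp
  qed
  ultimately show ?thesis
    unfolding has_field_derivative_def by simp
qed

end

section \<open>A priori estimates along one viscous curve\<close>

locale viscous_curve = energy_system \<Psi>\<^sub>0 \<Psi> T C E
  for \<Psi>\<^sub>0 \<Psi> :: "'a::real_normed_vector \<Rightarrow> real" and T C E +
  fixes \<epsilon> :: real and u :: "real \<Rightarrow> 'a"
  assumes eps: "0 < \<epsilon>" and sol: "viscous_solution T E \<Psi> \<epsilon> u"
begin

definition V :: "real \<Rightarrow> real" where
  "V t = E 0 (u 0) + integral {0..t} (\<lambda>s. Et s (u s)) - E t (u t)"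

definition du :: "real \<Rightarrow> 'a" where "du t = vector_derivative u (at t)"

definition diss :: "real \<Rightarrow> real" where "diss t = blinfun_apply (- DE t (u t)) (du t)"

lemma u_ac: "abs_continuous_on 0 T u"
  using sol by (simp add: viscous_solution_def)

lemma u_cont: "continuous_on {0..T} u"
  by (rule abs_continuous_on_imp_continuous[OF u_ac])

lemma u_bounded: obtains R where "0 < R" "\<And>t. t \<in> {0..T} \<Longrightarrow> norm (u t) \<le> R"
proof -
  have "compact (u ` {0..T})" by (intro compact_continuous_image u_cont compact_Icc)
  then obtain b where "\<forall>x\<in>u ` {0..T}. norm x \<le> b" using compact_imp_bounded bounded_iff by metis
  then have "norm (u t) \<le> \<bar>b\<bar> + 1" if "t \<in> {0..T}" for t
  proof -
    have "norm (u t) \<le> b" using \<open>\<forall>x\<in>u ` {0..T}. norm x \<le> b\<close> that by blast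
    then show ?thesis by linarith
  qed
  then show ?thesis using that[of "\<bar>b\<bar> + 1"] by simp
qed

lemma Et_cont: "continuous_on {0..T} (\<lambda>t. Et t (u t))"
  by (rule along_continuous[OF Et_continuous u_cont])

text \<open>Fixed by choice, so that all estimates for the same curve share one exceptional set. It
  contains 0 and \<open>T\<close>, where no two-sided derivative is claimed.\<close>

definition N :: "real set" where
  "N = (SOME N. negligible N \<and> (\<forall>t\<in>{0..T} - N. t \<in> {0<..<T} \<and> (u has_vector_derivative du t) (at t) \<and>
       \<Psi>v \<epsilon> (du t) + \<Psi>s (- DE t (u t)) / \<epsilon> \<le> diss t))"

lemma N: "negligible N" "\<And>t. t \<in> {0..T} - N \<Longrightarrow> t \<in> {0<..<T}"
  "\<And>t. t \<in> {0..T} - N \<Longrightarrow> (u has_vector_derivative du t) (at t)"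
  "\<And>t. t \<in> {0..T} - N \<Longrightarrow> \<Psi>v \<epsilon> (du t) + \<Psi>s (- DE t (u t)) / \<epsilon> \<le> diss t"
proof -
  have "\<exists>N. negligible N \<and> (\<forall>t\<in>{0..T} - N. t \<in> {0<..<T} \<and> (u has_vector_derivative du t) (at t) \<and>
       \<Psi>v \<epsilon> (du t) + \<Psi>s (- DE t (u t)) / \<epsilon> \<le> diss t)"
  proof -
    have "AE t in lborel. t \<in> {0<..<T} \<longrightarrow>
        (\<exists>v. (u has_vector_derivative v) (at t) \<and> (\<exists>w\<in>subdifferential (\<Psi>v \<epsilon>) v. w + DE t (u t) = 0))"
      using sol by (simp add: viscous_solution_def)
    then obtain N0 where N0: "N0 \<in> null_sets lborel"
      "{t \<in> space lborel. \<not> (t \<in> {0<..<T} \<longrightarrow> (\<exists>v. (u has_vector_derivative v) (at t) \<and> (\<exists>w\<in>subdifferential (\<Psi>v \<epsilon>) v. w + DE t (u t) = 0)))} \<subseteq> N0"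
      unfolding eventually_ae_filter by blast
    have "negligible N0" using N0(1) by (simp add: negligible_iff_null_sets null_sets_completionI)
    then have "negligible (N0 \<union> {0, T})" by (intro negligible_Un) auto
    moreover have "t \<in> {0<..<T} \<and> (u has_vector_derivative du t) (at t) \<and>
       \<Psi>v \<epsilon> (du t) + \<Psi>s (- DE t (u t)) / \<epsilon> \<le> diss t" if t: "t \<in> {0..T} - (N0 \<union> {0, T})" for t
    proof -
      have t': "t \<in> {0<..<T}" using t by auto
      have "\<exists>v. (u has_vector_derivative v) (at t) \<and> (\<exists>w\<in>subdifferential (\<Psi>v \<epsilon>) v. w + DE t (u t) = 0)"
      proof (rule ccontr)
        assume "\<not> ?thesis"
        then have "t \<in> N0" using t' by (intro subsetD[OF N0(2)]) simp
        then show False using t by simp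
      qed
      then obtain v w where vw: "(u has_vector_derivative v) (at t)" "w \<in> subdifferential (\<Psi>v \<epsilon>) v" "w + DE t (u t) = 0"
        by blast
      have v: "du t = v" unfolding du_def by (rule vector_derivative_at[OF vw(1)])
      have w: "w = - DE t (u t)" using vw(3) by (simp add: eq_neg_iff_add_eq_0)
      show ?thesis using subdifferential_viscous[OF eps vw(2)] vw(1) t' unfolding v w diss_def by simp
    qed
    ultimately show ?thesis by blast
  qed
  from someI_ex[OF this, folded N_def]
  show "negligible N" "\<And>t. t \<in> {0..T} - N \<Longrightarrow> t \<in> {0<..<T}"
    "\<And>t. t \<in> {0..T} - N \<Longrightarrow> (u has_vector_derivative du t) (at t)"
    "\<And>t. t \<in> {0..T} - N \<Longrightarrow> \<Psi>v \<epsilon> (du t) + \<Psi>s (- DE t (u t)) / \<epsilon> \<le> diss t"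
    by blast+
qed

lemma gauge_le_diss: "t \<in> {0..T} - N \<Longrightarrow> \<Psi>\<^sub>0 (du t) \<le> diss t"
  and conjugate_le_diss: "t \<in> {0..T} - N \<Longrightarrow> \<Psi>s (- DE t (u t)) \<le> \<epsilon> * diss t"
  and diss_nonneg: "t \<in> {0..T} - N \<Longrightarrow> 0 \<le> diss t"
proof -
  assume t: "t \<in> {0..T} - N"
  have 0: "0 \<le> \<Psi>s (- DE t (u t)) / \<epsilon>" using eps conjugate_nonneg by simp
  show 1: "\<Psi>\<^sub>0 (du t) \<le> diss t" using N(4)[OF t] gauge_le_viscous[OF eps, of "du t"] 0 by linarith
  show "0 \<le> diss t" using 1 gauge_nonneg[of "du t"] by linarith
  have "\<Psi>s (- DE t (u t)) / \<epsilon> \<le> diss t"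
    using N(4)[OF t] gauge_le_viscous[OF eps, of "du t"] gauge_nonneg[of "du t"] by linarith
  then show "\<Psi>s (- DE t (u t)) \<le> \<epsilon> * diss t" using eps by (simp add: field_simps)
qed

lemma E_ac: "abs_continuous_on 0 T (\<lambda>t. E t (u t))"
proof -
  obtain R where R: "0 < R" "\<And>t. t \<in> {0..T} \<Longrightarrow> norm (u t) \<le> R" using u_bounded by blast
  obtain M where M: "\<And>s t x y. s \<in> {0..T} \<Longrightarrow> t \<in> {0..T} \<Longrightarrow> norm x \<le> R \<Longrightarrow> norm y \<le> R \<Longrightarrow>
       \<bar>E t y - E s x\<bar> \<le> M * \<bar>t - s\<bar> + M * norm (y - x)"
    by (rule cylinder_bounds) blast
  show ?thesis
  proof (rule abs_continuous_on_dominated1[OF u_ac, of _ M M])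
    fix s t assume "0 \<le> s" "s \<le> t" "t \<le> T"
    then show "norm (E t (u t) - E s (u s)) \<le> M * norm (u t - u s) + M * (t - s)"
      using M[of s t "u s" "u t"] R(2)[of s] R(2)[of t] by simp
  qed
qed

lemma Et_integral_diff:
  assumes "0 \<le> s" "s \<le> t" "t \<le> T"
  shows "integral {0..t} (\<lambda>r. Et r (u r)) - integral {0..s} (\<lambda>r. Et r (u r)) = integral {s..t} (\<lambda>r. Et r (u r))"
proof -
  have "(\<lambda>r. Et r (u r)) integrable_on {0..t}"
    using assms by (intro integrable_continuous_real continuous_on_subset[OF Et_cont]) auto
  from Henstock_Kurzweil_Integration.integral_combine[OF assms(1,2) this] show ?thesis by simp
qed

lemma V_ac: "abs_continuous_on 0 T V"
proof -
  obtain R where R: "0 < R" "\<And>t. t \<in> {0..T} \<Longrightarrow> norm (u t) \<le> R" using u_bounded by blast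
  obtain M where M: "0 < M" "\<And>t x. t \<in> {0..T} \<Longrightarrow> norm x \<le> R \<Longrightarrow> \<bar>Et t x\<bar> \<le> M"
    by (rule cylinder_bounds) blast
  show ?thesis
  proof (rule abs_continuous_on_dominated1[OF E_ac, of _ 1 M])
    fix s t assume st: "0 \<le> s" "s \<le> t" "t \<le> T"
    have "norm (integral {s..t} (\<lambda>r. Et r (u r))) \<le> M * (t - s)"
      using st R M by (intro integral_bound continuous_on_subset[OF Et_cont]) auto
    then show "norm (V t - V s) \<le> 1 * norm (E t (u t) - E s (u s)) + M * (t - s)"
      using Et_integral_diff[OF st] by (simp add: V_def)
  qed
qed

lemma V_derivative:
  assumes t: "t \<in> {0..T} - N"
  shows "(V has_real_derivative diss t) (at t)"
proof -
  have t': "t \<in> {0<..<T}" by (rule N(2)[OF t])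
  have "((\<lambda>r. integral {0..r} (\<lambda>s. Et s (u s))) has_vector_derivative Et t (u t)) (at t within {0..T})"
    by (rule integral_has_vector_derivative[OF Et_cont]) (use t in auto)
  moreover have "at t within {0..T} = at t" using t' by (intro at_within_interior) (simp add: interior_atLeastAtMost_real)
  ultimately have "((\<lambda>r. integral {0..r} (\<lambda>s. Et s (u s))) has_real_derivative Et t (u t)) (at t)"
    by (simp add: has_real_derivative_iff_has_vector_derivative)
  then show ?thesis
    unfolding V_def[abs_def] diss_def using E_chain[OF N(3)[OF t] t']
    by (auto intro!: derivative_eq_intros simp: blinfun.minus_left)
qed

lemma V_0: "V 0 = 0"
  by (simp add: V_def)

lemma V_integral:
  assumes "0 \<le> s" "s \<le> t" "t \<le> T"
  shows "(diss has_integral V t - V s) {s..t}"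
proof (rule abs_continuous_FTC[OF assms(2) abs_continuous_on_subinterval[OF V_ac assms(1,3)] N(1)])
  fix x assume "x \<in> {s..t} - N"
  then have "x \<in> {0..T} - N" using assms by auto
  from V_derivative[OF this] show "(V has_vector_derivative diss x) (at x within {s..t})"
    by (simp add: has_real_derivative_iff_has_vector_derivative has_vector_derivative_at_within)
qed

text \<open>The difference \<open>V r - \<Psi>\<^sub>0 (u r - u s)\<close> is nondecreasing in
  \<open>r\<close>. Since its second term need not be differentiable, the increments around a point
  are estimated directly: \<open>u\<close> is replaced by its linearisation and subadditivity of the
  gauge collects the errors.\<close>

lemma gauge_increment:
  assumes st: "0 \<le> s" "s \<le> t" "t \<le> T"
  shows "\<Psi>\<^sub>0 (u t - u s) \<le> V t - V s"
proof -
  obtain K where K: "0 < K" "\<And>v. \<Psi>\<^sub>0 v \<le> K * norm v" using gauge_upper_bound by metis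
  define f where "f r = V r - \<Psi>\<^sub>0 (u r - u s)" for r
  have ac: "abs_continuous_on 0 T f"
  proof (rule abs_continuous_on_dominated[OF V_ac u_ac, of _ 1 K 0])
    fix r r'
    have "\<bar>\<Psi>\<^sub>0 (u r' - u s) - \<Psi>\<^sub>0 (u r - u s)\<bar> \<le> K * norm (u r' - u r)"
      using gauge_diff[of "u r' - u s" "u r - u s"] gauge_diff[of "u r - u s" "u r' - u s"]
        K(2)[of "u r' - u r"] K(2)[of "u r - u r'"] by (simp add: norm_minus_commute)
    then show "norm (f r' - f r) \<le> 1 * norm (V r' - V r) + K * norm (u r' - u r) + 0 * (r' - r)"
      unfolding f_def by simp
  qed
  have "f s \<le> f t"
  proof (rule abs_continuous_mono_straddle[OF st(2) abs_continuous_on_subinterval[OF ac st(1,3)] N(1)])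
    fix x e :: real assume x: "x \<in> {s..t} - N" and e: "0 < e"
    have x': "x \<in> {0..T} - N" using x st by auto
    \<comment> \<open>One \<open>e'\<close> is spent on the linearisation of \<open>V\<close>, and
      \<open>K * e'\<close> on the gauge of the remainder of \<open>u\<close>.\<close>
    define e' where "e' = e / (K + 1)"
    have e': "0 < e'" using e K(1) by (simp add: e'_def)
    obtain d1 where d1: "0 < d1" "\<And>p q. p \<le> x \<Longrightarrow> x \<le> q \<Longrightarrow> q - p < d1 \<Longrightarrow> norm (u q - u p - (q - p) *\<^sub>R du x) \<le> e' * (q - p)"
      by (rule has_vector_derivative_straddle[OF N(3)[OF x'] e']) blast
    have "(V has_vector_derivative diss x) (at x)"
      using V_derivative[OF x'] by (simp add: has_real_derivative_iff_has_vector_derivative)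
    from has_vector_derivative_straddle[OF this e']
    obtain d2 where d2: "0 < d2" "\<And>p q. p \<le> x \<Longrightarrow> x \<le> q \<Longrightarrow> q - p < d2 \<Longrightarrow> norm (V q - V p - (q - p) *\<^sub>R diss x) \<le> e' * (q - p)"
      by blast
    have "f p - f q \<le> e * (q - p)" if pq: "p \<le> x" "x \<le> q" "q - p < min d1 d2" for p q
    proof -
      have h: "0 \<le> q - p" using pq by simp
      have 1: "norm (u q - u p - (q - p) *\<^sub>R du x) \<le> e' * (q - p)" using d1(2) pq by simp
      have 2: "\<bar>V q - V p - (q - p) * diss x\<bar> \<le> e' * (q - p)" using d2(2) pq by simp
      have "\<Psi>\<^sub>0 (u q - u p) \<le> \<Psi>\<^sub>0 ((q - p) *\<^sub>R du x) + \<Psi>\<^sub>0 (u q - u p - (q - p) *\<^sub>R du x)"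
        using gauge_add[of "(q - p) *\<^sub>R du x" "u q - u p - (q - p) *\<^sub>R du x"] by simp
      also have "\<Psi>\<^sub>0 ((q - p) *\<^sub>R du x) = (q - p) * \<Psi>\<^sub>0 (du x)" by (rule gauge_scale[OF h])
      also have "\<dots> \<le> (q - p) * diss x" by (rule mult_left_mono[OF gauge_le_diss[OF x'] h])
      also have "\<Psi>\<^sub>0 (u q - u p - (q - p) *\<^sub>R du x) \<le> K * (e' * (q - p))"
        using K(2)[of "u q - u p - (q - p) *\<^sub>R du x"] mult_left_mono[OF 1, of K] K(1) by linarith
      finally have 3: "\<Psi>\<^sub>0 (u q - u p) \<le> (q - p) * diss x + K * (e' * (q - p))" by simp
      have "f p - f q = - (V q - V p) + (\<Psi>\<^sub>0 (u q - u s) - \<Psi>\<^sub>0 (u p - u s))" by (simp add: f_def)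
      also have "\<dots> \<le> - (V q - V p) + \<Psi>\<^sub>0 (u q - u p)" using gauge_diff[of "u q - u s" "u p - u s"] by simp
      also have "\<dots> \<le> e' * (q - p) + K * (e' * (q - p))" using 2 3 by linarith
      also have "\<dots> = ((K + 1) * e') * (q - p)" by (simp add: algebra_simps)
      also have "(K + 1) * e' = e" using K(1) by (simp add: e'_def)
      finally show ?thesis .
    qed
    then show "\<exists>d>0. \<forall>p q. s \<le> p \<and> p \<le> x \<and> x \<le> q \<and> q \<le> t \<and> q - p < d \<longrightarrow> f p - f q \<le> e * (q - p)"
      using d1(1) d2(1) by (intro exI[of _ "min d1 d2"]) auto
  qed
  then show ?thesis by (simp add: f_def)
qed

lemma V_mono: "0 \<le> s \<Longrightarrow> s \<le> t \<Longrightarrow> t \<le> T \<Longrightarrow> V s \<le> V t"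
  using gauge_increment[of s t] gauge_nonneg[of "u t - u s"] by linarith

text \<open>Gronwall's inequality in logarithmic form: \<open>C * t - ln (y t)\<close> has a
  nonnegative derivative. Adding \<open>1 + C\<close> to the energy makes the argument of the
  logarithm at least 1 and makes it dominate \<open>1 + max 0 (E t x)\<close>; the dissipation has
  the favourable sign.\<close>

lemma energy_bound:
  assumes t: "t \<in> {0..T}"
  shows "1 + C + E t (u t) \<le> (1 + C + E 0 (u 0)) * exp (C * T)"
proof -
  define y where "y t = 1 + C + E t (u t)" for t
  have y1: "1 \<le> y t" if "t \<in> {0..T}" for t using E_bdd_below[OF that, of "u t"] by (simp add: y_def)
  have lnl: "\<bar>ln p - ln q\<bar> \<le> \<bar>p - q\<bar>" if "1 \<le> p" "1 \<le> q" for p q :: real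
  proof -
    have "ln p - ln q \<le> (p - q) / q" "ln q - ln p \<le> (q - p) / p" using that by (auto intro!: ln_diff_le)
    moreover have "(p - q) / q \<le> \<bar>p - q\<bar>" "(q - p) / p \<le> \<bar>p - q\<bar>"
      using that mult_left_mono[of 1 q "\<bar>p - q\<bar>"] mult_left_mono[of 1 p "\<bar>p - q\<bar>"] by (auto simp: divide_le_eq)
    ultimately show ?thesis by linarith
  qed
  define f where "f t = C * t - ln (y t)" for t
  have ac: "abs_continuous_on 0 T f"
  proof (rule abs_continuous_on_dominated1[OF E_ac, of _ 1 C])
    fix s t assume st: "0 \<le> s" "s \<le> t" "t \<le> T"
    have "\<bar>ln (y t) - ln (y s)\<bar> \<le> \<bar>y t - y s\<bar>" using st by (intro lnl y1) auto
    moreover have "f t - f s = C * (t - s) - (ln (y t) - ln (y s))" by (simp add: f_def algebra_simps)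
    moreover have "0 \<le> C * (t - s)" using C_pos st by simp
    ultimately show "norm (f t - f s) \<le> 1 * norm (E t (u t) - E s (u s)) + C * (t - s)"
      by (simp add: y_def abs_le_iff)
  qed
  have "f 0 \<le> f t"
  proof (rule abs_continuous_deriv_mono[OF _ abs_continuous_on_subinterval[OF ac] N(1)])
    fix x assume "x \<in> {0..t} - N"
    then have x: "x \<in> {0..T} - N" using t by auto
    have yx: "1 \<le> y x" using x by (intro y1) auto
    have "(y has_real_derivative (Et x (u x) + blinfun_apply (DE x (u x)) (du x))) (at x)"
      unfolding y_def[abs_def] using E_chain[OF N(3)[OF x] N(2)[OF x]] by (auto intro!: derivative_eq_intros)
    then show "(f has_real_derivative (C - (Et x (u x) - diss x) / y x)) (at x)"
      unfolding f_def[abs_def] using yx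
      by (auto intro!: derivative_eq_intros simp: diss_def blinfun.minus_left)
    have "Et x (u x) - diss x \<le> C * (1 + max 0 (E x (u x)))"
      using E_dt_bound[of x "u x"] diss_nonneg[OF x] x by (auto simp: abs_le_iff)
    also have "\<dots> \<le> C * y x"
      using E_bdd_below[of x "u x"] x C_pos by (intro mult_left_mono) (auto simp: y_def)
    finally show "0 \<le> C - (Et x (u x) - diss x) / y x" using yx by (simp add: divide_le_eq)
  qed (use t in auto)
  then have "ln (y t) \<le> ln (y 0) + C * t" by (simp add: f_def)
  also have "\<dots> \<le> ln (y 0) + C * T" using t C_pos by simp
  also have "\<dots> = ln (y 0 * exp (C * T))" using y1[of 0] T_pos by (simp add: ln_mult)
  finally show ?thesis using y1[OF t] y1[of 0] T_pos unfolding y_def[symmetric]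
    by (subst (asm) ln_le_cancel_iff) auto
qed

lemma conjugate_integral:
  "integral {0..T} (\<lambda>t. \<Psi>s (- DE t (u t))) \<le> \<epsilon> * V T"
proof -
  have c: "continuous_on {0..T} (\<lambda>t. \<Psi>s (- DE t (u t)))"
    by (intro continuous_on_compose2[OF conjugate_continuous] continuous_on_minus along_continuous[OF DE_continuous u_cont]) auto
  have "((\<lambda>t. \<epsilon> * diss t) has_integral \<epsilon> * (V T - V 0)) {0..T}"
    using V_integral[of 0 T] T_pos by (intro has_integral_mult_right) auto
  then have i: "((\<lambda>t. if t \<in> N then \<Psi>s (- DE t (u t)) else \<epsilon> * diss t) has_integral \<epsilon> * (V T - V 0)) {0..T}"
    by (rule has_integral_spike[OF N(1), rotated]) auto
  have "integral {0..T} (\<lambda>t. \<Psi>s (- DE t (u t))) \<le> \<epsilon> * (V T - V 0)"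
    by (rule has_integral_le[OF integrable_integral[OF integrable_continuous_real[OF c]] i])
      (use conjugate_le_diss in auto)
  then show ?thesis by (simp add: V_0)
qed

end

section \<open>The Finsler cost\<close>

lemma e2ennreal_le_ennreal: "p \<le> ereal a \<Longrightarrow> e2ennreal p \<le> ennreal a"
  using e2ennreal_mono[of p "ereal a"] by simp

lemma ennreal_le_e2ennreal: "ereal a \<le> p \<Longrightarrow> ennreal a \<le> e2ennreal p"
  using e2ennreal_mono[of "ereal a" p] by simp

text \<open>By the chain rule the released energy is the integral of \<open>- DE\<close> applied to
  the speed, and \<open>contact_lower\<close> bounds this by the integrand of the cost. The
  derivative of the energy along the curve is known to be Lebesgue measurable, so the comparison
  takes place for the completed measure; the positive part is taken since the cost is
  nonnegative.\<close>

lemma (in energy_system) finsler_lower: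
  assumes t: "t \<in> {0..T}"
  shows "ennreal (E t x\<^sub>0 - E t x\<^sub>1) \<le> finsler_cost (contact_potential \<Psi>) E t x\<^sub>0 x\<^sub>1"
  unfolding finsler_cost_def
proof (rule Inf_greatest, clarify)
  fix \<theta> :: "real \<Rightarrow> 'a" and a b :: real
  assume ab: "a < b" and ac: "abs_continuous_on a b \<theta>"
  let ?p = "\<lambda>r. e2ennreal (contact_potential \<Psi> (vector_derivative \<theta> (at r)) (- DE t (\<theta> r)))"
  let ?z = "\<integral>\<^sup>+ r\<in>{a..b}. ?p r \<partial>lborel"
  obtain N where N: "negligible N" "\<And>r. r \<in> {a..b} - N \<Longrightarrow> (\<theta> has_vector_derivative vector_derivative \<theta> (at r)) (at r)"
    by (rule abs_continuous_derivative_ae[OF fin ac]) blast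
  have "compact (\<theta> ` {a..b})" by (intro compact_continuous_image abs_continuous_on_imp_continuous ac compact_Icc)
  then obtain R where R: "\<And>r. r \<in> {a..b} \<Longrightarrow> norm (\<theta> r) \<le> R"
    using compact_imp_bounded bounded_iff by (metis imageI)
  obtain M where M: "\<And>s t x y. s \<in> {0..T} \<Longrightarrow> t \<in> {0..T} \<Longrightarrow> norm x \<le> R \<Longrightarrow> norm y \<le> R \<Longrightarrow>
       \<bar>E t y - E s x\<bar> \<le> M * \<bar>t - s\<bar> + M * norm (y - x)"
    by (rule cylinder_bounds) blast
  have acE: "abs_continuous_on a b (\<lambda>r. - E t (\<theta> r))"
  proof (rule abs_continuous_on_dominated1[OF ac, of _ M 0])
    fix r r' assume "a \<le> r" "r \<le> r'" "r' \<le> b"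
    then show "norm (- E t (\<theta> r') - - E t (\<theta> r)) \<le> M * norm (\<theta> r' - \<theta> r) + 0 * (r' - r)"
      using M[OF t t, of "\<theta> r" "\<theta> r'"] R[of r] R[of r'] by (simp add: abs_minus_commute)
  qed
  define g where "g r = (if r \<in> N then 0 else - blinfun_apply (DE t (\<theta> r)) (vector_derivative \<theta> (at r)))" for r
  have gI: "(g has_integral (- E t (\<theta> b) - - E t (\<theta> a))) {a..b}"
  proof (rule abs_continuous_FTC[OF less_imp_le[OF ab] acE N(1)])
    fix r assume r: "r \<in> {a..b} - N"
    have "((\<lambda>r. - E t (\<theta> r)) has_real_derivative g r) (at r)"
      using DERIV_minus[OF E_chain_frozen[OF N(2)[OF r] t]] r by (simp add: g_def)
    then show "((\<lambda>r. - E t (\<theta> r)) has_vector_derivative g r) (at r within {a..b})"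
      by (simp add: has_real_derivative_iff_has_vector_derivative has_vector_derivative_at_within)
  qed
  let ?h = "\<lambda>r. indicator {a..b} r *\<^sub>R g r"
  have hm: "?h \<in> borel_measurable lebesgue"
    by (rule has_integral_implies_lebesgue_measurable[OF gI])
  have le: "(\<integral>\<^sup>+ r. ennreal (max 0 (?h r)) \<partial>lebesgue) \<le> ?z"
    unfolding nn_integral_completion
  proof (rule nn_integral_mono)
    fix r :: real
    show "ennreal (max 0 (?h r)) \<le> ?p r * indicator {a..b} r"
    proof (cases "r \<in> {a..b} \<and> r \<notin> N")
      case True
      have "ereal (blinfun_apply (- DE t (\<theta> r)) (vector_derivative \<theta> (at r))) \<le> contact_potential \<Psi> (vector_derivative \<theta> (at r)) (- DE t (\<theta> r))"
        by (rule contact_lower)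
      then have "ennreal (g r) \<le> ?p r"
        using True by (intro ennreal_le_e2ennreal) (simp add: g_def blinfun.minus_left)
      then show ?thesis using True by (simp add: max_def ennreal_neg)
    next
      case False
      then show ?thesis by (auto simp: g_def indicator_def)
    qed
  qed
  show "ennreal (E t (\<theta> a) - E t (\<theta> b)) \<le> ?z"
  proof (cases "?z = \<infinity>")
    case False
    then have fz: "?z < \<infinity>" by (simp add: less_top)
    have int: "integrable lebesgue (\<lambda>r. max 0 (?h r))"
      using hm le_less_trans[OF le fz] by (intro integrableI_nonneg) auto
    have "(?h has_integral (E t (\<theta> a) - E t (\<theta> b))) UNIV"
    proof -
      have "?h = (\<lambda>r. if r \<in> {a..b} then g r else 0)" by auto
      then show ?thesis using gI by (simp only: has_integral_restrict_UNIV) simp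
    qed
    then have "E t (\<theta> a) - E t (\<theta> b) \<le> integral\<^sup>L lebesgue (\<lambda>r. max 0 (?h r))"
      by (rule has_integral_le[OF _ has_integral_integral_lebesgue[OF int]]) auto
    then have "ennreal (E t (\<theta> a) - E t (\<theta> b)) \<le> ennreal (integral\<^sup>L lebesgue (\<lambda>r. max 0 (?h r)))" by (rule ennreal_leI)
    also have "\<dots> = (\<integral>\<^sup>+ r. ennreal (max 0 (?h r)) \<partial>lebesgue)"
      by (rule nn_integral_eq_integral[OF int, symmetric]) simp
    finally show ?thesis using le by (rule order_trans)
  qed simp
qed

context viscous_curve
begin

text \<open>The competitor runs along a segment from \<open>x\<close> to \<open>u s\<close>, then along \<open>u\<close> with the time in
  \<open>DE\<close> frozen at \<open>\<tau>\<close>, and finally along a segment from \<open>u t\<close> to \<open>y\<close>.\<close>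

lemma finsler_upper:
  assumes st: "0 \<le> s" "s < t" "t \<le> T" and \<tau>: "\<tau> \<in> {s..t}"
    and R: "norm x \<le> R" "norm y \<le> R" "\<And>r. r \<in> {0..T} \<Longrightarrow> norm (u r) \<le> R"
    and M: "\<And>r z. r \<in> {0..T} \<Longrightarrow> norm z \<le> R \<Longrightarrow> norm (DE r z) \<le> M"
    and K: "0 < K" "\<And>v w. norm w \<le> M \<Longrightarrow> contact_potential \<Psi> v w \<le> ereal (K * norm v)"
    and \<eta>: "0 < \<eta>" and frozen: "\<And>v w w' e. 0 < e \<Longrightarrow> norm w \<le> M \<Longrightarrow> norm w' \<le> M \<Longrightarrow> norm (w' - w) \<le> \<omega> \<Longrightarrow>
       contact_potential \<Psi> v w' \<le> ereal (\<Psi>v e v + \<Psi>s w / e + \<eta> * norm v)"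
    and \<omega>: "\<And>r. r \<in> {s..t} \<Longrightarrow> norm (DE r (u r) - DE \<tau> (u r)) \<le> \<omega>"
    and c: "0 < c" "\<And>v. c * norm v \<le> \<Psi>\<^sub>0 v"
  shows "finsler_cost (contact_potential \<Psi>) E \<tau> x y
      \<le> ennreal (K * norm (u s - x) + (V t - V s) * (1 + \<eta> / c) + K * norm (y - u t))"
proof -
  \<comment> \<open>Both connecting segments are traversed in unit time, which makes their speed
    equal to the displacement. Adding clamped terms describes the whole curve by one formula and
    reduces its absolute continuity to that of the summands.\<close>
  let ?a = "s - 1" and ?b = "t + 1"
  define \<theta> where "\<theta> r = (x + max 0 (min 1 (r - ?a)) *\<^sub>R (u s - x)) + (u (max s (min t r)) - u s) + max 0 (min 1 (r - t)) *\<^sub>R (y - u t)" for r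
  have clamp: "\<bar>max 0 (min 1 (q - d)) - max 0 (min 1 (p - d))\<bar> \<le> q - p" if "p \<le> q" for p q d :: real
    using that by (auto simp: max_def min_def)
  have ac1: "abs_continuous_on ?a ?b (\<lambda>r. z + max 0 (min 1 (r - d)) *\<^sub>R v)" for z v :: 'a and d
  proof (rule abs_continuous_on_lipschitz[where L = "norm v"])
    fix p q :: real assume "p \<le> q"
    have "norm ((max 0 (min 1 (q - d)) - max 0 (min 1 (p - d))) *\<^sub>R v) \<le> (q - p) * norm v"
      using clamp[OF \<open>p \<le> q\<close>, of d] by (simp add: mult_right_mono)
    then show "norm (z + max 0 (min 1 (q - d)) *\<^sub>R v - (z + max 0 (min 1 (p - d)) *\<^sub>R v)) \<le> norm v * (q - p)"
      by (simp add: scaleR_left_diff_distrib mult.commute)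
  qed
  have ac2: "abs_continuous_on ?a ?b (\<lambda>r. u (max s (min t r)) + (- u s))"
    by (rule abs_continuous_on_add[OF abs_continuous_on_clamp[OF abs_continuous_on_subinterval[OF u_ac]] abs_continuous_on_const])
      (use st in auto)
  have ac: "abs_continuous_on ?a ?b \<theta>"
    using abs_continuous_on_add[OF abs_continuous_on_add[OF ac1[of x ?a "u s - x"] ac2] ac1[of 0 t "y - u t"]]
    by (simp add: \<theta>_def[abs_def])
  have ends: "\<theta> ?a = x" "\<theta> ?b = y" using st by (auto simp: \<theta>_def max_def min_def)
  let ?p = "\<lambda>r. e2ennreal (contact_potential \<Psi> (vector_derivative \<theta> (at r)) (- DE \<tau> (\<theta> r)))"
  have \<tau>T: "\<tau> \<in> {0..T}" using \<tau> st by auto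
  have seg: "?p r \<le> ennreal (K * norm v)"
    if v: "(\<theta> has_vector_derivative v) (at r)" and z: "norm (\<theta> r) \<le> R" for r v
    using K(2)[of "- DE \<tau> (\<theta> r)" v] M[OF \<tau>T z] vector_derivative_at[OF v]
    by (intro e2ennreal_le_ennreal) simp
  have conv: "norm (p + l *\<^sub>R (q - p)) \<le> R" if "norm p \<le> R" "norm q \<le> R" "0 \<le> l" "l \<le> 1" for p q :: 'a and l
  proof -
    have "p + l *\<^sub>R (q - p) = (1 - l) *\<^sub>R p + l *\<^sub>R q" by (simp add: algebra_simps)
    also have "norm \<dots> \<le> (1 - l) * norm p + l * norm q"
      using norm_triangle_ineq[of "(1 - l) *\<^sub>R p" "l *\<^sub>R q"] that by simp
    also have "\<dots> \<le> (1 - l) * R + l * R" using that by (intro add_mono mult_left_mono) auto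
    finally show ?thesis by (simp add: algebra_simps)
  qed
  have us: "norm (u s) \<le> R" "norm (u t) \<le> R" using st by (auto intro!: R(3))
  have left: "?p r \<le> ennreal (K * norm (u s - x))" if r: "r \<in> {?a<..<s}" for r
  proof (rule seg)
    have eq: "\<theta> r' = x + (r' - ?a) *\<^sub>R (u s - x)" if "r' \<in> {?a<..<s}" for r'
      using that st by (simp add: \<theta>_def max_def min_def)
    have "((\<lambda>r'. x + (r' - ?a) *\<^sub>R (u s - x)) has_vector_derivative (u s - x)) (at r)"
      by (auto intro!: derivative_eq_intros)
    then show "(\<theta> has_vector_derivative (u s - x)) (at r)"
      by (rule has_vector_derivative_transform_within_open[of _ _ _ "{?a<..<s}"]) (use r eq in auto)
    show "norm (\<theta> r) \<le> R" unfolding eq[OF r] using r by (intro conv R us) auto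
  qed
  have right: "?p r \<le> ennreal (K * norm (y - u t))" if r: "r \<in> {t<..<?b}" for r
  proof (rule seg)
    have eq: "\<theta> r' = u t + (r' - t) *\<^sub>R (y - u t)" if "r' \<in> {t<..<?b}" for r'
      using that st by (simp add: \<theta>_def max_def min_def)
    have "((\<lambda>r'. u t + (r' - t) *\<^sub>R (y - u t)) has_vector_derivative (y - u t)) (at r)"
      by (auto intro!: derivative_eq_intros)
    then show "(\<theta> has_vector_derivative (y - u t)) (at r)"
      by (rule has_vector_derivative_transform_within_open[of _ _ _ "{t<..<?b}"]) (use r eq in auto)
    show "norm (\<theta> r) \<le> R" unfolding eq[OF r] using r by (intro conv R us) auto
  qed
  \<comment> \<open>The factor absorbs the error of freezing the time:
    \<open>\<eta> * norm (du r)\<close> is at most \<open>\<eta> / c\<close> times the gauge of the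
    speed, hence at most \<open>\<eta> / c\<close> times the dissipated power.\<close>
  define l where "l = 1 + \<eta> / c"
  have l: "0 < l" using \<eta> c(1) by (simp add: l_def add_pos_pos)
  have mid: "?p r \<le> ennreal (l * diss r)" if r: "r \<in> {s<..<t} - N" for r
  proof -
    have rT: "r \<in> {0..T} - N" using r st by auto
    have eq: "\<theta> r' = u r'" if "r' \<in> {s<..<t}" for r'
      using that st by (simp add: \<theta>_def max_def min_def)
    have d: "(\<theta> has_vector_derivative du r) (at r)"
      by (rule has_vector_derivative_transform_within_open[OF N(3)[OF rT], of "{s<..<t}"]) (use r eq in auto)
    have nr: "norm (u r) \<le> R" using rT by (intro R) simp
    have "contact_potential \<Psi> (du r) (- DE \<tau> (u r)) \<le> ereal (\<Psi>v \<epsilon> (du r) + \<Psi>s (- DE r (u r)) / \<epsilon> + \<eta> * norm (du r))"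
    proof (rule frozen[OF eps])
      show "norm (- DE r (u r)) \<le> M" "norm (- DE \<tau> (u r)) \<le> M" using M[OF _ nr] rT \<tau>T by auto
      show "norm (- DE \<tau> (u r) - - DE r (u r)) \<le> \<omega>" using \<omega>[of r] r by simp
    qed
    also have "\<dots> \<le> ereal (l * diss r)"
    proof -
      have "\<eta> * norm (du r) = \<eta> / c * (c * norm (du r))" using c(1) by simp
      also have "\<dots> \<le> \<eta> / c * diss r"
        using \<eta> c(1) order_trans[OF c(2) gauge_le_diss[OF rT]] by (intro mult_left_mono) auto
      finally show ?thesis using N(4)[OF rT] by (simp add: l_def algebra_simps)
    qed
    finally show ?thesis
      using vector_derivative_at[OF d] eq[of r] r by (intro e2ennreal_le_ennreal) simp
  qed
  define d' where "d' r = (if r \<in> N then 0 else l * diss r)" for r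
  have dI: "(d' has_integral l * (V t - V s)) {s..t}"
    by (rule has_integral_spike[OF N(1) _ has_integral_mult_right[OF V_integral]]) (use st in \<open>auto simp: d'_def\<close>)
  have d0: "0 \<le> d' r" if "r \<in> {s..t}" for r
    using that st l diss_nonneg[of r] by (auto simp: d'_def)
  have dn: "(\<integral>\<^sup>+ r. ennreal (indicator {s..t} r * d' r) \<partial>lebesgue) = ennreal (l * (V t - V s))"
    unfolding nn_integral_completion using nn_integral_has_integral_lebesgue[OF d0 dI] by simp
  have dm: "(\<lambda>r. indicator {s..t} r * d' r) \<in> borel_measurable lebesgue"
    using has_integral_implies_lebesgue_measurable[OF dI] by simp
  have Vst: "0 \<le> V t - V s" using V_mono[of s t] st by simp
  have "finsler_cost (contact_potential \<Psi>) E \<tau> x y \<le> (\<integral>\<^sup>+ r\<in>{?a..?b}. ?p r \<partial>lborel)"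
    unfolding finsler_cost_def
    by (rule Inf_lower, rule CollectI, rule exI[of _ \<theta>], rule exI[of _ ?a], rule exI[of _ ?b])
      (use ac ends st in auto)
  \<comment> \<open>The exceptional set is negligible in the sense of the completed measure, so the
    pointwise bounds are integrated there.\<close>
  also have "\<dots> = (\<integral>\<^sup>+ r\<in>{?a..?b}. ?p r \<partial>lebesgue)" by (simp only: nn_integral_completion)
  also have "\<dots> \<le> (\<integral>\<^sup>+ r. ennreal (K * norm (u s - x)) * indicator {?a..s} r + ennreal (indicator {s..t} r * d' r)
      + ennreal (K * norm (y - u t)) * indicator {t..?b} r \<partial>lebesgue)"
  proof (rule nn_integral_mono_AE)
    have "negligible (N \<union> {?a, s, t, ?b})" using N(1) by (intro negligible_Un) auto
    then have "AE r in lebesgue. r \<notin> N \<union> {?a, s, t, ?b}" by (intro AE_not_in) (simp add: negligible_iff_null_sets)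
    then show "AE r in lebesgue. ?p r * indicator {?a..?b} r \<le> ennreal (K * norm (u s - x)) * indicator {?a..s} r
        + ennreal (indicator {s..t} r * d' r) + ennreal (K * norm (y - u t)) * indicator {t..?b} r"
    proof eventually_elim
      case (elim r)
      consider "r < ?a \<or> ?b < r" | "r \<in> {?a<..<s}" | "r \<in> {s<..<t} - N" | "r \<in> {t<..<?b}" using elim by fastforce
      then show ?case
      proof cases
        case 1
        then show ?thesis by auto
      next
        case 2
        then show ?thesis using left[OF 2] st by (auto simp: indicator_def)
      next
        case 3
        then show ?thesis using mid[OF 3] st by (auto simp: indicator_def d'_def)
      next
        case 4
        then show ?thesis using right[OF 4] st by (auto simp: indicator_def)
      qed
    qed
  qed
  also have "\<dots> = ennreal (K * norm (u s - x)) * emeasure lebesgue {?a..s} + ennreal (l * (V t - V s))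
      + ennreal (K * norm (y - u t)) * emeasure lebesgue {t..?b}"
  proof -
    have m1: "(\<lambda>r. ennreal k * indicator {p..q} r) \<in> borel_measurable lebesgue" for k p q :: real
      by (intro borel_measurable_times_ennreal borel_measurable_const borel_measurable_indicator) auto
    have m2: "(\<lambda>r. ennreal (indicator {s..t} r * d' r)) \<in> borel_measurable lebesgue"
      using dm by (rule measurable_compose) simp
    have i1: "(\<integral>\<^sup>+ r. ennreal k * indicator {p..q} r \<partial>lebesgue) = ennreal k * emeasure lebesgue {p..q}" for k p q :: real
      by (rule nn_integral_cmult_indicator) simp
    show ?thesis
      by (subst nn_integral_add[OF borel_measurable_add[OF m1 m2] m1], subst nn_integral_add[OF m1 m2]) (simp only: i1 dn)
  qed
  also have "\<dots> = ennreal (K * norm (u s - x)) + ennreal (l * (V t - V s)) + ennreal (K * norm (y - u t))"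
    by simp
  also have "\<dots> = ennreal (K * norm (u s - x) + l * (V t - V s) + K * norm (y - u t))"
    using K(1) l Vst by (simp add: ennreal_plus[symmetric] del: ennreal_plus)
  finally show ?thesis by (simp add: l_def mult.commute)
qed

end

section \<open>Compactness\<close>

lemma finite_dim_convergent_if_near_Cauchy:
  fixes f :: "nat \<Rightarrow> 'a::real_normed_vector"
  assumes fin: "finite_dim TYPE('a)"
    and near: "\<And>e. 0 < e \<Longrightarrow> \<exists>g. convergent g \<and> (\<forall>\<^sub>F n in sequentially. norm (f n - g n) \<le> e)"
  shows "convergent f"
proof (rule finite_dim_Cauchy_convergent[OF fin])
  show "Cauchy f"
    unfolding Cauchy_def
  proof (intro allI impI)
    fix e :: real assume e: "0 < e"
    then obtain g where g: "convergent g" "\<forall>\<^sub>F n in sequentially. norm (f n - g n) \<le> e / 4" using near[of "e / 4"] by auto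
    obtain n1 where n1: "\<And>n. n1 \<le> n \<Longrightarrow> norm (f n - g n) \<le> e / 4" using g(2) by (auto simp: eventually_sequentially)
    obtain n2 where n2: "\<And>m n. n2 \<le> m \<Longrightarrow> n2 \<le> n \<Longrightarrow> dist (g m) (g n) < e / 4"
      using convergent_Cauchy[OF g(1)] e unfolding Cauchy_def by (meson divide_pos_pos zero_less_numeral)
    have "dist (f m) (f n) < e" if "max n1 n2 \<le> m" "max n1 n2 \<le> n" for m n
    proof -
      have "norm (f m - f n) = norm ((f m - g m) + (g m - g n) - (f n - g n))" by simp
      then have "norm (f m - f n) \<le> norm (f m - g m) + norm (g m - g n) + norm (f n - g n)"
        using norm_triangle_ineq4[of "(f m - g m) + (g m - g n)" "f n - g n"]
          norm_triangle_ineq[of "f m - g m" "g m - g n"] by linarith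
      then show ?thesis using n1[of m] n1[of n] n2[of m n] that e by (simp add: dist_norm)
    qed
    then show "\<exists>M. \<forall>m\<ge>M. \<forall>n\<ge>M. dist (f m) (f n) < e" by blast
  qed
qed

text \<open>Compactness is taken from the real majorants: their limits on a countable dense set
  extend to a monotone \<open>G\<close>. At a continuity point of \<open>G\<close> the increments of
  \<open>W n\<close> between two neighbouring rationals are eventually small, so the values of
  \<open>f n\<close> there follow those at a rational point. The countably many discontinuities are
  added to the points on which convergence is arranged directly.\<close>

theorem Helly_selection_majorant:
  fixes f :: "nat \<Rightarrow> real \<Rightarrow> 'a::real_normed_vector" and W :: "nat \<Rightarrow> real \<Rightarrow> real"
  assumes fin: "finite_dim TYPE('a)" and T: "0 < T"
    and f_W: "\<And>n s t. 0 \<le> s \<Longrightarrow> s \<le> t \<Longrightarrow> t \<le> T \<Longrightarrow> norm (f n t - f n s) \<le> K * (W n t - W n s)"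
    and W_mono: "\<And>n s t. 0 \<le> s \<Longrightarrow> s \<le> t \<Longrightarrow> t \<le> T \<Longrightarrow> W n s \<le> W n t"
    and W_bd: "\<And>n t. t \<in> {0..T} \<Longrightarrow> \<bar>W n t\<bar> \<le> B" and f_bd: "\<And>n t. t \<in> {0..T} \<Longrightarrow> norm (f n t) \<le> R"
  obtains r where "strict_mono (r :: nat \<Rightarrow> nat)" "\<And>t. t \<in> {0..T} \<Longrightarrow> convergent (\<lambda>n. f (r n) t)"
proof -
  define S where "S = insert 0 (insert T (\<rat> \<inter> {0..T}))"
  have S: "countable S" "S \<subseteq> {0..T}" unfolding S_def using countable_rat T by (auto intro: countable_subset)
  obtain k1 where k1: "strict_mono (k1 :: nat \<Rightarrow> nat)" "\<And>q. q \<in> S \<Longrightarrow> \<exists>l. (\<lambda>n. W (k1 n) q) \<longlonglongrightarrow> l"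
    using function_convergent_subsequence[OF S(1), of W B] W_bd S(2) by (metis real_norm_def subsetD)
  then obtain L where L: "\<And>q. q \<in> S \<Longrightarrow> (\<lambda>n. W (k1 n) q) \<longlonglongrightarrow> L q" by metis
  have L_mono: "L p \<le> L q" if "p \<in> S" "q \<in> S" "p \<le> q" for p q
    using LIMSEQ_le[OF L[OF that(1)] L[OF that(2)]] W_mono that S(2) by (meson atLeastAtMost_iff subsetD)
  \<comment> \<open>Clamping makes \<open>G\<close> monotone on the whole line, so that its
    discontinuities are countable, and leaves it unchanged on \<open>{0..T}\<close>.\<close>
  define c where "c t = max 0 (min T t)" for t
  have c: "c t \<in> {0..T}" "p \<le> t \<Longrightarrow> c p \<le> c t" "t \<in> {0..T} \<Longrightarrow> c t = t" for p t using T by (auto simp: c_def)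
  define G where "G t = Sup (L ` (S \<inter> {..c t}))" for t
  have bdd: "bdd_above (L ` (S \<inter> {..z}))" for z
    by (rule bdd_aboveI[of _ "L T"]) (use S(2) in \<open>auto intro!: L_mono simp: S_def\<close>)
  have ne: "L ` (S \<inter> {..c t}) \<noteq> {}" for t using c(1)[of t] by (auto simp: S_def)
  have G_mono: "mono G"
    unfolding mono_def G_def using ne bdd c(2) by (intro allI impI cSup_subset_mono image_mono) (auto intro: order_trans)
  have G_eq: "G q = L q" if "q \<in> S" for q
  proof -
    have cq: "c q = q" using that S(2) c(3) by blast
    show ?thesis unfolding G_def cq
      by (rule cSup_eq_maximum) (use that in \<open>auto intro: L_mono\<close>)
  qed
  define D where "D = {t. \<not> isCont G t}"
  have D: "countable D" unfolding D_def using mono_ctble_discont[OF G_mono] by simp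
  have cSD: "countable (S \<union> (D \<inter> {0..T}))" using S(1) D by (auto intro: countable_Int1)
  obtain k2 where k2: "strict_mono (k2 :: nat \<Rightarrow> nat)"
    "\<And>t. t \<in> S \<union> (D \<inter> {0..T}) \<Longrightarrow> \<exists>l. (\<lambda>n. f (k1 (k2 n)) t) \<longlonglongrightarrow> l"
    by (rule finite_dim_bounded_convergent_subsequence[OF fin cSD, of "\<lambda>n t. f (k1 n) t" R])
      (use f_bd S(2) in auto)
  define r where "r n = k1 (k2 n)" for n
  have r: "strict_mono r" unfolding r_def using k1(1) k2(1) by (simp add: strict_mono_def)
  have Lr: "(\<lambda>n. W (r n) q) \<longlonglongrightarrow> L q" if "q \<in> S" for q
    using LIMSEQ_subseq_LIMSEQ[OF L[OF that] k2(1)] by (simp add: o_def r_def)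
  have "convergent (\<lambda>n. f (r n) t)" if t: "t \<in> {0..T}" for t
  proof (cases "t \<in> S \<union> (D \<inter> {0..T})")
    case True
    then show ?thesis using k2(2) unfolding r_def convergent_def by blast
  next
    case False
    then have t': "0 < t" "t < T" and cont: "isCont G t" using t by (auto simp: S_def D_def)
    show ?thesis
    proof (rule finite_dim_convergent_if_near_Cauchy[OF fin])
      fix e :: real assume e: "0 < e"
      define e' where "e' = e / (\<bar>K\<bar> + 1)"
      have e': "0 < e'" using e by (simp add: e'_def)
      obtain d where d: "0 < d" "\<And>z. \<bar>z - t\<bar> < d \<Longrightarrow> \<bar>G z - G t\<bar> < e' / 4"
      proof -
        have "0 < e' / 4" using e' by simp
        then obtain d where "0 < d" "\<forall>z. norm (z - t) < d \<longrightarrow> \<bar>G z - G t\<bar> < e' / 4"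
          using cont unfolding continuous_at_real_range by blast
        then show ?thesis using that by simp
      qed
      obtain q where q: "q \<in> \<rat>" "max 0 (t - d) < q" "q < t"
        using Rats_dense_in_real[of "max 0 (t - d)" t] t' d(1) by auto
      obtain q' where q': "q' \<in> \<rat>" "t < q'" "q' < min T (t + d)"
        using Rats_dense_in_real[of t "min T (t + d)"] t' d(1) by auto
      have qS: "q \<in> S" "q' \<in> S" using q q' t' by (auto simp: S_def)
      have "\<bar>q - t\<bar> < d" "\<bar>q' - t\<bar> < d" using q q' by auto
      then have "\<bar>G q - G t\<bar> < e' / 4" "\<bar>G q' - G t\<bar> < e' / 4" using d(2) by blast+
      then have "L q' - L q < e' / 2" using G_eq[OF qS(1)] G_eq[OF qS(2)] by linarith
      moreover have "(\<lambda>n. W (r n) q' - W (r n) q) \<longlonglongrightarrow> L q' - L q" by (intro tendsto_diff Lr qS)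
      ultimately have "\<forall>\<^sub>F n in sequentially. W (r n) q' - W (r n) q < e' / 2" by (rule order_tendstoD(2)[rotated])
      then have "\<forall>\<^sub>F n in sequentially. norm (f (r n) t - f (r n) q) \<le> e"
      proof eventually_elim
        case (elim n)
        have qt: "0 \<le> q" "q \<le> t" "t \<le> q'" "q' \<le> T" "t \<le> T" "0 \<le> t" using q q' t' by auto
        have h: "0 \<le> W (r n) t - W (r n) q" using W_mono[OF qt(1,2,5)] by simp
        have "norm (f (r n) t - f (r n) q) \<le> K * (W (r n) t - W (r n) q)" by (rule f_W[OF qt(1,2,5)])
        also have "\<dots> \<le> \<bar>K\<bar> * (W (r n) t - W (r n) q)" using h by (intro mult_right_mono) auto
        also have "\<dots> \<le> (\<bar>K\<bar> + 1) * e'"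
          using h elim W_mono[OF qt(6,3,4), of "r n"] e' by (intro mult_mono) auto
        also have "\<dots> = e" by (simp add: e'_def)
        finally show ?case .
      qed
      moreover have "convergent (\<lambda>n. f (r n) q)"
        using k2(2)[of q] qS(1) unfolding r_def convergent_def by blast
      ultimately show "\<exists>g. convergent g \<and> (\<forall>\<^sub>F n in sequentially. norm (f (r n) t - g n) \<le> e)" by blast
    qed
  qed
  then show ?thesis using that r by blast
qed

section \<open>Functions dominated by the increments of an increasing function\<close>

text \<open>The left limit of the majorant is its supremum. A sequence \<open>p n\<close> along
  which \<open>W\<close> approaches the supremum controls \<open>f\<close> on the whole interval
  from \<open>p n\<close> to \<open>t\<close>, so \<open>f\<close> converges there even if the
  \<open>p n\<close> do not tend to \<open>t\<close>.\<close>

lemma finite_dim_tendsto_at_left: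
  fixes f :: "real \<Rightarrow> 'a::real_normed_vector" and W :: "real \<Rightarrow> real"
  assumes fin: "finite_dim TYPE('a)" and "a < t"
    and dom: "\<And>p q. a < p \<Longrightarrow> p \<le> q \<Longrightarrow> q < t \<Longrightarrow> norm (f q - f p) \<le> K * (W q - W p)"
    and mon: "\<And>p q. a < p \<Longrightarrow> p \<le> q \<Longrightarrow> q < t \<Longrightarrow> W p \<le> W q" and bd: "\<And>p. a < p \<Longrightarrow> p < t \<Longrightarrow> W p \<le> B"
  obtains l w where "(f \<longlongrightarrow> l) (at_left t)" "(W \<longlongrightarrow> w) (at_left t)" "\<And>p. a < p \<Longrightarrow> p < t \<Longrightarrow> W p \<le> w"
proof -
  define w where "w = Sup (W ` {a<..<t})"
  have ne: "W ` {a<..<t} \<noteq> {}" using assms(2) by auto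
  have bdd: "bdd_above (W ` {a<..<t})" by (rule bdd_aboveI[of _ B]) (use bd in auto)
  have ub: "W p \<le> w" if "a < p" "p < t" for p unfolding w_def using bdd that by (intro cSUP_upper) auto
  have appr: "\<exists>p. a < p \<and> p < t \<and> w - e < W p" if "0 < e" for e
    using less_cSUP_iff[OF _ bdd, of "w - e"] ne that unfolding w_def[symmetric] by auto
  have ev: "\<forall>\<^sub>F q in at_left t. p < q \<and> q < t" if "p < t" for p
    using eventually_at_left_real[OF that] by eventually_elim auto
  have wlim: "(W \<longlongrightarrow> w) (at_left t)"
  proof (rule tendstoI)
    fix e :: real assume "0 < e"
    then obtain p where p: "a < p" "p < t" "w - e < W p" using appr by blast
    show "\<forall>\<^sub>F q in at_left t. dist (W q) w < e"
      using ev[OF p(2)]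
    proof eventually_elim
      case (elim q)
      then show ?case using mon[of p q] ub[of q] p by (simp add: dist_real_def)
    qed
  qed
  have "\<exists>l. (f \<longlongrightarrow> l) (at_left t)"
  proof -
    have "\<forall>n. \<exists>p. a < p \<and> p < t \<and> w - inverse (real (Suc n)) < W p" using appr by simp
    then obtain p where p: "\<And>n. a < p n" "\<And>n. p n < t" "\<And>n. w - inverse (real (Suc n)) < W (p n)" by metis
    have close: "norm (f q - f (p n)) \<le> \<bar>K\<bar> * inverse (real (Suc n))" if "p n \<le> q" "q < t" for q n
    proof -
      have "norm (f q - f (p n)) \<le> K * (W q - W (p n))" using dom[OF p(1) that] .
      also have "\<dots> \<le> \<bar>K\<bar> * (W q - W (p n))" using mon[OF p(1) that] by (intro mult_right_mono) auto
      also have "\<dots> \<le> \<bar>K\<bar> * inverse (real (Suc n))"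
        using ub[of q] p(3)[of n] p(1)[of n] that by (intro mult_left_mono) auto
      finally show ?thesis .
    qed
    have lim0: "(\<lambda>n. \<bar>K\<bar> * inverse (real (Suc n))) \<longlonglongrightarrow> 0"
      using tendsto_mult_right_zero[OF LIMSEQ_inverse_real_of_nat, of "\<bar>K\<bar>"] by simp
    have small: "\<exists>n0. \<forall>n\<ge>n0. \<bar>K\<bar> * inverse (real (Suc n)) < e" if "0 < e" for e
      using order_tendstoD(2)[OF lim0 that] unfolding eventually_sequentially .
    have "Cauchy (\<lambda>n. f (p n))"
      unfolding Cauchy_def
    proof (intro allI impI)
      fix e :: real assume "0 < e"
      then obtain n0 where n0: "\<forall>n\<ge>n0. \<bar>K\<bar> * inverse (real (Suc n)) < e" using small by blast
      have *: "norm (f (p m) - f (p n)) < e" if "p n \<le> p m" "n0 \<le> n" for m n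
        using close[OF that(1) p(2)] n0 that(2) by (meson le_less_trans)
      have "dist (f (p m)) (f (p n)) < e" if "n0 \<le> m" "n0 \<le> n" for m n
        using *[of n m] *[of m n] that by (cases "p n \<le> p m") (auto simp: dist_norm norm_minus_commute)
      then show "\<exists>M. \<forall>m\<ge>M. \<forall>n\<ge>M. dist (f (p m)) (f (p n)) < e" by blast
    qed
    then obtain l where l: "(\<lambda>n. f (p n)) \<longlonglongrightarrow> l"
      using finite_dim_Cauchy_convergent[OF fin] convergent_def by blast
    have "(f \<longlongrightarrow> l) (at_left t)"
    proof (rule tendstoI)
      fix e :: real assume e: "0 < e"
      then obtain n0 where n0: "\<forall>n\<ge>n0. \<bar>K\<bar> * inverse (real (Suc n)) < e / 2" using small[of "e / 2"] by auto
      obtain n1 where n1: "\<forall>n\<ge>n1. dist (f (p n)) l < e / 2" using l e unfolding lim_sequentially by (meson half_gt_zero)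
      define n where "n = max n0 n1"
      have n: "\<bar>K\<bar> * inverse (real (Suc n)) < e / 2" "dist (f (p n)) l < e / 2" using n0 n1 unfolding n_def by simp_all
      show "\<forall>\<^sub>F q in at_left t. dist (f q) l < e"
        using ev[OF p(2)[of n]]
      proof eventually_elim
        case (elim q)
        have "dist (f q) (f (p n)) < e / 2" using close[of n q] elim n(1) by (simp add: dist_norm)
        then show ?case using n(2) dist_triangle_half_r[of "f (p n)" "f q" e l] by (simp add: dist_commute)
      qed
    qed
    then show ?thesis by blast
  qed
  then show ?thesis using that wlim ub by blast
qed

lemma finite_dim_tendsto_at_right:
  fixes f :: "real \<Rightarrow> 'a::real_normed_vector" and W :: "real \<Rightarrow> real"
  assumes fin: "finite_dim TYPE('a)" and "t < b"
    and dom: "\<And>p q. t < p \<Longrightarrow> p \<le> q \<Longrightarrow> q < b \<Longrightarrow> norm (f q - f p) \<le> K * (W q - W p)"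
    and mon: "\<And>p q. t < p \<Longrightarrow> p \<le> q \<Longrightarrow> q < b \<Longrightarrow> W p \<le> W q" and bd: "\<And>p. t < p \<Longrightarrow> p < b \<Longrightarrow> B \<le> W p"
  obtains l w where "(f \<longlongrightarrow> l) (at_right t)" "(W \<longlongrightarrow> w) (at_right t)" "\<And>p. t < p \<Longrightarrow> p < b \<Longrightarrow> w \<le> W p"
proof -
  obtain l w where lw: "((\<lambda>s. f (- s)) \<longlongrightarrow> l) (at_left (- t))" "((\<lambda>s. - W (- s)) \<longlongrightarrow> w) (at_left (- t))"
    "\<And>p. - b < p \<Longrightarrow> p < - t \<Longrightarrow> - W (- p) \<le> w"
  proof (rule finite_dim_tendsto_at_left[OF fin, of "- b" "- t" "\<lambda>s. f (- s)" K "\<lambda>s. - W (- s)" "- B"])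
    fix p q assume pq: "- b < p" "p \<le> q" "q < - t"
    show "norm (f (- q) - f (- p)) \<le> K * (- W (- q) - - W (- p))"
      using dom[of "- q" "- p"] pq by (simp add: norm_minus_commute)
    show "- W (- p) \<le> - W (- q)" using mon[of "- q" "- p"] pq by simp
  next
    fix p assume "- b < p" "p < - t"
    then show "- W (- p) \<le> - B" using bd[of "- p"] by simp
  qed (use assms(2) in auto)
  have "(f \<longlongrightarrow> l) (at_right t)" using lw(1) by (subst at_right_minus) (simp add: filterlim_filtermap)
  moreover have "((\<lambda>s. - (- W s)) \<longlongrightarrow> - w) (at_right t)"
    using tendsto_minus[OF lw(2)] by (subst at_right_minus) (simp add: filterlim_filtermap)
  moreover have "- w \<le> W p" if "t < p" "p < b" for p using lw(3)[of "- p"] that by simp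
  ultimately show ?thesis using that[of l "- w"] by simp
qed

section \<open>The vanishing viscosity limit\<close>

context energy_system
begin

lemma viscous_curveI: "0 < \<epsilon> \<Longrightarrow> viscous_solution T E \<Psi> \<epsilon> u \<Longrightarrow> viscous_curve \<Psi>\<^sub>0 \<Psi> T C E \<epsilon> u"
  by unfold_locales

text \<open>Convergent initial values bound the initial energies; Gronwall's inequality then bounds
  the energies and with them the power \<open>Et\<close>. This bounds the dissipation, whose
  increments control the distance from the initial value. All constants are independent of
  \<open>k\<close>.\<close>

lemma uniform_bounds:
  assumes eps: "\<And>k. 0 < \<epsilon> k" and sol: "\<And>k. viscous_solution T E \<Psi> (\<epsilon> k) (v k)"
    and init: "(\<lambda>k::nat. v k 0) \<longlonglongrightarrow> u0"
  obtains R B where "0 < R" "\<And>k t. t \<in> {0..T} \<Longrightarrow> norm (v k t) \<le> R"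
    "\<And>k t. t \<in> {0..T} \<Longrightarrow> 0 \<le> viscous_curve.V T E (v k) t \<and> viscous_curve.V T E (v k) t \<le> B"
proof -
  obtain R0 where R0: "0 < R0" "\<And>k. norm (v k 0) \<le> R0"
    using convergent_imp_Bseq[OF convergentI[OF init]] unfolding Bseq_def by blast
  obtain M where M: "0 < M" "\<And>s t x y. s \<in> {0..T} \<Longrightarrow> t \<in> {0..T} \<Longrightarrow> norm x \<le> R0 \<Longrightarrow> norm y \<le> R0 \<Longrightarrow>
       \<bar>E t y - E s x\<bar> \<le> M * \<bar>t - s\<bar> + M * norm (y - x)"
    by (rule cylinder_bounds) blast
  obtain c where c: "0 < c" "\<And>v. c * norm v \<le> \<Psi>\<^sub>0 v" using gauge_lower_bound by blast
  have 0: "0 \<in> {0..T}" using T_pos by simp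
  define e0 where "e0 = \<bar>E 0 0\<bar> + M * R0"
  have e0: "E 0 (v k 0) \<le> e0" for k
  proof -
    have "\<bar>E 0 (v k 0) - E 0 0\<bar> \<le> M * norm (v k 0)" using M(2)[OF 0 0, of 0 "v k 0"] R0 by simp
    also have "\<dots> \<le> M * R0" using R0 M by (intro mult_left_mono) auto
    finally show ?thesis by (simp add: e0_def)
  qed
  \<comment> \<open>\<open>B1\<close> bounds \<open>1 + C + E\<close> along every curve. The three
    summands of \<open>B\<close> estimate the three terms of \<open>V\<close>: initial energy, work,
    and minus the final energy, which is at most \<open>C\<close>.\<close>
  define B1 where "B1 = (1 + C + e0) * exp (C * T)"
  define B where "B = e0 + C * B1 * T + C"
  have V: "0 \<le> viscous_curve.V T E (v k) t \<and> viscous_curve.V T E (v k) t \<le> B"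
    and d: "c * norm (v k t - v k 0) \<le> viscous_curve.V T E (v k) t" if t: "t \<in> {0..T}" for k t
  proof -
    interpret c: viscous_curve \<Psi>\<^sub>0 \<Psi> T C E "\<epsilon> k" "v k" by (rule viscous_curveI[OF eps sol])
    have yb: "1 + C + E s (v k s) \<le> B1" if "s \<in> {0..T}" for s
    proof -
      have "1 + C + E s (v k s) \<le> (1 + C + E 0 (v k 0)) * exp (C * T)" by (rule c.energy_bound[OF that])
      also have "\<dots> \<le> B1" unfolding B1_def using e0[of k] by (intro mult_right_mono) auto
      finally show ?thesis .
    qed
    have Etb: "\<bar>Et s (v k s)\<bar> \<le> C * B1" if "s \<in> {0..T}" for s
    proof -
      have "\<bar>Et s (v k s)\<bar> \<le> C * (1 + max 0 (E s (v k s)))" by (rule E_dt_bound[OF that])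
      also have "\<dots> \<le> C * B1"
        using yb[OF that] E_bdd_below[OF that, of "v k s"] C_pos by (intro mult_left_mono) auto
      finally show ?thesis .
    qed
    have B1: "0 \<le> C * B1" using Etb[OF 0] by (meson abs_ge_zero order_trans)
    have "norm (integral {0..t} (\<lambda>s. Et s (v k s))) \<le> C * B1 * (t - 0)"
      using t Etb by (intro integral_bound continuous_on_subset[OF c.Et_cont]) auto
    also have "\<dots> \<le> C * B1 * T" using t B1 by (intro mult_left_mono) auto
    finally have "c.V t \<le> B"
      using e0[of k] E_bdd_below[OF t, of "v k t"] unfolding c.V_def B_def by simp
    moreover have inc: "\<Psi>\<^sub>0 (v k t - v k 0) \<le> c.V t" using c.gauge_increment[of 0 t] t c.V_0 by simp
    ultimately show "0 \<le> c.V t \<and> c.V t \<le> B" using gauge_nonneg[of "v k t - v k 0"] by linarith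
    show "c * norm (v k t - v k 0) \<le> c.V t" using c(2)[of "v k t - v k 0"] inc by linarith
  qed
  have "norm (v k t) \<le> R0 + B / c" if t: "t \<in> {0..T}" for k t
  proof -
    have "c * norm (v k t - v k 0) \<le> B" using V[OF t, of k] d[OF t, of k] by linarith
    then have "norm (v k t - v k 0) \<le> B / c" using c(1) by (simp add: field_simps)
    then show ?thesis using R0(2)[of k] norm_triangle_sub[of "v k t" "v k 0"] by linarith
  qed
  moreover have "0 < R0 + B / c" using R0(1) V[OF 0, of 0] c(1) by (intro add_pos_nonneg) auto
  ultimately show ?thesis using that V by blast
qed

end

section \<open>The limit curve: dissipation, stability, and the cost of short transitions\<close>

locale viscosity_limit = energy_system \<Psi>\<^sub>0 \<Psi> T C E
  for \<Psi>\<^sub>0 \<Psi> :: "'a::real_normed_vector \<Rightarrow> real" and T C E +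
  fixes \<epsilon> :: "nat \<Rightarrow> real" and v :: "nat \<Rightarrow> real \<Rightarrow> 'a" and u :: "real \<Rightarrow> 'a" and R B :: real
  assumes eps_pos: "\<And>k. 0 < \<epsilon> k" and eps_lim: "\<epsilon> \<longlonglongrightarrow> 0"
    and v_sol: "\<And>k. viscous_solution T E \<Psi> (\<epsilon> k) (v k)"
    and v_lim: "\<And>t. t \<in> {0..T} \<Longrightarrow> (\<lambda>k. v k t) \<longlonglongrightarrow> u t"
    and v_bd: "\<And>k t. t \<in> {0..T} \<Longrightarrow> norm (v k t) \<le> R"
    and Vk_bd: "\<And>k t. t \<in> {0..T} \<Longrightarrow> viscous_curve.V T E (v k) t \<le> B"
begin

abbreviation "Vk k \<equiv> viscous_curve.V T E (v k)"

lemma curve: "viscous_curve \<Psi>\<^sub>0 \<Psi> T C E (\<epsilon> k) (v k)"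
  by (rule viscous_curveI[OF eps_pos v_sol])

definition V :: "real \<Rightarrow> real" where
  "V t = E 0 (u 0) + integral {0..t} (\<lambda>s. Et s (u s)) - E t (u t)"

text \<open>A lower constant of the gauge, made global because \<open>1 / c0\<close> has to appear
  as an argument of the \<open>stieltjes\<close> locale.\<close>

definition c0 :: real where "c0 = (SOME c. 0 < c \<and> (\<forall>v. c * norm v \<le> \<Psi>\<^sub>0 v))"

lemma c0: "0 < c0" "c0 * norm z \<le> \<Psi>\<^sub>0 z"
proof -
  have "\<exists>c. 0 < c \<and> (\<forall>v. c * norm v \<le> \<Psi>\<^sub>0 v)" using gauge_lower_bound by metis
  from someI_ex[OF this, folded c0_def] show "0 < c0" "c0 * norm z \<le> \<Psi>\<^sub>0 z" by auto
qed

lemma u_bd: "t \<in> {0..T} \<Longrightarrow> norm (u t) \<le> R"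
  using LIMSEQ_le_const2[OF tendsto_norm[OF v_lim]] v_bd by blast

lemma lim_along:
  fixes G :: "real \<Rightarrow> 'a \<Rightarrow> 'c::topological_space"
  assumes G: "continuous_on ({0..T} \<times> UNIV) (\<lambda>z. G (fst z) (snd z))" and t: "t \<in> {0..T}"
  shows "(\<lambda>k. G t (v k t)) \<longlonglongrightarrow> G t (u t)"
  by (rule along_tendsto[OF G tendsto_const v_lim[OF t]]) (use t in auto)

lemma dominated_along:
  fixes G :: "real \<Rightarrow> 'a \<Rightarrow> real"
  assumes G: "continuous_on ({0..T} \<times> UNIV) (\<lambda>z. G (fst z) (snd z))" and t: "t \<in> {0..T}"
  shows "(\<lambda>s. G s (u s)) integrable_on {0..t}"
    and "(\<lambda>k. integral {0..t} (\<lambda>s. G s (v k s))) \<longlonglongrightarrow> integral {0..t} (\<lambda>s. G s (u s))"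
proof -
  have "compact ((\<lambda>z. G (fst z) (snd z)) ` ({0..T} \<times> cball (0::'a) R))"
    by (intro compact_continuous_image compact_cyl continuous_on_subset[OF G]) auto
  then obtain b where b: "\<forall>z\<in>(\<lambda>z. G (fst z) (snd z)) ` ({0..T} \<times> cball (0::'a) R). norm z \<le> b"
    using compact_imp_bounded bounded_iff by metis
  have Gb: "norm (G s (v k s)) \<le> b" if "s \<in> {0..t}" for k s
  proof -
    have "(s, v k s) \<in> {0..T} \<times> cball (0::'a) R" using that t v_bd[of s k] by auto
    then have "G (fst (s, v k s)) (snd (s, v k s)) \<in> (\<lambda>z. G (fst z) (snd z)) ` ({0..T} \<times> cball (0::'a) R)"
      by (rule imageI)
    then have "norm (G (fst (s, v k s)) (snd (s, v k s))) \<le> b" by (rule bspec[OF b])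
    then show ?thesis by simp
  qed
  have int: "(\<lambda>s. G s (v k s)) integrable_on {0..t}" for k
  proof -
    interpret c: viscous_curve \<Psi>\<^sub>0 \<Psi> T C E "\<epsilon> k" "v k" by (rule curve)
    show ?thesis
      using t by (intro integrable_continuous_real continuous_on_subset[OF along_continuous[OF G c.u_cont]]) auto
  qed
  have lim: "(\<lambda>k. G s (v k s)) \<longlonglongrightarrow> G s (u s)" if "s \<in> {0..t}" for s
    using that t by (intro lim_along[OF G]) auto
  show "(\<lambda>s. G s (u s)) integrable_on {0..t}"
    by (rule dominated_convergence(1)[OF int integrable_const_ivl Gb lim])
  show "(\<lambda>k. integral {0..t} (\<lambda>s. G s (v k s))) \<longlonglongrightarrow> integral {0..t} (\<lambda>s. G s (u s))"
    by (rule dominated_convergence(2)[OF int integrable_const_ivl Gb lim])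
qed

lemma Vk_lim:
  assumes t: "t \<in> {0..T}"
  shows "(\<lambda>k. Vk k t) \<longlonglongrightarrow> V t"
proof -
  have 0: "0 \<in> {0..T}" using T_pos by simp
  have "(\<lambda>k. E 0 (v k 0) + integral {0..t} (\<lambda>s. Et s (v k s)) - E t (v k t)) \<longlonglongrightarrow> V t"
    unfolding V_def
    by (intro tendsto_diff tendsto_add lim_along[OF E_continuous 0] lim_along[OF E_continuous t] dominated_along(2)[OF Et_continuous t])
  moreover have "Vk k t = E 0 (v k 0) + integral {0..t} (\<lambda>s. Et s (v k s)) - E t (v k t)" for k
  proof -
    interpret c: viscous_curve \<Psi>\<^sub>0 \<Psi> T C E "\<epsilon> k" "v k" by (rule curve)
    show ?thesis by (rule c.V_def)
  qed
  ultimately show ?thesis by simp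
qed

lemma V_0: "V 0 = 0"
  by (simp add: V_def)

lemma gauge_increment:
  assumes st: "0 \<le> s" "s \<le> t" "t \<le> T"
  shows "\<Psi>\<^sub>0 (u t - u s) \<le> V t - V s"
proof (rule LIMSEQ_le)
  show "(\<lambda>k. \<Psi>\<^sub>0 (v k t - v k s)) \<longlonglongrightarrow> \<Psi>\<^sub>0 (u t - u s)"
    using st by (intro gauge_tendsto tendsto_diff v_lim) auto
  show "(\<lambda>k. Vk k t - Vk k s) \<longlonglongrightarrow> V t - V s" using st by (intro tendsto_diff Vk_lim) auto
  have "\<Psi>\<^sub>0 (v k t - v k s) \<le> Vk k t - Vk k s" for k
  proof -
    interpret c: viscous_curve \<Psi>\<^sub>0 \<Psi> T C E "\<epsilon> k" "v k" by (rule curve)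
    show ?thesis by (rule c.gauge_increment[OF st])
  qed
  then show "\<exists>N. \<forall>k\<ge>N. \<Psi>\<^sub>0 (v k t - v k s) \<le> Vk k t - Vk k s" by blast
qed

lemma V_mono: "0 \<le> s \<Longrightarrow> s \<le> t \<Longrightarrow> t \<le> T \<Longrightarrow> V s \<le> V t"
  using gauge_increment[of s t] gauge_nonneg[of "u t - u s"] by linarith

lemma norm_increment:
  assumes "0 \<le> s" "s \<le> t" "t \<le> T"
  shows "norm (u t - u s) \<le> 1 / c0 * (V t - V s)"
  using gauge_increment[OF assms] c0(2)[of "u t - u s"] c0(1) by (simp add: field_simps)

lemma stability_ae:
  obtains N where "negligible N" "\<And>t z. t \<in> {0..T} - N \<Longrightarrow> blinfun_apply (- DE t (u t)) z \<le> \<Psi>\<^sub>0 z"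
proof -
  let ?G = "\<lambda>t x. \<Psi>s (- DE t x)"
  have G: "continuous_on ({0..T} \<times> UNIV) (\<lambda>z. ?G (fst z) (snd z))"
    by (rule continuous_on_compose2[OF conjugate_continuous continuous_on_minus[OF DE_continuous]]) auto
  have T: "T \<in> {0..T}" using T_pos by simp
  note d = dominated_along[OF G T]
  have "integral {0..T} (\<lambda>s. ?G s (u s)) \<le> 0"
  proof (rule LIMSEQ_le[OF d(2)])
    show "(\<lambda>k. \<epsilon> k * Vk k T) \<longlonglongrightarrow> 0" using tendsto_mult[OF eps_lim Vk_lim[OF T]] by simp
    have "integral {0..T} (\<lambda>s. ?G s (v k s)) \<le> \<epsilon> k * Vk k T" for k
    proof -
      interpret c: viscous_curve \<Psi>\<^sub>0 \<Psi> T C E "\<epsilon> k" "v k" by (rule curve)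
      show ?thesis by (rule c.conjugate_integral)
    qed
    then show "\<exists>N. \<forall>k\<ge>N. integral {0..T} (\<lambda>s. ?G s (v k s)) \<le> \<epsilon> k * Vk k T" by blast
  qed
  moreover have "0 \<le> integral {0..T} (\<lambda>s. ?G s (u s))"
    using d(1) by (intro integral_nonneg) (auto simp: conjugate_nonneg)
  ultimately have "((\<lambda>s. ?G s (u s)) has_integral 0) {0..T}" using d(1) by (simp add: has_integral_iff)
  then have hi: "((\<lambda>s. ?G s (u s)) has_integral 0) {0..T}" .
  have meas: "(\<lambda>s. indicator {0..T} s * ?G s (u s)) \<in> borel_measurable lebesgue"
    using has_integral_implies_lebesgue_measurable[OF hi] by simp
  have "(\<integral>\<^sup>+ s. ennreal (indicator {0..T} s * ?G s (u s)) \<partial>lebesgue) = 0"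
    unfolding nn_integral_completion using nn_integral_has_integral_lebesgue[OF _ hi] by (simp add: conjugate_nonneg)
  then have "AE s in lebesgue. ennreal (indicator {0..T} s * ?G s (u s)) = 0"
    using meas by (subst (asm) nn_integral_0_iff_AE) auto
  then obtain N where N: "N \<in> null_sets lebesgue" "{s \<in> space lebesgue. \<not> ennreal (indicator {0..T} s * ?G s (u s)) = 0} \<subseteq> N"
    unfolding eventually_ae_filter by blast
  have "blinfun_apply (- DE t (u t)) z \<le> \<Psi>\<^sub>0 z" if t: "t \<in> {0..T} - N" for t z
  proof (rule conjugate_zero_imp_le)
    have "ennreal (indicator {0..T} t * ?G t (u t)) = 0"
    proof (rule ccontr)
      assume "\<not> ?thesis"
      then have "t \<in> N" by (intro subsetD[OF N(2)]) simp
      then show False using t by simp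
    qed
    then show "?G t (u t) = 0" using t conjugate_nonneg[of "- DE t (u t)"] by (simp add: ennreal_eq_0_iff)
  qed
  then show ?thesis using that N(1) by (simp add: negligible_iff_null_sets)
qed

text \<open>The energy balance is stated with the Lebesgue integral, the estimates use the
  Henstock-Kurzweil integral. They agree because the integrand is bounded and, as a pointwise limit
  of continuous functions on the interval, measurable.\<close>

lemma Lebesgue_integral_Et:
  assumes t: "t \<in> {0..T}"
  shows "(LINT s:{0..t}|lborel. Et s (u s)) = integral {0..t} (\<lambda>s. Et s (u s))"
proof -
  obtain M where M: "0 < M" "\<And>t x. t \<in> {0..T} \<Longrightarrow> norm x \<le> R \<Longrightarrow> \<bar>Et t x\<bar> \<le> M"
    by (rule cylinder_bounds) blast
  have "(\<lambda>s. indicator {0..t} s *\<^sub>R Et s (u s)) \<in> borel_measurable lborel"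
  proof (rule borel_measurable_LIMSEQ_real)
    show "(\<lambda>k. indicator {0..t} s *\<^sub>R Et s (v k s)) \<longlonglongrightarrow> indicator {0..t} s *\<^sub>R Et s (u s)" for s
      using lim_along[OF Et_continuous, of s] t by (cases "s \<in> {0..t}") auto
    show "(\<lambda>s. indicator {0..t} s *\<^sub>R Et s (v k s)) \<in> borel_measurable lborel" for k
    proof -
      interpret c: viscous_curve \<Psi>\<^sub>0 \<Psi> T C E "\<epsilon> k" "v k" by (rule curve)
      have "(\<lambda>s. indicator {0..t} s *\<^sub>R Et s (v k s)) \<in> borel_measurable borel"
        using t by (intro borel_measurable_continuous_on_indicator continuous_on_subset[OF c.Et_cont]) auto
      then show ?thesis by simp
    qed
  qed
  then have "set_integrable lborel {0..t} (\<lambda>s. Et s (u s))"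
    unfolding set_integrable_def
  proof (rule Bochner_Integration.integrable_bound[rotated])
    show "integrable lborel (\<lambda>s. indicator {0..t} s *\<^sub>R M)" by (rule borel_integrable_compact) auto
    show "AE s in lborel. norm (indicator {0..t} s *\<^sub>R Et s (u s)) \<le> norm (indicator {0..t} s *\<^sub>R M)"
    proof (rule AE_I2)
      fix s show "norm (indicator {0..t} s *\<^sub>R Et s (u s)) \<le> norm (indicator {0..t} s *\<^sub>R M)"
        using M(2)[of s "u s"] u_bd[of s] t M(1) by (cases "s \<in> {0..t}") auto
    qed
  qed
  then show ?thesis by (rule set_borel_integral_eq_integral(2))
qed

text \<open>The constants of \<open>finsler_upper\<close> come from the common bound
  \<open>R\<close> and do not depend on \<open>k\<close>. For fixed \<open>s\<close> and
  \<open>t\<close> the estimate therefore passes to the limit, using convergence of the curves and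
  of their dissipation at these two times only.\<close>

lemma finsler_approx:
  assumes "0 < \<eta>"
  obtains d K where "0 < d" "0 < K"
    "\<And>s t \<tau> x y. 0 \<le> s \<Longrightarrow> s < t \<Longrightarrow> t \<le> T \<Longrightarrow> t - s < d \<Longrightarrow> \<tau> \<in> {s..t} \<Longrightarrow> norm x \<le> R \<Longrightarrow> norm y \<le> R \<Longrightarrow>
       finsler_cost (contact_potential \<Psi>) E \<tau> x y \<le> ennreal (K * norm (u s - x) + (V t - V s) * (1 + \<eta> / c0) + K * norm (y - u t))"
proof -
  obtain M where M: "\<And>t x. t \<in> {0..T} \<Longrightarrow> norm x \<le> R \<Longrightarrow> norm (DE t x) \<le> M"
    by (rule cylinder_bounds) blast
  obtain K where K: "0 < K" "\<And>v w. norm w \<le> M \<Longrightarrow> contact_potential \<Psi> v w \<le> ereal (K * norm v)"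
    by (rule contact_norm_bound) blast
  obtain \<omega> where \<omega>: "0 < \<omega>" "\<And>v w w' e. 0 < e \<Longrightarrow> norm w \<le> M \<Longrightarrow> norm w' \<le> M \<Longrightarrow> norm (w' - w) \<le> \<omega> \<Longrightarrow>
       contact_potential \<Psi> v w' \<le> ereal (\<Psi>v e v + \<Psi>s w / e + \<eta> * norm v)"
    by (rule contact_frozen[OF assms]) blast
  obtain d where d: "0 < d"
    "\<And>s t x y. s \<in> {0..T} \<Longrightarrow> t \<in> {0..T} \<Longrightarrow> norm x \<le> R \<Longrightarrow> norm y \<le> R \<Longrightarrow> \<bar>t - s\<bar> < d \<Longrightarrow> norm (y - x) < d \<Longrightarrow>
       norm (DE t y - DE s x) \<le> \<omega> \<and> \<bar>Et t y - Et s x\<bar> \<le> \<omega>"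
    by (rule cylinder_modulus[OF \<omega>(1)]) blast
  have "finsler_cost (contact_potential \<Psi>) E \<tau> x y \<le> ennreal (K * norm (u s - x) + (V t - V s) * (1 + \<eta> / c0) + K * norm (y - u t))"
    if h: "0 \<le> s" "s < t" "t \<le> T" "t - s < d" "\<tau> \<in> {s..t}" "norm x \<le> R" "norm y \<le> R" for s t \<tau> x y
  proof (rule LIMSEQ_le_const)
    show "(\<lambda>k. ennreal (K * norm (v k s - x) + (Vk k t - Vk k s) * (1 + \<eta> / c0) + K * norm (y - v k t)))
        \<longlonglongrightarrow> ennreal (K * norm (u s - x) + (V t - V s) * (1 + \<eta> / c0) + K * norm (y - u t))"
      using h by (intro tendsto_ennrealI tendsto_intros v_lim Vk_lim) auto
    have "finsler_cost (contact_potential \<Psi>) E \<tau> x y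
        \<le> ennreal (K * norm (v k s - x) + (Vk k t - Vk k s) * (1 + \<eta> / c0) + K * norm (y - v k t))" for k
    proof -
      interpret c: viscous_curve \<Psi>\<^sub>0 \<Psi> T C E "\<epsilon> k" "v k" by (rule curve)
      show ?thesis
      proof (rule c.finsler_upper[OF h(1-3,5-7) v_bd M K assms \<omega>(2) _ c0])
        fix r assume r: "r \<in> {s..t}"
        have "norm (DE r (v k r) - DE \<tau> (v k r)) \<le> \<omega> \<and> \<bar>Et r (v k r) - Et \<tau> (v k r)\<bar> \<le> \<omega>"
          using r h d(1) by (intro d(2) v_bd) auto
        then show "norm (DE r (v k r) - DE \<tau> (v k r)) \<le> \<omega>" by simp
      qed
    qed
    then show "\<exists>N. \<forall>k\<ge>N. finsler_cost (contact_potential \<Psi>) E \<tau> x y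
        \<le> ennreal (K * norm (v k s - x) + (Vk k t - Vk k s) * (1 + \<eta> / c0) + K * norm (y - v k t))" by blast
  qed
  then show ?thesis using that d(1) K(1) by blast
qed

end

lemma interval_meets_co_negligible:
  fixes a b :: real
  assumes "negligible N" "a < b"
  obtains q where "q \<in> {a<..<b}" "q \<notin> N"
proof -
  have "\<not> {a<..<b} \<subseteq> N"
    using open_not_negligible[of "{a<..<b}"] negligible_subset[OF assms(1)] assms(2) by fastforce
  then show ?thesis using that by blast
qed

section \<open>One-sided limits and the cost of jumps\<close>

context viscosity_limit
begin

text \<open>Initial energy plus external work. Its continuity is the reason why a jump of
  \<open>V\<close> equals the energy released by the corresponding jump of \<open>u\<close>.\<close>

definition P :: "real \<Rightarrow> real" where
  "P t = E 0 (u 0) + integral {0..t} (\<lambda>s. Et s (u s))"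

lemma V_eq: "V t = P t - E t (u t)"
  by (simp add: V_def P_def)

lemma Et_integrable: "(\<lambda>s. Et s (u s)) integrable_on {0..T}"
  using T_pos by (intro dominated_along(1)[OF Et_continuous]) auto

lemma P_continuous: "continuous_on {0..T} P"
  unfolding P_def by (intro continuous_intros indefinite_integral_continuous_1 Et_integrable)

lemma V_tendsto:
  assumes "((\<lambda>s. s) \<longlongrightarrow> t) G" "(u \<longlongrightarrow> x) G" "t \<in> {0..T}" "\<forall>\<^sub>F s in G. s \<in> {0..T}"
  shows "(V \<longlongrightarrow> P t - E t x) G"
  unfolding V_eq[abs_def]
  by (intro tendsto_diff along_tendsto[OF E_continuous] assms continuous_on_tendsto_compose[OF P_continuous])

lemma left_limits:
  assumes t: "0 < t" "t \<le> T"
  shows "(u \<longlongrightarrow> left_lim u t) (at_left t)" "(V \<longlongrightarrow> left_lim V t) (at_left t)"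
    and "V t - left_lim V t = E t (left_lim u t) - E t (u t)"
    and "\<forall>\<^sub>F s in at_left t. s \<in> {0..T}" "norm (left_lim u t) \<le> R"
    and "\<And>p. 0 \<le> p \<Longrightarrow> p < t \<Longrightarrow> V p \<le> left_lim V t" "left_lim V t \<le> V t"
proof -
  obtain l w where lw: "(u \<longlongrightarrow> l) (at_left t)" "(V \<longlongrightarrow> w) (at_left t)"
  proof (rule finite_dim_tendsto_at_left[OF fin t(1), of u "1 / c0" V "V T"])
    show "norm (u q - u p) \<le> 1 / c0 * (V q - V p)" "V p \<le> V q" if "0 < p" "p \<le> q" "q < t" for p q
      using that t norm_increment[of p q] V_mono[of p q] by linarith+
    show "V p \<le> V T" if "0 < p" "p < t" for p using that t by (auto intro!: V_mono)
  qed blast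
  have eq: "left_lim u t = l" "left_lim V t = w"
    using t lw by (simp_all add: left_lim_def tendsto_Lim)
  show u: "(u \<longlongrightarrow> left_lim u t) (at_left t)" and V: "(V \<longlongrightarrow> left_lim V t) (at_left t)"
    using lw eq by simp_all
  have ev: "\<forall>\<^sub>F s in at_left t. s \<in> {p<..<t}" if "p < t" for p using eventually_at_left_real[OF that] .
  show ev': "\<forall>\<^sub>F s in at_left t. s \<in> {0..T}"
    using ev[OF t(1)] by eventually_elim (use t in auto)
  have "left_lim V t = P t - E t (left_lim u t)"
    by (rule tendsto_unique[OF _ V V_tendsto[OF tendsto_ident_at u _ ev']]) (use t in auto)
  then show "V t - left_lim V t = E t (left_lim u t) - E t (u t)" by (simp add: V_eq)
  show "norm (left_lim u t) \<le> R"
  proof (rule tendsto_upperbound[OF tendsto_norm[OF u]])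
    show "\<forall>\<^sub>F s in at_left t. norm (u s) \<le> R" using ev' by eventually_elim (rule u_bd)
  qed simp
  show "V p \<le> left_lim V t" if "0 \<le> p" "p < t" for p
  proof (rule tendsto_lowerbound[OF V])
    show "\<forall>\<^sub>F s in at_left t. V p \<le> V s" using ev[OF that(2)] by eventually_elim (use that t in \<open>auto intro!: V_mono\<close>)
  qed simp
  show "left_lim V t \<le> V t"
  proof (rule tendsto_upperbound[OF V])
    show "\<forall>\<^sub>F s in at_left t. V s \<le> V t" using ev[OF t(1)] by eventually_elim (use t in \<open>auto intro!: V_mono\<close>)
  qed simp
qed

lemma right_limits:
  assumes t: "0 \<le> t" "t < T"
  shows "(u \<longlongrightarrow> right_lim T u t) (at_right t)" "(V \<longlongrightarrow> right_lim T V t) (at_right t)"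
    and "right_lim T V t - V t = E t (u t) - E t (right_lim T u t)"
    and "\<forall>\<^sub>F s in at_right t. s \<in> {0..T}" "norm (right_lim T u t) \<le> R"
    and "V t \<le> right_lim T V t"
proof -
  obtain l w where lw: "(u \<longlongrightarrow> l) (at_right t)" "(V \<longlongrightarrow> w) (at_right t)"
  proof (rule finite_dim_tendsto_at_right[OF fin t(2), of u "1 / c0" V "V t"])
    show "norm (u q - u p) \<le> 1 / c0 * (V q - V p)" "V p \<le> V q" if "t < p" "p \<le> q" "q < T" for p q
      using that t norm_increment[of p q] V_mono[of p q] by linarith+
    show "V t \<le> V p" if "t < p" "p < T" for p using that t by (auto intro!: V_mono)
  qed blast
  have eq: "right_lim T u t = l" "right_lim T V t = w"
    using t lw by (simp_all add: right_lim_def tendsto_Lim)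
  show u: "(u \<longlongrightarrow> right_lim T u t) (at_right t)" and V: "(V \<longlongrightarrow> right_lim T V t) (at_right t)"
    using lw eq by simp_all
  have ev: "\<forall>\<^sub>F s in at_right t. s \<in> {t<..<T}" using eventually_at_right_real[OF t(2)] .
  show ev': "\<forall>\<^sub>F s in at_right t. s \<in> {0..T}"
    using ev by eventually_elim (use t in auto)
  have "right_lim T V t = P t - E t (right_lim T u t)"
    by (rule tendsto_unique[OF _ V V_tendsto[OF tendsto_ident_at u _ ev']]) (use t in auto)
  then show "right_lim T V t - V t = E t (u t) - E t (right_lim T u t)" by (simp add: V_eq)
  show "norm (right_lim T u t) \<le> R"
  proof (rule tendsto_upperbound[OF tendsto_norm[OF u]])
    show "\<forall>\<^sub>F s in at_right t. norm (u s) \<le> R" using ev' by eventually_elim (rule u_bd)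
  qed simp
  show "V t \<le> right_lim T V t"
  proof (rule tendsto_lowerbound[OF V])
    show "\<forall>\<^sub>F s in at_right t. V t \<le> V s" using ev by eventually_elim (use t in \<open>auto intro!: V_mono\<close>)
  qed simp
qed

text \<open>One statement serves both sides of a jump: the intervals \<open>{a s..b s}\<close>
  shrink to \<open>\<tau>\<close> while the states at their ends tend to \<open>x\<close> and
  \<open>y\<close>. The connecting segments then cost nothing in the limit, and the factor
  \<open>1 + \<eta> / c0\<close> disappears as \<open>\<eta>\<close> tends to 0.\<close>

lemma finsler_limit:
  fixes G :: "real filter"
  assumes G: "G \<noteq> bot" and ab: "\<forall>\<^sub>F s in G. 0 \<le> a s \<and> a s < b s \<and> b s \<le> T \<and> \<tau> \<in> {a s..b s}"
    and ba: "((\<lambda>s. b s - a s) \<longlongrightarrow> 0) G" and xy: "norm x \<le> R" "norm y \<le> R"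
    and lim: "((\<lambda>s. u (a s)) \<longlongrightarrow> x) G" "((\<lambda>s. u (b s)) \<longlongrightarrow> y) G" "((\<lambda>s. V (b s) - V (a s)) \<longlongrightarrow> w) G"
  shows "finsler_cost (contact_potential \<Psi>) E \<tau> x y \<le> ennreal w"
proof (rule tendsto_lowerbound)
  have "((\<lambda>\<eta>. ennreal (w * (1 + \<eta> / c0))) \<longlongrightarrow> ennreal (w * (1 + 0 / c0))) (at_right 0)"
    using c0(1) by (intro tendsto_ennrealI tendsto_intros) auto
  then show "((\<lambda>\<eta>. ennreal (w * (1 + \<eta> / c0))) \<longlongrightarrow> ennreal w) (at_right 0)" by simp
  show "\<forall>\<^sub>F \<eta> in at_right 0. finsler_cost (contact_potential \<Psi>) E \<tau> x y \<le> ennreal (w * (1 + \<eta> / c0))"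
    unfolding eventually_at_filter
  proof (rule always_eventually, intro allI impI)
    fix \<eta> :: real assume "\<eta> \<in> {0<..}"
    then have "0 < \<eta>" by simp
    from finsler_approx[OF this] obtain d K where d: "0 < d" "0 < K"
      "\<And>s t \<tau> x y. 0 \<le> s \<Longrightarrow> s < t \<Longrightarrow> t \<le> T \<Longrightarrow> t - s < d \<Longrightarrow> \<tau> \<in> {s..t} \<Longrightarrow> norm x \<le> R \<Longrightarrow> norm y \<le> R \<Longrightarrow>
       finsler_cost (contact_potential \<Psi>) E \<tau> x y \<le> ennreal (K * norm (u s - x) + (V t - V s) * (1 + \<eta> / c0) + K * norm (y - u t))"
      by blast
    have "((\<lambda>s. ennreal (K * norm (u (a s) - x) + (V (b s) - V (a s)) * (1 + \<eta> / c0) + K * norm (y - u (b s))))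
       \<longlongrightarrow> ennreal (K * norm (x - x) + w * (1 + \<eta> / c0) + K * norm (y - y))) G"
      using c0(1) by (intro tendsto_ennrealI tendsto_intros lim) auto
    then have "((\<lambda>s. ennreal (K * norm (u (a s) - x) + (V (b s) - V (a s)) * (1 + \<eta> / c0) + K * norm (y - u (b s))))
       \<longlongrightarrow> ennreal (w * (1 + \<eta> / c0))) G" by simp
    moreover have "\<forall>\<^sub>F s in G. b s - a s < d" using order_tendstoD(2)[OF ba d(1)] .
    then have "\<forall>\<^sub>F s in G. finsler_cost (contact_potential \<Psi>) E \<tau> x y
        \<le> ennreal (K * norm (u (a s) - x) + (V (b s) - V (a s)) * (1 + \<eta> / c0) + K * norm (y - u (b s)))"
      using ab by eventually_elim (rule d(3); use xy in auto)
    ultimately show "finsler_cost (contact_potential \<Psi>) E \<tau> x y \<le> ennreal (w * (1 + \<eta> / c0))"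
      using G by (rule tendsto_lowerbound)
  qed
qed simp

lemma finsler_left:
  assumes t: "0 < t" "t \<le> T"
  shows "finsler_cost (contact_potential \<Psi>) E t (left_lim u t) (u t) = ennreal (V t - left_lim V t)"
proof (rule antisym)
  note l = left_limits[OF t]
  have "\<forall>\<^sub>F s in at_left t. s \<in> {0<..<t}" by (rule eventually_at_left_real[OF t(1)])
  then have "\<forall>\<^sub>F s in at_left t. 0 \<le> s \<and> s < t \<and> t \<le> T \<and> t \<in> {s..t}"
    by eventually_elim (use t in auto)
  moreover have "((\<lambda>s. t - s) \<longlongrightarrow> t - t) (at_left t)" by (intro tendsto_intros)
  ultimately show "finsler_cost (contact_potential \<Psi>) E t (left_lim u t) (u t) \<le> ennreal (V t - left_lim V t)"
    using t l(1,2,5) by (intro finsler_limit[of "at_left t" "\<lambda>s. s" "\<lambda>s. t"]) (auto intro!: tendsto_intros u_bd)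
  show "ennreal (V t - left_lim V t) \<le> finsler_cost (contact_potential \<Psi>) E t (left_lim u t) (u t)"
    unfolding l(3) using t by (intro finsler_lower) auto
qed

lemma finsler_right:
  assumes t: "0 \<le> t" "t < T"
  shows "finsler_cost (contact_potential \<Psi>) E t (u t) (right_lim T u t) = ennreal (right_lim T V t - V t)"
proof (rule antisym)
  note l = right_limits[OF t]
  have "\<forall>\<^sub>F s in at_right t. s \<in> {t<..<T}" by (rule eventually_at_right_real[OF t(2)])
  then have "\<forall>\<^sub>F s in at_right t. 0 \<le> t \<and> t < s \<and> s \<le> T \<and> t \<in> {t..s}"
    by eventually_elim (use t in auto)
  moreover have "((\<lambda>s. s - t) \<longlongrightarrow> t - t) (at_right t)" by (intro tendsto_intros)
  ultimately show "finsler_cost (contact_potential \<Psi>) E t (u t) (right_lim T u t) \<le> ennreal (right_lim T V t - V t)"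
    using t l(1,2,5) by (intro finsler_limit[of "at_right t" "\<lambda>s. t" "\<lambda>s. s"]) (auto intro!: tendsto_intros u_bd)
  show "ennreal (right_lim T V t - V t) \<le> finsler_cost (contact_potential \<Psi>) E t (u t) (right_lim T u t)"
    unfolding l(3) using t by (intro finsler_lower) auto
qed

text \<open>Right-continuous on \<open>(0,T)\<close> and extended by constants, so that the derivative measures do not charge the endpoints.\<close>

definition F :: "real \<Rightarrow> real" where
  "F t = (if T \<le> t then left_lim V T else right_lim T V (max 0 t))"

definition X :: "real \<Rightarrow> 'a" where
  "X t = (if T \<le> t then left_lim u T else right_lim T u (max 0 t))"

text \<open>At \<open>T\<close> the values of \<open>X\<close> and \<open>F\<close> are left limits,
  elsewhere right limits; the filter hides this difference. That it meets the complement of every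
  negligible set is what carries statements valid almost everywhere to the traces.\<close>

lemma trace:
  assumes c: "c \<in> {0..T}"
  obtains G where "G \<noteq> bot" "((\<lambda>s. s) \<longlongrightarrow> c) G" "(u \<longlongrightarrow> X c) G" "(V \<longlongrightarrow> F c) G" "\<forall>\<^sub>F s in G. s \<in> {0..T}"
    "\<And>N. negligible N \<Longrightarrow> \<exists>\<^sub>F s in G. s \<notin> N"
proof (cases "c = T")
  case True
  note l = left_limits[OF T_pos order_refl]
  have "\<exists>\<^sub>F s in at_left T. s \<notin> N" if nN: "negligible N" for N
    unfolding frequently_def
  proof
    assume "\<forall>\<^sub>F s in at_left T. \<not> s \<notin> N"
    then have "\<exists>b<T. \<forall>s>b. s < T \<longrightarrow> \<not> s \<notin> N" by (simp only: eventually_at_left_field)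
    then obtain b where "b < T" "\<forall>s>b. s < T \<longrightarrow> \<not> s \<notin> N" by blast
    moreover obtain q where "q \<in> {b<..<T}" "q \<notin> N"
      using interval_meets_co_negligible[OF nN \<open>b < T\<close>] by blast
    ultimately show False by simp
  qed
  moreover have "X c = left_lim u T" "F c = left_lim V T" using True by (simp_all add: F_def X_def)
  ultimately show ?thesis
    using l(1,2,4) True by (intro that[of "at_left T"]) (simp_all add: tendsto_ident_at)
next
  case False
  then have c': "0 \<le> c" "c < T" using c by auto
  note l = right_limits[OF c']
  have "\<exists>\<^sub>F s in at_right c. s \<notin> N" if nN: "negligible N" for N
    unfolding frequently_def
  proof
    assume "\<forall>\<^sub>F s in at_right c. \<not> s \<notin> N"
    then have "\<exists>b>c. \<forall>s>c. s < b \<longrightarrow> \<not> s \<notin> N" by (simp only: eventually_at_right_field)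
    then obtain b where "c < b" "\<forall>s>c. s < b \<longrightarrow> \<not> s \<notin> N" by blast
    moreover obtain q where "q \<in> {c<..<b}" "q \<notin> N"
      using interval_meets_co_negligible[OF nN \<open>c < b\<close>] by blast
    ultimately show False by simp
  qed
  moreover have "X c = right_lim T u c" "F c = right_lim T V c" using c' by (simp_all add: F_def X_def)
  ultimately show ?thesis
    using l(1,2,4) by (intro that[of "at_right c"]) (simp_all add: tendsto_ident_at)
qed

text \<open>\<open>u\<close> may be unstable at a jump time, but its traces are limits along stable
  times and \<open>DE\<close> is continuous. So \<open>X\<close> is stable at every time, end points
  included.\<close>

lemma F_eq:
  assumes c: "c \<in> {0..T}"
  shows "F c = P c - E c (X c)" "norm (X c) \<le> R" "blinfun_apply (- DE c (X c)) z \<le> \<Psi>\<^sub>0 z"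
proof -
  obtain G where G: "G \<noteq> bot" "((\<lambda>s. s) \<longlongrightarrow> c) G" "(u \<longlongrightarrow> X c) G" "(V \<longlongrightarrow> F c) G" "\<forall>\<^sub>F s in G. s \<in> {0..T}"
    "\<And>N. negligible N \<Longrightarrow> \<exists>\<^sub>F s in G. s \<notin> N" by (rule trace[OF c]) blast
  show "F c = P c - E c (X c)" by (rule tendsto_unique[OF G(1,4) V_tendsto[OF G(2,3) c G(5)]])
  show "norm (X c) \<le> R"
  proof (rule tendsto_upperbound[OF tendsto_norm[OF G(3)] _ G(1)])
    show "\<forall>\<^sub>F s in G. norm (u s) \<le> R" using G(5) by eventually_elim (rule u_bd)
  qed
  obtain N where N: "negligible N" "\<And>t z. t \<in> {0..T} - N \<Longrightarrow> blinfun_apply (- DE t (u t)) z \<le> \<Psi>\<^sub>0 z"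
    by (rule stability_ae) blast
  have "((\<lambda>s. DE s (u s)) \<longlongrightarrow> DE c (X c)) G" by (rule along_tendsto[OF DE_continuous G(2,3) c G(5)])
  then have lim: "((\<lambda>s. blinfun_apply (- DE s (u s)) z) \<longlongrightarrow> blinfun_apply (- DE c (X c)) z) G"
    by (intro tendsto_intros)
  show "blinfun_apply (- DE c (X c)) z \<le> \<Psi>\<^sub>0 z"
  proof (rule ccontr)
    assume "\<not> ?thesis"
    then have "\<forall>\<^sub>F s in G. \<Psi>\<^sub>0 z < blinfun_apply (- DE s (u s)) z" by (intro order_tendstoD(1)[OF lim]) simp
    then have "\<forall>\<^sub>F s in G. \<not> s \<notin> N" using G(5)
    proof eventually_elim
      case (elim s)
      then show ?case using N(2)[of s z] by force
    qed
    then show False using G(6)[OF N(1)] unfolding frequently_def by blast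
  qed
qed

lemma F_le_V: "c \<in> {0..T} \<Longrightarrow> c < q \<Longrightarrow> q \<le> T \<Longrightarrow> F c \<le> V q"
  and gauge_le_F: "c \<in> {0..T} \<Longrightarrow> 0 \<le> p \<Longrightarrow> p < c \<Longrightarrow> \<Psi>\<^sub>0 (X c - u p) \<le> F c - V p"
proof -
  assume c: "c \<in> {0..T}"
  obtain G where G: "G \<noteq> bot" "((\<lambda>s. s) \<longlongrightarrow> c) G" "(u \<longlongrightarrow> X c) G" "(V \<longlongrightarrow> F c) G" "\<forall>\<^sub>F s in G. s \<in> {0..T}"
    using trace[OF c] by metis
  show "\<Psi>\<^sub>0 (X c - u p) \<le> F c - V p" if p: "0 \<le> p" "p < c"
  proof (rule tendsto_le[OF G(1)])
    show "((\<lambda>s. V s - V p) \<longlongrightarrow> F c - V p) G" "((\<lambda>s. \<Psi>\<^sub>0 (u s - u p)) \<longlongrightarrow> \<Psi>\<^sub>0 (X c - u p)) G"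
      by (intro tendsto_intros gauge_tendsto G)+
    have "\<forall>\<^sub>F s in G. p < s" by (rule order_tendstoD(1)[OF G(2) p(2)])
    then show "\<forall>\<^sub>F s in G. \<Psi>\<^sub>0 (u s - u p) \<le> V s - V p"
      using G(5) by eventually_elim (use p in \<open>auto intro!: gauge_increment\<close>)
  qed
  show "F c \<le> V q" if q: "c < q" "q \<le> T"
  proof (rule tendsto_upperbound[OF G(4) _ G(1)])
    have "\<forall>\<^sub>F s in G. s < q" by (rule order_tendstoD(2)[OF G(2) q(1)])
    then show "\<forall>\<^sub>F s in G. V s \<le> V q" using G(5) by eventually_elim (use q in \<open>auto intro!: V_mono\<close>)
  qed
qed

lemma gauge_X_aux:
  assumes st: "0 \<le> s" "s < t" "t \<le> T"
  shows "\<Psi>\<^sub>0 (X t - X s) \<le> F t - F s"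
proof -
  have s: "s \<in> {0..T}" using st by auto
  obtain G where G: "G \<noteq> bot" "((\<lambda>s. s) \<longlongrightarrow> s) G" "(u \<longlongrightarrow> X s) G" "(V \<longlongrightarrow> F s) G" "\<forall>\<^sub>F s in G. s \<in> {0..T}"
    using trace[OF s] by metis
  show ?thesis
  proof (rule tendsto_le[OF G(1)])
    show "((\<lambda>p. F t - V p) \<longlongrightarrow> F t - F s) G" "((\<lambda>p. \<Psi>\<^sub>0 (X t - u p)) \<longlongrightarrow> \<Psi>\<^sub>0 (X t - X s)) G"
      by (intro tendsto_intros gauge_tendsto G)+
    have "\<forall>\<^sub>F p in G. p < t" by (rule order_tendstoD(2)[OF G(2) st(2)])
    then show "\<forall>\<^sub>F p in G. \<Psi>\<^sub>0 (X t - u p) \<le> F t - V p"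
      using G(5) by eventually_elim (use st in \<open>auto intro!: gauge_le_F\<close>)
  qed
qed

lemma F_clamp: "F t = F (max 0 (min T t))" "X t = X (max 0 (min T t))"
  using T_pos by (auto simp: F_def X_def max_def min_def)

lemma gauge_X: "s \<le> t \<Longrightarrow> \<Psi>\<^sub>0 (X t - X s) \<le> F t - F s"
proof -
  assume st: "s \<le> t"
  let ?s = "max 0 (min T s)" and ?t = "max 0 (min T t)"
  have "\<Psi>\<^sub>0 (X ?t - X ?s) \<le> F ?t - F ?s"
  proof (cases "?s = ?t")
    case True
    show ?thesis unfolding True by (simp add: gauge_zero)
  next
    case False
    show ?thesis by (rule gauge_X_aux) (use False st T_pos in linarith)+
  qed
  then show ?thesis unfolding F_clamp[symmetric] .
qed

lemma F_mono: "s \<le> t \<Longrightarrow> F s \<le> F t"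
  using gauge_X[of s t] gauge_nonneg[of "X t - X s"] by linarith

lemma norm_X: "s \<le> t \<Longrightarrow> norm (X t - X s) \<le> 1 / c0 * (F t - F s)"
  using gauge_X[of s t] c0(2)[of "X t - X s"] c0(1) by (simp add: field_simps)

lemma F_at_left: "0 < t \<Longrightarrow> t \<le> T \<Longrightarrow> (F \<longlongrightarrow> left_lim V t) (at_left t)"
proof -
  assume t: "0 < t" "t \<le> T"
  have ev: "\<forall>\<^sub>F s in at_left t. s \<in> {0<..<t}" by (rule eventually_at_left_real[OF t(1)])
  note l = left_limits[OF t]
  show ?thesis
  proof (rule tendsto_sandwich[OF _ _ l(2) tendsto_const])
    show "\<forall>\<^sub>F s in at_left t. V s \<le> F s" using ev
    proof eventually_elim
      case (elim s)
      then have "s < T" "0 < s" using t by auto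
      then show ?case using right_limits(6)[of s] by (simp add: F_def)
    qed
    show "\<forall>\<^sub>F s in at_left t. F s \<le> left_lim V t" using ev
    proof eventually_elim
      case (elim s)
      then have "F s \<le> V ((s + t) / 2)" using t by (intro F_le_V) auto
      also have "\<dots> \<le> left_lim V t" using elim by (intro l(6)) auto
      finally show ?case .
    qed
  qed
qed

lemma F_right_continuous: "(F \<longlongrightarrow> F a) (at_right a)"
proof -
  consider "a < 0" | "T \<le> a" | "0 \<le> a" "a < T" by linarith
  then show ?thesis
  proof cases
    case 1
    have "\<forall>\<^sub>F s in at_right a. s \<in> {a<..<0}" by (rule eventually_at_right_real[OF 1])
    then have "\<forall>\<^sub>F s in at_right a. F s = F a"
      by eventually_elim (use 1 T_pos in \<open>auto simp: F_def max_def\<close>)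
    then show ?thesis by (simp add: tendsto_eventually)
  next
    case 2
    have "\<forall>\<^sub>F s in at_right a. s \<in> {a<..<a+1}" by (rule eventually_at_right_real) simp
    then have "\<forall>\<^sub>F s in at_right a. F s = F a" by eventually_elim (use 2 in \<open>auto simp: F_def\<close>)
    then show ?thesis by (simp add: tendsto_eventually)
  next
    case 3
    have Fa: "F a = right_lim T V a" using 3 by (simp add: F_def)
    have "\<forall>\<^sub>F s in at_right a. s \<in> {a<..<(a + T) / 2}" by (rule eventually_at_right_real) (use 3 in auto)
    \<comment> \<open>\<open>F s\<close> is bounded by \<open>V\<close> at any later point. The
      point at twice the distance from \<open>a\<close> is later than \<open>s\<close> and still
      tends to \<open>a\<close>.\<close>
    moreover have "filterlim (\<lambda>s. s + (s - a)) (at_right a) (at_right a)"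
    proof (rule filterlim_at_withinI)
      have "((\<lambda>s. s + (s - a)) \<longlongrightarrow> a + (a - a)) (at_right a)" by (intro tendsto_intros)
      then show "((\<lambda>s. s + (s - a)) \<longlongrightarrow> a) (at_right a)" by simp
      show "\<forall>\<^sub>F s in at_right a. s + (s - a) \<in> {a<..} - {a}" by (simp add: eventually_at_filter)
    qed
    note filterlim_compose[OF right_limits(2)[OF 3] this]
    ultimately show ?thesis
      unfolding Fa
    proof (intro tendsto_sandwich[OF _ _ tendsto_const, of _ F "at_right a" "\<lambda>s. V (s + (s - a))"])
      assume ev: "\<forall>\<^sub>F s in at_right a. s \<in> {a<..<(a + T) / 2}"
      show "\<forall>\<^sub>F s in at_right a. right_lim T V a \<le> F s" using ev
        by eventually_elim (use F_mono Fa in \<open>auto simp: Fa[symmetric]\<close>)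
      show "\<forall>\<^sub>F s in at_right a. F s \<le> V (s + (s - a))" using ev
        by eventually_elim (use 3 in \<open>auto intro!: F_le_V simp: field_simps\<close>)
    qed
  qed
qed

lemma X_right_continuous: "(X \<longlongrightarrow> X a) (at_right a)"
proof (rule LIM_zero_cancel)
  show "((\<lambda>s. X s - X a) \<longlongrightarrow> 0) (at_right a)"
  proof (rule Lim_null_comparison)
    have "\<forall>\<^sub>F s in at_right a. s \<in> {a<..<a+1}" by (rule eventually_at_right_real) simp
    then show "\<forall>\<^sub>F s in at_right a. norm (X s - X a) \<le> 1 / c0 * (F s - F a)"
      by eventually_elim (rule norm_X, simp)
    have "((\<lambda>s. 1 / c0 * (F s - F a)) \<longlongrightarrow> 1 / c0 * (F a - F a)) (at_right a)"
      by (intro tendsto_intros F_right_continuous)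
    then show "((\<lambda>s. 1 / c0 * (F s - F a)) \<longlongrightarrow> 0) (at_right a)" by simp
  qed
qed

sublocale st: stieltjes T F X "1 / c0"
proof
  show "(F \<longlongrightarrow> F T) (at_left T)" using F_at_left[OF T_pos order_refl] by (simp add: F_def)
  show "continuous (at_right a) F" "continuous (at_right a) X" for a
    using F_right_continuous[of a] X_right_continuous[of a] by (simp_all add: continuous_within)
  show "F t = F 0" if "t \<le> 0" for t using that T_pos by (simp add: F_def max_def)
  show "F t = F T" if "T \<le> t" for t using that by (simp add: F_def)
qed (use fin T_pos F_mono norm_X in auto)

end

section \<open>Increments of the dissipation between traces\<close>

text \<open>\<open>Z\<close> consists of the first times at which \<open>F\<close> reaches the
  multiples of \<open>d\<close>; right continuity makes \<open>F\<close> attain the level there. An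
  increment of at least \<open>d\<close> passes a multiple, whose first time then lies in the
  half-open interval. In particular all large jumps are in \<open>Z\<close>.\<close>

lemma monotone_level_points:
  fixes F :: "real \<Rightarrow> real"
  assumes mono: "\<And>s t. s \<le> t \<Longrightarrow> F s \<le> F t" and rc: "\<And>a. (F \<longlongrightarrow> F a) (at_right a)" and F0: "0 \<le> F 0" and "0 < d"
  shows "\<exists>Z. finite Z \<and> (\<forall>s t. 0 \<le> s \<longrightarrow> s < t \<longrightarrow> t \<le> T \<longrightarrow> {s<..t} \<inter> Z = {} \<longrightarrow> F t - F s < d)"
proof -
  define S where "S i = {r \<in> {0..T}. real i * d \<le> F r}" for i :: nat
  \<comment> \<open>The indices up to the ceiling include all levels not above \<open>F T\<close>.
    An index whose level is never reached only adds the harmless point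
    \<open>Inf {}\<close>.\<close>
  define Z where "Z = (\<lambda>i. Inf (S i)) ` {..nat \<lceil>F T / d\<rceil>}"
  have "F t - F s < d" if st: "0 \<le> s" "s < t" "t \<le> T" and Z: "{s<..t} \<inter> Z = {}" for s t
  proof (rule ccontr)
    assume "\<not> ?thesis"
    then have big: "d \<le> F t - F s" by simp
    have s0: "0 \<le> F s" using mono[OF st(1)] F0 by linarith
    define i where "i = nat \<lfloor>F s / d\<rfloor> + 1"
    have fl: "0 \<le> \<lfloor>F s / d\<rfloor>" using s0 \<open>0 < d\<close> by simp
    have "F s / d < real i" "real i \<le> F s / d + 1" unfolding i_def using fl by linarith+
    then have i: "F s < real i * d" "real i * d \<le> F s + d" using \<open>0 < d\<close> by (simp_all add: field_simps)
    have it: "real i * d \<le> F t" using i big by linarith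
    then have "real i * d \<le> F T" using mono[OF st(3)] by linarith
    then have "real i \<le> F T / d" using \<open>0 < d\<close> by (simp add: field_simps)
    then have "i \<le> nat \<lceil>F T / d\<rceil>" by linarith
    then have pZ: "Inf (S i) \<in> Z" unfolding Z_def by blast
    have tS: "t \<in> S i" using it st by (auto simp: S_def)
    have gt: "s < r" if "r \<in> S i" for r
    proof (rule ccontr)
      assume "\<not> s < r"
      then have "F r \<le> F s" by (intro mono) simp
      then show False using that i(1) by (auto simp: S_def)
    qed
    have bdd: "bdd_below (S i)" using gt less_imp_le by (metis bdd_below.I)
    have pt: "Inf (S i) \<le> t" by (rule cInf_lower[OF tS bdd])
    have ne: "S i \<noteq> {}" using tS by blast
    have "real i * d \<le> F (Inf (S i))"
    proof (rule ccontr)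
      assume "\<not> ?thesis"
      then have "\<forall>\<^sub>F r in at_right (Inf (S i)). F r < real i * d" by (intro order_tendstoD(2)[OF rc]) simp
      then have "\<exists>b>Inf (S i). \<forall>r>Inf (S i). r < b \<longrightarrow> F r < real i * d" by (simp only: eventually_at_right_field)
      then obtain b where b: "Inf (S i) < b" "\<And>r. Inf (S i) < r \<Longrightarrow> r < b \<Longrightarrow> F r < real i * d" by blast
      obtain r where r: "r \<in> S i" "r < b" using cInf_lessD[OF ne b(1)] by blast
      have Fr: "real i * d \<le> F r" using r(1) by (simp add: S_def)
      have "Inf (S i) \<le> r" by (rule cInf_lower[OF r(1) bdd])
      moreover have "Inf (S i) \<noteq> r"
      proof
        assume "Inf (S i) = r"
        then show False using Fr \<open>\<not> real i * d \<le> F (Inf (S i))\<close> by simp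
      qed
      ultimately show False using b(2)[of r] r(2) Fr by linarith
    qed
    then have "s < Inf (S i)" using mono[of "Inf (S i)" s] i(1) by linarith
    then show False using pt pZ Z by auto
  qed
  moreover have "finite Z" by (simp add: Z_def)
  ultimately show ?thesis by blast
qed

lemma emeasure_countable_infsum:
  fixes M :: "real measure"
  assumes S: "sets M = sets borel" and X: "countable X"
  shows "(\<Sum>\<^sub>\<infinity>x\<in>X. emeasure M {x}) = emeasure M X"
proof -
  have fin: "sum (\<lambda>x. emeasure M {x}) A = emeasure M A" if "finite A" for A
    using emeasure_eq_sum_singleton[OF that, of M] S by simp
  have Xs: "X \<in> sets M" by (rule sets.countable[OF _ X]) (simp add: S)
  have "(\<Sum>\<^sub>\<infinity>x\<in>X. emeasure M {x}) = (SUP A\<in>{A. finite A \<and> A \<subseteq> X}. sum (\<lambda>x. emeasure M {x}) A)"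
    by (rule nonneg_infsum_complete) simp
  also have "\<dots> = emeasure M X"
  proof (rule antisym)
    show "(SUP A\<in>{A. finite A \<and> A \<subseteq> X}. sum (\<lambda>x. emeasure M {x}) A) \<le> emeasure M X"
      proof (rule SUP_least)
      fix A assume "A \<in> {A. finite A \<and> A \<subseteq> X}"
      then have A: "finite A" "A \<subseteq> X" by simp_all
      show "sum (\<lambda>x. emeasure M {x}) A \<le> emeasure M X" unfolding fin[OF A(1)] by (rule emeasure_mono[OF A(2) Xs])
    qed
    show "emeasure M X \<le> (SUP A\<in>{A. finite A \<and> A \<subseteq> X}. sum (\<lambda>x. emeasure M {x}) A)"
    proof (cases "X = {}")
      case False
      define A where "A n = from_nat_into X ` {..<n::nat}" for n
      have A: "finite (A n)" "A n \<subseteq> X" for n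
        unfolding A_def using from_nat_into[OF False] by auto
      have Asets: "A n \<in> sets M" for n using A(1)[of n] S by (simp add: finite_imp_closed)
      have "(\<Union>n. A n) = range (from_nat_into X)"
        unfolding A_def by blast
      then have "(\<Union>n. A n) = X" using range_from_nat_into[OF False X] by simp
      moreover have "(SUP n. emeasure M (A n)) = emeasure M (\<Union>n. A n)"
      proof (rule SUP_emeasure_incseq)
        show "incseq A" unfolding incseq_def A_def by (intro allI impI image_mono) auto
      qed (use Asets in blast)
      ultimately have "emeasure M X = (SUP n. emeasure M (A n))" by simp
      also have "\<dots> \<le> (SUP A\<in>{A. finite A \<and> A \<subseteq> X}. sum (\<lambda>x. emeasure M {x}) A)"
      proof (rule SUP_least)
        fix n
        show "emeasure M (A n) \<le> (SUP A\<in>{A. finite A \<and> A \<subseteq> X}. sum (\<lambda>x. emeasure M {x}) A)"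
          unfolding fin[OF A(1), symmetric] by (rule SUP_upper) (simp add: A)
      qed
      finally show ?thesis .
    qed simp
  qed
  finally show ?thesis .
qed

context viscosity_limit
begin

text \<open>The energy identity between two traces, combined with the stability of the left one.\<close>

lemma F_increment_le:
  assumes \<eta>: "0 < \<eta>"
  obtains d where "0 < d" "\<And>s t. 0 \<le> s \<Longrightarrow> s < t \<Longrightarrow> t \<le> T \<Longrightarrow> F t - F s < d \<Longrightarrow>
      F t - F s \<le> \<Psi>\<^sub>0 (X t - X s) + (\<eta> * (t - s) + \<eta> / c0 * (F t - F s))"
proof -
  obtain d where d: "0 < d"
    "\<And>s t x y. s \<in> {0..T} \<Longrightarrow> t \<in> {0..T} \<Longrightarrow> norm x \<le> R \<Longrightarrow> norm y \<le> R \<Longrightarrow> \<bar>t - s\<bar> < d \<Longrightarrow> norm (y - x) < d \<Longrightarrow>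
       norm (DE t y - DE s x) \<le> \<eta> \<and> \<bar>Et t y - Et s x\<bar> \<le> \<eta>"
    by (rule cylinder_modulus[OF \<eta>]) blast
  \<comment> \<open>The threshold \<open>c0 * d\<close> for the increment of \<open>F\<close> keeps
    the two traces within distance \<open>d\<close>, where the modulus of continuity of
    \<open>DE\<close> and \<open>Et\<close> applies.\<close>
  have "F t - F s \<le> \<Psi>\<^sub>0 (X t - X s) + (\<eta> * (t - s) + \<eta> / c0 * (F t - F s))"
    if st: "0 \<le> s" "s < t" "t \<le> T" and small: "F t - F s < c0 * d" for s t
  proof -
    have s: "s \<in> {0..T}" and t: "t \<in> {0..T}" using st by auto
    let ?x = "X s" and ?y = "X t"
    have xy: "norm ?x \<le> R" "norm ?y \<le> R" using F_eq(2) s t by blast+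
    have nrm: "norm (?y - ?x) \<le> 1 / c0 * (F t - F s)" using st by (intro norm_X) simp
    have quot: "1 / c0 * (F t - F s) < d" using small c0(1) by (simp add: field_simps)
    \<comment> \<open>The work along \<open>u\<close> is compared with the work at the fixed state
      \<open>?y\<close>. For \<open>r\<close> strictly between \<open>s\<close> and \<open>t\<close>
      the state \<open>u r\<close> is close to \<open>?y\<close>, since \<open>F t - V r\<close>
      controls the distance and \<open>V r\<close> is at least \<open>F s\<close>.\<close>
    have time: "(P t - P s) - (E t ?y - E s ?y) \<le> \<eta> * (t - s)"
    proof (rule has_integral_le)
      have "(\<lambda>r. Et r (u r)) integrable_on {0..t}" by (rule dominated_along(1)[OF Et_continuous t])
      from Henstock_Kurzweil_Integration.integral_combine[OF st(1) less_imp_le[OF st(2)] this]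
      have "integral {s..t} (\<lambda>r. Et r (u r)) = P t - P s" by (simp add: P_def)
      moreover have "(\<lambda>r. Et r (u r)) integrable_on {s..t}"
        by (rule integrable_subinterval_real[OF Et_integrable]) (use st in auto)
      ultimately have 1: "((\<lambda>r. Et r (u r)) has_integral P t - P s) {s..t}" by (metis has_integral_integral)
      have 2: "(Et_y has_integral E t ?y - E s ?y) {s..t}" if "Et_y = (\<lambda>r. Et r ?y)" for Et_y
      proof (rule fundamental_theorem_of_calculus_interior)
        show "continuous_on {s..t} (\<lambda>r. E r ?y)"
          by (rule continuous_on_subset[OF along_continuous[OF E_continuous continuous_on_const]]) (use st in auto)
        show "((\<lambda>r. E r ?y) has_vector_derivative Et_y r) (at r)" if "r \<in> {s<..<t}" for r
          using E_chain[of "\<lambda>_. ?y" 0 r] that st unfolding has_real_derivative_iff_has_vector_derivative \<open>Et_y = _\<close>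
          by (auto simp: blinfun.zero_right)
      qed (use st in simp)
      show "((\<lambda>r. Et r (u r) - Et r ?y) has_integral (P t - P s) - (E t ?y - E s ?y)) {s<..<t}"
        using has_integral_diff[OF 1 2[OF refl]] by (simp only: has_integral_Icc_iff_Ioo)
      show "((\<lambda>r. \<eta>) has_integral \<eta> * (t - s)) {s<..<t}"
        using has_integral_const_real[of \<eta> s t] st by (simp add: has_integral_Icc_iff_Ioo mult.commute)
      fix r assume r: "r \<in> {s<..<t}"
      then have r': "r \<in> {0..T}" using st by auto
      have "norm (?y - u r) \<le> 1 / c0 * (F t - V r)"
        using gauge_le_F[OF t, of r] r st c0(2)[of "?y - u r"] c0(1) by (simp add: field_simps)
      also have "\<dots> \<le> 1 / c0 * (F t - F s)"
        using F_le_V[OF s, of r] r st c0(1) by (intro mult_left_mono) auto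
      finally have "norm (u r - ?y) < d" using quot by (simp add: norm_minus_commute)
      then have "\<bar>Et r (u r) - Et r ?y\<bar> \<le> \<eta>" using d(2)[OF r' r' xy(2) u_bd[OF r']] d(1) by simp
      then show "Et r (u r) - Et r ?y \<le> \<eta>" by linarith
    qed
    \<comment> \<open>With the time fixed at \<open>s\<close> the energies are compared along the
      segment. Moving the derivative from the intermediate point to \<open>?x\<close>, where
      stability is available, costs \<eta> times the length of the segment.\<close>
    let ?z = "\<lambda>r. ?x + r *\<^sub>R (?y - ?x)"
    have "\<exists>r>0. r < 1 \<and> E s (?z 1) - E s (?z 0) = (1 - 0) * blinfun_apply (DE s (?z r)) (?y - ?x)"
    proof (rule MVT2)
      fix r :: real
      have "(?z has_vector_derivative ?y - ?x) (at r)" by (auto intro!: derivative_eq_intros)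
      from E_chain_frozen[OF this s]
      show "((\<lambda>r. E s (?z r)) has_real_derivative blinfun_apply (DE s (?z r)) (?y - ?x)) (at r)" .
    qed simp
    then obtain r where r: "0 < r" "r < 1" "E s ?y - E s ?x = blinfun_apply (DE s (?z r)) (?y - ?x)" by auto
    have "norm (?z r - ?x) = r * norm (?y - ?x)" using r by simp
    also have "\<dots> \<le> 1 * norm (?y - ?x)" using r by (intro mult_right_mono) auto
    finally have zx: "norm (?z r - ?x) < d" using nrm quot by linarith
    have "?z r = (1 - r) *\<^sub>R ?x + r *\<^sub>R ?y" by (simp add: algebra_simps)
    then have "norm (?z r) \<le> (1 - r) * norm ?x + r * norm ?y"
      using norm_triangle_ineq[of "(1 - r) *\<^sub>R ?x" "r *\<^sub>R ?y"] r by simp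
    also have "\<dots> \<le> (1 - r) * R + r * R" using xy r by (intro add_mono mult_left_mono) auto
    finally have zR: "norm (?z r) \<le> R" by (simp add: algebra_simps)
    have "norm (DE s (?z r) - DE s ?x) \<le> \<eta>" using d(2)[OF s s xy(1) zR _ zx] d(1) by simp
    note mult_right_mono[OF this norm_ge_zero[of "?y - ?x"]]
    with norm_blinfun[of "DE s (?z r) - DE s ?x" "?y - ?x"]
    have "norm (blinfun_apply (DE s (?z r) - DE s ?x) (?y - ?x)) \<le> \<eta> * norm (?y - ?x)" by (rule order_trans)
    then have "- (\<eta> * norm (?y - ?x)) \<le> blinfun_apply (DE s (?z r) - DE s ?x) (?y - ?x)"
      unfolding real_norm_def by linarith
    moreover have "\<eta> * norm (?y - ?x) \<le> \<eta> / c0 * (F t - F s)"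
      using mult_left_mono[OF nrm, of \<eta>] \<eta> by simp
    moreover have "- blinfun_apply (DE s ?x) (?y - ?x) \<le> \<Psi>\<^sub>0 (?y - ?x)"
      using F_eq(3)[OF s, of "?y - ?x"] by (simp add: blinfun.minus_left)
    ultimately have "- (E s ?y - E s ?x) \<le> \<Psi>\<^sub>0 (?y - ?x) + \<eta> / c0 * (F t - F s)"
      unfolding r(3) blinfun.diff_left by linarith
    then show ?thesis using time F_eq(1)[OF s] F_eq(1)[OF t] by linarith
  qed
  then show ?thesis using that[of "c0 * d"] d(1) c0(1) by simp
qed

lemma F_0: "0 \<le> F 0" "F 0 = right_lim T V 0"
  using right_limits(6)[of 0] T_pos V_0 by (auto simp: F_def)

lemma left_V_ge: "0 < t \<Longrightarrow> t \<le> T \<Longrightarrow> F 0 \<le> left_lim V t"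
  using F_le_V[of 0 "t / 2"] left_limits(6)[of t "t / 2"] T_pos by simp

lemma F_interior: "t \<in> {0<..<T} \<Longrightarrow> F t = right_lim T V t" "t \<in> {0<..<T} \<Longrightarrow> X t = right_lim T u t"
  by (simp_all add: F_def X_def)

lemma measure_Ioo:
  assumes t: "0 < t" "t \<le> T"
  shows "measure st.\<rho> {0<..<t} = left_lim V t - F 0"
proof -
  \<comment> \<open>The summand 2 makes already \<open>s 0 = t / 2\<close> positive.\<close>
  define s where "s n = t - t / (real n + 2)" for n :: nat
  have s: "0 < s n" "s n < t" for n
  proof -
    have "t / (real n + 2) < t / 1" using t by (intro divide_strict_left_mono) auto
    then show "0 < s n" "s n < t" using t by (simp_all add: s_def)
  qed
  have inc: "incseq s"
    unfolding incseq_def s_def using t by (auto intro!: divide_left_mono)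
  have lim: "s \<longlonglongrightarrow> t"
  proof -
    have "(\<lambda>n. t - t / (real n + 2)) \<longlonglongrightarrow> t - 0" by (intro tendsto_intros) real_asymp
    then show ?thesis by (simp add: s_def[abs_def])
  qed
  have un: "(\<Union>n. {0<..s n}) = {0<..<t}"
  proof (intro set_eqI iffI)
    fix r assume "r \<in> (\<Union>n. {0<..s n})"
    then obtain n where "0 < r" "r \<le> s n" by auto
    then show "r \<in> {0<..<t}" using s[of n] by simp
  next
    fix r assume r: "r \<in> {0<..<t}"
    then have "\<forall>\<^sub>F n in sequentially. r < s n" using order_tendstoD(1)[OF lim] by simp
    then obtain n where "r < s n" using eventually_happens[of _ sequentially] by auto
    then show "r \<in> (\<Union>n. {0<..s n})" using r by (auto intro!: exI[of _ n])
  qed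
  have "(\<lambda>n. measure st.\<rho> {0<..s n}) \<longlonglongrightarrow> measure st.\<rho> (\<Union>n. {0<..s n})"
  proof (rule st.rho.finite_Lim_measure_incseq)
    show "incseq (\<lambda>n. {0<..s n})"
      unfolding incseq_def[of "\<lambda>n. {0<..s n}"]
    proof (intro allI impI)
      fix k n :: nat assume "k \<le> n"
      then have "s k \<le> s n" by (rule incseqD[OF inc])
      then show "{0<..s k} \<le> {0<..s n}" by auto
    qed
  qed auto
  then have 1: "(\<lambda>n. F (s n) - F 0) \<longlonglongrightarrow> measure st.\<rho> {0<..<t}"
    unfolding un using s(1) by (simp add: st.measure_Ioc less_imp_le)
  have "filterlim s (at_left t) sequentially"
    using lim s(2) by (intro filterlim_at_withinI) (auto simp: less_imp_neq)
  from filterlim_compose[OF F_at_left[OF t] this]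
  have "(\<lambda>n. F (s n) - F 0) \<longlonglongrightarrow> left_lim V t - F 0" by (intro tendsto_diff tendsto_const)
  then show ?thesis using LIMSEQ_unique[OF 1] by simp
qed

lemma measure_point:
  assumes t: "t \<in> {0<..<T}"
  shows "measure st.\<rho> {t} = right_lim T V t - left_lim V t"
proof -
  have "{0<..t} = {0<..<t} \<union> {t}" using t by auto
  then have "measure st.\<rho> {0<..t} = measure st.\<rho> ({0<..<t} \<union> {t})" by simp
  also have "\<dots> = measure st.\<rho> {0<..<t} + measure st.\<rho> {t}" by (rule st.rho.finite_measure_Union) auto
  finally have "measure st.\<rho> {0<..t} = measure st.\<rho> {0<..<t} + measure st.\<rho> {t}" .
  then show ?thesis using measure_Ioo[of t] st.measure_Ioc[of 0 t] t F_interior(1)[OF t] by simp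
qed

abbreviation "J \<equiv> jump_set T u"

lemma no_jump: "t \<in> {0..T} \<Longrightarrow> t \<notin> J \<Longrightarrow> left_lim u t = u t \<and> right_lim T u t = u t"
  by (auto simp: jump_set_def)

lemma measure_point_no_jump:
  assumes "t \<notin> J"
  shows "emeasure st.\<rho> {t} = 0"
proof (cases "t \<in> {0<..<T}")
  case True
  then have "left_lim V t = V t" "right_lim T V t = V t"
    using left_limits(3)[of t] right_limits(3)[of t] no_jump[of t] assms by auto
  then show ?thesis using measure_point[OF True] by (simp add: st.rho.emeasure_eq_measure)
qed (simp add: st.emeasure_\<rho>_outside)

text \<open>A jump of \<open>u\<close> inside \<open>(0,T)\<close> forces an atom of the finite
  measure of \<open>F\<close>, because increments of \<open>V\<close> dominate those of
  \<open>u\<close>. The end points are added by hand, as they carry no mass even if \<open>u\<close>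
  jumps there.\<close>

lemma jump_set_countable: "countable J"
proof -
  have "J \<subseteq> insert 0 (insert T {t. measure st.\<rho> {t} \<noteq> 0})"
  proof
    fix t assume t: "t \<in> J"
    have "measure st.\<rho> {t} \<noteq> 0" if t': "t \<in> {0<..<T}"
    proof
      assume "measure st.\<rho> {t} = 0"
      then have eq: "left_lim V t = V t" "right_lim T V t = V t"
        using measure_point[OF t'] left_limits(7)[of t] right_limits(6)[of t] t' by auto
      have t0: "0 < t" "t \<le> T" "0 \<le> t" "t < T" using t' by auto
      note l = left_limits[OF t0(1,2)] and r = right_limits[OF t0(3,4)]
      have "norm (u t - left_lim u t) \<le> 1 / c0 * (V t - left_lim V t)"
      proof (rule tendsto_le)
        show "((\<lambda>s. 1 / c0 * (V t - V s)) \<longlongrightarrow> 1 / c0 * (V t - left_lim V t)) (at_left t)"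
          "((\<lambda>s. norm (u t - u s)) \<longlongrightarrow> norm (u t - left_lim u t)) (at_left t)"
          by (intro tendsto_intros l)+
        have "\<forall>\<^sub>F s in at_left t. s \<in> {0<..<t}" by (rule eventually_at_left_real[OF t0(1)])
        then show "\<forall>\<^sub>F s in at_left t. norm (u t - u s) \<le> 1 / c0 * (V t - V s)"
          by eventually_elim (rule norm_increment; use t0 in auto)
      qed simp
      moreover have "norm (right_lim T u t - u t) \<le> 1 / c0 * (right_lim T V t - V t)"
      proof (rule tendsto_le)
        show "((\<lambda>s. 1 / c0 * (V s - V t)) \<longlongrightarrow> 1 / c0 * (right_lim T V t - V t)) (at_right t)"
          "((\<lambda>s. norm (u s - u t)) \<longlongrightarrow> norm (right_lim T u t - u t)) (at_right t)"
          by (intro tendsto_intros r)+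
        have "\<forall>\<^sub>F s in at_right t. s \<in> {t<..<T}" by (rule eventually_at_right_real[OF t0(4)])
        then show "\<forall>\<^sub>F s in at_right t. norm (u s - u t) \<le> 1 / c0 * (V s - V t)"
          by eventually_elim (rule norm_increment; use t0 in auto)
      qed simp
      ultimately show False using eq t by (simp add: jump_set_def)
    qed
    moreover have "t \<in> {0..T}" using t by (simp add: jump_set_def)
    ultimately show "t \<in> insert 0 (insert T {t. measure st.\<rho> {t} \<noteq> 0})" by force
  qed
  then show ?thesis by (rule countable_subset) (intro countable_insert st.rho.countable_support)
qed

end

section \<open>Identification of the pseudo-variation\<close>

locale viscosity_limit_density = viscosity_limit \<Psi>\<^sub>0 \<Psi> T C E \<epsilon> v u R B
  for \<Psi>\<^sub>0 \<Psi> :: "'a::real_normed_vector \<Rightarrow> real" and T C E \<epsilon> v u R B +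
  fixes m :: "real set \<Rightarrow> 'a" and g :: "real \<Rightarrow> 'a"
  assumes vd: "vector_density m (interval_measure F) g" and m_Ioc: "\<And>s t. s \<le> t \<Longrightarrow> m {s<..t} = X t - X s"
begin

sublocale bv: stieltjes_BV T F X "1 / c0" m g u
proof
  show "u t = X t" if "t \<in> {0<..<T} - J" for t
    using that no_jump[of t] F_interior(2)[of t] by simp
  show "m {t} = 0" if "t \<notin> J" for t
    by (rule vector_density_null[OF fin vd _ _ measure_point_no_jump[OF that]]) auto
qed (use vd m_Ioc jump_set_countable in auto)

abbreviation "\<rho> \<equiv> interval_measure F"

lemma borel_J [simp]: "A \<in> sets borel \<Longrightarrow> A - J \<in> sets borel" "A \<in> sets borel \<Longrightarrow> J \<inter> A \<in> sets borel"
  by (rule sets.Diff, assumption, rule bv.J_borel, rule sets.Int, rule bv.J_borel, assumption)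

text \<open>The gauge of the derivative as a measure, so that its comparison with
  \<open>\<rho>\<close> can be summed over cells and restricted to the complement of
  \<open>J\<close>.\<close>

definition Q :: "real measure" where "Q = density \<rho> (\<lambda>t. ennreal (\<Psi>\<^sub>0 (g t)))"

lemma sets_Q [simp]: "sets Q = sets borel"
  by (simp add: Q_def)

lemma emeasure_Q: "A \<in> sets borel \<Longrightarrow> emeasure Q A = (\<integral>\<^sup>+t\<in>A. ennreal (\<Psi>\<^sub>0 (g t)) \<partial>\<rho>)"
  unfolding Q_def using measurable_compose[OF vector_density_measurable[OF vd] gauge_measurable]
  by (intro emeasure_density) auto

text \<open>The bound of \<open>\<Psi>\<^sub>0 (m A)\<close> by \<open>measure \<rho> A\<close>,
  known for increments, holds for all Borel sets. The variation formula turns it into an inequality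
  between measures.\<close>

lemma Q_le:
  assumes A: "A \<in> sets borel"
  shows "emeasure Q A \<le> emeasure \<rho> A"
proof -
  have fin\<rho>: "emeasure \<rho> A < \<infinity>" by (simp add: less_top[symmetric])
  show ?thesis
    unfolding emeasure_Q[OF A] vector_density_variation[OF vd st.sets_\<rho> A fin\<rho>]
  proof (rule SUP_least)
    fix D :: "nat \<Rightarrow> real set"
    assume "D \<in> {D. range D \<subseteq> sets borel \<and> disjoint_family D \<and> (\<Union>n. D n) = A}"
    then have D: "range D \<subseteq> sets borel" "disjoint_family D" "(\<Union>n. D n) = A" by auto
    have "ennreal (\<Psi>\<^sub>0 (m (D n))) \<le> emeasure \<rho> (D n)" for n
      unfolding st.rho.emeasure_eq_measure
    proof (rule ennreal_leI, rule gauge_le_measure[OF vd st.sets_\<rho> st.finite_\<rho>])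
      show "\<Psi>\<^sub>0 (m {s<..t}) \<le> measure \<rho> {s<..t}" if "s \<le> t" for s t
        using gauge_X[OF that] by (simp add: m_Ioc that st.measure_Ioc)
      show "D n \<in> sets borel" using D(1) by blast
    qed
    then have "(\<Sum>n. ennreal (\<Psi>\<^sub>0 (m (D n)))) \<le> (\<Sum>n. emeasure \<rho> (D n))" by (intro suminf_le) auto
    also have "\<dots> = emeasure \<rho> (\<Union>n. D n)" using D by (intro suminf_emeasure) auto
    finally show "(\<Sum>n. ennreal (\<Psi>\<^sub>0 (m (D n)))) \<le> emeasure \<rho> A" unfolding D(3) .
  qed
qed

text \<open>
  Outside the finite set of large increments the dissipation rate of the limit is almost optimal on
  every dyadic cell.
\<close>

lemma rho_open_le:
  assumes \<eta>: "0 < \<eta>" and b: "b \<le> T"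
  obtains Z where "finite Z"
    "emeasure \<rho> ({0<..<b} - Z) \<le> emeasure Q ({0<..<b} - Z) + ennreal (\<eta> * (T + (F T - F 0) / c0))"
proof -
  obtain d where d: "0 < d" "\<And>s t. 0 \<le> s \<Longrightarrow> s < t \<Longrightarrow> t \<le> T \<Longrightarrow> F t - F s < d \<Longrightarrow>
      F t - F s \<le> \<Psi>\<^sub>0 (X t - X s) + (\<eta> * (t - s) + \<eta> / c0 * (F t - F s))"
    by (rule F_increment_le[OF \<eta>]) blast
  obtain Z where Z: "finite Z" "\<And>s t. 0 \<le> s \<Longrightarrow> s < t \<Longrightarrow> t \<le> T \<Longrightarrow> {s<..t} \<inter> Z = {} \<Longrightarrow> F t - F s < d"
    using monotone_level_points[of F d T, OF F_mono F_right_continuous F_0(1) d(1)] by blast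
  define U where "U = {0<..<b} - Z"
  have "open U" unfolding U_def using Z(1) by (intro open_Diff finite_imp_closed) auto
  then obtain D :: "nat \<Rightarrow> nat \<Rightarrow> real set" where
    D: "\<And>n j. D n j = {} \<or> (\<exists>s t. s < t \<and> D n j = {s<..t} \<and> {s<..t} \<subseteq> U)"
    "\<And>n. disjoint_family (D n)" "incseq (\<lambda>n. \<Union>j. D n j)" "(\<Union>n. \<Union>j. D n j) = U"
    by (rule open_dyadic_cells) blast
  have Db: "D n j \<in> sets borel" for n j using D(1)[of n j] by auto
  have Ub: "U \<in> sets borel" using \<open>open U\<close> by simp
  have cell: "emeasure \<rho> (D n j) \<le> emeasure Q (D n j) + (ennreal \<eta> * emeasure lborel (D n j) + ennreal (\<eta> / c0) * emeasure \<rho> (D n j))"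
    for n j
  proof (cases "D n j = {}")
    case False
    then obtain s t where st: "s < t" "D n j = {s<..t}" "{s<..t} \<subseteq> U" using D(1)[of n j] by blast
    have t: "t \<in> U" using st by auto
    have s: "0 \<le> s"
    proof (rule ccontr)
      assume "\<not> 0 \<le> s"
      then have "min t 0 \<in> {s<..t}" using st(1) by auto
      then have "min t 0 \<in> U" using st(3) by blast
      then show False by (simp add: U_def)
    qed
    have tT: "t \<le> T" using t b by (simp add: U_def)
    have "F t - F s < d" using st(3) by (intro Z(2)[OF s st(1) tT]) (auto simp: U_def)
    from d(2)[OF s st(1) tT this]
    have "ennreal (F t - F s) \<le> ennreal (\<Psi>\<^sub>0 (X t - X s) + (\<eta> * (t - s) + \<eta> / c0 * (F t - F s)))" by (rule ennreal_leI)
    also have "\<dots> = ennreal (\<Psi>\<^sub>0 (m {s<..t})) + (ennreal \<eta> * ennreal (t - s) + ennreal (\<eta> / c0) * ennreal (F t - F s))"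
      using st(1) F_mono[of s t] \<eta> c0(1) gauge_nonneg
      by (simp add: m_Ioc ennreal_plus[symmetric] ennreal_mult[symmetric] del: ennreal_plus)
    also have "\<dots> \<le> emeasure Q {s<..t} + (ennreal \<eta> * ennreal (t - s) + ennreal (\<eta> / c0) * ennreal (F t - F s))"
    proof (rule add_right_mono)
      have "emeasure \<rho> {s<..t} < \<infinity>" by (simp add: less_top[symmetric])
      then show "ennreal (\<Psi>\<^sub>0 (m {s<..t})) \<le> emeasure Q {s<..t}"
        using vector_density_Jensen[OF vd st.sets_\<rho>, of "{s<..t}"] by (simp add: emeasure_Q)
    qed
    finally show ?thesis unfolding st(2) using st(1) by (simp add: st.emeasure_Ioc)
  qed simp
  have level: "emeasure \<rho> (\<Union>j. D n j) \<le> emeasure Q U + ennreal (\<eta> * (T + (F T - F 0) / c0))" for n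
  proof -
    let ?W = "\<Union>j. D n j"
    have W: "?W \<subseteq> U" using D(4) by blast
    have rD: "range (D n) \<subseteq> sets M" if "sets M = sets borel" for M using Db that by blast
    have sum: "(\<Sum>j. emeasure M (D n j)) = emeasure M ?W" if "sets M = sets borel" for M
      by (rule suminf_emeasure[OF rD[OF that] D(2)])
    have "emeasure \<rho> ?W = (\<Sum>j. emeasure \<rho> (D n j))" by (rule sum[symmetric]) simp
    also have "\<dots> \<le> (\<Sum>j. emeasure Q (D n j) + (ennreal \<eta> * emeasure lborel (D n j) + ennreal (\<eta> / c0) * emeasure \<rho> (D n j)))"
      by (intro suminf_le cell) auto
    also have "\<dots> = emeasure Q ?W + (ennreal \<eta> * emeasure lborel ?W + ennreal (\<eta> / c0) * emeasure \<rho> ?W)"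
      by (simp add: suminf_add[symmetric] sum)
    also have "\<dots> \<le> emeasure Q U + (ennreal \<eta> * ennreal T + ennreal (\<eta> / c0) * ennreal (F T - F 0))"
    proof (intro add_mono mult_left_mono)
      show "emeasure Q ?W \<le> emeasure Q U" using W Ub by (intro emeasure_mono) auto
      have sub: "?W \<subseteq> {0<..T}" using W b by (auto simp: U_def)
      have "emeasure lborel ?W \<le> emeasure lborel {0<..T}" using sub by (intro emeasure_mono) auto
      then show "emeasure lborel ?W \<le> ennreal T" using T_pos by simp
      have "emeasure \<rho> ?W \<le> emeasure \<rho> {0<..T}" using sub by (intro emeasure_mono) auto
      then show "emeasure \<rho> ?W \<le> ennreal (F T - F 0)" using T_pos by (simp add: st.emeasure_Ioc)
    qed auto
    also have "ennreal \<eta> * ennreal T + ennreal (\<eta> / c0) * ennreal (F T - F 0) = ennreal (\<eta> * (T + (F T - F 0) / c0))"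
      using F_mono[of 0 T] T_pos \<eta> c0(1)
      by (simp add: ennreal_plus[symmetric] ennreal_mult[symmetric] distrib_left del: ennreal_plus)
    finally show ?thesis .
  qed
  have "(SUP n. emeasure \<rho> (\<Union>j. D n j)) = emeasure \<rho> (\<Union>n. \<Union>j. D n j)"
    using Db D(3) by (intro SUP_emeasure_incseq) auto
  then have "emeasure \<rho> U = (SUP n. emeasure \<rho> (\<Union>j. D n j))" unfolding D(4) by (rule sym)
  also have "\<dots> \<le> emeasure Q U + ennreal (\<eta> * (T + (F T - F 0) / c0))" by (intro SUP_least level)
  finally have "emeasure \<rho> U \<le> emeasure Q U + ennreal (\<eta> * (T + (F T - F 0) / c0))" .
  then show ?thesis using that[OF Z(1)] unfolding U_def by blast
qed

text \<open>On the part inside \<open>J\<close> the opposite inequality \<open>Q_le\<close> holds,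
  so that part can be cancelled from the estimate on the open set; finiteness of
  \<open>\<rho>\<close> permits this. The finite set \<open>Z\<close> does no harm off
  \<open>J\<close>, where single points have no mass.\<close>

lemma rho_co_le_Q:
  assumes b: "b \<le> T"
  shows "emeasure \<rho> ({0<..<b} - J) \<le> emeasure Q ({0<..<b} - J)"
proof (rule ennreal_le_epsilon)
  fix e :: real assume e: "0 < e"
  \<comment> \<open>With \<eta> equal to \<open>e / k\<close> the accumulated error is exactly
    \<open>e\<close>.\<close>
  define k where "k = T + (F T - F 0) / c0"
  have k: "0 < k" using T_pos F_mono[of 0 T] c0(1) by (simp add: k_def add_pos_nonneg)
  obtain Z where Z: "finite Z" "emeasure \<rho> ({0<..<b} - Z) \<le> emeasure Q ({0<..<b} - Z) + ennreal (e / k * k)"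
    using rho_open_le[OF divide_pos_pos[OF e k] b] unfolding k_def[symmetric] by metis
  let ?U = "{0<..<b} - Z"
  have Zb: "Z \<in> sets borel" using Z(1) by (simp add: finite_imp_closed)
  have Ub: "?U \<in> sets borel" using Zb by simp
  have split: "emeasure M ?U = emeasure M (?U \<inter> J) + emeasure M (?U - J)" if "sets M = sets borel" for M
  proof -
    have "emeasure M ((?U \<inter> J) \<union> (?U - J)) = emeasure M (?U \<inter> J) + emeasure M (?U - J)"
    proof (rule plus_emeasure[symmetric])
      show "?U \<inter> J \<in> sets M" "?U - J \<in> sets M"
        unfolding that by (rule sets.Int[OF Ub bv.J_borel], rule sets.Diff[OF Ub bv.J_borel])
    qed blast
    then show ?thesis by (simp only: Int_Diff_Un)
  qed
  have "emeasure \<rho> (?U \<inter> J) + emeasure \<rho> (?U - J) \<le> emeasure Q (?U \<inter> J) + emeasure Q (?U - J) + ennreal e"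
    using Z(2) k unfolding split[OF st.sets_\<rho>] split[OF sets_Q] by simp
  also have "\<dots> \<le> emeasure \<rho> (?U \<inter> J) + (emeasure Q (?U - J) + ennreal e)"
    unfolding add.assoc by (intro add_right_mono Q_le sets.Int[OF Ub bv.J_borel])
  finally have U: "emeasure \<rho> (?U - J) \<le> emeasure Q (?U - J) + ennreal e"
    by (subst (asm) ennreal_add_left_cancel_le) simp
  have "emeasure \<rho> (Z - J) = (\<Sum>t\<in>Z - J. emeasure \<rho> {t})"
    using Z(1) by (intro emeasure_eq_sum_singleton) auto
  then have null: "emeasure \<rho> (Z - J) = 0" using measure_point_no_jump by simp
  have UJ: "?U - J \<in> sets \<rho>" "Z - J \<in> sets \<rho>"
    unfolding st.sets_\<rho> by (rule sets.Diff[OF Ub bv.J_borel], rule sets.Diff[OF Zb bv.J_borel])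
  have "emeasure \<rho> ({0<..<b} - J) \<le> emeasure \<rho> ((?U - J) \<union> (Z - J))"
    by (rule emeasure_mono[OF _ sets.Un[OF UJ]]) blast
  also have "\<dots> \<le> emeasure \<rho> (?U - J) + emeasure \<rho> (Z - J)"
    by (rule emeasure_subadditive[OF UJ])
  also have "\<dots> \<le> emeasure Q (?U - J) + ennreal e" using U null by simp
  also have "emeasure Q (?U - J) \<le> emeasure Q ({0<..<b} - J)" by (intro emeasure_mono) auto
  finally show "emeasure \<rho> ({0<..<b} - J) \<le> emeasure Q ({0<..<b} - J) + ennreal e"
    by (simp add: add_right_mono)
qed

text \<open>The closed interval may be replaced by the open one: \<open>\<rho>\<close> does not
  charge 0, and it charges \<open>t\<close> only if \<open>t\<close> is a jump time, which is
  removed. On the open interval the two inequalities between \<open>Q\<close> and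
  \<open>\<rho>\<close> meet.\<close>

lemma co_dissipation:
  assumes t: "0 < t" "t \<le> T"
  shows "(\<integral>\<^sup>+ s\<in>{0..t}. ennreal (\<Psi>\<^sub>0 (co_density T u s)) \<partial>(ref_measure T u)) = emeasure \<rho> ({0<..<t} - J)"
proof -
  have "(\<integral>\<^sup>+ s\<in>{0..t}. ennreal (\<Psi>\<^sub>0 (co_density T u s)) \<partial>(ref_measure T u)) = emeasure Q ({0..t} - J)"
    using bv.co_density_integral[OF gauge, of 0 t] t emeasure_Q[of "{0..t} - J"] by simp
  also have "\<dots> = emeasure \<rho> ({0<..<t} - J)"
  proof (rule antisym)
    have S: "{0<..<t} - J \<in> sets \<rho>" "{0} \<in> sets \<rho>" "{t} - J \<in> sets \<rho>" by simp_all
    have "emeasure Q ({0..t} - J) \<le> emeasure \<rho> ({0..t} - J)" by (rule Q_le) simp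
    also have "\<dots> \<le> emeasure \<rho> (({0<..<t} - J) \<union> ({0} \<union> ({t} - J)))"
      by (rule emeasure_mono[OF _ sets.Un[OF S(1) sets.Un[OF S(2,3)]]]) auto
    also have "\<dots> \<le> emeasure \<rho> ({0<..<t} - J) + emeasure \<rho> ({0} \<union> ({t} - J))"
      by (rule emeasure_subadditive[OF S(1) sets.Un[OF S(2,3)]])
    also have "\<dots> \<le> emeasure \<rho> ({0<..<t} - J) + (emeasure \<rho> {0} + emeasure \<rho> ({t} - J))"
      by (intro add_left_mono emeasure_subadditive S)
    also have "emeasure \<rho> {0} = 0" by (rule st.emeasure_\<rho>_outside) auto
    also have "emeasure \<rho> ({t} - J) = 0"
      using measure_point_no_jump[of t] by (cases "t \<in> J") (simp_all add: insert_Diff_if)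
    finally show "emeasure Q ({0..t} - J) \<le> emeasure \<rho> ({0<..<t} - J)" by simp
    have "emeasure \<rho> ({0<..<t} - J) \<le> emeasure Q ({0<..<t} - J)" by (rule rho_co_le_Q[OF t(2)])
    also have "\<dots> \<le> emeasure Q ({0..t} - J)" by (intro emeasure_mono) auto
    finally show "emeasure \<rho> ({0<..<t} - J) \<le> emeasure Q ({0..t} - J)" .
  qed
  finally show ?thesis .
qed

lemma jump_dissipation:
  assumes t: "t \<le> T"
  shows "(\<Sum>\<^sub>\<infinity>s\<in>J \<inter> {0<..<t}. finsler_cost (contact_potential \<Psi>) E s (left_lim u s) (u s)
      + finsler_cost (contact_potential \<Psi>) E s (u s) (right_lim T u s)) = emeasure \<rho> (J \<inter> {0<..<t})"
proof -
  have "finsler_cost (contact_potential \<Psi>) E s (left_lim u s) (u s) + finsler_cost (contact_potential \<Psi>) E s (u s) (right_lim T u s)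
      = emeasure \<rho> {s}" if "s \<in> J \<inter> {0<..<t}" for s
  proof -
    have s: "0 < s" "s \<le> T" "0 \<le> s" "s < T" "s \<in> {0<..<T}" using that t by auto
    have "emeasure \<rho> {s} = ennreal ((V s - left_lim V s) + (right_lim T V s - V s))"
      using measure_point[OF s(5)] by (simp add: st.rho.emeasure_eq_measure)
    also have "\<dots> = ennreal (V s - left_lim V s) + ennreal (right_lim T V s - V s)"
      using left_limits(7)[OF s(1,2)] right_limits(6)[OF s(3,4)] by (intro ennreal_plus) auto
    finally show ?thesis using finsler_left[OF s(1,2)] finsler_right[OF s(3,4)] by simp
  qed
  then have "(\<Sum>\<^sub>\<infinity>s\<in>J \<inter> {0<..<t}. finsler_cost (contact_potential \<Psi>) E s (left_lim u s) (u s)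
      + finsler_cost (contact_potential \<Psi>) E s (u s) (right_lim T u s)) = (\<Sum>\<^sub>\<infinity>s\<in>J \<inter> {0<..<t}. emeasure \<rho> {s})"
    by (intro infsum_cong)
  also have "\<dots> = emeasure \<rho> (J \<inter> {0<..<t})"
    by (rule emeasure_countable_infsum) (use jump_set_countable in auto)
  finally show ?thesis .
qed

text \<open>The terms telescope. The initial jump costs \<open>F 0\<close>, the right limit of
  \<open>V\<close> at 0, because \<open>V 0 = 0\<close>; the mass of the open interval is the left
  limit of \<open>V\<close> at \<open>t\<close> minus \<open>F 0\<close>; the half jump at
  \<open>t\<close> restores \<open>V t\<close>.\<close>

theorem pseudo_variation_eq:
  assumes t: "t \<in> {0..T}"
  shows "pseudo_variation T E \<Psi>\<^sub>0 (contact_potential \<Psi>) u 0 t = ennreal (V t)"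
proof (cases "t = 0")
  case True
  then show ?thesis by (simp add: pseudo_variation_def V_0)
next
  case False
  then have t': "0 < t" "t \<le> T" using t by auto
  have "emeasure \<rho> (({0<..<t} - J) \<union> (J \<inter> {0<..<t})) = emeasure \<rho> ({0<..<t} - J) + emeasure \<rho> (J \<inter> {0<..<t})"
    by (rule plus_emeasure[symmetric]) auto
  moreover have "({0<..<t} - J) \<union> (J \<inter> {0<..<t}) = {0<..<t}" by blast
  ultimately have split: "emeasure \<rho> ({0<..<t} - J) + emeasure \<rho> (J \<inter> {0<..<t}) = ennreal (left_lim V t - F 0)"
    using measure_Ioo[OF t'] by (simp add: st.rho.emeasure_eq_measure)
  have "pseudo_variation T E \<Psi>\<^sub>0 (contact_potential \<Psi>) u 0 t
      = emeasure \<rho> ({0<..<t} - J) + ennreal (F 0) + ennreal (V t - left_lim V t) + emeasure \<rho> (J \<inter> {0<..<t})"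
    using t' T_pos unfolding pseudo_variation_def
    by (simp add: co_dissipation jump_dissipation finsler_left finsler_right F_0(2) V_0)
  also have "\<dots> = (emeasure \<rho> ({0<..<t} - J) + emeasure \<rho> (J \<inter> {0<..<t})) + ennreal (F 0) + ennreal (V t - left_lim V t)"
    by (simp add: ac_simps)
  also have "\<dots> = ennreal ((left_lim V t - F 0) + F 0 + (V t - left_lim V t))"
    unfolding split using left_V_ge[OF t'] F_0(1) left_limits(7)[OF t'] by (simp add: ennreal_plus[symmetric] del: ennreal_plus)
  finally show ?thesis by simp
qed

end

context viscosity_limit
begin

lemma u_BV: "BV_on T u"
  unfolding BV_on_def
proof (intro exI allI impI)
  fix \<D> assume D: "\<D> division_of {0..T}"
  have "(\<Sum>I\<in>\<D>. norm (u (Sup I) - u (Inf I))) \<le> (\<Sum>I\<in>\<D>. 1 / c0 * (V (Sup I) - V (Inf I)))"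
  proof (rule sum_mono)
    fix I assume I: "I \<in> \<D>"
    then obtain a b where ab: "I = {a..b}" using D by (metis division_ofD(4) box_real(2))
    have "I \<noteq> {}" "I \<subseteq> {0..T}" using D I by (auto dest: division_ofD)
    then have "a \<le> b" "0 \<le> a" "b \<le> T" unfolding ab by auto
    then show "norm (u (Sup I) - u (Inf I)) \<le> 1 / c0 * (V (Sup I) - V (Inf I))"
      unfolding ab using norm_increment[of a b] by simp
  qed
  also have "\<dots> = 1 / c0 * (\<Sum>I\<in>\<D>. V (Sup I) - V (Inf I))" by (simp add: sum_distrib_left)
  also have "\<dots> = 1 / c0 * (V T - V 0)" using division_telescope[OF _ D, of V] T_pos by simp
  finally show "(\<Sum>I\<in>\<D>. norm (u (Sup I) - u (Inf I))) \<le> 1 / c0 * (V T - V 0)" .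
qed

theorem u_BV_solution: "BV_solution T E \<Psi>\<^sub>0 (contact_potential \<Psi>) u"
  unfolding BV_solution_def
proof (intro conjI ballI)
  show "BV_on T u" by (rule u_BV)
  obtain N where N: "negligible N" "\<And>t z. t \<in> {0..T} - N \<Longrightarrow> blinfun_apply (- DE t (u t)) z \<le> \<Psi>\<^sub>0 z"
    by (rule stability_ae) blast
  have "AE t in lebesgue. t \<notin> N"
    using N(1) by (intro AE_not_in) (simp add: negligible_iff_null_sets)
  then have "AE t in lborel. t \<notin> N" by (simp add: AE_completion_iff)
  then show "AE t in lborel. t \<in> {0..T} - J \<longrightarrow> - DE t (u t) \<in> subdifferential \<Psi>\<^sub>0 0"
  proof eventually_elim
    case (elim t)
    then show ?case using N(2)[of t] by (auto simp: subdifferential_def gauge_zero)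
  qed
  fix t assume t: "t \<in> {0..T}"
  obtain m g where "vector_density m (interval_measure F) g" "\<And>s t. s \<le> t \<Longrightarrow> m {s<..t} = X t - X s"
    by (rule st.ex_density) blast
  then interpret viscosity_limit_density \<Psi>\<^sub>0 \<Psi> T C E \<epsilon> v u R B m g by unfold_locales
  have "0 \<le> V t" using V_mono[of 0 t] V_0 t by simp
  then show "enn2ereal (pseudo_variation T E \<Psi>\<^sub>0 (contact_potential \<Psi>) u 0 t) + ereal (E t (u t))
      = ereal (E 0 (u 0) + (LINT s:{0..t}|lborel. Et s (u s)))"
    unfolding pseudo_variation_eq[OF t] Lebesgue_integral_Et[OF t] by (simp add: V_def enn2ereal_ennreal)
qed

end

theorem theorem4p10:
  fixes T C :: real
    and E :: "real \<Rightarrow> 'a::real_normed_vector \<Rightarrow> real"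
    and \<Psi> \<Psi>\<^sub>0 :: "'a \<Rightarrow> real"
    and u\<^sub>0 :: 'a
    and u\<epsilon> :: "real \<Rightarrow> real \<Rightarrow> 'a"
    and \<epsilon> :: "nat \<Rightarrow> real"
  assumes X_fin: "finite_dim TYPE('a)"
    and T_pos: "0 < T"
    and gauge_\<Psi>\<^sub>0: "gauge_function \<Psi>\<^sub>0"
    and E_C1: "C1_on ({0..T} \<times> UNIV) (\<lambda>(t, x). E t x)"
    and C_pos: "0 < C"
    and E_bdd_below: "\<And>t x. t \<in> {0..T} \<Longrightarrow> - C \<le> E t x"
    and E_dt_bound: "\<And>t x. t \<in> {0..T} \<Longrightarrow> \<bar>energy_dt T E t x\<bar> \<le> C * (1 + max 0 (E t x))"
    and \<Psi>_nonneg: "\<And>v. 0 \<le> \<Psi> v"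
    and \<Psi>_convex: "convex_on UNIV \<Psi>"
    and \<Psi>_zero: "\<Psi> 0 = 0"
    and \<Psi>_superlinear: "filterlim (\<lambda>v. \<Psi> v / norm v) at_top at_infinity"
    and \<Psi>_limit: "\<And>v. ((\<lambda>\<epsilon>. viscous_potential \<Psi> \<epsilon> v) \<longlongrightarrow> \<Psi>\<^sub>0 v) (at_right 0)"
    and u\<epsilon>_sol: "\<And>\<epsilon>. 0 < \<epsilon> \<Longrightarrow> viscous_solution T E \<Psi> \<epsilon> (u\<epsilon> \<epsilon>)"
    and u\<epsilon>_init: "((\<lambda>\<epsilon>. u\<epsilon> \<epsilon> 0) \<longlongrightarrow> u\<^sub>0) (at_right 0)"
    and \<epsilon>_pos: "\<And>k. 0 < \<epsilon> k"
    and \<epsilon>_vanishing: "\<epsilon> \<longlonglongrightarrow> 0"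
  shows "\<exists>r u. strict_mono (r :: nat \<Rightarrow> nat) \<and> BV_on T u \<and>
           (\<forall>t\<in>{0..T}. (\<lambda>k. u\<epsilon> (\<epsilon> (r k)) t) \<longlonglongrightarrow> u t) \<and>
           BV_solution T E \<Psi>\<^sub>0 (contact_potential \<Psi>) u"
proof -
  interpret energy_system \<Psi>\<^sub>0 \<Psi> T C E
    using assms by unfold_locales
  define v where "v k = u\<epsilon> (\<epsilon> k)" for k
  have sol: "viscous_solution T E \<Psi> (\<epsilon> k) (v k)" for k unfolding v_def by (rule u\<epsilon>_sol[OF \<epsilon>_pos])
  have "filterlim \<epsilon> (at_right 0) sequentially"
    using \<epsilon>_vanishing \<epsilon>_pos by (intro tendsto_imp_filterlim_at_right) auto
  from filterlim_compose[OF u\<epsilon>_init this]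
  have init: "(\<lambda>k. v k 0) \<longlonglongrightarrow> u\<^sub>0" by (simp add: v_def)
  obtain R B where RB: "0 < R" "\<And>k t. t \<in> {0..T} \<Longrightarrow> norm (v k t) \<le> R"
    "\<And>k t. t \<in> {0..T} \<Longrightarrow> 0 \<le> viscous_curve.V T E (v k) t \<and> viscous_curve.V T E (v k) t \<le> B"
    using uniform_bounds[OF \<epsilon>_pos sol init] by blast
  obtain c where c: "0 < c" "\<And>z. c * norm z \<le> \<Psi>\<^sub>0 z" using gauge_lower_bound by blast
  obtain r where r: "strict_mono (r :: nat \<Rightarrow> nat)" "\<And>t. t \<in> {0..T} \<Longrightarrow> convergent (\<lambda>n. v (r n) t)"
  proof (rule Helly_selection_majorant[OF X_fin T_pos, of v "1 / c" "\<lambda>k. viscous_curve.V T E (v k)" B R])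
    fix k s t assume st: "0 \<le> s" "s \<le> t" "t \<le> T"
    interpret c: viscous_curve \<Psi>\<^sub>0 \<Psi> T C E "\<epsilon> k" "v k" by (rule viscous_curveI[OF \<epsilon>_pos sol])
    show "c.V s \<le> c.V t" by (rule c.V_mono[OF st])
    have "c * norm (v k t - v k s) \<le> c.V t - c.V s"
      using c.gauge_increment[OF st] c(2)[of "v k t - v k s"] by linarith
    then show "norm (v k t - v k s) \<le> 1 / c * (c.V t - c.V s)" using c(1) by (simp add: field_simps)
  next
    show "\<bar>viscous_curve.V T E (v k) t\<bar> \<le> B" "norm (v k t) \<le> R" if "t \<in> {0..T}" for k t
      using RB(2,3)[OF that, of k] by auto
  qed blast
  define u where "u t = lim (\<lambda>n. v (r n) t)" for t
  have lim: "(\<lambda>n. v (r n) t) \<longlonglongrightarrow> u t" if "t \<in> {0..T}" for t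
    unfolding u_def using r(2)[OF that] by (simp add: convergent_LIMSEQ_iff)
  have "(\<epsilon> \<circ> r) \<longlonglongrightarrow> 0" by (rule LIMSEQ_subseq_LIMSEQ[OF \<epsilon>_vanishing r(1)])
  then interpret viscosity_limit \<Psi>\<^sub>0 \<Psi> T C E "\<lambda>n. \<epsilon> (r n)" "\<lambda>n. v (r n)" u R B
    using \<epsilon>_pos sol lim RB(2,3) by unfold_locales (auto simp: comp_def)
  show ?thesis
  proof (intro exI conjI ballI)
    show "strict_mono r" by (rule r(1))
    show "(\<lambda>k. u\<epsilon> (\<epsilon> (r k)) t) \<longlonglongrightarrow> u t" if "t \<in> {0..T}" for t using lim[OF that] by (simp add: v_def)
  qed (rule u_BV u_BV_solution)+
qed

end
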